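(* Consider the cotangent lift to $T^*G$ of the action by left translations of a Lie group $G$ on itself. For every $\mu\in\mathfrak g^*$ with $\ker\mu+\mathfrak g_\mu=\mathfrak g$, the ray reduced space $\big((T^*G)_{\mathbb R^+\mu},\omega_{\mathbb R^+\mu}\big)$ is well defined and symplectomorphic to the diagonal manifold $$\Big(\operatorname{Diag}\big(\mathcal O_{\mathbb R^+\mu}\times\tfrac{G}{K_\mu}\big),\ \omega^-_{\mathbb R^+\mu}\Big),$$ where, for tangent vectors $v_i=\big(\mathrm{ad}^*_{\xi_i}\mathrm{Ad}^*_g r\mu+r_i\mathrm{Ad}^*_g r\mu,\ \hat\xi_{i\,G}(\hat g)\big)$, $\xi_i\in\mathfrak g$, $r_i\in\mathbb R$, $i=1,2$, at the point $(\mathrm{Ad}^*_g r\mu,\hat g)$, the symplectic form is $$\omega^-_{\mathbb R^+\mu}(\mathrm{Ad}^*_g r\mu,\hat g)(v_1,v_2)=-\langle \mathrm{Ad}^*_g r\mu,[\xi_1,\xi_2]\rangle+r_2\langle \mathrm{Ad}^*_g r\mu,\xi_1\rangle-r_1\langle \mathrm{Ad}^*_g r\mu,\xi_2\rangle .$$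
   Context: $\mathbb R^+=(0,\infty)$, $\mathbb R^+\mu=\{r\mu:r>0\}$. $\langle\mathrm{Ad}^*_g\mu,\xi\rangle=\langle\mu,\mathrm{Ad}_g\xi\rangle$, $\langle\mathrm{ad}^*_\xi\mu,\eta\rangle=\langle\mu,[\xi,\eta]\rangle$; the coadjoint action is $g\cdot\mu=\mathrm{Ad}^*_{g^{-1}}\mu$, with isotropy group $G_\mu$ and isotropy algebra $\mathfrak g_\mu$. The kernel group $K_\mu$ is the unique connected normal Lie subgroup of $G_\mu$ with Lie algebra $\ker(\mu|_{\mathfrak g_\mu})$. $T^*G$ carries the canonical form $\omega=-d\theta$ and the lifted left translation action has momentum map $J_L(\alpha_g)=T^*_eR_g(\alpha_g)$. The ray reduced space is $(T^*G)_{\mathbb R^+\mu}=J_L^{-1}(\mathbb R^+\mu)/K_\mu$, with $\omega_{\mathbb R^+\mu}$ determined by $\pi_{\mathbb R^+\mu}^*\omega_{\mathbb R^+\mu}=i_{\mathbb R^+\mu}^*\omega$ ($\pi_{\mathbb R^+\mu}$ the projection, $i_{\mathbb R^+\mu}$ the inclusion of $J_L^{-1}(\mathbb R^+\mu)$). The cone of the coadjoint orbit is $\mathcal O_{\mathbb R^+\mu}=\{\mathrm{Ad}^*_{g^{-1}}r\mu: g\in G,\ r\in\mathbb R^+\}$, and $G_{\mathbb R^+\mu}=\{g\in G:\mathrm{Ad}^*_g\mu=r_g\mu\text{ for some }r_g>0\}$. $G/K_\mu$ denotes the quotient manifold of $G$ by left translations by $K_\mu$, $\hat g$ being the class of $g$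 (so $\widehat{kg}=\hat g$ for $k\in K_\mu$); similarly for $G/G_{\mathbb R^+\mu}$. The diagonal product is $$\operatorname{Diag}\big(\mathcal O_{\mathbb R^+\mu}\times\tfrac G{K_\mu}\big)=\{(\mathrm{Ad}^*_g r\mu,\hat g): g\in G,\ r\in\mathbb R^+\},$$ a submanifold of the product: it is the fibre product of $\mathcal O_{\mathbb R^+\mu}\to G/G_{\mathbb R^+\mu}$, $\mathrm{Ad}^*_g r\mu\mapsto\hat g$, and the projection $G/K_\mu\to G/G_{\mathbb R^+\mu}$. Its tangent vectors at $(\mathrm{Ad}^*_g r\mu,\hat g)$ are the pairs $(\mathrm{ad}^*_\xi\mathrm{Ad}^*_g r\mu+r'\mathrm{Ad}^*_g r\mu,\ \hat\xi_G(\hat g))$, $\xi\in\mathfrak g$, $r'\in\mathbb R$, i.e. the velocities at $t=0$ of the curves $\big(\mathrm{Ad}^*_{\exp t\xi}(e^{tr'}\mathrm{Ad}^*_g r\mu),\ \widehat{g\exp t\xi}\big)$, so $\hat\xi_G(\hat g)=\frac{d}{dt}\big|_{t=0}\widehat{g\exp t\xi}$.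
   Formalization: The existence of the quotient manifold G/K_μ (equivalently, that K_μ is closed in G) is assumed; without it the claim fails, e.g. for G = T² and μ with irrational kernel, where K_μ is dense and the reduced space is not a manifold. *)

theory Defs
  imports "HOL-Analysis.Analysis" "HOL-Algebra.Coset"
begin

section \<open>Smooth maps between subsets of Euclidean spaces\<close>

primrec Ck_on :: "nat \<Rightarrow> 'a::real_normed_vector set \<Rightarrow> ('a \<Rightarrow> 'b::real_normed_vector) \<Rightarrow> bool" where
  "Ck_on 0 S f \<longleftrightarrow> continuous_on S f"
| "Ck_on (Suc k) S f \<longleftrightarrow>
     (\<forall>x\<in>S. f differentiable (at x)) \<and> (\<forall>v. Ck_on k S (\<lambda>x. frechet_derivative f (at x) v))"

text \<open>On an arbitrary set, smooth means locally the restriction of a smooth map on an open set.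
  The definition is used for relatively open subsets of linear subspaces, where this is the usual
  notion.\<close>

definition smooth_on :: "'a::real_normed_vector set \<Rightarrow> ('a \<Rightarrow> 'b::real_normed_vector) \<Rightarrow> bool" where
  "smooth_on S f \<longleftrightarrow>
     (\<forall>x\<in>S. \<exists>U g. open U \<and> x \<in> U \<and> (\<forall>k. Ck_on k U g) \<and> (\<forall>y\<in>S \<inter> U. g y = f y))"


section \<open>Manifolds\<close>

text \<open>The dimension of a quotient or of an orbit is not known in advance, so it cannot be read off
  a type: charts take values in a linear subspace \<open>model M\<close> of the type \<open>'e\<close>, and the dimension of
  the manifold is the dimension of that subspace (possibly 0). Points are a set, and a chart is a
  pair of its domain and a function whose values outside the domain are irrelevant.\<close>

type_synonym ('a, 'e) chart = "'a set \<times> ('a \<Rightarrow> 'e)"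

record ('a, 'e) mfd =
  points :: "'a set"
  model :: "'e set"
  charts :: "('a, 'e) chart set"

definition mtop :: "('a, 'e::euclidean_space) mfd \<Rightarrow> 'a topology" where
  "mtop M = topology (\<lambda>W. W \<subseteq> points M \<and>
     (\<forall>(U, \<phi>)\<in>charts M. openin (top_of_set (model M)) (\<phi> ` (U \<inter> W))))"

definition manifold :: "('a, 'e::euclidean_space) mfd \<Rightarrow> bool" where
  "manifold M \<longleftrightarrow>
     subspace (model M) \<and>
     \<Union> (fst ` charts M) = points M \<and>
     (\<forall>(U, \<phi>)\<in>charts M. inj_on \<phi> U \<and> openin (top_of_set (model M)) (\<phi> ` U)) \<and>
     (\<forall>(U, \<phi>)\<in>charts M. \<forall>(W, \<psi>)\<in>charts M.
        openin (top_of_set (model M)) (\<phi> ` (U \<inter> W)) \<and>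
        smooth_on (\<phi> ` (U \<inter> W)) (\<lambda>y. \<psi> (inv_into U \<phi> y))) \<and>
     Hausdorff_space (mtop M) \<and>
     second_countable (mtop M)"

definition euclid :: "'e::euclidean_space set \<Rightarrow> ('e, 'e) mfd" where
  "euclid S = \<lparr>points = S, model = UNIV, charts = {(S, \<lambda>x. x)}\<rparr>"

definition open_sub :: "('a, 'e) mfd \<Rightarrow> 'a set \<Rightarrow> ('a, 'e) mfd" where
  "open_sub M W = \<lparr>points = points M \<inter> W, model = model M,
     charts = (\<lambda>(U, \<phi>). (U \<inter> W, \<phi>)) ` charts M\<rparr>"

definition prod_mfd :: "('a, 'e) mfd \<Rightarrow> ('b, 'f) mfd \<Rightarrow> ('a \<times> 'b, 'e \<times> 'f) mfd" where
  "prod_mfd M N = \<lparr>points = points M \<times> points N, model = model M \<times> model N,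
     charts = {(U \<times> W, map_prod \<phi> \<psi>) |U \<phi> W \<psi>. (U, \<phi>) \<in> charts M \<and> (W, \<psi>) \<in> charts N}\<rparr>"

definition smooth_map ::
    "('a, 'e::euclidean_space) mfd \<Rightarrow> ('b, 'f::euclidean_space) mfd \<Rightarrow> ('a \<Rightarrow> 'b) \<Rightarrow> bool" where
  "smooth_map M N F \<longleftrightarrow>
     F ` points M \<subseteq> points N \<and>
     (\<forall>(U, \<phi>)\<in>charts M. \<forall>(W, \<psi>)\<in>charts N.
        openin (top_of_set (model M)) (\<phi> ` (U \<inter> F -` W)) \<and>
        smooth_on (\<phi> ` (U \<inter> F -` W)) (\<lambda>y. \<psi> (F (inv_into U \<phi> y))))"

definition diffeomorphism ::
    "('a, 'e::euclidean_space) mfd \<Rightarrow> ('b, 'f::euclidean_space) mfd \<Rightarrow> ('a \<Rightarrow> 'b) \<Rightarrow> bool" where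
  "diffeomorphism M N F \<longleftrightarrow>
     bij_betw F (points M) (points N) \<and> smooth_map M N F \<and>
     smooth_map N M (inv_into (points M) F)"

definition smooth_near :: "('a, 'e::euclidean_space) mfd \<Rightarrow> 'a \<Rightarrow> ('a \<Rightarrow> real) \<Rightarrow> bool" where
  "smooth_near M p f \<longleftrightarrow>
     (\<exists>W. openin (mtop M) W \<and> p \<in> W \<and> smooth_map (open_sub M W) (euclid UNIV) f)"


section \<open>Tangent and cotangent vectors\<close>

text \<open>A tangent vector is the velocity of a smooth curve, regarded as the operator
  \<open>f \<mapsto> (f \<circ> \<gamma>)'(0)\<close> on the functions that are smooth near the base point. It is 0 on all other
  functions, so that equality of velocities is equality of operators. The vector space structure is
  the pointwise one.\<close>

type_synonym 'a tvec = "('a \<Rightarrow> real) \<Rightarrow> real"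
type_synonym 'a cvec = "'a tvec \<Rightarrow> real"

definition velocity :: "('a, 'e::euclidean_space) mfd \<Rightarrow> (real \<Rightarrow> 'a) \<Rightarrow> 'a tvec" where
  "velocity M \<gamma> = (\<lambda>f. if smooth_near M (\<gamma> 0) f then deriv (\<lambda>t. f (\<gamma> t)) 0 else 0)"

definition tangent_space :: "('a, 'e::euclidean_space) mfd \<Rightarrow> 'a \<Rightarrow> 'a tvec set" where
  "tangent_space M p =
     {velocity M \<gamma> |\<gamma> \<epsilon>. \<epsilon> > 0 \<and> smooth_map (euclid {-\<epsilon><..<\<epsilon>}) M \<gamma> \<and> \<gamma> 0 = p}"

definition push ::
    "('a, 'e::euclidean_space) mfd \<Rightarrow> ('b, 'f::euclidean_space) mfd \<Rightarrow> ('a \<Rightarrow> 'b) \<Rightarrow> 'a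
     \<Rightarrow> 'a tvec \<Rightarrow> 'b tvec" where
  "push M N F p v = (\<lambda>h. if smooth_near N (F p) h then v (\<lambda>x. h (F x)) else 0)"

definition lincomb :: "real \<Rightarrow> 'a tvec \<Rightarrow> real \<Rightarrow> 'a tvec \<Rightarrow> 'a tvec" where
  "lincomb a u b v = (\<lambda>f. a * u f + b * v f)"

definition rscale :: "real \<Rightarrow> ('b \<Rightarrow> real) \<Rightarrow> 'b \<Rightarrow> real" where
  "rscale a v = (\<lambda>x. a * v x)"

definition cotangent_space :: "('a, 'e::euclidean_space) mfd \<Rightarrow> 'a \<Rightarrow> 'a cvec set" where
  "cotangent_space M p =
     {\<alpha>. (\<forall>u\<in>tangent_space M p. \<forall>v\<in>tangent_space M p. \<forall>a b.
            \<alpha> (lincomb a u b v) = a * \<alpha> u + b * \<alpha> v) \<and>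
         (\<forall>v. v \<notin> tangent_space M p \<longrightarrow> \<alpha> v = 0)}"

definition copull ::
    "('a, 'e::euclidean_space) mfd \<Rightarrow> ('b, 'f::euclidean_space) mfd \<Rightarrow> ('a \<Rightarrow> 'b) \<Rightarrow> 'a
     \<Rightarrow> 'b cvec \<Rightarrow> 'a cvec" where
  "copull M N F p \<alpha> = (\<lambda>v. if v \<in> tangent_space M p then \<alpha> (push M N F p v) else 0)"

definition embedded_submanifold ::
    "('a, 'f::euclidean_space) mfd \<Rightarrow> ('a, 'e::euclidean_space) mfd \<Rightarrow> bool" where
  "embedded_submanifold S N \<longleftrightarrow>
     manifold S \<and> points S \<subseteq> points N \<and> smooth_map S N (\<lambda>x. x) \<and>
     (\<forall>p\<in>points S. inj_on (push S N (\<lambda>x. x) p) (tangent_space S p)) \<and>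
     mtop S = subtopology (mtop N) (points S)"

text \<open>There is at most one smooth structure on the set \<open>points Q\<close> for which a given surjection
  \<open>\<pi>\<close> is a submersion; this is the quotient manifold.\<close>

definition quotient_manifold ::
    "('a, 'e::euclidean_space) mfd \<Rightarrow> ('a \<Rightarrow> 'b) \<Rightarrow> ('b, 'f::euclidean_space) mfd \<Rightarrow> bool" where
  "quotient_manifold P \<pi> Q \<longleftrightarrow>
     manifold Q \<and> \<pi> ` points P = points Q \<and> smooth_map P Q \<pi> \<and>
     (\<forall>p\<in>points P. push P Q \<pi> p ` tangent_space P p = tangent_space Q (\<pi> p))"


section \<open>Differential forms\<close>

text \<open>\<open>coord_vec M (U, \<phi>) y a\<close> is the coordinate vector in direction \<open>a\<close> at the point with
  coordinates \<open>y\<close>; conversely \<open>chart_diff \<phi> v\<close> is the coordinate expression of \<open>v\<close>.\<close>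

definition coord_vec ::
    "('a, 'e::euclidean_space) mfd \<Rightarrow> ('a, 'e) chart \<Rightarrow> 'e \<Rightarrow> 'e \<Rightarrow> 'a tvec" where
  "coord_vec M c y a = velocity M (\<lambda>t. inv_into (fst c) (snd c) (y + t *\<^sub>R a))"

definition chart_diff :: "('a \<Rightarrow> 'e::euclidean_space) \<Rightarrow> 'a tvec \<Rightarrow> 'e" where
  "chart_diff \<phi> v = (\<Sum>i\<in>Basis. v (\<lambda>x. \<phi> x \<bullet> i) *\<^sub>R i)"

type_synonym 'a form1 = "'a \<Rightarrow> 'a tvec \<Rightarrow> real"
type_synonym 'a form2 = "'a \<Rightarrow> 'a tvec \<Rightarrow> 'a tvec \<Rightarrow> real"

definition coef1 ::
    "('a, 'e::euclidean_space) mfd \<Rightarrow> 'a form1 \<Rightarrow> ('a, 'e) chart \<Rightarrow> 'e \<Rightarrow> 'e \<Rightarrow> real" where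
  "coef1 M \<theta> c a y = \<theta> (inv_into (fst c) (snd c) y) (coord_vec M c y a)"

definition coef2 ::
    "('a, 'e::euclidean_space) mfd \<Rightarrow> 'a form2 \<Rightarrow> ('a, 'e) chart \<Rightarrow> 'e \<Rightarrow> 'e \<Rightarrow> 'e \<Rightarrow> real" where
  "coef2 M \<omega> c a b y = \<omega> (inv_into (fst c) (snd c) y) (coord_vec M c y a) (coord_vec M c y b)"

definition dir_deriv :: "('e::real_vector \<Rightarrow> real) \<Rightarrow> 'e \<Rightarrow> 'e \<Rightarrow> real" where
  "dir_deriv f a y = deriv (\<lambda>t. f (y + t *\<^sub>R a)) 0"

text \<open>The coordinate formula for the exterior derivative of a 1-form,
  \<open>d\<theta>(a, b) = D\<^sub>a \<theta>(b) - D\<^sub>b \<theta>(a)\<close> for constant \<open>a\<close> and \<open>b\<close>. The result does not depend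
  on the chart.\<close>

definition ext_deriv1 :: "('a, 'e::euclidean_space) mfd \<Rightarrow> 'a form1 \<Rightarrow> 'a form2" where
  "ext_deriv1 M \<theta> = (\<lambda>p u v.
     let c = (SOME c. c \<in> charts M \<and> p \<in> fst c);
         a = chart_diff (snd c) u;
         b = chart_diff (snd c) v
     in dir_deriv (coef1 M \<theta> c b) a (snd c p) - dir_deriv (coef1 M \<theta> c a) b (snd c p))"

definition two_form :: "('a, 'e::euclidean_space) mfd \<Rightarrow> 'a form2 \<Rightarrow> bool" where
  "two_form M \<omega> \<longleftrightarrow>
     (\<forall>p\<in>points M. \<forall>u\<in>tangent_space M p. \<forall>v\<in>tangent_space M p.
        \<omega> p u v = - \<omega> p v u \<and>
        (\<forall>w\<in>tangent_space M p. \<forall>a b.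
           \<omega> p (lincomb a u b v) w = a * \<omega> p u w + b * \<omega> p v w)) \<and>
     (\<forall>c\<in>charts M. \<forall>a\<in>model M. \<forall>b\<in>model M. smooth_on (snd c ` fst c) (coef2 M \<omega> c a b))"

definition closed_form2 :: "('a, 'e::euclidean_space) mfd \<Rightarrow> 'a form2 \<Rightarrow> bool" where
  "closed_form2 M \<omega> \<longleftrightarrow>
     (\<forall>k\<in>charts M. \<forall>y\<in>snd k ` fst k. \<forall>a\<in>model M. \<forall>b\<in>model M. \<forall>c\<in>model M.
        dir_deriv (coef2 M \<omega> k b c) a y + dir_deriv (coef2 M \<omega> k c a) b y +
        dir_deriv (coef2 M \<omega> k a b) c y = 0)"

definition symplectic_form :: "('a, 'e::euclidean_space) mfd \<Rightarrow> 'a form2 \<Rightarrow> bool" where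
  "symplectic_form M \<omega> \<longleftrightarrow>
     two_form M \<omega> \<and> closed_form2 M \<omega> \<and>
     (\<forall>p\<in>points M. \<forall>u\<in>tangent_space M p.
        (\<forall>v\<in>tangent_space M p. \<omega> p u v = 0) \<longrightarrow> u = (\<lambda>_. 0))"

definition symplectomorphism ::
    "('a, 'e::euclidean_space) mfd \<Rightarrow> 'a form2 \<Rightarrow> ('b, 'f::euclidean_space) mfd \<Rightarrow> 'b form2
     \<Rightarrow> ('a \<Rightarrow> 'b) \<Rightarrow> bool" where
  "symplectomorphism M \<omega> N \<omega>' F \<longleftrightarrow>
     diffeomorphism M N F \<and>
     (\<forall>p\<in>points M. \<forall>u\<in>tangent_space M p. \<forall>v\<in>tangent_space M p.
        \<omega>' (F p) (push M N F p u) (push M N F p v) = \<omega> p u v)"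


section \<open>The cotangent bundle\<close>

text \<open>A chart \<open>\<phi>\<close> of the base gives the coordinates \<open>(\<phi> p, a)\<close> of a covector \<open>\<alpha>\<close> at \<open>p\<close>, where
  \<open>\<alpha> = a \<bullet> d\<phi>\<close>.\<close>

definition cotangent_bundle ::
    "('a, 'e::euclidean_space) mfd \<Rightarrow> ('a \<times> 'a cvec, 'e \<times> 'e) mfd" where
  "cotangent_bundle M =
     \<lparr>points = (SIGMA p:points M. cotangent_space M p),
      model = model M \<times> model M,
      charts = (\<lambda>(U, \<phi>). (SIGMA p:U. cotangent_space M p,
         \<lambda>(p, \<alpha>). (\<phi> p, THE a. a \<in> model M \<and>
            (\<forall>v\<in>tangent_space M p. \<alpha> v = a \<bullet> chart_diff \<phi> v)))) ` charts M\<rparr>"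

definition canonical_1form :: "('a, 'e::euclidean_space) mfd \<Rightarrow> ('a \<times> 'a cvec) form1" where
  "canonical_1form M x w = snd x (push (cotangent_bundle M) M fst x w)"

definition canonical_form :: "('a, 'e::euclidean_space) mfd \<Rightarrow> ('a \<times> 'a cvec) form2" where
  "canonical_form M x u v = - ext_deriv1 (cotangent_bundle M) (canonical_1form M) x u v"


section \<open>Lie groups\<close>

definition lie_group :: "'g monoid \<Rightarrow> ('g, 'e::euclidean_space) mfd \<Rightarrow> bool" where
  "lie_group G M \<longleftrightarrow>
     group G \<and> manifold M \<and> points M = carrier G \<and>
     smooth_map (prod_mfd M M) M (\<lambda>(g, h). g \<otimes>\<^bsub>G\<^esub> h) \<and>
     smooth_map M M (\<lambda>g. inv\<^bsub>G\<^esub> g)"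

abbreviation lie_algebra :: "'g monoid \<Rightarrow> ('g, 'e::euclidean_space) mfd \<Rightarrow> 'g tvec set" where
  "lie_algebra G M \<equiv> tangent_space M \<one>\<^bsub>G\<^esub>"

definition left_invariant_field ::
    "'g monoid \<Rightarrow> ('g, 'e::euclidean_space) mfd \<Rightarrow> 'g tvec \<Rightarrow> 'g \<Rightarrow> 'g tvec" where
  "left_invariant_field G M \<xi> g = push M M (\<lambda>h. g \<otimes>\<^bsub>G\<^esub> h) \<one>\<^bsub>G\<^esub> \<xi>"

text \<open>The commutator of the left invariant vector fields at the unit.\<close>

definition lie_bracket ::
    "'g monoid \<Rightarrow> ('g, 'e::euclidean_space) mfd \<Rightarrow> 'g tvec \<Rightarrow> 'g tvec \<Rightarrow> 'g tvec" where
  "lie_bracket G M \<xi> \<eta> = (\<lambda>f. if smooth_near M \<one>\<^bsub>G\<^esub> f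
     then \<xi> (\<lambda>g. left_invariant_field G M \<eta> g f) - \<eta> (\<lambda>g. left_invariant_field G M \<xi> g f)
     else 0)"

definition exponential_map ::
    "'g monoid \<Rightarrow> ('g, 'e::euclidean_space) mfd \<Rightarrow> ('g tvec \<Rightarrow> 'g) \<Rightarrow> bool" where
  "exponential_map G M ex \<longleftrightarrow>
     (\<forall>\<xi>\<in>lie_algebra G M.
        smooth_map (euclid UNIV) M (\<lambda>t::real. ex (rscale t \<xi>)) \<and>
        (\<forall>s t. ex (rscale (s + t) \<xi>) = ex (rscale s \<xi>) \<otimes>\<^bsub>G\<^esub> ex (rscale t \<xi>)) \<and>
        velocity M (\<lambda>t. ex (rscale t \<xi>)) = \<xi>)"

definition Ad :: "'g monoid \<Rightarrow> ('g, 'e::euclidean_space) mfd \<Rightarrow> 'g \<Rightarrow> 'g tvec \<Rightarrow> 'g tvec" where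
  "Ad G M g \<xi> = push M M (\<lambda>h. g \<otimes>\<^bsub>G\<^esub> h \<otimes>\<^bsub>G\<^esub> inv\<^bsub>G\<^esub> g) \<one>\<^bsub>G\<^esub> \<xi>"

definition Ad_star :: "'g monoid \<Rightarrow> ('g, 'e::euclidean_space) mfd \<Rightarrow> 'g \<Rightarrow> 'g cvec \<Rightarrow> 'g cvec" where
  "Ad_star G M g \<mu> = (\<lambda>\<xi>. if \<xi> \<in> lie_algebra G M then \<mu> (Ad G M g \<xi>) else 0)"

definition ad_star ::
    "'g monoid \<Rightarrow> ('g, 'e::euclidean_space) mfd \<Rightarrow> 'g tvec \<Rightarrow> 'g cvec \<Rightarrow> 'g cvec" where
  "ad_star G M \<xi> \<mu> = (\<lambda>\<eta>. if \<eta> \<in> lie_algebra G M then \<mu> (lie_bracket G M \<xi> \<eta>) else 0)"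

definition isotropy_group :: "'g monoid \<Rightarrow> ('g, 'e::euclidean_space) mfd \<Rightarrow> 'g cvec \<Rightarrow> 'g set" where
  "isotropy_group G M \<mu> = {g \<in> carrier G. Ad_star G M (inv\<^bsub>G\<^esub> g) \<mu> = \<mu>}"

definition isotropy_algebra ::
    "'g monoid \<Rightarrow> ('g, 'e::euclidean_space) mfd \<Rightarrow> 'g cvec \<Rightarrow> 'g tvec set" where
  "isotropy_algebra G M \<mu> = {\<xi> \<in> lie_algebra G M. ad_star G M \<xi> \<mu> = (\<lambda>_. 0)}"

definition cvec_kernel ::
    "'g monoid \<Rightarrow> ('g, 'e::euclidean_space) mfd \<Rightarrow> 'g cvec \<Rightarrow> 'g tvec set" where
  "cvec_kernel G M \<mu> = {\<xi> \<in> lie_algebra G M. \<mu> \<xi> = 0}"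

text \<open>A Lie subgroup is a subgroup carrying a Lie group structure \<open>N\<close> for which the inclusion is an
  immersion; its topology may be finer than the subspace topology. Since its
  dimension is at most that of the ambient group, \<open>N\<close> can be modelled on the same type.\<close>

definition kernel_group ::
    "'g monoid \<Rightarrow> ('g, 'e::euclidean_space) mfd \<Rightarrow> 'g cvec \<Rightarrow> 'g set \<Rightarrow> bool" where
  "kernel_group G M \<mu> K \<longleftrightarrow>
     K \<lhd> (G\<lparr>carrier := isotropy_group G M \<mu>\<rparr>) \<and>
     (\<exists>N :: ('g, 'e) mfd.
        lie_group (G\<lparr>carrier := K\<rparr>) N \<and> connected_space (mtop N) \<and>
        smooth_map N M (\<lambda>k. k) \<and>
        (\<forall>k\<in>K. inj_on (push N M (\<lambda>k. k) k) (tangent_space N k)) \<and>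
        push N M (\<lambda>k. k) \<one>\<^bsub>G\<^esub> ` tangent_space N \<one>\<^bsub>G\<^esub> =
          isotropy_algebra G M \<mu> \<inter> cvec_kernel G M \<mu>)"


section \<open>Ray reduction of the cotangent bundle of a Lie group\<close>

text \<open>Elements of \<open>T\<^sup>*G\<close> are pairs \<open>(g, \<alpha>)\<close> with \<open>\<alpha>\<close> a covector at \<open>g\<close>.\<close>

definition cotangent_lift ::
    "'g monoid \<Rightarrow> ('g, 'e::euclidean_space) mfd \<Rightarrow> 'g \<Rightarrow> 'g \<times> 'g cvec \<Rightarrow> 'g \<times> 'g cvec" where
  "cotangent_lift G M k = (\<lambda>(g, \<alpha>).
     (k \<otimes>\<^bsub>G\<^esub> g, copull M M (\<lambda>h. inv\<^bsub>G\<^esub> k \<otimes>\<^bsub>G\<^esub> h) (k \<otimes>\<^bsub>G\<^esub> g) \<alpha>))"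

definition momentum_map ::
    "'g monoid \<Rightarrow> ('g, 'e::euclidean_space) mfd \<Rightarrow> 'g \<times> 'g cvec \<Rightarrow> 'g cvec" where
  "momentum_map G M = (\<lambda>(g, \<alpha>). copull M M (\<lambda>h. h \<otimes>\<^bsub>G\<^esub> g) \<one>\<^bsub>G\<^esub> \<alpha>)"

definition ray_level_set ::
    "'g monoid \<Rightarrow> ('g, 'e::euclidean_space) mfd \<Rightarrow> 'g cvec \<Rightarrow> ('g \<times> 'g cvec) set" where
  "ray_level_set G M \<mu> =
     {x \<in> points (cotangent_bundle M). \<exists>r>0. momentum_map G M x = rscale r \<mu>}"

definition lift_orbit ::
    "'g monoid \<Rightarrow> ('g, 'e::euclidean_space) mfd \<Rightarrow> 'g set \<Rightarrow> 'g \<times> 'g cvec \<Rightarrow> ('g \<times> 'g cvec) set"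
  where "lift_orbit G M K x = (\<lambda>k. cotangent_lift G M k x) ` K"

text \<open>\<open>P\<close> is the manifold \<open>J\<^sub>L\<^sup>-\<^sup>1(\<real>\<^sup>+\<mu>)\<close> and \<open>R\<close> its quotient by \<open>K\<close>.\<close>

definition ray_reduced_manifold ::
    "'g monoid \<Rightarrow> ('g, 'e::euclidean_space) mfd \<Rightarrow> 'g cvec \<Rightarrow> 'g set
     \<Rightarrow> ('g \<times> 'g cvec, 'p::euclidean_space) mfd \<Rightarrow> (('g \<times> 'g cvec) set, 'r::euclidean_space) mfd
     \<Rightarrow> bool" where
  "ray_reduced_manifold G M \<mu> K P R \<longleftrightarrow>
     embedded_submanifold P (cotangent_bundle M) \<and> points P = ray_level_set G M \<mu> \<and>
     (\<forall>k\<in>K. cotangent_lift G M k ` points P = points P) \<and>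
     quotient_manifold P (lift_orbit G M K) R"

text \<open>The defining property \<open>\<pi>\<^sup>* \<omega>\<^sub>R = i\<^sup>* \<omega>\<close> of the reduced form.\<close>

definition ray_reduced_form ::
    "'g monoid \<Rightarrow> ('g, 'e::euclidean_space) mfd \<Rightarrow> 'g set
     \<Rightarrow> ('g \<times> 'g cvec, 'p::euclidean_space) mfd \<Rightarrow> (('g \<times> 'g cvec) set, 'r::euclidean_space) mfd
     \<Rightarrow> ('g \<times> 'g cvec) set form2 \<Rightarrow> bool" where
  "ray_reduced_form G M K P R \<omega>R \<longleftrightarrow>
     two_form R \<omega>R \<and>
     (\<forall>x\<in>points P. \<forall>u\<in>tangent_space P x. \<forall>v\<in>tangent_space P x.
        \<omega>R (lift_orbit G M K x)
           (push P R (lift_orbit G M K) x u) (push P R (lift_orbit G M K) x v) =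
        canonical_form M x
           (push P (cotangent_bundle M) (\<lambda>x. x) x u) (push P (cotangent_bundle M) (\<lambda>x. x) x v))"

text \<open>The cone of the coadjoint orbit is the orbit of \<open>\<mu>\<close> under the action of \<open>G \<times> \<real>\<^sup>+\<close> on the
  dual of the Lie algebra. As an orbit it carries the smooth structure for which the orbit map is a
  submersion.\<close>

definition orbit_cone ::
    "'g monoid \<Rightarrow> ('g, 'e::euclidean_space) mfd \<Rightarrow> 'g cvec \<Rightarrow> ('g cvec, 'o::euclidean_space) mfd
     \<Rightarrow> bool" where
  "orbit_cone G M \<mu> C \<longleftrightarrow>
     quotient_manifold (prod_mfd M (euclid {0<..}))
       (\<lambda>(g, r::real). Ad_star G M (inv\<^bsub>G\<^esub> g) (rscale r \<mu>)) C"

definition diag_product ::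
    "'g monoid \<Rightarrow> ('g, 'e::euclidean_space) mfd \<Rightarrow> 'g cvec \<Rightarrow> 'g set \<Rightarrow> ('g cvec \<times> 'g set) set" where
  "diag_product G M \<mu> K =
     {(Ad_star G M g (rscale r \<mu>), K #>\<^bsub>G\<^esub> g) |g r. g \<in> carrier G \<and> r > 0}"

text \<open>The curve through \<open>(Ad\<^sup>*\<^sub>g r\<mu>, K g)\<close> whose velocity at 0 is the tangent vector
  \<open>(ad\<^sup>*\<^sub>\<xi> Ad\<^sup>*\<^sub>g r\<mu> + s Ad\<^sup>*\<^sub>g r\<mu>, \<xi>\<^sub>G(K g))\<close>.\<close>

definition diag_curve ::
    "'g monoid \<Rightarrow> ('g, 'e::euclidean_space) mfd \<Rightarrow> ('g tvec \<Rightarrow> 'g) \<Rightarrow> 'g cvec \<Rightarrow> 'g set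
     \<Rightarrow> 'g \<Rightarrow> real \<Rightarrow> 'g tvec \<Rightarrow> real \<Rightarrow> real \<Rightarrow> 'g cvec \<times> 'g set" where
  "diag_curve G M ex \<mu> K g r \<xi> s t =
     (Ad_star G M (ex (rscale t \<xi>)) (rscale (exp (t * s)) (Ad_star G M g (rscale r \<mu>))),
      K #>\<^bsub>G\<^esub> (g \<otimes>\<^bsub>G\<^esub> ex (rscale t \<xi>)))"

definition diag_vector ::
    "'g monoid \<Rightarrow> ('g, 'e::euclidean_space) mfd \<Rightarrow> ('g tvec \<Rightarrow> 'g) \<Rightarrow> 'g cvec \<Rightarrow> 'g set
     \<Rightarrow> ('g cvec \<times> 'g set, 'd::euclidean_space) mfd
     \<Rightarrow> 'g \<Rightarrow> real \<Rightarrow> 'g tvec \<Rightarrow> real \<Rightarrow> ('g cvec \<times> 'g set) tvec" where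
  "diag_vector G M ex \<mu> K D g r \<xi> s = velocity D (diag_curve G M ex \<mu> K g r \<xi> s)"

end

theory Submission
  imports Defs
begin

text \<open>Right translations trivialise \<open>T\<^sup>*G\<close> and turn \<open>J\<^sub>L\<close> into the projection to the dual of the Lie algebra.
  So the level set consists of the covectors \<open>e\<^sup>l \<sigma>\<^sub>g\<close>, where \<open>\<sigma>\<close> is the right invariant 1-form with
  value \<open>\<mu>\<close> at the unit, and the canonical 1-form restricts to \<open>e\<^sup>l \<sigma>\<close>. The form \<open>\<sigma>\<close> descends to \<open>G/K\<close>.
  Both the reduced space and the diagonal are images of \<open>G/K \<times> \<real>\<close>, under \<open>(Kg, l) \<mapsto> K (e\<^sup>l \<sigma>\<^sub>g)\<close> and
  \<open>(Kg, l) \<mapsto> (Ad\<^sup>*\<^sub>g e\<^sup>l \<mu>, Kg)\<close>, and both symplectic forms correspond to \<open>- d(e\<^sup>l \<sigma>)\<close>.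
  A vector \<open>(\<xi>, r)\<close> in the kernel of this form satisfies \<open>\<mu>[\<xi>, \<eta>] + r \<mu>(\<eta>) - s \<mu>(\<xi>) = 0\<close> for all \<open>\<eta>\<close>
  and \<open>s\<close>. Thus \<open>\<mu>(\<xi>) = 0\<close>, and \<open>r \<mu>\<close> vanishes on the isotropy algebra and so, since the
  latter and \<open>ker \<mu>\<close> span the Lie algebra, \<open>r = 0\<close> if \<open>\<mu> \<noteq> 0\<close>. Then \<open>\<xi>\<close> lies in the Lie algebra of \<open>K\<close>.\<close>

section \<open>Calculus\<close>

text \<open>Smooth structures on the level set, the reduced space and the diagonal are never built
  from scratch: those of \<open>G\<close> and \<open>G/K\<close>, times a line, are transported
  along the bijections. What has to be shown is that the transported structures are submanifolds and
  quotients. Submanifolds are recognised by smooth local retractions, and maps out of a quotient are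
  tested on smooth local sections, which come from the submersion theorem. Since charts take values
  in linear subspaces, functions are differentiated after composition with the orthogonal
  projection, so that calculus on open sets of the full space applies. 2-forms are compared through
  1-forms: naturality of the exterior derivative carries an equality of pullbacks over to the
  derivatives, and closedness is symmetry of second derivatives. The delicate point is that
  \<open>\<sigma>\<close> descends to \<open>G/K\<close>. The topology of \<open>K\<close> may be
  finer than the one induced from \<open>G\<close>, and \<open>Q\<close> is only known to be a
  quotient manifold, so it is not evident that vertical vectors belong to the Lie algebra of
  \<open>K\<close>.\<close>

lemma frechet_derivative_eqI:
  "(f has_derivative f') (at x) \<Longrightarrow> frechet_derivative f (at x) = f'"
  by (rule frechet_derivative_at[symmetric])

text \<open>\<open>frechet_derivative\<close> is a choice among the derivatives at \<open>x\<close>.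
  Functions that coincide near \<open>x\<close> have the same derivatives, so the choices agree,
  even where there is none to choose.\<close>

lemma frechet_derivative_cong_open:
  assumes "open U" "x \<in> U" "\<And>y. y \<in> U \<Longrightarrow> f y = g y"
  shows "frechet_derivative f (at x) = frechet_derivative g (at x)"
proof -
  have "(f has_derivative D) (at x) \<longleftrightarrow> (g has_derivative D) (at x)" for D
    using has_derivative_transform_within_open[OF _ assms(1,2)] assms(3) by (auto simp: eq_commute)
  then show ?thesis unfolding frechet_derivative_def by simp
qed

lemma Ck_on_cong:
  assumes "open U" "\<And>y. y \<in> U \<Longrightarrow> f y = g y" "Ck_on k U f"
  shows "Ck_on k U g"
  using assms
proof (induction k arbitrary: f g)
  case 0
  then show ?case by (simp cong: continuous_on_cong)
next
  case (Suc k)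
  have d: "g differentiable (at x)" if "x \<in> U" for x
    using Suc.prems that has_derivative_transform_within_open
    by (metis Ck_on.simps(2) differentiable_def)
  moreover have "Ck_on k U (\<lambda>x. frechet_derivative g (at x) v)" for v
    by (rule Suc.IH[of "\<lambda>x. frechet_derivative f (at x) v"])
      (use Suc.prems frechet_derivative_cong_open[of U _ f g] in auto)
  ultimately show ?case by simp
qed

lemma Ck_on_subset: "Ck_on k U f \<Longrightarrow> V \<subseteq> U \<Longrightarrow> Ck_on k V f"
  by (induction k arbitrary: f) (auto intro: continuous_on_subset)

lemma Ck_on_imp_continuous_on:
  assumes "Ck_on k U f" shows "continuous_on U f"
proof (cases k)
  case (Suc j)
  then show ?thesis using assms
    by (auto intro!: continuous_at_imp_continuous_on differentiable_imp_continuous_within)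
qed (use assms in auto)

lemma Ck_on_SucD: "Ck_on (Suc k) U f \<Longrightarrow> Ck_on k U f"
proof (induction k arbitrary: f)
  case 0
  then show ?case using Ck_on_imp_continuous_on[OF 0] by simp
next
  case (Suc k)
  then show ?case by (metis Ck_on.simps(2))
qed

lemma Ck_on_has_derivative:
  "Ck_on (Suc k) U f \<Longrightarrow> x \<in> U \<Longrightarrow> (f has_derivative frechet_derivative f (at x)) (at x)"
  using frechet_derivative_works by auto

lemma Ck_on_frechet: "Ck_on (Suc k) U f \<Longrightarrow> Ck_on k U (\<lambda>x. frechet_derivative f (at x) v)"
  by simp

lemma Ck_on_local:
  assumes "\<And>x. x \<in> U \<Longrightarrow> \<exists>W. open W \<and> x \<in> W \<and> Ck_on k W f"
  shows "Ck_on k U f"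
  using assms
proof (induction k arbitrary: f)
  case 0
  have "continuous (at x) f" if "x \<in> U" for x
    using 0[OF that] continuous_on_eq_continuous_at by auto
  then show ?case by (simp add: continuous_at_imp_continuous_on)
next
  case (Suc k)
  have "\<exists>W. open W \<and> x \<in> W \<and> Ck_on k W (\<lambda>x. frechet_derivative f (at x) v)" if "x \<in> U" for x v
    using Suc.prems[OF that] Ck_on_frechet by blast
  then have "Ck_on k U (\<lambda>x. frechet_derivative f (at x) v)" for v
    by (rule Suc.IH)
  moreover have "f differentiable (at x)" if "x \<in> U" for x
    using Suc.prems[OF that] Ck_on_has_derivative unfolding differentiable_def by blast
  ultimately show ?case by simp
qed

text \<open>The case of \<open>smooth_on\<close> in which the function serves as its own extension.
  It is meant for open \<open>U\<close>, because \<open>Ck_on\<close> differentiates in the full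
  space.\<close>

definition Cinf :: "'a::real_normed_vector set \<Rightarrow> ('a \<Rightarrow> 'b::real_normed_vector) \<Rightarrow> bool" where
  "Cinf U f \<longleftrightarrow> (\<forall>k. Ck_on k U f)"

lemma CinfI: "(\<And>k. Ck_on k U f) \<Longrightarrow> Cinf U f" by (simp add: Cinf_def)

lemma Cinf_Ck: "Cinf U f \<Longrightarrow> Ck_on k U f" by (simp add: Cinf_def)

lemma Cinf_cong: "open U \<Longrightarrow> (\<And>y. y \<in> U \<Longrightarrow> f y = g y) \<Longrightarrow> Cinf U f \<Longrightarrow> Cinf U g"
  unfolding Cinf_def using Ck_on_cong by blast

lemma Cinf_subset: "Cinf U f \<Longrightarrow> V \<subseteq> U \<Longrightarrow> Cinf V f"
  unfolding Cinf_def using Ck_on_subset by blast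

lemma Cinf_local:
  "(\<And>x. x \<in> U \<Longrightarrow> \<exists>W. open W \<and> x \<in> W \<and> Cinf W f) \<Longrightarrow> Cinf U f"
  unfolding Cinf_def using Ck_on_local by metis

lemma Cinf_continuous_on: "Cinf U f \<Longrightarrow> continuous_on U f"
  unfolding Cinf_def using Ck_on_imp_continuous_on by blast

lemma Cinf_has_derivative:
  "Cinf U f \<Longrightarrow> x \<in> U \<Longrightarrow> (f has_derivative frechet_derivative f (at x)) (at x)"
  using Cinf_Ck[of U f "Suc 0"] frechet_derivative_works by auto

lemma Cinf_frechet: "Cinf U f \<Longrightarrow> Cinf U (\<lambda>x. frechet_derivative f (at x) v)"
  unfolding Cinf_def by (metis Ck_on.simps(2))

section \<open>Closure properties of iterated differentiability\<close>

lemma Ck_on_const: "Ck_on k U (\<lambda>x. c)"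
  by (induction k arbitrary: c) (auto simp: frechet_derivative_const)

lemma Ck_on_bounded_linear:
  assumes "bounded_linear f" shows "Ck_on k U f"
proof (cases k)
  case 0
  then show ?thesis using assms linear_continuous_on by auto
next
  case (Suc j)
  have d: "(f has_derivative f) (at x)" for x
    using assms bounded_linear_imp_has_derivative by blast
  then show ?thesis
    using Suc Ck_on_const frechet_derivative_eqI[OF d] by (auto simp: differentiable_def)
qed

text \<open>Lets inductive steps work with an explicit derivative. Since \<open>U\<close> is open,
  regularity passes from \<open>f'\<close> to the chosen \<open>frechet_derivative\<close>, which
  has the same values on \<open>U\<close>.\<close>

lemma Ck_on_SucI:
  assumes "open U" "\<And>x. x \<in> U \<Longrightarrow> (f has_derivative f' x) (at x)"
    "\<And>v. Ck_on k U (\<lambda>x. f' x v)"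
  shows "Ck_on (Suc k) U f"
proof -
  have "frechet_derivative f (at x) v = f' x v" if "x \<in> U" for x v
    by (rule fun_cong[OF frechet_derivative_eqI[OF assms(2)[OF that]]])
  then have "Ck_on k U (\<lambda>x. frechet_derivative f (at x) v)" for v
    by (intro Ck_on_cong[OF assms(1) _ assms(3)]) simp
  then show ?thesis using assms(2) by (auto simp: differentiable_def)
qed

lemma Ck_on_add:
  assumes U: "open U" and "Ck_on k U p" "Ck_on k U q"
  shows "Ck_on k U (\<lambda>x. p x + q x)"
    using assms(2,3)
proof (induction k arbitrary: p q)
  case 0
  then show ?case by (auto intro: continuous_intros)
next
  case (Suc k)
  show ?case
    by (rule Ck_on_SucI[OF U has_derivative_add[OF Suc.prems[THEN Ck_on_has_derivative]]
        Suc.IH[OF Suc.prems[THEN Ck_on_frechet]]])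
qed

text \<open>The product rule turns one derivative into two products of functions of class
  \<open>k\<close>, to which the induction hypothesis applies. Scalar multiplication, inner products
  and real products are instances.\<close>

lemma Ck_on_bilinear:
  assumes B: "bounded_bilinear B" and U: "open U" and "Ck_on k U f" "Ck_on k U g"
  shows "Ck_on k U (\<lambda>x. B (f x) (g x))"
  using assms(3-)
proof (induction k arbitrary: f g)
  case 0
  then show ?case using bounded_bilinear.continuous_on[OF B] by auto
next
  case (Suc k)
  note f = Suc.prems(1) and g = Suc.prems(2)
  have *: "Ck_on k U (\<lambda>x. B (f x) (frechet_derivative g (at x) v))"
     "Ck_on k U (\<lambda>x. B (frechet_derivative f (at x) v) (g x))" for v
    by (rule Suc.IH[OF Ck_on_SucD[OF f] Ck_on_frechet[OF g]] Suc.IH[OF Ck_on_frechet[OF f] Ck_on_SucD[OF g]])+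
  show ?case
    by (rule Ck_on_SucI[OF U bounded_bilinear.FDERIV[OF B Ck_on_has_derivative[OF f] Ck_on_has_derivative[OF g]]
        Ck_on_add[OF U *]])
qed

lemma Ck_on_sum:
  assumes "open U" "\<And>i. i \<in> I \<Longrightarrow> Ck_on k U (f i)"
  shows "Ck_on k U (\<lambda>x. \<Sum>i\<in>I. f i x)"
  using assms(2)
  by (induction I rule: infinite_finite_induct) (auto intro: Ck_on_add[OF assms(1)] Ck_on_const)

lemma Ck_on_compose:
  fixes f :: "'b::euclidean_space \<Rightarrow> 'c::real_normed_vector"
  assumes "open U" "open V" "Ck_on k V f" "Ck_on k U g" "g ` U \<subseteq> V"
  shows "Ck_on k U (\<lambda>x. f (g x))"
  using assms(3-)
proof (induction k arbitrary: f g)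
  case 0
  then show ?case using continuous_on_compose2 by auto
next
  case (Suc k)
  have g: "(g has_derivative frechet_derivative g (at x)) (at x)" if "x \<in> U" for x
    by (rule Ck_on_has_derivative[OF Suc.prems(2) that])
  have f: "(f has_derivative frechet_derivative f (at (g x))) (at (g x))" if "x \<in> U" for x
    by (rule Ck_on_has_derivative[OF Suc.prems(1)]) (use that Suc.prems(3) in auto)
  \<comment> \<open>The chain rule produces a linear map depending on \<open>x\<close>, applied to a
    vector depending on \<open>x\<close>. Expanding the vector in \<open>Basis\<close> leaves sums
    of products of functions of class \<open>k\<close>; this is where the intermediate space has to
    be Euclidean.\<close>
  have sum: "Ck_on k U (\<lambda>x. \<Sum>i\<in>Basis. (frechet_derivative g (at x) v \<bullet> i) *\<^sub>R frechet_derivative f (at (g x)) i)" for v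
  proof (intro Ck_on_sum[OF assms(1)] Ck_on_bilinear[OF bounded_bilinear_scaleR assms(1)])
    fix i :: 'b
    show "Ck_on k U (\<lambda>x. frechet_derivative f (at (g x)) i)"
      by (rule Suc.IH[OF Ck_on_frechet[OF Suc.prems(1)] Ck_on_SucD[OF Suc.prems(2)] Suc.prems(3)])
    show "Ck_on k U (\<lambda>x. frechet_derivative g (at x) v \<bullet> i)"
      by (rule Ck_on_bilinear[OF bounded_bilinear_inner assms(1) Ck_on_frechet[OF Suc.prems(2)] Ck_on_const])
  qed
  have eq: "frechet_derivative f (at (g x)) (frechet_derivative g (at x) v) =
      (\<Sum>i\<in>Basis. (frechet_derivative g (at x) v \<bullet> i) *\<^sub>R frechet_derivative f (at (g x)) i)" if "x \<in> U" for x v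
  proof -
    interpret linear "frechet_derivative f (at (g x))"
      by (rule has_derivative_linear[OF f[OF that]])
    show ?thesis
      by (subst euclidean_representation[of "frechet_derivative g (at x) v", symmetric])
        (simp only: sum scale)
  qed
  have "Ck_on k U (\<lambda>x. frechet_derivative f (at (g x)) (frechet_derivative g (at x) v))" for v
    by (rule Ck_on_cong[OF assms(1) eq[symmetric] sum])
  from Ck_on_SucI[OF assms(1) has_derivative_compose[OF g f] this] show ?case .
qed

lemma Cinf_const: "Cinf U (\<lambda>x. c)" by (simp add: Cinf_def Ck_on_const)

lemma Cinf_linear: "bounded_linear f \<Longrightarrow> Cinf U f" by (simp add: Cinf_def Ck_on_bounded_linear)

lemma Cinf_bilinear:
  "bounded_bilinear B \<Longrightarrow> open U \<Longrightarrow> Cinf U f \<Longrightarrow> Cinf U g \<Longrightarrow> Cinf U (\<lambda>x. B (f x) (g x))"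
  by (simp add: Cinf_def Ck_on_bilinear)

lemma Cinf_add: "open U \<Longrightarrow> Cinf U f \<Longrightarrow> Cinf U g \<Longrightarrow> Cinf U (\<lambda>x. f x + g x)"
  by (simp add: Cinf_def Ck_on_add)

lemma Cinf_compose:
  fixes f :: "'b::euclidean_space \<Rightarrow> 'c::real_normed_vector"
  shows "open U \<Longrightarrow> open V \<Longrightarrow> Cinf V f \<Longrightarrow> Cinf U g \<Longrightarrow> g ` U \<subseteq> V \<Longrightarrow> Cinf U (\<lambda>x. f (g x))"
  by (simp add: Cinf_def Ck_on_compose)

lemma Cinf_Pair:
  assumes U: "open U" and "Cinf U f" "Cinf U g" shows "Cinf U (\<lambda>x. (f x, g x))"
proof (rule CinfI)
  fix k
  show "Ck_on k U (\<lambda>x. (f x, g x))"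
    using Cinf_Ck[OF assms(2), of k] Cinf_Ck[OF assms(3), of k]
  proof (induction k arbitrary: f g)
    case 0
    then show ?case by (auto intro: continuous_intros)
  next
    case (Suc k)
    show ?case
      by (rule Ck_on_SucI[OF U has_derivative_Pair[OF Suc.prems[THEN Ck_on_has_derivative]]
          Suc.IH[OF Suc.prems[THEN Ck_on_frechet]]])
  qed
qed

lemma Cinf_exp: "Cinf UNIV (exp :: real \<Rightarrow> real)"
proof (rule CinfI)
  fix k show "Ck_on k UNIV (exp :: real \<Rightarrow> real)"
  proof (induction k)
    case (Suc k)
    have "Ck_on k UNIV (\<lambda>x::real. exp x * v)" for v
      using Ck_on_bilinear[OF bounded_bilinear_mult open_UNIV Suc Ck_on_const] .
    moreover have "((exp :: real \<Rightarrow> real) has_derivative (\<lambda>v. exp x * v)) (at x)" for x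
      using DERIV_exp has_field_derivative_def by blast
    ultimately show ?case by (rule Ck_on_SucI[OF open_UNIV, rotated])
  qed (auto intro: continuous_intros)
qed

text \<open>The derivative is a product of two inverses and a constant, so the class rises with each
  induction step.\<close>

lemma Cinf_inverse: "Cinf {0<..} (inverse :: real \<Rightarrow> real)"
proof (rule CinfI)
  fix k show "Ck_on k {0<..} (inverse :: real \<Rightarrow> real)"
  proof (induction k)
    case 0
    then show ?case by (auto intro!: continuous_intros)
  next
    case (Suc k)
    have "Ck_on k {0<..} (\<lambda>x::real. inverse x * (inverse x * (-v)))" for v
      by (rule Ck_on_bilinear[OF bounded_bilinear_mult open_greaterThan Suc
            Ck_on_bilinear[OF bounded_bilinear_mult open_greaterThan Suc Ck_on_const]])
    moreover have "((inverse :: real \<Rightarrow> real) has_derivative (\<lambda>v. inverse x * (inverse x * (-v)))) (at x)"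
      if "x \<in> {0<..}" for x
      using that by (auto intro!: derivative_eq_intros simp: power2_eq_square)
    ultimately show ?case by (rule Ck_on_SucI[OF open_greaterThan, rotated])
  qed
qed

lemma Cinf_ln: "Cinf {0<..} (ln :: real \<Rightarrow> real)"
proof (rule CinfI)
  fix k show "Ck_on k {0<..} (ln :: real \<Rightarrow> real)"
  proof (cases k)
    case 0
    then show ?thesis by (auto intro!: continuous_intros)
  next
    case (Suc k)
    have "Ck_on k {0<..} (\<lambda>x::real. inverse x * v)" for v
      by (rule Ck_on_bilinear[OF bounded_bilinear_mult open_greaterThan Cinf_Ck[OF Cinf_inverse] Ck_on_const])
    moreover have "((ln :: real \<Rightarrow> real) has_derivative (\<lambda>v. inverse x * v)) (at x)"
      if "x \<in> {0<..}" for x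
      using that by (auto intro!: derivative_eq_intros simp: divide_inverse)
    ultimately show ?thesis unfolding Suc by (rule Ck_on_SucI[OF open_greaterThan, rotated])
  qed
qed

section \<open>Symmetry of second derivatives\<close>

lemma has_real_derivative_line:
  assumes "(f has_derivative f') (at (x + t *\<^sub>R a))"
  shows "((\<lambda>t. f (x + t *\<^sub>R a)) has_vector_derivative f' a) (at t)"
proof -
  have "((\<lambda>t. x + t *\<^sub>R a) has_derivative (\<lambda>s. s *\<^sub>R a)) (at t)"
    by (auto intro!: derivative_eq_intros)
  from has_derivative_compose[OF this assms] show ?thesis
    unfolding has_vector_derivative_def
    using linear_scale[OF has_derivative_linear[OF assms]] by simp
qed

lemma Cinf_vector_derivative_line:
  assumes "Cinf U f" "x + t *\<^sub>R a \<in> U"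
  shows "((\<lambda>t. f (x + t *\<^sub>R a)) has_vector_derivative frechet_derivative f (at (x + t *\<^sub>R a)) a) (at t)"
  by (rule has_real_derivative_line[OF Cinf_has_derivative[OF assms]])

text \<open>The mean value theorem is applied twice: to the difference \<open>?p\<close> of
  \<open>f\<close> along two parallel sides of the parallelogram, then to the derivative in
  direction \<open>a\<close> between these sides. The second difference on the left is symmetric in
  \<open>a\<close> and \<open>b\<close>, which is what the next lemma exploits.\<close>

lemma mixed_difference:
  fixes f :: "'a::real_normed_vector \<Rightarrow> real"
  assumes f: "Cinf U f" and h: "h > 0"
    and U: "\<And>s t. 0 \<le> s \<Longrightarrow> s \<le> h \<Longrightarrow> 0 \<le> t \<Longrightarrow> t \<le> h \<Longrightarrow> x + s *\<^sub>R a + t *\<^sub>R b \<in> U"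
  shows "\<exists>s t. 0 < s \<and> s < h \<and> 0 < t \<and> t < h \<and>
    f (x + h *\<^sub>R a + h *\<^sub>R b) - f (x + h *\<^sub>R a) - f (x + h *\<^sub>R b) + f x =
    h * h * frechet_derivative (\<lambda>y. frechet_derivative f (at y) a) (at (x + s *\<^sub>R a + t *\<^sub>R b)) b"
proof -
  let ?g = "\<lambda>y. frechet_derivative f (at y) a"
  let ?p = "\<lambda>s. f ((x + h *\<^sub>R b) + s *\<^sub>R a) - f (x + s *\<^sub>R a)"
  have "\<exists>s. 0 < s \<and> s < h \<and> ?p h - ?p 0 = (h - 0) * (?g ((x + h *\<^sub>R b) + s *\<^sub>R a) - ?g (x + s *\<^sub>R a))"
  proof (rule MVT2[OF h])
    fix s assume s: "0 \<le> s" "s \<le> h"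
    have "(x + h *\<^sub>R b) + s *\<^sub>R a \<in> U" "x + s *\<^sub>R a \<in> U"
      using U[OF s, of h] U[OF s, of 0] h by (simp_all add: algebra_simps)
    from this[THEN Cinf_vector_derivative_line[OF f]]
    show "DERIV ?p s :> ?g ((x + h *\<^sub>R b) + s *\<^sub>R a) - ?g (x + s *\<^sub>R a)"
      unfolding has_real_derivative_iff_has_vector_derivative by (rule has_vector_derivative_diff)
  qed
  then obtain s where s: "0 < s" "s < h"
    "?p h - ?p 0 = h * (?g ((x + h *\<^sub>R b) + s *\<^sub>R a) - ?g (x + s *\<^sub>R a))" by auto
  have "\<exists>t. 0 < t \<and> t < h \<and> ?g ((x + s *\<^sub>R a) + h *\<^sub>R b) - ?g ((x + s *\<^sub>R a) + 0 *\<^sub>R b) =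
     (h - 0) * frechet_derivative ?g (at ((x + s *\<^sub>R a) + t *\<^sub>R b)) b"
  proof (rule MVT2[OF h])
    fix t assume t: "0 \<le> t" "t \<le> h"
    have "(x + s *\<^sub>R a) + t *\<^sub>R b \<in> U" using U[OF _ _ t, of s] s by simp
    from Cinf_vector_derivative_line[OF Cinf_frechet[OF f] this]
    show "DERIV (\<lambda>t. ?g ((x + s *\<^sub>R a) + t *\<^sub>R b)) t :> frechet_derivative ?g (at ((x + s *\<^sub>R a) + t *\<^sub>R b)) b"
      unfolding has_real_derivative_iff_has_vector_derivative .
  qed
  then obtain t where t: "0 < t" "t < h" "?g ((x + s *\<^sub>R a) + h *\<^sub>R b) - ?g (x + s *\<^sub>R a) =
     h * frechet_derivative ?g (at ((x + s *\<^sub>R a) + t *\<^sub>R b)) b" by auto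
  have "(x + h *\<^sub>R b) + s *\<^sub>R a = (x + s *\<^sub>R a) + h *\<^sub>R b" "(x + h *\<^sub>R b) + h *\<^sub>R a = x + h *\<^sub>R a + h *\<^sub>R b"
    by (simp_all add: algebra_simps)
  with s t show ?thesis
    by (intro exI[of _ s] exI[of _ t]) (simp add: algebra_simps)
qed

text \<open>The same second difference equals \<open>h * h\<close> times either mixed derivative,
  each taken at some point of a small parallelogram. If the two differed at \<open>x\<close>,
  continuity would keep them apart on the whole parallelogram.\<close>

lemma symmetric_second_derivative_real:
  fixes f :: "'a::real_normed_vector \<Rightarrow> real"
  assumes U: "open U" and f: "Cinf U f" and x: "x \<in> U"
  shows "frechet_derivative (\<lambda>y. frechet_derivative f (at y) a) (at x) b =
         frechet_derivative (\<lambda>y. frechet_derivative f (at y) b) (at x) a" (is "?P x = ?Q x")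
proof (rule ccontr)
  assume ne: "?P x \<noteq> ?Q x"
  \<comment> \<open>Half the gap, so that the open intervals of radius \<open>e\<close> around the
    two values are disjoint.\<close>
  define e where "e = \<bar>?P x - ?Q x\<bar> / 2"
  have e: "e > 0" using ne by (simp add: e_def)
  have cont: "continuous (at x) (\<lambda>x. ?P x)" "continuous (at x) (\<lambda>x. ?Q x)"
    using f U x by (auto intro!: continuous_on_interior[where S=U] Cinf_continuous_on Cinf_frechet simp: interior_open)
  obtain d1 where d1: "d1 > 0" "\<And>y. dist y x < d1 \<Longrightarrow> dist (?P y) (?P x) < e"
    using cont(1) e unfolding continuous_at_eps_delta by blast
  obtain d2 where d2: "d2 > 0" "\<And>y. dist y x < d2 \<Longrightarrow> dist (?Q y) (?Q x) < e"
    using cont(2) e unfolding continuous_at_eps_delta by blast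
  obtain d3 where d3: "d3 > 0" "ball x d3 \<subseteq> U" using U x open_contains_ball by metis
  define d where "d = min d1 (min d2 d3)"
  \<comment> \<open>Keeps the parallelogram with sides \<open>h\<close> times \<open>a\<close> and
    \<open>b\<close> within \<open>d / 2\<close> of \<open>x\<close>; the summand 1 prevents a
    division by zero when both directions vanish.\<close>
  define h where "h = d / (2 * (norm a + norm b + 1))"
  have d: "d > 0" using d1 d2 d3 by (simp add: d_def)
  have pos: "norm a + norm b + 1 > 0" by (simp add: add_nonneg_pos)
  have h: "h > 0" using d pos by (simp add: h_def)
  have hb: "h * (norm a + norm b + 1) = d / 2"
  proof -
    obtain n where n: "n = norm a + norm b + 1" "n > 0" using pos by blast
    then show ?thesis unfolding h_def n(1)[symmetric] by (simp add: field_simps)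
  qed
  have near: "dist (x + s *\<^sub>R a + t *\<^sub>R b) x < d" if "0 \<le> s" "s \<le> h" "0 \<le> t" "t \<le> h" for s t
  proof -
    have "dist (x + s *\<^sub>R a + t *\<^sub>R b) x \<le> s * norm a + t * norm b"
      using that norm_triangle_ineq[of "s *\<^sub>R a" "t *\<^sub>R b"] by (simp add: dist_norm)
    also have "\<dots> \<le> h * norm a + h * norm b"
      using that by (intro add_mono mult_right_mono) auto
    also have "\<dots> \<le> d / 2" using hb h by (simp add: algebra_simps)
    finally show ?thesis using d by simp
  qed
  have inU: "x + s *\<^sub>R a + t *\<^sub>R b \<in> U" if "0 \<le> s" "s \<le> h" "0 \<le> t" "t \<le> h" for s t
    using near[OF that] d3(2) by (auto simp: d_def dist_commute)
  obtain s t where 1: "0 < s" "s < h" "0 < t" "t < h" and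
    eq1: "f (x + h *\<^sub>R a + h *\<^sub>R b) - f (x + h *\<^sub>R a) - f (x + h *\<^sub>R b) + f x = h * h * ?P (x + s *\<^sub>R a + t *\<^sub>R b)"
    using mixed_difference[OF f h inU] by blast
  have inU': "x + s *\<^sub>R b + t *\<^sub>R a \<in> U" if "0 \<le> s" "s \<le> h" "0 \<le> t" "t \<le> h" for s t
    using inU[OF that(3,4,1,2)] by (simp add: algebra_simps)
  obtain s' t' where 2: "0 < s'" "s' < h" "0 < t'" "t' < h" and
    eq2: "f (x + h *\<^sub>R b + h *\<^sub>R a) - f (x + h *\<^sub>R b) - f (x + h *\<^sub>R a) + f x = h * h * ?Q (x + s' *\<^sub>R b + t' *\<^sub>R a)"
    using mixed_difference[OF f h inU'] by blast
  have "x + h *\<^sub>R b + h *\<^sub>R a = x + h *\<^sub>R a + h *\<^sub>R b" by simp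
  with eq1 eq2 have "h * h * ?P (x + s *\<^sub>R a + t *\<^sub>R b) = h * h * ?Q (x + s' *\<^sub>R b + t' *\<^sub>R a)"
    by (simp add: algebra_simps)
  then have "?P (x + s *\<^sub>R a + t *\<^sub>R b) = ?Q (x + s' *\<^sub>R b + t' *\<^sub>R a)" using h by simp
  moreover have "dist (?P (x + s *\<^sub>R a + t *\<^sub>R b)) (?P x) < e"
    using near[of s t] 1 by (intro d1(2)) (auto simp: d_def)
  moreover have "dist (?Q (x + s' *\<^sub>R b + t' *\<^sub>R a)) (?Q x) < e"
    using near[of t' s'] 2 by (intro d2(2)) (auto simp: d_def add.assoc add.commute add.left_commute)
  ultimately show False unfolding e_def dist_real_def by (simp add: abs_if split: if_splits)
qed

lemma frechet_derivative_inner: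
  assumes "(f has_derivative f') (at x)"
  shows "frechet_derivative (\<lambda>y. f y \<bullet> i) (at x) v = f' v \<bullet> i"
  by (rule fun_cong[OF frechet_derivative_eqI[OF has_derivative_inner_left[OF assms]]])

lemma Cinf_inner: "open U \<Longrightarrow> Cinf U f \<Longrightarrow> Cinf U g \<Longrightarrow> Cinf U (\<lambda>x. f x \<bullet> g x)"
  by (rule Cinf_bilinear[OF bounded_bilinear_inner])

text \<open>Componentwise reduction to real values, for which the mean value theorem holds.\<close>

lemma symmetric_second_derivative:
  fixes f :: "'a::real_normed_vector \<Rightarrow> 'b::euclidean_space"
  assumes U: "open U" and f: "Cinf U f" and x: "x \<in> U"
  shows "frechet_derivative (\<lambda>y. frechet_derivative f (at y) a) (at x) b =
         frechet_derivative (\<lambda>y. frechet_derivative f (at y) b) (at x) a"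
proof (rule euclidean_eqI)
  fix i :: 'b assume "i \<in> Basis"
  let ?f = "\<lambda>y. f y \<bullet> i"
  have fi: "Cinf U ?f" by (rule Cinf_inner[OF U f Cinf_const])
  have *: "frechet_derivative (\<lambda>y. frechet_derivative f (at y) v) (at x) w \<bullet> i =
     frechet_derivative (\<lambda>y. frechet_derivative ?f (at y) v) (at x) w" for v w
  proof -
    have "frechet_derivative (\<lambda>y. frechet_derivative f (at y) v) (at x) w \<bullet> i =
      frechet_derivative (\<lambda>y. frechet_derivative f (at y) v \<bullet> i) (at x) w"
      by (rule frechet_derivative_inner[OF Cinf_has_derivative[OF Cinf_frechet[OF f] x], symmetric])
    also have "\<dots> = frechet_derivative (\<lambda>y. frechet_derivative ?f (at y) v) (at x) w"
      by (rule fun_cong[OF frechet_derivative_cong_open[OF U x]])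
        (rule frechet_derivative_inner[OF Cinf_has_derivative[OF f], symmetric])
    finally show ?thesis .
  qed
  show "frechet_derivative (\<lambda>y. frechet_derivative f (at y) a) (at x) b \<bullet> i =
      frechet_derivative (\<lambda>y. frechet_derivative f (at y) b) (at x) a \<bullet> i"
    unfolding * by (rule symmetric_second_derivative_real[OF U fi x])
qed

text \<open>A linear projection onto a subspace turns functions that are smooth on a relatively open subset
  into functions that are smooth on an open set, without a choice of local extensions.\<close>

definition onb :: "'a::euclidean_space set \<Rightarrow> 'a set" where
  "onb V = (SOME B. B \<subseteq> V \<and> pairwise orthogonal B \<and> (\<forall>x\<in>B. norm x = 1) \<and> independent B \<and> span B = V)"

definition proj :: "'a::euclidean_space set \<Rightarrow> 'a \<Rightarrow> 'a" where
  "proj V x = (\<Sum>b\<in>onb V. (x \<bullet> b) *\<^sub>R b)"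

lemma onb:
  assumes "subspace V"
  shows "onb V \<subseteq> V" "pairwise orthogonal (onb V)" "\<forall>x\<in>onb V. norm x = 1" "independent (onb V)"
    "span (onb V) = V" "finite (onb V)"
proof -
  have "\<exists>B. B \<subseteq> V \<and> pairwise orthogonal B \<and> (\<forall>x\<in>B. norm x = 1) \<and> independent B \<and> span B = V"
    by (rule orthonormal_basis_subspace[OF assms]) blast
  from someI_ex[OF this] show "onb V \<subseteq> V" "pairwise orthogonal (onb V)" "\<forall>x\<in>onb V. norm x = 1"
    "independent (onb V)" "span (onb V) = V" unfolding onb_def by blast+
  then show "finite (onb V)" using independent_imp_finite by blast
qed

lemma inner_onb:
  assumes "subspace V" "b \<in> onb V" "b' \<in> onb V"
  shows "b \<bullet> b' = (if b = b' then 1 else 0)"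
  using onb(2,3)[OF assms(1)] assms(2,3) by (auto simp: pairwise_def orthogonal_def norm_eq_1)

lemma bounded_linear_proj: "bounded_linear (proj V)"
  unfolding linear_conv_bounded_linear[symmetric]
  by (rule linearI) (simp_all add: proj_def inner_add_left scaleR_add_left sum.distrib scaleR_sum_right)

lemma open_vimage_proj: "open T \<Longrightarrow> open (proj V -` T)"
  by (rule open_vimage[OF _ linear_continuous_on[OF bounded_linear_proj]])

lemma proj_in: "subspace V \<Longrightarrow> proj V x \<in> V"
  unfolding proj_def using onb(1) by (auto intro!: subspace_sum subspace_scale)

lemma inner_sum_onb:
  assumes "subspace V" "b \<in> onb V"
  shows "(\<Sum>c\<in>onb V. f c *\<^sub>R c) \<bullet> b = f b"
proof -
  have "(\<Sum>c\<in>onb V. f c *\<^sub>R c) \<bullet> b = (\<Sum>c\<in>onb V. if c = b then f c else 0)"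
    unfolding inner_sum_left by (intro sum.cong refl) (simp add: inner_onb[OF assms(1) _ assms(2)])
  also have "\<dots> = f b" using assms onb(6)[OF assms(1)] by (simp add: sum.delta)
  finally show ?thesis .
qed

lemma proj_id:
  assumes "subspace V" "x \<in> V" shows "proj V x = x"
proof -
  have "x \<in> span (onb V)" using assms(2) onb(5)[OF assms(1)] by simp
  then obtain f where f: "x = (\<Sum>c\<in>onb V. f c *\<^sub>R c)"
    unfolding span_finite[OF onb(6)[OF assms(1)]] by auto
  have "proj V x = (\<Sum>b\<in>onb V. f b *\<^sub>R b)"
    unfolding proj_def f by (intro sum.cong refl) (simp add: inner_sum_onb[OF assms(1)])
  then show ?thesis using f by simp
qed

lemma openin_subset_subspace: "openin (top_of_set V) S \<Longrightarrow> S \<subseteq> V"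
  using openin_imp_subset by blast

section \<open>Smoothness on relatively open subsets of a subspace\<close>

lemma open_proj_vimage:
  assumes "subspace V" "openin (top_of_set V) S" shows "open (proj V -` S)"
proof -
  obtain T where "open T" "S = V \<inter> T" using assms(2) unfolding openin_open by blast
  then have "proj V -` S = proj V -` T" using proj_in[OF assms(1)] by auto
  then show ?thesis using open_vimage_proj[OF \<open>open T\<close>] by simp
qed

text \<open>Forward: local extensions composed with the projection agree with
  \<open>f \<circ> proj V\<close> and so fit together to one smooth function on an open set.
  Backward: this function is itself an extension, because the projection is the identity on
  \<open>V\<close>.\<close>

lemma smooth_on_iff:
  fixes V :: "'a::euclidean_space set"
  assumes V: "subspace V" and S: "openin (top_of_set V) S"
  shows "smooth_on S f \<longleftrightarrow> Cinf (proj V -` S) (\<lambda>x. f (proj V x))"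
proof
  assume L: "smooth_on S f"
  show "Cinf (proj V -` S) (\<lambda>x. f (proj V x))"
  proof (rule Cinf_local)
    fix x assume "x \<in> proj V -` S"
    then obtain U g where U: "open U" "proj V x \<in> U" "Cinf U g" "\<forall>y\<in>S \<inter> U. g y = f y"
      using L unfolding smooth_on_def Cinf_def by blast
    let ?W = "proj V -` S \<inter> proj V -` U"
    have W: "open ?W" using open_vimage_proj[OF U(1)] open_proj_vimage[OF V S] by blast
    have "Cinf ?W (\<lambda>x. g (proj V x))"
      by (rule Cinf_compose[OF W U(1) U(3) Cinf_linear[OF bounded_linear_proj]]) auto
    then have "Cinf ?W (\<lambda>x. f (proj V x))"
      by (rule Cinf_cong[OF W, rotated]) (use U(4) in auto)
    then show "\<exists>W. open W \<and> x \<in> W \<and> Cinf W (\<lambda>x. f (proj V x))"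
      using W U(2) \<open>x \<in> proj V -` S\<close> by blast
  qed
next
  assume R: "Cinf (proj V -` S) (\<lambda>x. f (proj V x))"
  have "proj V y = y" if "y \<in> S" for y using proj_id[OF V] openin_subset_subspace[OF S] that by auto
  then show "smooth_on S f"
    using R open_proj_vimage[OF V S] unfolding smooth_on_def Cinf_def
    by (intro ballI exI[of _ "proj V -` S"] exI[of _ "\<lambda>x. f (proj V x)"]) auto
qed

lemma smooth_onI_Cinf: "open U \<Longrightarrow> Cinf U f \<Longrightarrow> S \<subseteq> U \<Longrightarrow> smooth_on S f"
  unfolding smooth_on_def Cinf_def by blast

lemma smooth_onE:
  assumes "smooth_on S f" "x \<in> S"
  obtains U g where "open U" "x \<in> U" "Cinf U g" "\<forall>y\<in>S \<inter> U. g y = f y"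
proof -
  obtain U g where "open U" "x \<in> U" "Cinf U g" "\<forall>y\<in>S \<inter> U. g y = f y"
    using bspec[OF assms(1)[unfolded smooth_on_def] assms(2)] unfolding Cinf_def by auto
  then show ?thesis by (rule that)
qed

lemma smooth_onI:
  assumes "\<And>x. x \<in> S \<Longrightarrow> \<exists>U g. open U \<and> x \<in> U \<and> Cinf U g \<and> (\<forall>y\<in>S \<inter> U. g y = f y)"
  shows "smooth_on S f"
  unfolding smooth_on_def using assms[unfolded Cinf_def] by (rule ballI)

lemma smooth_on_mono:
  assumes "smooth_on S f" "T \<subseteq> S" "\<And>x. x \<in> T \<Longrightarrow> f x = g x"
  shows "smooth_on T g"
proof (rule smooth_onI)
  fix x assume x: "x \<in> T"
  then have "x \<in> S" using assms(2) by auto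
  obtain U h where U: "open U" "x \<in> U" "Cinf U h" "\<forall>y\<in>S \<inter> U. h y = f y"
    by (rule smooth_onE[OF assms(1) \<open>x \<in> S\<close>]) (rule that; assumption)
  then show "\<exists>U h. open U \<and> x \<in> U \<and> Cinf U h \<and> (\<forall>y\<in>T \<inter> U. h y = g y)"
    using assms(2,3) by (intro exI[of _ U] exI[of _ h]) auto
qed

lemma smooth_on_subset: "smooth_on S f \<Longrightarrow> T \<subseteq> S \<Longrightarrow> smooth_on T f"
  by (rule smooth_on_mono) simp_all

lemma smooth_on_cong: "smooth_on S f \<Longrightarrow> (\<And>x. x \<in> S \<Longrightarrow> f x = g x) \<Longrightarrow> smooth_on S g"
  by (rule smooth_on_mono[of S f S g]) simp_all

lemma smooth_on_const: "smooth_on S (\<lambda>x. c)"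
  by (rule smooth_onI_Cinf[OF open_UNIV Cinf_const]) simp

lemma smooth_on_linear: "bounded_linear f \<Longrightarrow> smooth_on S f"
  by (rule smooth_onI_Cinf[OF open_UNIV Cinf_linear]) simp_all

lemma smooth_on_id: "smooth_on S (\<lambda>x. x)"
  by (rule smooth_on_linear[OF bounded_linear_ident])

lemma smooth_on_local:
  assumes "\<And>x. x \<in> S \<Longrightarrow> \<exists>T. openin (top_of_set S) T \<and> x \<in> T \<and> smooth_on T f"
  shows "smooth_on S f"
proof (rule smooth_onI)
  fix x assume "x \<in> S"
  then obtain T where T: "openin (top_of_set S) T" "x \<in> T" "smooth_on T f" using assms by blast
  obtain W where W: "open W" "T = S \<inter> W" using T(1) unfolding openin_open by blast
  obtain U g where U: "open U" "x \<in> U" "Cinf U g" "\<forall>y\<in>T \<inter> U. g y = f y"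
    by (rule smooth_onE[OF T(3,2)]) (rule that; assumption)
  show "\<exists>U g. open U \<and> x \<in> U \<and> Cinf U g \<and> (\<forall>y\<in>S \<inter> U. g y = f y)"
    using U W T(2) Cinf_subset[OF U(3), of "U \<inter> W"]
    by (intro exI[of _ "U \<inter> W"] exI[of _ g]) auto
qed

text \<open>Local extensions of \<open>f\<close> and \<open>g\<close> are restricted to the common
  part of their domains, so an operation has to be checked only for smooth functions on open
  sets.\<close>

lemma smooth_on_combine:
  fixes f :: "'a::real_normed_vector \<Rightarrow> 'b::real_normed_vector" and g :: "'a \<Rightarrow> 'c::real_normed_vector"
  assumes f: "smooth_on S f" and g: "smooth_on S g"
    and B: "\<And>(U :: 'a set) p q. open U \<Longrightarrow> Cinf U p \<Longrightarrow> Cinf U q \<Longrightarrow> Cinf U (\<lambda>x. B (p x) (q x))"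
  shows "smooth_on S (\<lambda>x. B (f x) (g x))"
proof (rule smooth_onI)
  fix x assume x: "x \<in> S"
  obtain U p where U: "open U" "x \<in> U" "Cinf U p" "\<forall>y\<in>S \<inter> U. p y = f y"
    by (rule smooth_onE[OF f x]) (rule that; assumption)
  obtain W q where W: "open W" "x \<in> W" "Cinf W q" "\<forall>y\<in>S \<inter> W. q y = g y"
    by (rule smooth_onE[OF g x]) (rule that; assumption)
  show "\<exists>U h. open U \<and> x \<in> U \<and> Cinf U h \<and> (\<forall>y\<in>S \<inter> U. h y = B (f y) (g y))"
    using U W B[OF open_Int[OF U(1) W(1)] Cinf_subset[OF U(3) Int_lower1] Cinf_subset[OF W(3) Int_lower2]]
    by (intro exI[of _ "U \<inter> W"] exI[of _ "\<lambda>x. B (p x) (q x)"]) auto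
qed

lemma smooth_on_Pair: "smooth_on S f \<Longrightarrow> smooth_on S g \<Longrightarrow> smooth_on S (\<lambda>x. (f x, g x))"
  by (rule smooth_on_combine[OF _ _ Cinf_Pair])

lemma smooth_on_add: "smooth_on S f \<Longrightarrow> smooth_on S g \<Longrightarrow> smooth_on S (\<lambda>x. f x + g x)"
  by (rule smooth_on_combine[OF _ _ Cinf_add])

lemma smooth_on_bilinear:
  "bounded_bilinear B \<Longrightarrow> smooth_on S f \<Longrightarrow> smooth_on S g \<Longrightarrow> smooth_on S (\<lambda>x. B (f x) (g x))"
  by (rule smooth_on_combine[OF _ _ Cinf_bilinear])

lemmas smooth_on_scaleR = smooth_on_bilinear[OF bounded_bilinear_scaleR]
lemmas smooth_on_inner = smooth_on_bilinear[OF bounded_bilinear_inner]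
lemma smooth_on_compose:
  fixes g :: "'b::euclidean_space \<Rightarrow> 'c::real_normed_vector" and f :: "'a::real_normed_vector \<Rightarrow> 'b"
  assumes f: "smooth_on S f" and g: "smooth_on T g" and "f ` S \<subseteq> T"
  shows "smooth_on S (\<lambda>x. g (f x))"
proof (rule smooth_onI)
  fix x assume x: "x \<in> S"
  obtain U p where U: "open U" "x \<in> U" "Cinf U p" "\<forall>y\<in>S \<inter> U. p y = f y"
    by (rule smooth_onE[OF f x]) (rule that; assumption)
  have "f x \<in> T" using assms(3) x by auto
  obtain W q where W: "open W" "f x \<in> W" "Cinf W q" "\<forall>y\<in>T \<inter> W. q y = g y"
    by (rule smooth_onE[OF g \<open>f x \<in> T\<close>]) (rule that; assumption)
  have op: "open (U \<inter> p -` W)"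
    using continuous_open_preimage[OF Cinf_continuous_on[OF U(3)] U(1) W(1)] .
  have "Cinf (U \<inter> p -` W) (\<lambda>x. q (p x))"
    by (rule Cinf_compose[OF op W(1,3) Cinf_subset[OF U(3)]]) auto
  then show "\<exists>U h. open U \<and> x \<in> U \<and> Cinf U h \<and> (\<forall>y\<in>S \<inter> U. h y = g (f y))"
    using U W op x assms(3)
    by (intro exI[of _ "U \<inter> p -` W"] exI[of _ "\<lambda>x. q (p x)"]) auto
qed

lemma smooth_on_continuous_on: "smooth_on S f \<Longrightarrow> continuous_on S f"
  unfolding continuous_on_eq_continuous_within
proof
  fix x assume f: "smooth_on S f" and x: "x \<in> S"
  obtain U g where U: "open U" "x \<in> U" "Cinf U g" "\<forall>y\<in>S \<inter> U. g y = f y"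
    by (rule smooth_onE[OF f x]) (rule that; assumption)
  have "continuous (at x) g" using Cinf_continuous_on[OF U(3)] U(1,2) by (simp add: continuous_on_eq_continuous_at)
  then have "(g \<longlongrightarrow> g x) (at x within S)"
    unfolding continuous_within[symmetric] by (rule continuous_at_imp_continuous_at_within)
  moreover have "eventually (\<lambda>y. g y = f y) (at x within S)"
    unfolding eventually_at_topological using U by blast
  ultimately have "(f \<longlongrightarrow> g x) (at x within S)" by (rule Lim_transform_eventually)
  then show "continuous (at x within S) f" unfolding continuous_within using U(2,4) x by simp
qed

lemma smooth_on_sum:
  assumes "\<And>i. i \<in> I \<Longrightarrow> smooth_on S (f i)"
  shows "smooth_on S (\<lambda>x. \<Sum>i\<in>I. f i x)"
  using assms
  by (induction I rule: infinite_finite_induct) (auto intro: smooth_on_add smooth_on_const)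

text \<open>The derivative of the extension \<open>f \<circ> proj V\<close> in the full space. It
  describes \<open>f\<close> along directions in \<open>V\<close>, sends directions orthogonal to
  \<open>V\<close> to 0, and is unique even if \<open>V\<close> is a proper subspace.\<close>

definition dV :: "'a::euclidean_space set \<Rightarrow> ('a \<Rightarrow> 'b::real_normed_vector) \<Rightarrow> 'a \<Rightarrow> 'a \<Rightarrow> 'b" where
  "dV V f y = frechet_derivative (\<lambda>x. f (proj V x)) (at y)"

locale smooth_fn =
  fixes V :: "'a::euclidean_space set" and S and f :: "'a \<Rightarrow> 'b::real_normed_vector"
  assumes V: "subspace V" and S: "openin (top_of_set V) S" and f: "smooth_on S f"
begin

lemma hat: "open (proj V -` S)" "Cinf (proj V -` S) (\<lambda>x. f (proj V x))"
  using open_proj_vimage[OF V S] smooth_on_iff[OF V S] f by blast+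

lemma S_V: "S \<subseteq> V" using openin_subset_subspace[OF S] .

lemma in_hat: "y \<in> S \<Longrightarrow> y \<in> proj V -` S"
  using proj_id[OF V] S_V by auto

lemma has_dV: "y \<in> S \<Longrightarrow> ((\<lambda>x. f (proj V x)) has_derivative dV V f y) (at y)"
  unfolding dV_def by (rule Cinf_has_derivative[OF hat(2) in_hat])

lemma linear_dV: "y \<in> S \<Longrightarrow> linear (dV V f y)"
  using has_derivative_linear[OF has_dV] .

text \<open>As long as the curve stays in \<open>V\<close>, projecting it changes nothing, so the
  chain rule for the extension differentiates \<open>f\<close> along the curve.\<close>

lemma dV_curve:
  assumes c: "(c has_vector_derivative c') (at t)" and "c t \<in> S" and "eventually (\<lambda>s. c s \<in> V) (nhds t)"
  shows "((\<lambda>s. f (c s)) has_vector_derivative dV V f (c t) c') (at t)"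
proof -
  have "((\<lambda>s. f (proj V (c s))) has_derivative (\<lambda>h. dV V f (c t) (h *\<^sub>R c'))) (at t)"
    using has_derivative_compose[OF c[unfolded has_vector_derivative_def] has_dV[OF assms(2)]] .
  moreover have "(\<lambda>h. dV V f (c t) (h *\<^sub>R c')) = (\<lambda>h. h *\<^sub>R dV V f (c t) c')"
    using linear_scale[OF linear_dV[OF assms(2)]] by auto
  ultimately have *: "((\<lambda>s. f (proj V (c s))) has_vector_derivative dV V f (c t) c') (at t)"
    unfolding has_vector_derivative_def by simp
  obtain E where E: "open E" "t \<in> E" "\<And>s. s \<in> E \<Longrightarrow> c s \<in> V"
    using assms(3) unfolding eventually_nhds by blast
  show ?thesis
    by (rule has_vector_derivative_transform_within_open[OF * E(1,2)])
      (simp add: proj_id[OF V E(3)])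
qed

lemma dV_line:
  assumes "y \<in> S" "a \<in> V"
  shows "((\<lambda>s. f (y + s *\<^sub>R a)) has_vector_derivative dV V f y a) (at 0)"
proof -
  have "((\<lambda>s. y + s *\<^sub>R a) has_vector_derivative a) (at 0)"
    by (auto intro!: derivative_eq_intros)
  moreover have "\<And>s. y + s *\<^sub>R a \<in> V" using V assms S_V by (auto intro!: subspace_add subspace_scale)
  ultimately show ?thesis using dV_curve[of "\<lambda>s. y + s *\<^sub>R a" a 0] assms(1) by simp
qed

lemma dV_smooth: "smooth_on S (\<lambda>y. dV V f y a)"
  unfolding dV_def by (rule smooth_onI_Cinf[OF hat(1) Cinf_frechet[OF hat(2)]]) (use in_hat in auto)

lemma dV_cong:
  assumes "\<And>x. x \<in> S \<Longrightarrow> f x = g x" "y \<in> S"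
  shows "dV V f y = dV V g y"
  unfolding dV_def
  by (rule frechet_derivative_cong_open[OF hat(1) in_hat[OF assms(2)]]) (simp add: assms(1))

end

text \<open>Near \<open>y\<close>, projecting the values to \<open>W\<close> has no effect; by
  uniqueness the derivative therefore equals its own projection.\<close>

lemma dV_in:
  fixes f :: "'a::euclidean_space \<Rightarrow> 'b::euclidean_space"
  assumes sf: "smooth_fn V S f" and W: "subspace W" and "f ` S \<subseteq> W" "y \<in> S"
  shows "dV V f y a \<in> W"
proof -
  interpret smooth_fn V S f by (rule sf)
  have "((\<lambda>x. proj W (f (proj V x))) has_derivative (\<lambda>a. proj W (dV V f y a))) (at y)"
    by (rule bounded_linear.has_derivative[OF bounded_linear_proj has_dV[OF assms(4)]])
  then have "((\<lambda>x. f (proj V x)) has_derivative (\<lambda>a. proj W (dV V f y a))) (at y)"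
    by (rule has_derivative_transform_within_open[OF _ hat(1) in_hat[OF assms(4)]])
      (use assms(3) proj_id[OF W] in auto)
  then have "(\<lambda>a. proj W (dV V f y a)) = dV V f y"
    using has_derivative_unique has_dV[OF assms(4)] by blast
  then have "proj W (dV V f y a) = dV V f y a" by (rule fun_cong)
  then show ?thesis using proj_in[OF W, of "dV V f y a"] by simp
qed

lemma dV_chain:
  fixes f :: "'a::euclidean_space \<Rightarrow> 'b::euclidean_space" and g :: "'b \<Rightarrow> 'c::real_normed_vector"
  assumes sf: "smooth_fn V S f" and sg: "smooth_fn W T g" and "f ` S \<subseteq> T" "y \<in> S"
  shows "dV V (\<lambda>x. g (f x)) y a = dV W g (f y) (dV V f y a)"
proof -
  interpret f: smooth_fn V S f by (rule sf)
  interpret g: smooth_fn W T g by (rule sg)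
  have "f y \<in> T" using assms(3,4) by auto
  have "f (proj V y) = f y" using proj_id[OF f.V] f.S_V assms(4) by auto
  then have "((\<lambda>x. g (proj W (f (proj V x)))) has_derivative (\<lambda>a. dV W g (f y) (dV V f y a))) (at y)"
    using has_derivative_compose[OF f.has_dV[OF assms(4)]] g.has_dV[OF \<open>f y \<in> T\<close>] by simp
  then have "((\<lambda>x. g (f (proj V x))) has_derivative (\<lambda>a. dV W g (f y) (dV V f y a))) (at y)"
    by (rule has_derivative_transform_within_open[OF _ f.hat(1) f.in_hat[OF assms(4)]])
      (use assms(3) proj_id[OF g.V] g.S_V in \<open>simp add: image_subset_iff subset_iff\<close>)
  then show ?thesis unfolding dV_def[of V "\<lambda>x. g (f x)"] by (rule fun_cong[OF frechet_derivative_eqI])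
qed

lemma dV_symmetric:
  fixes f :: "'a::euclidean_space \<Rightarrow> 'b::euclidean_space"
  assumes sf: "smooth_fn V S f" and y: "y \<in> S" and a: "a \<in> V" and b: "b \<in> V"
  shows "dV V (\<lambda>y. dV V f y a) y b = dV V (\<lambda>y. dV V f y b) y a"
proof -
  interpret smooth_fn V S f by (rule sf)
  \<comment> \<open>The outer \<open>dV\<close> inserts another projection in front of the inner
    derivative. In a direction of \<open>V\<close> both versions are the derivative along the same
    line, so ordinary iterated derivatives may be used instead.\<close>
  have *: "dV V (\<lambda>y. dV V f y u) y w = frechet_derivative (\<lambda>y. dV V f y u) (at y) w" if w: "w \<in> V" for u w
  proof -
    interpret d: smooth_fn V S "\<lambda>y. dV V f y u"
      by unfold_locales (rule V S dV_smooth)+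
    have "Cinf (proj V -` S) (\<lambda>y. dV V f y u)"
      unfolding dV_def by (rule Cinf_frechet[OF hat(2)])
    from Cinf_vector_derivative_line[OF this, of y 0 w] in_hat[OF y]
    have "((\<lambda>t. dV V f (y + t *\<^sub>R w) u) has_vector_derivative
        frechet_derivative (\<lambda>y. dV V f y u) (at y) w) (at 0)" by simp
    with d.dV_line[OF y w] show ?thesis by (rule vector_derivative_unique_at)
  qed
  show ?thesis
    unfolding *[OF a] *[OF b] unfolding dV_def
    by (rule symmetric_second_derivative[OF hat in_hat[OF y]])
qed

lemma dir_deriv_eq:
  assumes "smooth_fn V S f" "y \<in> S" "a \<in> V"
  shows "dir_deriv f a y = dV V f y a"
  using smooth_fn.dV_line[OF assms]
  unfolding dir_deriv_def has_real_derivative_iff_has_vector_derivative[symmetric]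
  by (rule DERIV_imp_deriv)

lemma dV_linear:
  assumes "bounded_linear f" shows "dV V f y a = f (proj V a)"
proof -
  have "bounded_linear (\<lambda>x. f (proj V x))"
    using bounded_linear_compose[OF assms bounded_linear_proj] .
  from frechet_derivative_eqI[OF bounded_linear_imp_has_derivative[OF this]]
  show ?thesis unfolding dV_def by simp
qed

lemma dV_bilinear:
  assumes B: "bounded_bilinear B" and f: "smooth_fn V S f" and g: "smooth_fn V S g" and y: "y \<in> S"
  shows "dV V (\<lambda>x. B (f x) (g x)) y a = B (f y) (dV V g y a) + B (dV V f y a) (g y)"
proof -
  have "proj V y = y" using proj_id[OF smooth_fn.V[OF f]] smooth_fn.S_V[OF f] y by auto
  then show ?thesis
    using frechet_derivative_eqI[OF bounded_bilinear.FDERIV[OF B smooth_fn.has_dV[OF f y] smooth_fn.has_dV[OF g y]]]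
    unfolding dV_def by simp
qed

text \<open>A product rule in which one factor is merely continuous; it holds because the other
  factor vanishes at \<open>x\<close>. In \<open>Ck_on_inverse_family\<close> it breaks a circle,
  since there the inverse is not yet known to be differentiable.\<close>

lemma has_derivative_scaleR_vanishing:
  fixes e :: "'a::real_normed_vector \<Rightarrow> real" and w :: "'a \<Rightarrow> 'b::real_normed_vector"
  assumes e: "(e has_derivative e') (at x)" and e0: "e x = 0" and w: "continuous (at x) w"
  shows "((\<lambda>y. e y *\<^sub>R w y) has_derivative (\<lambda>h. e' h *\<^sub>R w x)) (at x)"
proof -
  obtain K where K: "\<And>h. norm (e' h) \<le> norm h * K"
    using bounded_linear.bounded[OF has_derivative_bounded_linear[OF e]] by blast
  have lim: "((\<lambda>y. norm (e y - e x - e' (y - x)) / norm (y - x)) \<longlongrightarrow> 0) (at x)"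
  proof -
    have "((\<lambda>y. (e y - e x - e' (y - x)) /\<^sub>R norm (y - x)) \<longlongrightarrow> 0) (at x)"
      using e unfolding has_derivative_at_within by blast
    from tendsto_norm_zero[OF this] show ?thesis by (simp add: divide_inverse mult.commute abs_mult)
  qed
  have wlim: "((\<lambda>y. norm (w y - w x)) \<longlongrightarrow> 0) (at x)"
    using w by (simp add: continuous_within tendsto_norm_zero LIM_zero)
  \<comment> \<open>The quotient of \<open>e y\<close> by \<open>norm (y - x)\<close> stays bounded,
    so multiplying \<open>e y\<close> by \<open>w y - w x\<close>, which tends to 0, gives something
    of smaller order than \<open>norm (y - x)\<close>.\<close>
  have "((\<lambda>y. e y *\<^sub>R (w y - w x)) has_derivative (\<lambda>h. 0)) (at x)"
    unfolding has_derivative_at_within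
  proof (intro conjI bounded_linear_zero)
    have "((\<lambda>y. (norm (e y - e x - e' (y - x)) / norm (y - x) + K) * norm (w y - w x)) \<longlongrightarrow> (0 + K) * 0) (at x)"
      by (intro tendsto_mult tendsto_add lim wlim tendsto_const)
    then have lim2: "((\<lambda>y. (norm (e y - e x - e' (y - x)) / norm (y - x) + K) * norm (w y - w x)) \<longlongrightarrow> 0) (at x)"
      by simp
    show "((\<lambda>y. (e y *\<^sub>R (w y - w x) - e x *\<^sub>R (w x - w x) - 0) /\<^sub>R norm (y - x)) \<longlongrightarrow> 0) (at x)"
    proof (rule Lim_null_comparison[OF _ lim2])
      have "norm ((e y *\<^sub>R (w y - w x) - e x *\<^sub>R (w x - w x) - 0) /\<^sub>R norm (y - x))
         \<le> (norm (e y - e x - e' (y - x)) / norm (y - x) + K) * norm (w y - w x)" if "y \<noteq> x" for y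
      proof -
        have n: "norm (y - x) > 0" using that by simp
        have "\<bar>e y\<bar> \<le> norm (e y - e x - e' (y - x)) + norm (e' (y - x))"
          using norm_triangle_ineq[of "e y - e x - e' (y - x)" "e' (y - x)"] e0 by simp
        also have "\<dots> \<le> norm (e y - e x - e' (y - x)) + norm (y - x) * K"
          using K[of "y - x"] by simp
        finally have "\<bar>e y\<bar> / norm (y - x) \<le> norm (e y - e x - e' (y - x)) / norm (y - x) + K"
          using n by (simp add: field_simps)
        from mult_right_mono[OF this, of "norm (w y - w x)"] show ?thesis
          by (simp add: divide_inverse ac_simps abs_mult)
      qed
      then show "\<forall>\<^sub>F y in at x. norm ((e y *\<^sub>R (w y - w x) - e x *\<^sub>R (w x - w x) - 0) /\<^sub>R norm (y - x))
         \<le> (norm (e y - e x - e' (y - x)) / norm (y - x) + K) * norm (w y - w x)"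
        by (auto simp: eventually_at_filter)
    qed
  qed
  moreover have "((\<lambda>y. e y *\<^sub>R w x) has_derivative (\<lambda>h. e' h *\<^sub>R w x)) (at x)"
    by (rule has_derivative_scaleR_left[OF e])
  ultimately have "((\<lambda>y. e y *\<^sub>R (w y - w x) + e y *\<^sub>R w x) has_derivative (\<lambda>h. 0 + e' h *\<^sub>R w x)) (at x)"
    by (rule has_derivative_add)
  then show ?thesis by (simp add: scaleR_right_diff_distrib)
qed

text \<open>Fix \<open>x\<close> and put \<open>c = W v x\<close>. Applying the inverse at
  \<open>y\<close> to \<open>v - A y c\<close> shows that \<open>W v y\<close> is \<open>c\<close>
  plus the sum of the \<open>W j y\<close> with coefficients \<open>(v - A y c) \<bullet> j\<close>.
  These vanish at \<open>x\<close>, so continuity of the \<open>W j\<close> already gives the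
  derivative \<open>W'\<close>. It is a polynomial expression in components of \<open>W\<close> and
  derivatives of \<open>A\<close>, and regularity rises step by step.\<close>

lemma Ck_on_inverse_family:
  fixes A :: "'a::euclidean_space \<Rightarrow> 'b::euclidean_space \<Rightarrow> 'b"
  assumes U: "open U" and lin: "\<And>x. x \<in> U \<Longrightarrow> linear (A x)" and bij: "\<And>x. x \<in> U \<Longrightarrow> bij (A x)"
    and bound: "\<And>x w. x \<in> U \<Longrightarrow> norm w \<le> 2 * norm (A x w)"
    and smooth: "\<And>v. Cinf U (\<lambda>x. A x v)"
  shows "Ck_on k U (\<lambda>x. inv_into UNIV (A x) v)"
proof -
  define W where "W v x = inv_into UNIV (A x) v" for v x
  have AW: "A x (W v x) = v" if "x \<in> U" for x v
    unfolding W_def using bij[OF that] by (simp add: bij_is_surj surj_f_inv_f)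
  have WA: "W (A x v) x = v" if "x \<in> U" for x v
    unfolding W_def using bij[OF that] by (simp add: bij_is_inj inv_f_f)
  have linW: "linear (\<lambda>v. W v x)" if "x \<in> U" for x
  proof -
    have "W (p + q) x = W p x + W q x" for p q
      using WA[OF that, of "W p x + W q x"] AW[OF that] linear_add[OF lin[OF that]] by simp
    moreover have "W (r *\<^sub>R p) x = r *\<^sub>R W p x" for r p
      using WA[OF that, of "r *\<^sub>R W p x"] AW[OF that] linear_scale[OF lin[OF that]] by simp
    ultimately show ?thesis by (rule linearI)
  qed
  \<comment> \<open>The uniform bound on the inverses turns smallness of
    \<open>v - A y (W v x)\<close> into smallness of \<open>W v y - W v x\<close>.\<close>
  have cont: "continuous (at x) (W v)" if x: "x \<in> U" for x v
  proof -
    have "continuous_on U (\<lambda>y. A y (W v x))" by (rule Cinf_continuous_on[OF smooth])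
    then have "((\<lambda>y. A y (W v x)) \<longlongrightarrow> A x (W v x)) (at x)"
      using U x by (simp add: continuous_on_eq_continuous_at continuous_within)
    then have "((\<lambda>y. 2 * norm (v - A y (W v x))) \<longlongrightarrow> 2 * norm (v - v)) (at x)"
      unfolding AW[OF x] by (intro tendsto_intros)
    then have lim: "((\<lambda>y. 2 * norm (v - A y (W v x))) \<longlongrightarrow> 0) (at x)" by simp
    have "norm (W v y - W v x) \<le> 2 * norm (v - A y (W v x))" if "y \<in> U" for y
      using bound[OF that, of "W v y - W v x"] AW[OF that] linear_diff[OF lin[OF that]] by simp
    then have "\<forall>\<^sub>F y in at x. norm (W v y - W v x) \<le> 2 * norm (v - A y (W v x))"
      using U x unfolding eventually_at_topological by blast
    from Lim_null_comparison[OF this lim] show ?thesis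
      by (simp add: continuous_within LIM_zero_cancel)
  qed
  define E where "E x i h = frechet_derivative (\<lambda>y. A y i) (at x) h" for x i h
  define W' where "W' v x h = (\<Sum>j\<in>Basis. (- (\<Sum>i\<in>Basis. (W v x \<bullet> i) * (E x i h \<bullet> j))) *\<^sub>R W j x)" for v x h
  have der: "(W v has_derivative W' v x) (at x)" if x: "x \<in> U" for v x
  proof -
    define c where "c = W v x"
    have expand: "A y c = (\<Sum>i\<in>Basis. (c \<bullet> i) *\<^sub>R A y i)" if "y \<in> U" for y
    proof -
      interpret linear "A y" by (rule lin[OF that])
      show ?thesis by (subst (1) euclidean_representation[of c, symmetric]) (simp only: sum scale)
    qed
    have "((\<lambda>y. \<Sum>i\<in>Basis. (c \<bullet> i) *\<^sub>R A y i) has_derivative (\<lambda>h. \<Sum>i\<in>Basis. (c \<bullet> i) *\<^sub>R E x i h)) (at x)"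
      unfolding E_def
      by (intro has_derivative_sum has_derivative_scaleR_right Cinf_has_derivative[OF smooth x])
    then have "((\<lambda>y. A y c) has_derivative (\<lambda>h. \<Sum>i\<in>Basis. (c \<bullet> i) *\<^sub>R E x i h)) (at x)"
      by (rule has_derivative_transform_within_open[OF _ U x]) (simp add: expand)
    then have "((\<lambda>y. (v - A y c) \<bullet> j) has_derivative (\<lambda>h. (0 - (\<Sum>i\<in>Basis. (c \<bullet> i) *\<^sub>R E x i h)) \<bullet> j)) (at x)" for j
      by (intro has_derivative_inner_left has_derivative_diff has_derivative_const)
    from has_derivative_scaleR_vanishing[OF this _ cont[OF x]]
    have "((\<lambda>y. ((v - A y c) \<bullet> j) *\<^sub>R W j y) has_derivative
        (\<lambda>h. ((0 - (\<Sum>i\<in>Basis. (c \<bullet> i) *\<^sub>R E x i h)) \<bullet> j) *\<^sub>R W j x)) (at x)" for j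
      using AW[OF x] by (simp add: c_def)
    then have "((\<lambda>y. c + (\<Sum>j\<in>Basis. ((v - A y c) \<bullet> j) *\<^sub>R W j y)) has_derivative
        (\<lambda>h. 0 + (\<Sum>j\<in>Basis. ((0 - (\<Sum>i\<in>Basis. (c \<bullet> i) *\<^sub>R E x i h)) \<bullet> j) *\<^sub>R W j x))) (at x)"
      by (intro has_derivative_add has_derivative_const has_derivative_sum)
    moreover have "c + (\<Sum>j\<in>Basis. ((v - A y c) \<bullet> j) *\<^sub>R W j y) = W v y" if y: "y \<in> U" for y
    proof -
      interpret linear "\<lambda>v. W v y" by (rule linW[OF y])
      have "(\<Sum>j\<in>Basis. ((v - A y c) \<bullet> j) *\<^sub>R W j y) = W (v - A y c) y"
      proof -
        have "W (\<Sum>j\<in>Basis. (u \<bullet> j) *\<^sub>R j) y = (\<Sum>j\<in>Basis. (u \<bullet> j) *\<^sub>R W j y)" for u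
          by (simp only: sum scale)
        from this[of "v - A y c"] show ?thesis unfolding euclidean_representation by simp
      qed
      then show ?thesis using WA[OF y] by (simp add: diff)
    qed
    ultimately have "(W v has_derivative
        (\<lambda>h. 0 + (\<Sum>j\<in>Basis. ((0 - (\<Sum>i\<in>Basis. (c \<bullet> i) *\<^sub>R E x i h)) \<bullet> j) *\<^sub>R W j x))) (at x)"
      using has_derivative_transform_within_open[OF _ U x] by blast
    moreover have "W' v x h = 0 + (\<Sum>j\<in>Basis. ((0 - (\<Sum>i\<in>Basis. (c \<bullet> i) *\<^sub>R E x i h)) \<bullet> j) *\<^sub>R W j x)" for h
      by (simp add: W'_def c_def inner_sum_left)
    ultimately show ?thesis by presburger
  qed
  have "Ck_on k U (W v)" for v
  proof (induction k arbitrary: v)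
    case 0
    then show ?case using cont by (simp add: continuous_at_imp_continuous_on)
  next
    case (Suc k)
    have Ei: "Ck_on k U (\<lambda>x. E x i h \<bullet> j)" for i h j
      unfolding E_def using Cinf_inner[OF U Cinf_frechet[OF smooth] Cinf_const] Cinf_Ck by blast
    have Wi: "Ck_on k U (\<lambda>x. W v x \<bullet> i)" for i
      by (rule Ck_on_bilinear[OF bounded_bilinear_inner U Suc Ck_on_const])
    have "Ck_on k U (\<lambda>x. \<Sum>i\<in>Basis. (W v x \<bullet> i) * (E x i h \<bullet> j))" for h j
      by (rule Ck_on_sum[OF U Ck_on_bilinear[OF bounded_bilinear_mult U Wi Ei]])
    from Ck_on_bilinear[OF bounded_bilinear_mult U Ck_on_const[of _ _ "-1"] this]
    have "Ck_on k U (\<lambda>x. - (\<Sum>i\<in>Basis. (W v x \<bullet> i) * (E x i h \<bullet> j)))" for h j by simp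
    from Ck_on_sum[OF U Ck_on_bilinear[OF bounded_bilinear_scaleR U this Suc]]
    have "Ck_on k U (\<lambda>x. W' v x h)" for h unfolding W'_def .
    from Ck_on_SucI[OF U der this] show ?case .
  qed
  then show ?thesis unfolding W_def by blast
qed

section \<open>Smooth local inverses, submersions and injective differentials\<close>

lemma continuous_on_Blinfun_frechet:
  fixes H :: "'a::euclidean_space \<Rightarrow> 'b::euclidean_space"
  assumes "Cinf U H"
  shows "continuous_on U (\<lambda>x. Blinfun (frechet_derivative H (at x)))"
proof (rule continuous_on_blinfun_componentwise)
  fix i :: 'a
  have "blinfun_apply (Blinfun (frechet_derivative H (at x))) i = frechet_derivative H (at x) i" if "x \<in> U" for x
    by (simp add: bounded_linear_Blinfun_apply[OF has_derivative_bounded_linear[OF Cinf_has_derivative[OF assms that]]])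
  then show "continuous_on U (\<lambda>x. blinfun_apply (Blinfun (frechet_derivative H (at x))) i)"
    using Cinf_continuous_on[OF Cinf_frechet[OF assms, of i]] by (simp cong: continuous_on_cong)
qed

text \<open>The derivative at \<open>x0\<close> is normalised to the identity. Where it is within
  1/2 of the identity, its inverses have norm at most 2, the bound that
  \<open>Ck_on_inverse_family\<close> asks for. The derivative of \<open>g\<close> at
  \<open>y\<close> is the inverse of the derivative of \<open>H\<close> at \<open>g y\<close>, so
  \<open>g\<close> gains one class in each induction step.\<close>

lemma Cinf_local_inverse:
  fixes H :: "'a::euclidean_space \<Rightarrow> 'a"
  assumes U: "open U" and H: "Cinf U H" and x0: "x0 \<in> U"
    and id: "frechet_derivative H (at x0) = (\<lambda>v. v)"
  obtains V g where "open V" "H x0 \<in> V" "Cinf V g" "g ` V \<subseteq> U" "g (H x0) = x0" "\<And>y. y \<in> V \<Longrightarrow> H (g y) = y"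
proof -
  define A where "A x = frechet_derivative H (at x)" for x
  define f' where "f' x = Blinfun (A x)" for x
  have bl: "bounded_linear (A x)" if "x \<in> U" for x
    unfolding A_def by (rule has_derivative_bounded_linear[OF Cinf_has_derivative[OF H that]])
  have f'A: "blinfun_apply (f' x) = A x" if "x \<in> U" for x
    unfolding f'_def by (rule bounded_linear_Blinfun_apply[OF bl[OF that]])
  have contf': "continuous_on U f'"
    unfolding f'_def A_def by (rule continuous_on_Blinfun_frechet[OF H])
  have f'id: "f' x0 = id_blinfun"
    by (rule blinfun_eqI) (simp add: f'A[OF x0] A_def id)
  obtain U' V g g' where g: "open U'" "U' \<subseteq> U" "x0 \<in> U'" "open V" "H x0 \<in> V" "homeomorphism U' V H g"
    "\<And>y. y \<in> V \<Longrightarrow> (g has_derivative (g' y)) (at y)"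
    "\<And>y. y \<in> V \<Longrightarrow> g' y = inv_into UNIV (blinfun_apply (f' (g y)))"
    "\<And>y. y \<in> V \<Longrightarrow> bij (blinfun_apply (f' (g y)))"
  proof (rule inverse_function_theorem[OF U _ contf' x0, of H id_blinfun])
    show "(H has_derivative blinfun_apply (f' x)) (at x)" if "x \<in> U" for x
      unfolding f'A[OF that] A_def by (rule Cinf_has_derivative[OF H that])
    show "id_blinfun o\<^sub>L f' x0 = id_blinfun" unfolding f'id by (rule blinfun_eqI) simp
  qed (rule that; assumption)
  define U2 where "U2 = U' \<inter> f' -` ball id_blinfun (1/2)"
  have U2: "open U2" unfolding U2_def
    by (rule continuous_open_preimage[OF continuous_on_subset[OF contf' g(2)] g(1) open_ball])
  have U2U: "x \<in> U" if "x \<in> U2" for x using that g(2) by (auto simp: U2_def)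
  define V2 where "V2 = V \<inter> g -` U2"
  have contg: "continuous_on V g" using g(6) by (simp add: homeomorphism_def)
  have V2: "open V2" unfolding V2_def by (rule continuous_open_preimage[OF contg g(4) U2])
  have bound: "norm w \<le> 2 * norm (A x w)" if x: "x \<in> U2" for x w
  proof -
    have "norm (blinfun_apply (f' x - id_blinfun) w) \<le> norm (f' x - id_blinfun) * norm w" by (rule norm_blinfun)
    also have "\<dots> \<le> 1/2 * norm w" using x
      by (intro mult_right_mono) (auto simp: U2_def dist_norm norm_minus_commute)
    finally have "norm (A x w - w) \<le> 1/2 * norm w" using f'A[OF U2U[OF x]] by (simp add: blinfun.diff_left)
    then show ?thesis using norm_triangle_ineq3[of "A x w" w] by linarith
  qed
  have bij: "bij (A x)" if x: "x \<in> U2" for x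
  proof -
    have "x \<in> U'" using x by (simp add: U2_def)
    then have "H x \<in> V" "g (H x) = x" using g(6) by (auto simp: homeomorphism_def)
    then show ?thesis using g(9)[of "H x"] f'A[OF U2U[OF x]] by simp
  qed
  have inv: "Ck_on k U2 (\<lambda>x. inv_into UNIV (A x) v)" for k v
    using Cinf_subset[OF H] U2U Cinf_frechet
    by (intro Ck_on_inverse_family[OF U2 _ bij bound])
      (auto simp: A_def[symmetric] linear_conv_bounded_linear intro: bl intro!: Cinf_frechet[of U2 H, folded A_def])
  have "Ck_on k V2 g" for k
  proof (induction k)
    case 0
    then show ?case using contg by (auto simp: V2_def intro: continuous_on_subset)
  next
    case (Suc k)
    have "Ck_on k V2 (\<lambda>y. inv_into UNIV (A (g y)) v)" for v
      by (rule Ck_on_compose[OF V2 U2 inv Suc]) (auto simp: V2_def)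
    moreover have "(g has_derivative inv_into UNIV (A (g y))) (at y)" if "y \<in> V2" for y
      using g(7)[of y] g(8)[of y] f'A[OF U2U, of "g y"] that by (simp add: V2_def)
    ultimately show ?case by (rule Ck_on_SucI[OF V2, rotated])
  qed
  then have "Cinf V2 g" by (rule CinfI)
  moreover have gx0: "g (H x0) = x0" using g(3,6) by (auto simp: homeomorphism_def)
  moreover have "x0 \<in> U2" using g(3) f'id by (simp add: U2_def)
  ultimately show ?thesis
    using g(5,6) U2U V2 by (intro that[of V2 g]) (auto simp: V2_def homeomorphism_def)
qed

text \<open>The submersion theorem on subspaces. A linear right inverse \<open>R\<close> of the
  derivative singles out the affine slice \<open>c w = x0 + R (w - y0)\<close>. Adding to
  \<open>f\<close> on this slice the part of \<open>w\<close> orthogonal to \<open>W\<close> yields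
  a map \<open>H\<close> of the full space whose derivative at \<open>y0\<close> is the identity.
  The section is \<open>c\<close> after a local inverse of \<open>H\<close>.\<close>

lemma smooth_right_inverse:
  fixes f :: "'a::euclidean_space \<Rightarrow> 'b::euclidean_space"
  assumes sf: "smooth_fn V S f" and W: "subspace W" and fS: "f ` S \<subseteq> W" and x0: "x0 \<in> S"
    and onto: "W \<subseteq> dV V f x0 ` V"
  obtains T s where "openin (top_of_set W) T" "f x0 \<in> T" "smooth_on T s" "s ` T \<subseteq> S" "s (f x0) = x0"
    "\<And>z. z \<in> T \<Longrightarrow> f (s z) = z"
proof -
  interpret smooth_fn V S f by (rule sf)
  define L where "L = dV V f x0"
  define y0 where "y0 = f x0"
  have linL: "linear L" unfolding L_def by (rule linear_dV[OF x0])
  define pre where "pre b = (SOME a. a \<in> V \<and> L a = b)" for b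
  have pre: "pre b \<in> V" "L (pre b) = b" if "b \<in> W" for b
    using someI_ex[of "\<lambda>a. a \<in> V \<and> L a = b"] onto that unfolding pre_def L_def by auto
  define R where "R w = (\<Sum>b\<in>onb W. (w \<bullet> b) *\<^sub>R pre b)" for w
  have linR: "linear R"
    by (rule linearI) (simp_all add: R_def inner_add_left scaleR_add_left sum.distrib scaleR_sum_right)
  have RV: "R w \<in> V" for w
    unfolding R_def using pre(1) onb(1)[OF W] by (intro subspace_sum[OF V] subspace_scale[OF V]) auto
  have LR: "L (R w) = proj W w" for w
    unfolding R_def proj_def linear_sum[OF linL] linear_scale[OF linL]
    using pre(2) onb(1)[OF W] by (intro sum.cong) auto
  have y0: "y0 \<in> W" using fS x0 by (auto simp: y0_def)
  define c where "c w = x0 + R (w - y0)" for w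
  have blR: "bounded_linear R" using linR linear_conv_bounded_linear by blast
  have cder: "(c has_derivative R) (at w)" for w
    unfolding c_def
    by (rule has_derivative_eq_rhs[OF has_derivative_add[OF has_derivative_const
          bounded_linear.has_derivative[OF blR has_derivative_diff[OF has_derivative_ident has_derivative_const]]]]) simp
  have cC: "Cinf UNIV c"
  proof -
    have eq: "c = (\<lambda>w. (x0 - R y0) + R w)" unfolding c_def using linear_diff[OF linR] by auto
    show ?thesis unfolding eq by (rule Cinf_add[OF open_UNIV Cinf_const Cinf_linear[OF blR]])
  qed
  have cV: "c w \<in> V" for w
    unfolding c_def using RV S_V x0 by (auto intro!: subspace_add[OF V])
  have cy0: "c y0 = x0" unfolding c_def using linear_0[OF linR] by simp
  let ?S = "proj V -` S"
  define U where "U = c -` ?S"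
  have U: "open U" unfolding U_def
    by (rule open_vimage[OF hat(1) Cinf_continuous_on[OF cC]])
  define H where "H w = f (proj V (c w)) + (w - proj W w)" for w
  have blW: "bounded_linear (\<lambda>w. w - proj W w)"
    by (intro bounded_linear_sub bounded_linear_ident bounded_linear_proj)
  have HC: "Cinf U H"
    unfolding H_def
    by (rule Cinf_add[OF U Cinf_compose[OF U hat(1) hat(2) Cinf_subset[OF cC subset_UNIV]] Cinf_linear[OF blW]])
      (auto simp: U_def)
  have y0U: "y0 \<in> U" using in_hat[OF x0] by (simp add: U_def cy0)
  have "((\<lambda>w. f (proj V (c w))) has_derivative (\<lambda>w. L (R w))) (at y0)"
    using has_derivative_compose[OF cder[of y0], of "\<lambda>x. f (proj V x)" L] has_dV[OF x0] by (simp add: cy0 L_def)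
  from has_derivative_add[OF this bounded_linear_imp_has_derivative[OF blW]]
  have "(H has_derivative (\<lambda>w. w)) (at y0)" unfolding H_def LR by simp
  then have idH: "frechet_derivative H (at y0) = (\<lambda>w. w)" by (rule frechet_derivative_eqI)
  have Hy0: "H y0 = y0"
    using proj_id[OF V subsetD[OF S_V x0]] proj_id[OF W y0] by (simp add: H_def cy0 y0_def[symmetric])
  obtain Z g where g: "open Z" "H y0 \<in> Z" "Cinf Z g" "g ` Z \<subseteq> U" "g (H y0) = y0" "\<And>y. y \<in> Z \<Longrightarrow> H (g y) = y"
    by (rule Cinf_local_inverse[OF U HC y0U idH]) (rule that; assumption)
  have pS: "proj V (c w) \<in> S" if "w \<in> U" for w using that by (simp add: U_def)
  have Hg: "f (c (g z)) = z" "g z \<in> U" if "z \<in> W \<inter> Z" for z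
  proof -
    show gz: "g z \<in> U" using g(4) that by auto
    have pc: "proj V (c (g z)) = c (g z)" by (rule proj_id[OF V cV])
    have fW: "f (c (g z)) \<in> W" using pS[OF gz] fS pc by auto
    have eq: "f (c (g z)) + (g z - proj W (g z)) = z" using g(6)[of z] that unfolding H_def pc by simp
    \<comment> \<open>For \<open>z\<close> in \<open>W\<close> the orthogonal part of
      \<open>g z\<close> is a difference of two elements of \<open>W\<close>. Hence
      \<open>g z\<close> lies in \<open>W\<close>, and the correction term in \<open>H\<close> is
      0.\<close>
    have "g z - proj W (g z) = z - f (c (g z))" using eq by (simp add: algebra_simps)
    also have "\<dots> \<in> W" using fW that subspace_diff[OF W] by blast
    finally have "g z \<in> W" using subspace_add[OF W _ proj_in[OF W, of "g z"]] by fastforce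
    then show "f (c (g z)) = z" using eq proj_id[OF W] by simp
  qed
  show ?thesis
  proof (rule that[of "W \<inter> Z" "\<lambda>z. c (g z)"])
    show "openin (top_of_set W) (W \<inter> Z)" using g(1) by (rule openin_open_Int)
    show "f x0 \<in> W \<inter> Z" using g(2) Hy0 y0 by (simp add: y0_def)
    show "smooth_on (W \<inter> Z) (\<lambda>z. c (g z))"
      by (rule smooth_onI_Cinf[OF g(1) Cinf_compose[OF g(1) open_UNIV cC g(3)]]) auto
    show "(\<lambda>z. c (g z)) ` (W \<inter> Z) \<subseteq> S"
      using Hg(2) pS proj_id[OF V cV] by fastforce
    show "c (g (f x0)) = x0" using g(5) Hy0 cy0 by (simp add: y0_def)
    show "f (c (g z)) = z" if "z \<in> W \<inter> Z" for z by (rule Hg(1)[OF that])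
  qed
qed

text \<open>Recording the part orthogonal to \<open>V\<close> as a second component makes the
  derivative injective on the full space, where the local injectivity theorem applies. On
  \<open>V\<close> this component is 0, so injectivity is inherited by \<open>f\<close>.\<close>

lemma smooth_locally_injective:
  fixes f :: "'a::euclidean_space \<Rightarrow> 'b::euclidean_space"
  assumes sf: "smooth_fn V S f" and x0: "x0 \<in> S"
    and inj: "\<And>a. a \<in> V \<Longrightarrow> dV V f x0 a = 0 \<Longrightarrow> a = 0"
  obtains T where "openin (top_of_set V) T" "x0 \<in> T" "T \<subseteq> S" "inj_on f T"
proof -
  interpret smooth_fn V S f by (rule sf)
  let ?S = "proj V -` S"
  define F where "F x = (f (proj V x), x - proj V x)" for x
  have blV: "bounded_linear (\<lambda>w. w - proj V w)"
    by (intro bounded_linear_sub bounded_linear_ident bounded_linear_proj)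
  have FC: "Cinf ?S F" unfolding F_def by (rule Cinf_Pair[OF hat Cinf_linear[OF blV]])
  define D where "D x = frechet_derivative F (at x)" for x
  have der: "(F has_derivative D x) (at x)" if "x \<in> ?S" for x
    unfolding D_def by (rule Cinf_has_derivative[OF FC that])
  have "(F has_derivative (\<lambda>a. (dV V f x0 a, a - proj V a))) (at x0)"
    unfolding F_def by (rule has_derivative_Pair[OF has_dV[OF x0] bounded_linear_imp_has_derivative[OF blV]])
  then have D0: "D x0 = (\<lambda>a. (dV V f x0 a, a - proj V a))" unfolding D_def by (rule frechet_derivative_eqI)
  have linD: "linear (D x0)" using has_derivative_linear[OF der[OF in_hat[OF x0]]] .
  have "inj (D x0)"
    unfolding linear_injective_0[OF linD]
  proof (intro allI impI)
    fix a assume "D x0 a = 0"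
    then have "dV V f x0 a = 0" "a = proj V a" by (auto simp: D0 zero_prod_def)
    then show "a = 0" using inj[of a] proj_in[OF V, of a] by simp
  qed
  then obtain g' where g': "linear g'" "g' \<circ> D x0 = id" using linear_injective_left_inverse[OF linD] by blast
  have cont: "continuous_on ?S (\<lambda>x. Blinfun (D x))" unfolding D_def by (rule continuous_on_Blinfun_frechet[OF FC])
  have bl: "bounded_linear (D x)" if "x \<in> ?S" for x using has_derivative_bounded_linear[OF der[OF that]] .
  obtain r where r: "r > 0" "ball x0 r \<subseteq> ?S" "inj_on F (ball x0 r)"
  proof (rule has_derivative_locally_injective[OF in_hat[OF x0] hat(1) _ g'(2) der])
    show "bounded_linear g'" using g'(1) linear_conv_bounded_linear by blast
    fix e :: real assume "e > 0"
    have "isCont (\<lambda>x. Blinfun (D x)) x0"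
      using cont hat(1) in_hat[OF x0] by (simp add: continuous_on_eq_continuous_at)
    then obtain d1 where d1: "d1 > 0" "\<And>x. dist x x0 < d1 \<Longrightarrow> dist (Blinfun (D x)) (Blinfun (D x0)) < e"
      using \<open>e > 0\<close> unfolding continuous_at_eps_delta by blast
    obtain d2 where d2: "d2 > 0" "ball x0 d2 \<subseteq> ?S" using hat(1) in_hat[OF x0] unfolding open_contains_ball by blast
    have "onorm (\<lambda>v. D x v - D x0 v) < e" if "dist x0 x < min d1 d2" for x
    proof -
      have "x \<in> ?S" using d2(2) that by auto
      then have "(\<lambda>v. D x v - D x0 v) = blinfun_apply (Blinfun (D x) - Blinfun (D x0))"
        using bl in_hat[OF x0] by (auto simp: blinfun.diff_left bounded_linear_Blinfun_apply)
      moreover have "dist x x0 < d1" using that by (simp add: dist_commute)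
      from d1(2)[OF this] have "onorm (blinfun_apply (Blinfun (D x) - Blinfun (D x0))) < e"
        by (simp add: dist_norm norm_blinfun.rep_eq)
      ultimately show ?thesis by simp
    qed
    then show "\<exists>d>0. \<forall>x. dist x0 x < d \<longrightarrow> onorm (\<lambda>v. D x v - D x0 v) < e"
      using d1(1) d2(1) by (intro exI[of _ "min d1 d2"]) auto
  qed (assumption | (rule that; assumption))+
  show ?thesis
  proof (rule that[of "V \<inter> ball x0 r"])
    show "openin (top_of_set V) (V \<inter> ball x0 r)" by (simp add: openin_open_Int)
    show "x0 \<in> V \<inter> ball x0 r" using x0 S_V r(1) by auto
    show "V \<inter> ball x0 r \<subseteq> S" using r(2) proj_id[OF V] by fastforce
    show "inj_on f (V \<inter> ball x0 r)"
    proof (rule inj_onI)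
      fix x y assume xy: "x \<in> V \<inter> ball x0 r" "y \<in> V \<inter> ball x0 r" "f x = f y"
      then have "F x = F y" using proj_id[OF V] by (simp add: F_def)
      then show "x = y" using r(3) xy by (auto dest: inj_onD)
    qed
  qed
qed

section \<open>Manifolds and smooth maps\<close>

abbreviation "opn V \<equiv> openin (top_of_set V)"

definition ic :: "('a, 'e) chart \<Rightarrow> 'e \<Rightarrow> 'a" where
  "ic c y = inv_into (fst c) (snd c) y"

text \<open>The part of \<open>manifold\<close> without separation and countability. Arguments about
  smooth maps and tangent vectors use only this part; the topological conditions are carried
  separately.\<close>

definition atlas :: "('a, 'e::euclidean_space) mfd \<Rightarrow> bool" where
  "atlas M \<longleftrightarrow> subspace (model M) \<and> \<Union> (fst ` charts M) = points M \<and>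
     (\<forall>c\<in>charts M. inj_on (snd c) (fst c) \<and> opn (model M) (snd c ` fst c)) \<and>
     (\<forall>c\<in>charts M. \<forall>d\<in>charts M. opn (model M) (snd c ` (fst c \<inter> fst d)) \<and>
        smooth_on (snd c ` (fst c \<inter> fst d)) (\<lambda>y. snd d (ic c y)))"

lemma manifold_iff: "manifold M \<longleftrightarrow> atlas M \<and> Hausdorff_space (mtop M) \<and> second_countable (mtop M)"
  unfolding manifold_def atlas_def ic_def by (simp add: case_prod_beta conj_assoc)

lemma smooth_preimage_open:
  assumes "smooth_on S f" "opn V S" "f ` S \<subseteq> W" "opn W T"
  shows "opn V (S \<inter> f -` T)"
proof -
  have "f \<in> S \<rightarrow> W" using assms(3) by auto
  then have "opn S (S \<inter> f -` T)"
    using continuous_openin_preimage[OF smooth_on_continuous_on[OF assms(1)] _ assms(4)] by blast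
  then show ?thesis using openin_trans[OF _ assms(2)] by blast
qed

context
  fixes M :: "('a, 'e::euclidean_space) mfd"
  assumes M: "atlas M"
begin

lemma atlas_model: "subspace (model M)" using M by (simp add: atlas_def)

lemma atlas_cover: "p \<in> points M \<Longrightarrow> \<exists>c\<in>charts M. p \<in> fst c"
  using M unfolding atlas_def by blast

lemma chart_points: "c \<in> charts M \<Longrightarrow> p \<in> fst c \<Longrightarrow> p \<in> points M"
  using M unfolding atlas_def by blast

lemma chart_inj: "c \<in> charts M \<Longrightarrow> inj_on (snd c) (fst c)"
  using M unfolding atlas_def by blast

lemma chart_open: "c \<in> charts M \<Longrightarrow> opn (model M) (snd c ` fst c)"
  using M unfolding atlas_def by blast

lemma chart_ic: "c \<in> charts M \<Longrightarrow> p \<in> fst c \<Longrightarrow> ic c (snd c p) = p"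
  unfolding ic_def using chart_inj by (simp add: inv_into_f_f)

lemma chart_in_model: "c \<in> charts M \<Longrightarrow> p \<in> fst c \<Longrightarrow> snd c p \<in> model M"
  using openin_subset_subspace[OF chart_open] by blast

lemma transition_open: "c \<in> charts M \<Longrightarrow> d \<in> charts M \<Longrightarrow> opn (model M) (snd c ` (fst c \<inter> fst d))"
  using M unfolding atlas_def by blast

lemma transition_smooth:
  "c \<in> charts M \<Longrightarrow> d \<in> charts M \<Longrightarrow> smooth_on (snd c ` (fst c \<inter> fst d)) (\<lambda>y. snd d (ic c y))"
  using M unfolding atlas_def by blast

end

lemma ic_in: "y \<in> snd c ` fst c \<Longrightarrow> ic c y \<in> fst c"
  unfolding ic_def by (rule inv_into_into)

lemma chart_of_ic: "y \<in> snd c ` fst c \<Longrightarrow> snd c (ic c y) = y"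
  unfolding ic_def by (rule f_inv_into_f)

text \<open>Smoothness at a point, witnessed by a coordinate expression on some relatively open set
  \<open>S\<close>. The set is explicit so that charts can be changed and domains shrunk while the
  calculation goes on in coordinates.\<close>

definition local_rep ::
    "('a, 'e::euclidean_space) mfd \<Rightarrow> ('b, 'f::euclidean_space) mfd \<Rightarrow> ('a \<Rightarrow> 'b) \<Rightarrow> 'a
     \<Rightarrow> ('a, 'e) chart \<Rightarrow> ('b, 'f) chart \<Rightarrow> 'e set \<Rightarrow> bool" where
  "local_rep M N F p c d S \<longleftrightarrow> c \<in> charts M \<and> d \<in> charts N \<and> p \<in> fst c \<and> opn (model M) S \<and> snd c p \<in> S \<and>
     S \<subseteq> snd c ` fst c \<and> (\<forall>y\<in>S. F (ic c y) \<in> fst d) \<and> smooth_on S (\<lambda>y. snd d (F (ic c y)))"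

definition smooth_at ::
    "('a, 'e::euclidean_space) mfd \<Rightarrow> ('b, 'f::euclidean_space) mfd \<Rightarrow> ('a \<Rightarrow> 'b) \<Rightarrow> 'a \<Rightarrow> bool" where
  "smooth_at M N F p \<longleftrightarrow> (\<exists>c d S. local_rep M N F p c d S)"

lemma local_rep_smooth_at: "local_rep M N F p c d S \<Longrightarrow> smooth_at M N F p"
  unfolding smooth_at_def by blast

text \<open>The domain shrinks twice: \<open>S1\<close> is where the transition to the old source
  chart lands in \<open>S0\<close>, and \<open>S\<close> is where the image also lies in the new
  target chart. There the new expression is the old one between two transition maps.\<close>

lemma local_rep_change:
  fixes M :: "('a, 'e::euclidean_space) mfd" and N :: "('b, 'f::euclidean_space) mfd"
  assumes M: "atlas M" and N: "atlas N" and rep: "local_rep M N F p c0 d0 S0"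
    and c: "c \<in> charts M" "p \<in> fst c" and d: "d \<in> charts N" "F p \<in> fst d"
  shows "\<exists>S. local_rep M N F p c d S"
proof -
  note r = rep[unfolded local_rep_def]
  let ?A = "snd c ` (fst c \<inter> fst c0)" and ?t = "\<lambda>y. snd c0 (ic c y)"
  have c0: "c0 \<in> charts M" "p \<in> fst c0" and d0: "d0 \<in> charts N" using r by blast+
  have icA: "ic c y \<in> fst c \<inter> fst c0" if "y \<in> ?A" for y using that chart_ic[OF M c(1)] by auto
  define S1 where "S1 = ?A \<inter> ?t -` S0"
  have S1: "opn (model M) S1" unfolding S1_def
    by (rule smooth_preimage_open[OF transition_smooth[OF M c(1) c0(1)] transition_open[OF M c(1) c0(1)], where W="model M"])
      (use icA chart_in_model[OF M c0(1)] r in auto)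
  let ?G = "\<lambda>y. snd d0 (F (ic c y))"
  have ict: "ic c0 (?t y) = ic c y" if "y \<in> S1" for y
    using icA[of y] that chart_ic[OF M c0(1)] by (auto simp: S1_def)
  have "smooth_on S1 (\<lambda>y. snd d0 (F (ic c0 (?t y))))"
    by (rule smooth_on_compose[of S1 ?t S0 "\<lambda>y. snd d0 (F (ic c0 y))"])
      (use r smooth_on_subset[OF transition_smooth[OF M c(1) c0(1)]] in \<open>auto simp: S1_def\<close>)
  then have G: "smooth_on S1 ?G" by (rule smooth_on_cong) (simp add: ict)
  have Fd0: "F (ic c y) \<in> fst d0" if "y \<in> S1" for y
    using r ict[OF that] that by (auto simp: S1_def)
  let ?B = "snd d0 ` (fst d0 \<inter> fst d)"
  define S where "S = S1 \<inter> ?G -` ?B"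
  have S: "opn (model M) S" unfolding S_def
    by (rule smooth_preimage_open[OF G S1, where W="model N"])
      (use Fd0 chart_in_model[OF N d0] transition_open[OF N d0 d(1)] in auto)
  have Fd: "F (ic c y) \<in> fst d" if "y \<in> S" for y
    using that Fd0[of y] inj_onD[OF chart_inj[OF N d0]] by (fastforce simp: S_def)
  have "smooth_on S (\<lambda>y. snd d (ic d0 (?G y)))"
    by (rule smooth_on_compose[of S ?G ?B "\<lambda>z. snd d (ic d0 z)"])
      (use transition_smooth[OF N d0 d(1)] smooth_on_subset[OF G] in \<open>auto simp: S_def\<close>)
  then have "smooth_on S (\<lambda>y. snd d (F (ic c y)))"
    by (rule smooth_on_cong) (use chart_ic[OF N d0 Fd0] in \<open>auto simp: S_def\<close>)
  moreover have "snd c p \<in> S"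
  proof -
    have "snd c p \<in> S1" using c c0(2) r chart_ic[OF M c] by (auto simp: S1_def)
    moreover have "?G (snd c p) \<in> ?B" using Fd0[OF calculation] chart_ic[OF M c] d(2) by auto
    ultimately show ?thesis by (simp add: S_def)
  qed
  moreover have "S \<subseteq> snd c ` fst c" by (auto simp: S_def S1_def)
  ultimately have "local_rep M N F p c d S"
    unfolding local_rep_def using c d(1) S Fd by blast
  then show ?thesis by blast
qed

lemma smooth_at_rep:
  assumes "atlas M" "atlas N" "smooth_at M N F p" "c \<in> charts M" "p \<in> fst c" "d \<in> charts N" "F p \<in> fst d"
  shows "\<exists>S. local_rep M N F p c d S"
proof -
  obtain c0 d0 S0 where "local_rep M N F p c0 d0 S0" using assms(3) unfolding smooth_at_def by blast
  from local_rep_change[OF assms(1,2) this assms(4-7)] show ?thesis .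
qed

lemma local_rep_point:
  assumes "atlas M" "local_rep M N F p c d S" "y \<in> S"
  shows "local_rep M N F (ic c y) c d S"
  using assms(2,3) ic_in[of y c] chart_of_ic[of y c] unfolding local_rep_def by auto

lemma smooth_at_points:
  assumes "atlas M" "atlas N" "smooth_at M N F p"
  shows "p \<in> points M" "F p \<in> points N"
proof -
  obtain c d S where r: "local_rep M N F p c d S" using assms(3) unfolding smooth_at_def by blast
  then have c: "c \<in> charts M" "p \<in> fst c" and d: "snd c p \<in> S" "d \<in> charts N" "\<forall>y\<in>S. F (ic c y) \<in> fst d"
    unfolding local_rep_def by blast+
  have "F p \<in> fst d" using d(1,3) chart_ic[OF assms(1) c] by auto
  then show "p \<in> points M" "F p \<in> points N"
    using chart_points[OF assms(1) c] chart_points[OF assms(2) d(2)] by blast+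
qed

text \<open>Replaces the condition on all pairs of charts by a local one. Conversely, the full chart
  preimage is a union of sets on which some \<open>local_rep\<close> holds, so it is open and the
  expression on it is smooth.\<close>

lemma smooth_map_iff:
  fixes M :: "('a, 'e::euclidean_space) mfd" and N :: "('b, 'f::euclidean_space) mfd"
  assumes M: "atlas M" and N: "atlas N"
  shows "smooth_map M N F \<longleftrightarrow> (\<forall>p\<in>points M. smooth_at M N F p)"
proof
  assume L: "smooth_map M N F"
  have L1: "F p \<in> points N" if "p \<in> points M" for p using L that unfolding smooth_map_def by blast
  have L2: "opn (model M) (snd c ` (fst c \<inter> F -` fst d)) \<and>
      smooth_on (snd c ` (fst c \<inter> F -` fst d)) (\<lambda>y. snd d (F (ic c y)))"
    if "c \<in> charts M" "d \<in> charts N" for c d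
    using L that unfolding smooth_map_def ic_def by (auto simp: case_prod_beta)
  show "\<forall>p\<in>points M. smooth_at M N F p"
  proof
    fix p assume p: "p \<in> points M"
    obtain c where c: "c \<in> charts M" "p \<in> fst c" using atlas_cover[OF M p] by blast
    obtain d where d: "d \<in> charts N" "F p \<in> fst d" using atlas_cover[OF N L1[OF p]] by blast
    have "local_rep M N F p c d (snd c ` (fst c \<inter> F -` fst d))"
      unfolding local_rep_def using L2[OF c(1) d(1)] c d chart_ic[OF M c(1)] by auto
    then show "smooth_at M N F p" by (rule local_rep_smooth_at)
  qed
next
  assume R: "\<forall>p\<in>points M. smooth_at M N F p"
  have key: "opn (model M) (snd c ` (fst c \<inter> F -` fst d)) \<and>
      smooth_on (snd c ` (fst c \<inter> F -` fst d)) (\<lambda>y. snd d (F (ic c y)))"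
    if c: "c \<in> charts M" and d: "d \<in> charts N" for c d
  proof -
    let ?T = "snd c ` (fst c \<inter> F -` fst d)"
    have loc: "\<exists>S. opn (model M) S \<and> y \<in> S \<and> S \<subseteq> ?T \<and> smooth_on S (\<lambda>y. snd d (F (ic c y)))"
      if y: "y \<in> ?T" for y
    proof -
      obtain p where p: "p \<in> fst c" "F p \<in> fst d" "y = snd c p" using y by blast
      have sp: "smooth_at M N F p" using R chart_points[OF M c p(1)] by blast
      obtain S where S: "local_rep M N F p c d S"
        using smooth_at_rep[OF M N sp c p(1) d p(2)] by blast
      have "z \<in> ?T" if "z \<in> S" for z
      proof -
        have z: "z \<in> snd c ` fst c" "F (ic c z) \<in> fst d" using S that unfolding local_rep_def by blast+
        show ?thesis using ic_in[OF z(1)] chart_of_ic[OF z(1)] z(2) by (intro image_eqI[of _ _ "ic c z"]) simp_all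
      qed
      then show ?thesis using S p(3) unfolding local_rep_def by blast
    qed
    have "opn (model M) ?T"
      by (subst openin_subopen) (use loc in blast)
    moreover have "smooth_on ?T (\<lambda>y. snd d (F (ic c y)))"
    proof (rule smooth_on_local)
      fix y assume "y \<in> ?T"
      from loc[OF this] obtain S where S: "opn (model M) S" "y \<in> S" "S \<subseteq> ?T" "smooth_on S (\<lambda>y. snd d (F (ic c y)))"
        by blast
      have "?T \<subseteq> model M" using chart_in_model[OF M c] by auto
      then have "opn ?T S" using S(1,3) openin_subset_trans by blast
      then show "\<exists>S. opn ?T S \<and> y \<in> S \<and> smooth_on S (\<lambda>y. snd d (F (ic c y)))" using S by blast
    qed
    ultimately show ?thesis ..
  qed
  moreover have "F ` points M \<subseteq> points N" using R smooth_at_points[OF M N] by blast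
  ultimately show "smooth_map M N F"
    unfolding smooth_map_def ic_def by (simp add: case_prod_beta)
qed

lemma smooth_at_compose:
  assumes M: "atlas M" and N: "atlas N" and L: "atlas L"
    and F: "smooth_at M N F p" and H: "smooth_at N L H (F p)"
  shows "smooth_at M L (\<lambda>x. H (F x)) p"
proof -
  obtain c where c: "c \<in> charts M" "p \<in> fst c" using atlas_cover[OF M smooth_at_points(1)[OF M N F]] by blast
  obtain d T e where H': "local_rep N L H (F p) d e T" using H unfolding smooth_at_def by blast
  note h = H'[unfolded local_rep_def]
  obtain S where S: "local_rep M N F p c d S" using smooth_at_rep[OF M N F c] h by blast
  note s = S[unfolded local_rep_def]
  let ?F = "\<lambda>y. snd d (F (ic c y))"
  define S' where "S' = S \<inter> ?F -` T"
  have d: "d \<in> charts N" using h by blast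
  have S': "opn (model M) S'" unfolding S'_def
    by (rule smooth_preimage_open[where W = "model N"]) (use s h chart_in_model[OF N d] in auto)
  have icd: "ic d (?F y) = F (ic c y)" if "y \<in> S'" for y
    using s that chart_ic[OF N d] by (auto simp: S'_def)
  have "smooth_on S' (\<lambda>y. snd e (H (ic d (?F y))))"
    by (rule smooth_on_compose[of S' ?F T "\<lambda>z. snd e (H (ic d z))"])
      (use s h smooth_on_subset[of S ?F S'] in \<open>auto simp: S'_def\<close>)
  then have "smooth_on S' (\<lambda>y. snd e (H (F (ic c y))))"
    by (rule smooth_on_cong) (simp add: icd)
  moreover have "H (F (ic c y)) \<in> fst e" if "y \<in> S'" for y
    using h that icd[OF that] by (auto simp: S'_def)
  moreover have "snd c p \<in> S'" using s h chart_ic[OF M c] by (auto simp: S'_def)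
  ultimately have "local_rep M L (\<lambda>x. H (F x)) p c e S'"
    unfolding local_rep_def using s h S' by (auto simp: S'_def)
  then show ?thesis by (rule local_rep_smooth_at)
qed

lemma smooth_at_id: "atlas M \<Longrightarrow> p \<in> points M \<Longrightarrow> smooth_at M M (\<lambda>x. x) p"
proof -
  assume M: "atlas M" and p: "p \<in> points M"
  obtain c where c: "c \<in> charts M" "p \<in> fst c" using atlas_cover[OF M p] by blast
  have "smooth_on (snd c ` fst c) (\<lambda>y. snd c (ic c y))"
    by (rule smooth_on_cong[OF smooth_on_id]) (rule chart_of_ic[symmetric])
  then have "local_rep M M (\<lambda>x. x) p c c (snd c ` fst c)"
    unfolding local_rep_def by (intro conjI ballI ic_in c chart_open[OF M c(1)] imageI subset_refl)
  then show ?thesis by (rule local_rep_smooth_at)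
qed

lemma smooth_at_const:
  assumes "atlas M" "atlas N" "p \<in> points M" "q \<in> points N"
  shows "smooth_at M N (\<lambda>x. q) p"
proof -
  obtain c where c: "c \<in> charts M" "p \<in> fst c" using atlas_cover[OF assms(1,3)] by blast
  obtain d where d: "d \<in> charts N" "q \<in> fst d" using atlas_cover[OF assms(2,4)] by blast
  have "local_rep M N (\<lambda>x. q) p c d (snd c ` fst c)"
    unfolding local_rep_def using c d chart_open[OF assms(1) c(1)] smooth_on_const by blast
  then show ?thesis by (rule local_rep_smooth_at)
qed

subsection \<open>The topology of a manifold\<close>

text \<open>\<open>topology\<close> returns the intended open sets only after they are shown to form
  a topology; intersections are preserved because charts are injective.\<close>

lemma openin_mtop:
  assumes M: "atlas M"
  shows "openin (mtop M) W \<longleftrightarrow> W \<subseteq> points M \<and> (\<forall>c\<in>charts M. opn (model M) (snd c ` (fst c \<inter> W)))"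
proof -
  let ?P = "\<lambda>W. W \<subseteq> points M \<and> (\<forall>(U, \<phi>)\<in>charts M. opn (model M) (\<phi> ` (U \<inter> W)))"
  have "istopology ?P"
    unfolding istopology_def
  proof (intro conjI allI impI)
    fix A B assume A: "?P A" and B: "?P B"
    have "opn (model M) (\<phi> ` (U \<inter> (A \<inter> B)))" if "(U, \<phi>) \<in> charts M" for U \<phi>
    proof -
      have "\<phi> ` (U \<inter> (A \<inter> B)) = \<phi> ` (U \<inter> A) \<inter> \<phi> ` (U \<inter> B)"
        using inj_on_image_Int[OF chart_inj[OF M that, simplified], of "U \<inter> A" "U \<inter> B"]
        by (simp add: Int_ac)
      then show ?thesis using A B that by auto
    qed
    then show "A \<inter> B \<subseteq> points M" "\<forall>(U, \<phi>)\<in>charts M. opn (model M) (\<phi> ` (U \<inter> (A \<inter> B)))" using A by auto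
  next
    fix K assume K: "\<forall>A\<in>K. ?P A"
    have "opn (model M) (\<phi> ` (U \<inter> \<Union>K))" if "(U, \<phi>) \<in> charts M" for U \<phi>
    proof -
      have "\<phi> ` (U \<inter> \<Union>K) = (\<Union>A\<in>K. \<phi> ` (U \<inter> A))" by auto
      moreover have "opn (model M) (\<phi> ` (U \<inter> A))" if "A \<in> K" for A
        using K that \<open>(U, \<phi>) \<in> charts M\<close> by fast
      ultimately show ?thesis by (auto intro!: openin_Union)
    qed
    then show "\<Union>K \<subseteq> points M" "\<forall>(U, \<phi>)\<in>charts M. opn (model M) (\<phi> ` (U \<inter> \<Union>K))" using K by auto
  qed
  then have "openin (mtop M) W \<longleftrightarrow> ?P W" unfolding mtop_def by (simp add: topology_inverse')
  then show ?thesis by (simp add: case_prod_beta)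
qed

lemma openin_points: "atlas M \<Longrightarrow> openin (mtop M) (points M)"
proof -
  assume M: "atlas M"
  have "fst c \<inter> points M = fst c" if "c \<in> charts M" for c using chart_points[OF M that] by blast
  then show ?thesis unfolding openin_mtop[OF M] using chart_open[OF M] by simp
qed

lemma topspace_mtop: "atlas M \<Longrightarrow> topspace (mtop M) = points M"
proof -
  assume M: "atlas M"
  show ?thesis
    by (rule antisym[OF _ openin_subset[OF openin_points[OF M]]])
      (use openin_topspace[of "mtop M", unfolded openin_mtop[OF M]] in blast)
qed

lemma openin_ic:
  assumes M: "atlas M" and c: "c \<in> charts M" and S: "opn (model M) S" "S \<subseteq> snd c ` fst c"
  shows "openin (mtop M) (ic c ` S)"
  unfolding openin_mtop[OF M]
proof (intro conjI ballI)
  show "ic c ` S \<subseteq> points M" by (intro image_subsetI chart_points[OF M c] ic_in subsetD[OF S(2)])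
  fix d assume d: "d \<in> charts M"
  let ?A = "snd d ` (fst d \<inter> fst c)" and ?t = "\<lambda>y. snd c (ic d y)"
  have "opn (model M) (?A \<inter> ?t -` S)"
    by (rule smooth_preimage_open[OF transition_smooth[OF M d c] transition_open[OF M d c] _ S(1)])
      (use chart_ic[OF M d] chart_in_model[OF M c] in auto)
  moreover have "?A \<inter> ?t -` S = snd d ` (fst d \<inter> ic c ` S)"
  proof (intro Set.set_eqI iffI)
    fix y assume "y \<in> ?A \<inter> ?t -` S"
    then obtain p where p: "p \<in> fst d" "p \<in> fst c" "y = snd d p" "snd c p \<in> S"
      using chart_ic[OF M d] by auto
    then have "p = ic c (snd c p)" using chart_ic[OF M c] by simp
    then show "y \<in> snd d ` (fst d \<inter> ic c ` S)" using p by blast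
  next
    fix y assume "y \<in> snd d ` (fst d \<inter> ic c ` S)"
    then obtain z where z: "z \<in> S" "ic c z \<in> fst d" "y = snd d (ic c z)" by auto
    have "z \<in> snd c ` fst c" using S(2) z(1) by auto
    from ic_in[OF this] chart_of_ic[OF this] show "y \<in> ?A \<inter> ?t -` S"
      using z chart_ic[OF M d z(2)] by auto
  qed
  ultimately show "opn (model M) (snd d ` (fst d \<inter> ic c ` S))" by simp
qed

lemma openin_chart_domain: "atlas M \<Longrightarrow> c \<in> charts M \<Longrightarrow> openin (mtop M) (fst c)"
  using openin_ic[of M c "snd c ` fst c"] chart_open[of M c] chart_ic[of M c] by (simp add: image_image)

lemma smooth_at_cong:
  assumes M: "atlas M" and F: "smooth_at M N F p" and W: "openin (mtop M) W" "p \<in> W"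
    and eq: "\<And>x. x \<in> W \<Longrightarrow> F x = F' x"
  shows "smooth_at M N F' p"
proof -
  obtain c d S where r: "local_rep M N F p c d S" using F unfolding smooth_at_def by blast
  note s = r[unfolded local_rep_def]
  have c: "c \<in> charts M" "p \<in> fst c" using s by blast+
  define S' where "S' = S \<inter> snd c ` (fst c \<inter> W)"
  have "opn (model M) S'" unfolding S'_def
    using s W(1) openin_mtop[OF M] by blast
  moreover have "F (ic c y) = F' (ic c y)" if "y \<in> S'" for y
    using that chart_ic[OF M c(1)] by (auto simp: S'_def eq)
  ultimately have "local_rep M N F' p c d S'"
    using s W(2) smooth_on_mono[of S "\<lambda>y. snd d (F (ic c y))" S' "\<lambda>y. snd d (F' (ic c y))"]
    unfolding local_rep_def by (auto simp: S'_def)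
  then show ?thesis by (rule local_rep_smooth_at)
qed

lemma smooth_at_nhd:
  assumes M: "atlas M" and F: "smooth_at M N F p"
  obtains W where "openin (mtop M) W" "p \<in> W" "\<And>x. x \<in> W \<Longrightarrow> smooth_at M N F x"
proof -
  obtain c d S where r: "local_rep M N F p c d S" using F unfolding smooth_at_def by blast
  note s = r[unfolded local_rep_def]
  show ?thesis
  proof (rule that[of "ic c ` S"])
    show "openin (mtop M) (ic c ` S)" using openin_ic[OF M] s by blast
    show "p \<in> ic c ` S" using s chart_ic[OF M, of c p] by (metis image_eqI)
    fix x assume "x \<in> ic c ` S"
    then obtain y where "y \<in> S" "x = ic c y" by blast
    then show "smooth_at M N F x" using local_rep_smooth_at[OF local_rep_point[OF M r]] by simp
  qed
qed

lemma smooth_at_preimage_open: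
  assumes M: "atlas M" and N: "atlas N" and W: "openin (mtop M) W"
    and F: "\<And>p. p \<in> W \<Longrightarrow> smooth_at M N F p" and T: "openin (mtop N) T"
  shows "openin (mtop M) (W \<inter> F -` T)"
proof (subst openin_subopen, intro ballI)
  fix p assume p: "p \<in> W \<inter> F -` T"
  then obtain c d S where r: "local_rep M N F p c d S" using F unfolding smooth_at_def by blast
  note s = r[unfolded local_rep_def]
  have c: "c \<in> charts M" "p \<in> fst c" and d: "d \<in> charts N" using s by blast+
  let ?F = "\<lambda>y. snd d (F (ic c y))"
  define S' where "S' = (S \<inter> ?F -` (snd d ` (fst d \<inter> T))) \<inter> snd c ` (fst c \<inter> W)"
  have "opn (model M) (S \<inter> ?F -` (snd d ` (fst d \<inter> T)))"
    by (rule smooth_preimage_open[where W = "model N"])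
      (use s chart_in_model[OF N d] T[unfolded openin_mtop[OF N]] in auto)
  then have S': "opn (model M) S'" unfolding S'_def
    using W openin_mtop[OF M] c by blast
  have "openin (mtop M) (ic c ` S')"
    by (rule openin_ic[OF M c(1) S']) (auto simp: S'_def)
  moreover have "p \<in> ic c ` S'"
    using p s chart_ic[OF M c] by (intro image_eqI[of _ _ "snd c p"]) (auto simp: S'_def)
  moreover have "ic c ` S' \<subseteq> W \<inter> F -` T"
  proof (intro image_subsetI IntI vimageI2)
    fix y assume y: "y \<in> S'"
    then show "ic c y \<in> W" using chart_ic[OF M c(1)] by (auto simp: S'_def)
    have "F (ic c y) \<in> fst d" using y s by (auto simp: S'_def)
    then show "F (ic c y) \<in> T" using y inj_onD[OF chart_inj[OF N d]] by (fastforce simp: S'_def)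
  qed
  ultimately show "\<exists>T'. openin (mtop M) T' \<and> p \<in> T' \<and> T' \<subseteq> W \<inter> F -` T" by blast
qed

lemma smooth_map_continuous:
  assumes "atlas M" "atlas N" "smooth_map M N F"
  shows "continuous_map (mtop M) (mtop N) F"
proof -
  have s: "\<And>p. p \<in> points M \<Longrightarrow> smooth_at M N F p" using assms(3) smooth_map_iff[OF assms(1,2)] by blast
  have "{x \<in> points M. F x \<in> U} = points M \<inter> F -` U" for U by auto
  then show ?thesis
    using smooth_at_preimage_open[OF assms(1,2) openin_points[OF assms(1)] s] smooth_at_points[OF assms(1,2) s]
    by (auto simp: continuous_map_def topspace_mtop assms)
qed

lemma openin_mtopD:
  "atlas M \<Longrightarrow> openin (mtop M) W \<Longrightarrow> c \<in> charts M \<Longrightarrow> opn (model M) (snd c ` (fst c \<inter> W))"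
  by (simp add: openin_mtop)

subsection \<open>Open subsets of linear subspaces\<close>

text \<open>Generalises \<open>euclid\<close> by a model space of choice, so that open subsets of a
  proper subspace, in particular the zero space, get the right dimension.\<close>

definition flat :: "'e set \<Rightarrow> 'e set \<Rightarrow> ('e, 'e) mfd" where
  "flat V S = \<lparr>points = S, model = V, charts = {(S, \<lambda>x. x)}\<rparr>"

abbreviation "EU \<equiv> flat UNIV UNIV"

lemma euclid_eq_flat: "euclid S = flat UNIV S"
  by (simp add: euclid_def flat_def)

lemma flat_simps [simp]: "points (flat V S) = S" "model (flat V S) = V" "charts (flat V S) = {(S, \<lambda>x. x)}"
  by (simp_all add: flat_def)

lemma ic_flat [simp]: "y \<in> S \<Longrightarrow> ic (S, \<lambda>x. x) y = y"
  unfolding ic_def by (simp add: inv_into_f_f[where f = "\<lambda>x. x", simplified])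

lemma atlas_flat: "subspace V \<Longrightarrow> opn V S \<Longrightarrow> atlas (flat V S)"
  unfolding atlas_def using smooth_on_cong[OF smooth_on_id, of S "ic (S, \<lambda>x. x)"] by simp

lemma atlas_EU [simp]: "atlas EU" by (rule atlas_flat) auto

lemma openin_flat:
  assumes "subspace V" "opn V S" shows "openin (mtop (flat V S)) W \<longleftrightarrow> W \<subseteq> S \<and> opn V W"
  unfolding openin_mtop[OF atlas_flat[OF assms]] by (auto simp: Int_absorb1)

lemma smooth_at_flatI:
  assumes "opn V T" "p \<in> T" "T \<subseteq> S" "d \<in> charts N" "\<And>y. y \<in> T \<Longrightarrow> F y \<in> fst d" "smooth_on T (\<lambda>y. snd d (F y))"
  shows "smooth_at (flat V S) N F p"
proof -
  have ic: "ic (S, \<lambda>x. x) y = y" if "y \<in> T" for y using that assms(3) by auto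
  have "smooth_on T (\<lambda>y. snd d (F (ic (S, \<lambda>x. x) y)))"
    by (rule smooth_on_cong[OF assms(6)]) (simp add: ic)
  then have "local_rep (flat V S) N F p (S, \<lambda>x. x) d T"
    unfolding local_rep_def using assms ic by auto
  then show ?thesis by (rule local_rep_smooth_at)
qed

lemma smooth_at_flatD:
  assumes V: "subspace V" "opn V S" and N: "atlas N" and F: "smooth_at (flat V S) N F p"
    and d: "d \<in> charts N" "F p \<in> fst d"
  obtains T where "opn V T" "p \<in> T" "T \<subseteq> S" "\<And>y. y \<in> T \<Longrightarrow> F y \<in> fst d" "smooth_on T (\<lambda>y. snd d (F y))"
proof -
  have p: "p \<in> S" using smooth_at_points(1)[OF atlas_flat[OF V] N F] by simp
  obtain T where T: "local_rep (flat V S) N F p (S, \<lambda>x. x) d T"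
    using smooth_at_rep[OF atlas_flat[OF V] N F _ _ d, of "(S, \<lambda>x. x)"] p by auto
  note t = T[unfolded local_rep_def, simplified]
  have ic: "ic (S, \<lambda>x. x) y = y" if "y \<in> T" for y using that t by auto
  have "smooth_on T (\<lambda>y. snd d (F y))"
    by (rule smooth_on_cong[of T "\<lambda>y. snd d (F (ic (S, \<lambda>x. x) y))"]) (use t ic in auto)
  moreover have "F y \<in> fst d" if "y \<in> T" for y using t ic[OF that] that by force
  ultimately show ?thesis using t by (intro that[of T]) auto
qed

lemma smooth_at_flat_flatI:
  "opn V T \<Longrightarrow> p \<in> T \<Longrightarrow> T \<subseteq> S \<Longrightarrow> F ` T \<subseteq> S' \<Longrightarrow> smooth_on T F \<Longrightarrow> smooth_at (flat V S) (flat V' S') F p"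
  by (rule smooth_at_flatI[where d = "(S', \<lambda>x. x)"]) auto

lemma smooth_at_flat_dom:
  assumes "subspace V" "opn V S" "opn V S'" "p \<in> S'" "atlas N" "smooth_at (flat V S) N F p"
  shows "smooth_at (flat V S') N F p"
proof -
  obtain d where d: "d \<in> charts N" "F p \<in> fst d"
    using atlas_cover[OF assms(5) smooth_at_points(2)[OF atlas_flat[OF assms(1,2)] assms(5,6)]] by blast
  obtain T where T: "opn V T" "p \<in> T" "T \<subseteq> S" "\<And>y. y \<in> T \<Longrightarrow> F y \<in> fst d" "smooth_on T (\<lambda>y. snd d (F y))"
    using smooth_at_flatD[OF assms(1,2,5,6) d] by blast
  show ?thesis
    by (rule smooth_at_flatI[where T = "T \<inter> S'" and d = d])
      (use T d(1) assms smooth_on_subset[OF T(5)] in auto)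
qed

text \<open>The charts of \<open>flat\<close> are identities, so the coordinate expression is the
  same for both targets, and only membership of the values has to be checked.\<close>

lemma smooth_at_flat_cod:
  assumes M: "atlas M" and F: "smooth_at M (flat V T) F p" and W: "openin (mtop M) W" "p \<in> W" "F ` W \<subseteq> T'"
  shows "smooth_at M (flat V' T') F p"
proof -
  obtain c S where r: "local_rep M (flat V T) F p c (T, \<lambda>x. x) S"
    using F unfolding smooth_at_def local_rep_def by auto
  note s = r[unfolded local_rep_def]
  have c: "c \<in> charts M" "p \<in> fst c" using s by blast+
  define S' where "S' = S \<inter> snd c ` (fst c \<inter> W)"
  have "opn (model M) S'" unfolding S'_def using s W(1) openin_mtop[OF M] by blast
  moreover have "F (ic c y) \<in> T'" if "y \<in> S'" for y
    using that chart_ic[OF M c(1)] W(3) by (auto simp: S'_def)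
  ultimately have "local_rep M (flat V' T') F p c (T', \<lambda>x. x) S'"
    using s W(2) smooth_on_subset[of S "\<lambda>y. F (ic c y)" S']
    unfolding local_rep_def by (auto simp: S'_def)
  then show ?thesis by (rule local_rep_smooth_at)
qed

lemma smooth_at_EU_cod: "atlas M \<Longrightarrow> smooth_at M (flat V T) F p \<Longrightarrow> p \<in> points M \<Longrightarrow> smooth_at M EU F p"
  by (rule smooth_at_flat_cod[OF _ _ openin_points]) auto

lemma smooth_at_chart:
  assumes M: "atlas M" and c: "c \<in> charts M" "p \<in> fst c"
  shows "smooth_at M (flat (model M) (snd c ` fst c)) (snd c) p"
proof -
  have "smooth_on (snd c ` fst c) (\<lambda>y. snd c (ic c y))"
    by (rule smooth_on_cong[OF smooth_on_id]) (rule chart_of_ic[symmetric])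
  then have "local_rep M (flat (model M) (snd c ` fst c)) (snd c) p c (snd c ` fst c, \<lambda>x. x) (snd c ` fst c)"
    unfolding local_rep_def using c chart_open[OF M c(1)] chart_of_ic[of _ c] by auto
  then show ?thesis by (rule local_rep_smooth_at)
qed

lemma smooth_at_ic:
  assumes M: "atlas M" and c: "c \<in> charts M" and y: "y \<in> snd c ` fst c"
  shows "smooth_at (flat (model M) (snd c ` fst c)) M (ic c) y"
proof (rule smooth_at_flatI[OF chart_open[OF M c] y subset_refl c ic_in])
  show "smooth_on (snd c ` fst c) (\<lambda>y. snd c (ic c y))"
    by (rule smooth_on_cong[OF smooth_on_id]) (rule chart_of_ic[symmetric])
qed

lemma smooth_at_EU_compose:
  fixes g :: "'b::euclidean_space \<Rightarrow> 'c::euclidean_space"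
  assumes M: "atlas M" and F: "smooth_at M EU F p" and g: "smooth_on S g" "open S" "F p \<in> S"
  shows "smooth_at M EU (\<lambda>x. g (F x)) p"
proof (rule smooth_at_compose[OF M _ _ F, where H = g])
  show "smooth_at EU EU g (F p)"
    by (rule smooth_at_flat_flatI[where T = S]) (use g in auto)
qed auto

lemma smooth_at_EU_Pair:
  fixes F :: "'a \<Rightarrow> 'b::euclidean_space" and G :: "'a \<Rightarrow> 'c::euclidean_space"
  assumes M: "atlas M" and F: "smooth_at M EU F p" and G: "smooth_at M EU G p"
  shows "smooth_at M EU (\<lambda>x. (F x, G x)) p"
proof -
  obtain c where c: "c \<in> charts M" "p \<in> fst c"
    using atlas_cover[OF M smooth_at_points(1)[OF M atlas_EU F]] by blast
  obtain S where S: "local_rep M EU F p c (UNIV, \<lambda>x. x) S"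
    using smooth_at_rep[OF M atlas_EU F c, of "(UNIV, \<lambda>x. x)"] by auto
  obtain T where T: "local_rep M EU G p c (UNIV, \<lambda>x. x) T"
    using smooth_at_rep[OF M atlas_EU G c, of "(UNIV, \<lambda>x. x)"] by auto
  have "smooth_on (S \<inter> T) (\<lambda>y. (F (ic c y), G (ic c y)))"
    by (rule smooth_on_Pair)
      (use S T smooth_on_subset[of _ _ "S \<inter> T"] in \<open>auto simp: local_rep_def\<close>)
  then have "local_rep M EU (\<lambda>x. (F x, G x)) p c (UNIV, \<lambda>x. x) (S \<inter> T)"
    using S T by (auto simp: local_rep_def)
  then show ?thesis by (rule local_rep_smooth_at)
qed

lemma smooth_at_EU_bilinear:
  fixes F :: "'a \<Rightarrow> 'b::euclidean_space" and G :: "'a \<Rightarrow> 'c::euclidean_space"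
    and B :: "'b \<Rightarrow> 'c \<Rightarrow> 'd::euclidean_space"
  assumes M: "atlas M" and F: "smooth_at M EU F p" and G: "smooth_at M EU G p" and B: "bounded_bilinear B"
  shows "smooth_at M EU (\<lambda>x. B (F x) (G x)) p"
  using smooth_at_EU_compose[OF M smooth_at_EU_Pair[OF M F G]
      smooth_on_bilinear[OF B smooth_on_linear[OF bounded_linear_fst] smooth_on_linear[OF bounded_linear_snd]], of UNIV]
  by simp

lemmas smooth_at_scaleR = smooth_at_EU_bilinear[OF _ _ _ bounded_bilinear_scaleR]
lemmas smooth_at_inner = smooth_at_EU_bilinear[OF _ _ _ bounded_bilinear_inner]

lemma smooth_at_linear:
  fixes F :: "'a \<Rightarrow> 'b::euclidean_space" and L :: "'b \<Rightarrow> 'c::euclidean_space"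
  shows "atlas M \<Longrightarrow> smooth_at M EU F p \<Longrightarrow> bounded_linear L \<Longrightarrow> smooth_at M EU (\<lambda>x. L (F x)) p"
  by (rule smooth_at_EU_compose[OF _ _ smooth_on_linear[where S = UNIV]]) auto

lemma smooth_at_add:
  fixes F :: "'a \<Rightarrow> 'b::euclidean_space"
  assumes M: "atlas M" and F: "smooth_at M EU F p" and G: "smooth_at M EU G p"
  shows "smooth_at M EU (\<lambda>x. F x + G x) p"
  using smooth_at_linear[OF M smooth_at_EU_Pair[OF M F G] bounded_linear_add[OF bounded_linear_fst bounded_linear_snd]]
  by simp

lemma smooth_at_EU_const: "atlas M \<Longrightarrow> p \<in> points M \<Longrightarrow> smooth_at M EU (\<lambda>x. c) p"
  by (rule smooth_at_const) auto

lemma smooth_at_sum: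
  fixes F :: "'i \<Rightarrow> 'a \<Rightarrow> 'b::euclidean_space"
  assumes M: "atlas M" and p: "p \<in> points M" and F: "\<And>i. i \<in> I \<Longrightarrow> smooth_at M EU (F i) p"
  shows "smooth_at M EU (\<lambda>x. \<Sum>i\<in>I. F i x) p"
  using F by (induction I rule: infinite_finite_induct)
    (auto intro: smooth_at_add[OF M] smooth_at_EU_const[OF M p])

subsection \<open>Products\<close>

definition prodc :: "('a, 'e) chart \<Rightarrow> ('b, 'f) chart \<Rightarrow> ('a \<times> 'b, 'e \<times> 'f) chart" where
  "prodc c d = (fst c \<times> fst d, map_prod (snd c) (snd d))"

lemma prodc_simps [simp]: "fst (prodc c d) = fst c \<times> fst d" "snd (prodc c d) = map_prod (snd c) (snd d)"
  by (simp_all add: prodc_def)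

lemma prod_mfd_simps:
  "points (prod_mfd M N) = points M \<times> points N" "model (prod_mfd M N) = model M \<times> model N"
  "charts (prod_mfd M N) = {prodc c d |c d. c \<in> charts M \<and> d \<in> charts N}"
  unfolding prod_mfd_def prodc_def by auto

lemma image_prodc: "map_prod f g ` (A \<times> B) = f ` A \<times> g ` B"
  by auto

context
  fixes M :: "('a, 'e::euclidean_space) mfd" and N :: "('b, 'f::euclidean_space) mfd"
  assumes M: "atlas M" and N: "atlas N"
begin

lemma prod_chartsE:
  assumes "k \<in> charts (prod_mfd M N)"
  obtains c d where "c \<in> charts M" "d \<in> charts N" "k = prodc c d"
  using assms unfolding prod_mfd_simps by blast

lemma prodc_chart: "c \<in> charts M \<Longrightarrow> d \<in> charts N \<Longrightarrow> prodc c d \<in> charts (prod_mfd M N)"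
  unfolding prod_mfd_simps by blast

lemma ic_prodc:
  assumes c: "c \<in> charts M" and d: "d \<in> charts N" and y: "y \<in> snd c ` fst c" "z \<in> snd d ` fst d"
  shows "ic (prodc c d) (y, z) = (ic c y, ic d z)"
proof -
  have inj: "inj_on (map_prod (snd c) (snd d)) (fst c \<times> fst d)"
    using map_prod_inj_on[OF chart_inj[OF M c] chart_inj[OF N d]] .
  have "(y, z) = map_prod (snd c) (snd d) (ic c y, ic d z)"
    using chart_of_ic[OF y(1)] chart_of_ic[OF y(2)] by simp
  moreover have "(ic c y, ic d z) \<in> fst c \<times> fst d" using ic_in[OF y(1)] ic_in[OF y(2)] by simp
  ultimately show ?thesis unfolding ic_def[of "prodc c d"] prodc_simps by (simp only: inv_into_f_f[OF inj])
qed

lemma atlas_prod: "atlas (prod_mfd M N)"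
  unfolding atlas_def
proof (intro conjI ballI)
  show "subspace (model (prod_mfd M N))"
    unfolding prod_mfd_simps using subspace_Times[OF atlas_model[OF M] atlas_model[OF N]] .
  show "\<Union> (fst ` charts (prod_mfd M N)) = points (prod_mfd M N)"
  proof (intro antisym subsetI)
    fix x assume "x \<in> \<Union> (fst ` charts (prod_mfd M N))"
    then obtain c d where "c \<in> charts M" "d \<in> charts N" "x \<in> fst c \<times> fst d"
      by (auto elim!: prod_chartsE)
    then show "x \<in> points (prod_mfd M N)"
      unfolding prod_mfd_simps using chart_points[OF M] chart_points[OF N] by blast
  next
    fix x assume "x \<in> points (prod_mfd M N)"
    then obtain p q where x: "x = (p, q)" "p \<in> points M" "q \<in> points N" unfolding prod_mfd_simps by blast
    obtain c where c: "c \<in> charts M" "p \<in> fst c" using atlas_cover[OF M x(2)] by blast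
    obtain d where d: "d \<in> charts N" "q \<in> fst d" using atlas_cover[OF N x(3)] by blast
    show "x \<in> \<Union> (fst ` charts (prod_mfd M N))"
      using c d x(1) by (intro UnionI[OF imageI[OF prodc_chart[OF c(1) d(1)]]]) auto
  qed
  fix k assume "k \<in> charts (prod_mfd M N)"
  then obtain c d where k: "c \<in> charts M" "d \<in> charts N" "k = prodc c d" by (rule prod_chartsE)
  show "inj_on (snd k) (fst k)" unfolding k(3) prodc_simps
    using map_prod_inj_on[OF chart_inj[OF M k(1)] chart_inj[OF N k(2)]] .
  show "opn (model (prod_mfd M N)) (snd k ` fst k)" unfolding k(3) prodc_simps prod_mfd_simps image_prodc
    using openin_Times[OF chart_open[OF M k(1)] chart_open[OF N k(2)]] .
  fix l assume "l \<in> charts (prod_mfd M N)"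
  then obtain c' d' where l: "c' \<in> charts M" "d' \<in> charts N" "l = prodc c' d'" by (rule prod_chartsE)
  have eq: "snd k ` (fst k \<inter> fst l) = snd c ` (fst c \<inter> fst c') \<times> snd d ` (fst d \<inter> fst d')"
    unfolding k(3) l(3) prodc_simps Times_Int_Times image_prodc ..
  show "opn (model (prod_mfd M N)) (snd k ` (fst k \<inter> fst l))" unfolding eq prod_mfd_simps
    using openin_Times[OF transition_open[OF M k(1) l(1)] transition_open[OF N k(2) l(2)]] .
  have sm: "smooth_on (A \<times> B) (\<lambda>y. (f (fst y), g (snd y)))" if "smooth_on A f" "smooth_on B g"
    for A B and f :: "'e \<Rightarrow> 'e" and g :: "'f \<Rightarrow> 'f"
    by (intro smooth_on_Pair smooth_on_compose[OF smooth_on_linear[OF bounded_linear_fst] that(1)]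
        smooth_on_compose[OF smooth_on_linear[OF bounded_linear_snd] that(2)]) auto
  have "smooth_on (snd k ` (fst k \<inter> fst l)) (\<lambda>y. (snd c' (ic c (fst y)), snd d' (ic d (snd y))))"
    unfolding eq by (rule sm[OF transition_smooth[OF M k(1) l(1)] transition_smooth[OF N k(2) l(2)]])
  then show "smooth_on (snd k ` (fst k \<inter> fst l)) (\<lambda>y. snd l (ic k y))"
  proof (rule smooth_on_cong)
    fix y assume "y \<in> snd k ` (fst k \<inter> fst l)"
    then obtain a b where y: "y = (a, b)" "a \<in> snd c ` fst c" "b \<in> snd d ` fst d" unfolding eq by blast
    show "(snd c' (ic c (fst y)), snd d' (ic d (snd y))) = snd l (ic k y)"
      unfolding k(3) l(3) y(1) ic_prodc[OF k(1,2) y(2,3)] by simp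
  qed
qed

lemma smooth_at_fst: "p \<in> points M \<times> points N \<Longrightarrow> smooth_at (prod_mfd M N) M fst p"
proof -
  assume "p \<in> points M \<times> points N"
  then obtain a b where p: "p = (a, b)" "a \<in> points M" "b \<in> points N" by blast
  obtain c where c: "c \<in> charts M" "a \<in> fst c" using atlas_cover[OF M p(2)] by blast
  obtain d where d: "d \<in> charts N" "b \<in> fst d" using atlas_cover[OF N p(3)] by blast
  let ?S = "snd c ` fst c \<times> snd d ` fst d"
  have ic: "fst (ic (prodc c d) y) = ic c (fst y)" if "y \<in> ?S" for y
    using that ic_prodc[OF c(1) d(1), of "fst y" "snd y"] by auto
  have "smooth_on ?S (\<lambda>y. snd c (fst (ic (prodc c d) y)))"
    by (rule smooth_on_cong[OF smooth_on_linear[OF bounded_linear_fst]])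
      (use ic chart_of_ic[of _ c] in auto)
  then have "local_rep (prod_mfd M N) M fst p (prodc c d) c ?S"
    unfolding local_rep_def using c d p(1) prodc_chart[OF c(1) d(1)] ic ic_in[of _ c]
      openin_Times[OF chart_open[OF M c(1)] chart_open[OF N d(1)]]
    by (auto simp: prod_mfd_simps image_prodc)
  then show ?thesis by (rule local_rep_smooth_at)
qed

lemma smooth_at_snd: "p \<in> points M \<times> points N \<Longrightarrow> smooth_at (prod_mfd M N) N snd p"
proof -
  assume "p \<in> points M \<times> points N"
  then obtain a b where p: "p = (a, b)" "a \<in> points M" "b \<in> points N" by blast
  obtain c where c: "c \<in> charts M" "a \<in> fst c" using atlas_cover[OF M p(2)] by blast
  obtain d where d: "d \<in> charts N" "b \<in> fst d" using atlas_cover[OF N p(3)] by blast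
  let ?S = "snd c ` fst c \<times> snd d ` fst d"
  have ic: "snd (ic (prodc c d) y) = ic d (snd y)" if "y \<in> ?S" for y
    using that ic_prodc[OF c(1) d(1), of "fst y" "snd y"] by auto
  have "smooth_on ?S (\<lambda>y. snd d (snd (ic (prodc c d) y)))"
    by (rule smooth_on_cong[OF smooth_on_linear[OF bounded_linear_snd]])
      (use ic chart_of_ic[of _ d] in auto)
  then have "local_rep (prod_mfd M N) N snd p (prodc c d) d ?S"
    unfolding local_rep_def using c d p(1) prodc_chart[OF c(1) d(1)] ic ic_in[of _ d]
      openin_Times[OF chart_open[OF M c(1)] chart_open[OF N d(1)]]
    by (auto simp: prod_mfd_simps image_prodc)
  then show ?thesis by (rule local_rep_smooth_at)
qed

lemma smooth_at_Pair:
  assumes L: "atlas L" and F: "smooth_at L M F p" and G: "smooth_at L N G p"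
  shows "smooth_at L (prod_mfd M N) (\<lambda>x. (F x, G x)) p"
proof -
  obtain e where e: "e \<in> charts L" "p \<in> fst e"
    using atlas_cover[OF L smooth_at_points(1)[OF L M F]] by blast
  obtain c where c: "c \<in> charts M" "F p \<in> fst c" using atlas_cover[OF M smooth_at_points(2)[OF L M F]] by blast
  obtain d where d: "d \<in> charts N" "G p \<in> fst d" using atlas_cover[OF N smooth_at_points(2)[OF L N G]] by blast
  obtain S where S: "local_rep L M F p e c S" using smooth_at_rep[OF L M F e c] by blast
  obtain T where T: "local_rep L N G p e d T" using smooth_at_rep[OF L N G e d] by blast
  have "smooth_on (S \<inter> T) (\<lambda>y. (snd c (F (ic e y)), snd d (G (ic e y))))"
    by (rule smooth_on_Pair)
      (use S T smooth_on_subset[of _ _ "S \<inter> T"] in \<open>auto simp: local_rep_def\<close>)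
  then have "local_rep L (prod_mfd M N) (\<lambda>x. (F x, G x)) p e (prodc c d) (S \<inter> T)"
    using S T prodc_chart[OF c(1) d(1)] by (auto simp: local_rep_def)
  then show ?thesis by (rule local_rep_smooth_at)
qed

text \<open>Makes the known permanence properties of \<open>prod_topology\<close> available, from
  which separation and countability of a product manifold follow.\<close>

lemma mtop_prod: "mtop (prod_mfd M N) = prod_topology (mtop M) (mtop N)"
  unfolding topology_eq
proof (intro allI iffI)
  fix W assume W: "openin (mtop (prod_mfd M N)) W"
  show "openin (prod_topology (mtop M) (mtop N)) W"
    unfolding openin_prod_topology_alt
  proof (intro allI impI)
    fix p q assume pq: "(p, q) \<in> W"
    then have "p \<in> points M" "q \<in> points N" using W openin_mtop[OF atlas_prod] by (auto simp: prod_mfd_simps)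
    then obtain c d where c: "c \<in> charts M" "p \<in> fst c" and d: "d \<in> charts N" "q \<in> fst d"
      using atlas_cover[OF M, of p] atlas_cover[OF N, of q] by blast
    have "opn (model M \<times> model N) (map_prod (snd c) (snd d) ` (fst c \<times> fst d \<inter> W))"
      using openin_mtopD[OF atlas_prod W prodc_chart[OF c(1) d(1)]] unfolding prod_mfd_simps(2) prodc_simps .
    then obtain T where T: "open T" "map_prod (snd c) (snd d) ` (fst c \<times> fst d \<inter> W) = (model M \<times> model N) \<inter> T"
      unfolding openin_open by blast
    have "(snd c p, snd d q) \<in> map_prod (snd c) (snd d) ` (fst c \<times> fst d \<inter> W)"
      using c d pq by (intro image_eqI[of _ _ "(p, q)"]) auto
    then have "(snd c p, snd d q) \<in> T" unfolding T(2) by simp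
    then obtain A B where AB: "open A" "open B" "(snd c p, snd d q) \<in> A \<times> B" "A \<times> B \<subseteq> T"
      by (rule open_prod_elim[OF T(1)]) (rule that; assumption)
    define S where "S = snd c ` fst c \<inter> (model M \<inter> A)"
    define S' where "S' = snd d ` fst d \<inter> (model N \<inter> B)"
    have S: "opn (model M) S" "S \<subseteq> snd c ` fst c" unfolding S_def
      by (rule openin_Int[OF chart_open[OF M c(1)] openin_open_Int[OF AB(1)]]) simp
    have S': "opn (model N) S'" "S' \<subseteq> snd d ` fst d" unfolding S'_def
      by (rule openin_Int[OF chart_open[OF N d(1)] openin_open_Int[OF AB(2)]]) simp
    have "ic c ` S \<times> ic d ` S' \<subseteq> W"
    proof
      fix z assume "z \<in> ic c ` S \<times> ic d ` S'"
      then obtain y y' where y: "y \<in> S" "y' \<in> S'" "z = (ic c y, ic d y')" by blast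
      then have "(y, y') \<in> (model M \<times> model N) \<inter> T" using AB(4) by (auto simp: S_def S'_def)
      then obtain a b where ab: "a \<in> fst c" "b \<in> fst d" "(a, b) \<in> W" "y = snd c a" "y' = snd d b"
        using T(2)[symmetric] by auto
      then show "z \<in> W" using y(3) chart_ic[OF M c(1)] chart_ic[OF N d(1)] by simp
    qed
    moreover have "p \<in> ic c ` S" using c AB(3) chart_in_model[OF M c] chart_ic[OF M c]
      by (intro image_eqI[of _ _ "snd c p"]) (auto simp: S_def)
    moreover have "q \<in> ic d ` S'" using d AB(3) chart_in_model[OF N d] chart_ic[OF N d]
      by (intro image_eqI[of _ _ "snd d q"]) (auto simp: S'_def)
    ultimately show "\<exists>U V. openin (mtop M) U \<and> openin (mtop N) V \<and> p \<in> U \<and> q \<in> V \<and> U \<times> V \<subseteq> W"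
      using openin_ic[OF M c(1) S] openin_ic[OF N d(1) S'] by blast
  qed
next
  fix W assume W: "openin (prod_topology (mtop M) (mtop N)) W"
  show "openin (mtop (prod_mfd M N)) W"
  proof (subst openin_subopen, intro ballI)
    fix z assume "z \<in> W"
    then obtain U V where UV: "openin (mtop M) U" "openin (mtop N) V" "fst z \<in> U" "snd z \<in> V" "U \<times> V \<subseteq> W"
      using W unfolding openin_prod_topology_alt by (metis prod.collapse)
    have "openin (mtop (prod_mfd M N)) (U \<times> V)"
      unfolding openin_mtop[OF atlas_prod]
    proof (intro conjI ballI)
      show "U \<times> V \<subseteq> points (prod_mfd M N)"
        using UV(1,2) unfolding openin_mtop[OF M] openin_mtop[OF N] prod_mfd_simps by blast
      fix k assume "k \<in> charts (prod_mfd M N)"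
      then obtain c d where k: "c \<in> charts M" "d \<in> charts N" "k = prodc c d" by (rule prod_chartsE)
      show "opn (model (prod_mfd M N)) (snd k ` (fst k \<inter> U \<times> V))"
        unfolding k(3) prodc_simps prod_mfd_simps Times_Int_Times image_prodc
        using UV(1,2) k(1,2) unfolding openin_mtop[OF M] openin_mtop[OF N] by (intro openin_Times) blast+
    qed
    then show "\<exists>T. openin (mtop (prod_mfd M N)) T \<and> z \<in> T \<and> T \<subseteq> W"
      using UV by (intro exI[of _ "U \<times> V"]) (auto simp: mem_Times_iff)
  qed
qed

end

lemma second_countable_prod_topology:
  assumes "second_countable X" "second_countable Y"
  shows "second_countable (prod_topology X Y)"
proof -
  obtain A where A: "countable A" "\<And>V. V \<in> A \<Longrightarrow> openin X V"
    "\<And>U x. openin X U \<Longrightarrow> x \<in> U \<Longrightarrow> \<exists>V\<in>A. x \<in> V \<and> V \<subseteq> U"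
    using assms(1) unfolding second_countable_def by metis
  obtain B where B: "countable B" "\<And>V. V \<in> B \<Longrightarrow> openin Y V"
    "\<And>U x. openin Y U \<Longrightarrow> x \<in> U \<Longrightarrow> \<exists>V\<in>B. x \<in> V \<and> V \<subseteq> U"
    using assms(2) unfolding second_countable_def by metis
  let ?C = "(\<lambda>(a, b). a \<times> b) ` (A \<times> B)"
  have "\<exists>V\<in>?C. z \<in> V \<and> V \<subseteq> U" if U: "openin (prod_topology X Y) U" "z \<in> U" for U z
  proof -
    obtain P Q where "openin X P" "openin Y Q" "fst z \<in> P" "snd z \<in> Q" "P \<times> Q \<subseteq> U"
      using U unfolding openin_prod_topology_alt by (metis prod.collapse)
    moreover obtain a where "a \<in> A" "fst z \<in> a" "a \<subseteq> P" using A(3) calculation(1,3) by blast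
    moreover obtain b where "b \<in> B" "snd z \<in> b" "b \<subseteq> Q" using B(3) calculation(2,4) by blast
    ultimately show ?thesis by (intro bexI[of _ "a \<times> b"]) (auto simp: mem_Times_iff)
  qed
  moreover have "openin (prod_topology X Y) V" if "V \<in> ?C" for V
    using that A(2) B(2) by (auto simp: openin_prod_Times_iff)
  moreover have "countable ?C" using A(1) B(1) by blast
  ultimately show ?thesis unfolding second_countable_def by (intro exI[of _ ?C]) blast
qed

lemma manifold_prod:
  assumes "manifold M" "manifold N" shows "manifold (prod_mfd M N)"
  using assms unfolding manifold_iff
  by (auto simp: atlas_prod mtop_prod Hausdorff_space_prod_topology second_countable_prod_topology)

lemma mtop_flat:
  assumes "subspace V" "opn V S" shows "mtop (flat V S) = top_of_set S"
  unfolding topology_eq openin_flat[OF assms]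
  using openin_subset_trans[OF _ _ openin_subset_subspace[OF assms(2)]] openin_trans[OF _ assms(2)] openin_subset_subspace
  by blast

lemma second_countable_top_of_set:
  fixes S :: "'a::euclidean_space set" shows "second_countable (top_of_set S)"
proof -
  obtain B :: "'a set set" where B: "countable B" "\<And>V. V \<in> B \<Longrightarrow> open V"
    "\<And>U. open U \<Longrightarrow> \<exists>A. A \<subseteq> B \<and> U = \<Union>A"
    using univ_second_countable by metis
  have "second_countable (euclidean :: 'a topology)"
    unfolding second_countable_def
  proof (intro exI[of _ B] conjI ballI allI impI)
    fix U :: "'a set" and x assume "openin euclidean U \<and> x \<in> U"
    then obtain A where "A \<subseteq> B" "U = \<Union>A" "x \<in> U" using B(3)[of U] by auto
    then show "\<exists>V\<in>B. x \<in> V \<and> V \<subseteq> U" by auto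
  qed (use B in auto)
  then show ?thesis by (rule second_countable_subtopology)
qed

lemma manifold_flat:
  assumes "subspace V" "opn V S" shows "manifold (flat V S)"
  unfolding manifold_iff mtop_flat[OF assms]
  using atlas_flat[OF assms] second_countable_top_of_set
  by (simp add: Hausdorff_space_subtopology Hausdorff_space_euclidean)

section \<open>Families with a real parameter, exponentials and logarithms\<close>

lemma smooth_slice:
  assumes A: "atlas A" and N: "atlas N" and H: "smooth_at (prod_mfd (flat UNIV (UNIV::real set)) A) N H (0, x)"
  shows "smooth_at EU N (\<lambda>t. H (t, x)) 0"
proof -
  have P: "atlas (prod_mfd (flat UNIV (UNIV::real set)) A)" by (rule atlas_prod[OF atlas_EU A])
  have x: "x \<in> points A" using smooth_at_points(1)[OF P N H] by (simp add: prod_mfd_simps)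
  have "smooth_at EU (prod_mfd (flat UNIV (UNIV::real set)) A) (\<lambda>t. (t, x)) 0"
    by (intro smooth_at_Pair[OF atlas_EU A atlas_EU] smooth_at_id[OF atlas_EU] smooth_at_const[OF atlas_EU A]) (simp_all add: x)
  from smooth_at_compose[OF atlas_EU P N this H] show ?thesis .
qed

lemma smooth_at_restrict0:
  assumes A: "atlas A" and N: "atlas N" and H: "smooth_at (prod_mfd (flat UNIV (UNIV::real set)) A) N H (0, x)"
  shows "smooth_at A N (\<lambda>x. H (0, x)) x"
proof -
  have P: "atlas (prod_mfd (flat UNIV (UNIV::real set)) A)" by (rule atlas_prod[OF atlas_EU A])
  have x: "x \<in> points A" using smooth_at_points(1)[OF P N H] by (simp add: prod_mfd_simps)
  have "smooth_at A (prod_mfd (flat UNIV (UNIV::real set)) A) (\<lambda>x. (0, x)) x"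
    by (intro smooth_at_Pair[OF atlas_EU A A] smooth_at_id[OF A] smooth_at_EU_const[OF A] x)
  from smooth_at_compose[OF A P N this H] show ?thesis .
qed

lemma smooth_at_exp: "atlas A \<Longrightarrow> smooth_at A EU f p \<Longrightarrow> smooth_at A EU (\<lambda>x. exp (f x :: real)) p"
  by (rule smooth_at_EU_compose[where S = UNIV, OF _ _ smooth_onI_Cinf[OF open_UNIV Cinf_exp subset_UNIV]]) auto

lemma smooth_at_ln: "atlas A \<Longrightarrow> smooth_at A EU f p \<Longrightarrow> f p > 0 \<Longrightarrow> smooth_at A EU (\<lambda>x. ln (f x :: real)) p"
  by (rule smooth_at_EU_compose[where S = "{0<..}", OF _ _ smooth_onI_Cinf[OF open_greaterThan Cinf_ln subset_refl]]) auto

lemma open_positive: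
  assumes A: "atlas A" and W: "openin (mtop A) W" and f: "\<And>x. x \<in> W \<Longrightarrow> smooth_at A EU f x"
  shows "openin (mtop A) (W \<inter> f -` {0::real<..})"
  by (rule smooth_at_preimage_open[OF A atlas_EU W f]) (simp_all add: openin_flat)

section \<open>Tangent vectors\<close>

text \<open>Restricting a chart to a smaller domain does not change its inverse there, by
  injectivity. So smoothness on the open submanifold is pointwise smoothness, which in turn spreads
  from \<open>p\<close> to a neighbourhood.\<close>

lemma smooth_near_iff:
  assumes M: "atlas M"
  shows "smooth_near M p f \<longleftrightarrow> smooth_at M EU f p"
proof
  assume "smooth_near M p f"
  then obtain W where W: "openin (mtop M) W" "p \<in> W" "smooth_map (open_sub M W) (euclid UNIV) f"
    unfolding smooth_near_def by blast
  have "p \<in> points M" using W(1,2) openin_mtop[OF M] by blast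
  then obtain c where c: "c \<in> charts M" "p \<in> fst c" using atlas_cover[OF M] by blast
  let ?S = "snd c ` (fst c \<inter> W)"
  have "(fst c \<inter> W, snd c) \<in> charts (open_sub M W)"
    using c(1) unfolding open_sub_def by (auto simp: case_prod_beta intro!: image_eqI[of _ _ c])
  then have sm: "smooth_on ?S (\<lambda>y. f (inv_into (fst c \<inter> W) (snd c) y))"
    using W(3) unfolding smooth_map_def euclid_def by fastforce
  have "inv_into (fst c \<inter> W) (snd c) y = ic c y" if "y \<in> ?S" for y
    using that inj_on_subset[OF chart_inj[OF M c(1)], of "fst c \<inter> W"] chart_ic[OF M c(1)] by (auto simp: inv_into_f_f)
  then have "smooth_on ?S (\<lambda>y. f (ic c y))"
    by (intro smooth_on_cong[OF sm]) simp
  then have "local_rep M EU f p c (UNIV, \<lambda>x. x) ?S"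
    unfolding local_rep_def using c W(2) openin_mtopD[OF M W(1) c(1)] by auto
  then show "smooth_at M EU f p" by (rule local_rep_smooth_at)
next
  assume f: "smooth_at M EU f p"
  obtain W where W: "openin (mtop M) W" "p \<in> W" "\<And>x. x \<in> W \<Longrightarrow> smooth_at M EU f x"
    using smooth_at_nhd[OF M f] by blast
  have "opn (model M) (snd c ` (fst c \<inter> W)) \<and> smooth_on (snd c ` (fst c \<inter> W)) (\<lambda>y. f (inv_into (fst c \<inter> W) (snd c) y))"
    if c: "c \<in> charts M" for c
  proof
    let ?S = "snd c ` (fst c \<inter> W)"
    show S: "opn (model M) ?S" by (rule openin_mtopD[OF M W(1) c])
    have inv: "inv_into (fst c \<inter> W) (snd c) y = ic c y" if "y \<in> ?S" for y
      using that inj_on_subset[OF chart_inj[OF M c(1)], of "fst c \<inter> W"] chart_ic[OF M c] by (auto simp: inv_into_f_f)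
    have "smooth_on ?S (\<lambda>y. f (ic c y))"
    proof (rule smooth_on_local)
      fix y assume y: "y \<in> ?S"
      then obtain x where x: "x \<in> fst c" "x \<in> W" "y = snd c x" by blast
      obtain T where T: "local_rep M EU f x c (UNIV, \<lambda>x. x) T"
        using smooth_at_rep[OF M atlas_EU W(3)[OF x(2)] c x(1), of "(UNIV, \<lambda>x. x)"] by auto
      have "opn (model M) (?S \<inter> T)" using S T unfolding local_rep_def by blast
      then have "opn ?S (?S \<inter> T)"
        using openin_subset_trans[OF _ _ openin_subset_subspace[OF S]] by blast
      moreover have "smooth_on (?S \<inter> T) (\<lambda>y. f (ic c y))"
        by (rule smooth_on_subset[OF _ Int_lower2]) (use T in \<open>simp add: local_rep_def\<close>)
      moreover have "y \<in> ?S \<inter> T" using y x(3) T unfolding local_rep_def by simp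
      ultimately show "\<exists>T. opn ?S T \<and> y \<in> T \<and> smooth_on T (\<lambda>y. f (ic c y))" by blast
    qed
    then show "smooth_on ?S (\<lambda>y. f (inv_into (fst c \<inter> W) (snd c) y))"
      by (rule smooth_on_cong) (simp add: inv)
  qed
  then have "smooth_map (open_sub M W) (euclid UNIV) f"
    unfolding smooth_map_def euclid_def open_sub_def by (auto simp: case_prod_beta)
  then show "smooth_near M p f" unfolding smooth_near_def using W by blast
qed

lemma smooth_near_compose:
  assumes "atlas M" "atlas N" "smooth_at M N F p" "smooth_near N (F p) h"
  shows "smooth_near M p (\<lambda>x. h (F x))"
  using smooth_at_compose[OF assms(1,2) atlas_EU assms(3)] assms(4)
  by (simp add: smooth_near_iff assms(1,2))

text \<open>Coordinate vectors as a formula in the direction \<open>a\<close> instead of velocities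
  of a curve, since linearity in \<open>a\<close> is visible in this form. The default 0 matches the
  one in \<open>velocity\<close>.\<close>

definition cv :: "('a, 'e::euclidean_space) mfd \<Rightarrow> ('a, 'e) chart \<Rightarrow> 'e \<Rightarrow> 'e \<Rightarrow> 'a tvec" where
  "cv M c y a = (\<lambda>f. if smooth_near M (ic c y) f then dV (model M) (\<lambda>z. f (ic c z)) y a else 0)"

lemma velocity_cong:
  assumes "eventually (\<lambda>t. \<gamma> t = \<gamma>' t) (nhds 0)"
  shows "velocity M \<gamma> = velocity M \<gamma>'"
proof -
  have "\<gamma> 0 = \<gamma>' 0" using assms by (rule eventually_nhds_x_imp_x)
  moreover have "deriv (\<lambda>t. f (\<gamma> t)) 0 = deriv (\<lambda>t. f (\<gamma>' t)) 0" for f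
    by (rule deriv_cong_ev) (use assms in \<open>auto elim: eventually_mono\<close>)
  ultimately show ?thesis unfolding velocity_def by presburger
qed

lemma smooth_fn_rep:
  assumes "atlas M" "local_rep M N F p c d S"
  shows "smooth_fn (model M) S (\<lambda>y. snd d (F (ic c y)))"
  using assms atlas_model unfolding smooth_fn_def local_rep_def by blast

context
  fixes M :: "('a, 'e::euclidean_space) mfd"
  assumes M: "atlas M"
begin

lemma near_rep:
  assumes "smooth_near M p f" "c \<in> charts M" "p \<in> fst c"
  obtains S where "smooth_fn (model M) S (\<lambda>y. f (ic c y))" "snd c p \<in> S" "S \<subseteq> snd c ` fst c"
proof -
  have f: "smooth_at M EU f p" using assms(1) smooth_near_iff[OF M] by blast
  obtain S where S: "local_rep M EU f p c (UNIV, \<lambda>x. x) S"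
    using smooth_at_rep[OF M atlas_EU f assms(2,3), of "(UNIV, \<lambda>x. x)"] by auto
  show ?thesis
    using that[of S] smooth_fn_rep[OF M S] S unfolding local_rep_def by simp
qed

lemma curve_chart:
  fixes \<gamma> :: "real \<Rightarrow> 'a"
  assumes g: "smooth_at EU M \<gamma> 0" and c: "c \<in> charts M" "\<gamma> 0 \<in> fst c"
  obtains a where "a \<in> model M" "((\<lambda>t. snd c (\<gamma> t)) has_vector_derivative a) (at 0)"
    "eventually (\<lambda>t. \<gamma> t \<in> fst c) (nhds 0)"
proof -
  obtain T where T: "open T" "0 \<in> T" "\<And>t. t \<in> T \<Longrightarrow> \<gamma> t \<in> fst c" "smooth_on T (\<lambda>t. snd c (\<gamma> t))"
    using smooth_at_flatD[OF subspace_UNIV _ M g c] by auto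
  interpret smooth_fn UNIV T "\<lambda>t. snd c (\<gamma> t)" using T by unfold_locales auto
  have "((\<lambda>s. snd c (\<gamma> s)) has_vector_derivative dV UNIV (\<lambda>t. snd c (\<gamma> t)) 0 1) (at 0)"
    using dV_line[OF T(2), of 1] by simp
  moreover have "dV UNIV (\<lambda>t. snd c (\<gamma> t)) 0 1 \<in> model M"
    by (rule dV_in[OF smooth_fn_axioms atlas_model[OF M] _ T(2)])
      (use T(3) chart_in_model[OF M c(1)] in blast)
  moreover have "eventually (\<lambda>t. \<gamma> t \<in> fst c) (nhds 0)"
    unfolding eventually_nhds using T by blast
  ultimately show ?thesis using that by blast
qed

text \<open>The chain rule in a chart. It reduces comparisons of velocities to comparisons of
  coordinate derivatives.\<close>

lemma velocity_cv:
  fixes \<gamma> :: "real \<Rightarrow> 'a"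
  assumes c: "c \<in> charts M" and ev: "eventually (\<lambda>t. \<gamma> t \<in> fst c) (nhds 0)"
    and a: "((\<lambda>t. snd c (\<gamma> t)) has_vector_derivative a) (at 0)"
  shows "velocity M \<gamma> = cv M c (snd c (\<gamma> 0)) a"
proof (rule ext)
  fix f
  have g0: "\<gamma> 0 \<in> fst c" using ev by (rule eventually_nhds_x_imp_x)
  have ic0: "ic c (snd c (\<gamma> 0)) = \<gamma> 0" by (rule chart_ic[OF M c g0])
  show "velocity M \<gamma> f = cv M c (snd c (\<gamma> 0)) a f"
  proof (cases "smooth_near M (\<gamma> 0) f")
    case True
    obtain S where S: "smooth_fn (model M) S (\<lambda>y. f (ic c y))" "snd c (\<gamma> 0) \<in> S"
      using near_rep[OF True c g0] by blast
    have "((\<lambda>t. f (ic c (snd c (\<gamma> t)))) has_vector_derivative dV (model M) (\<lambda>y. f (ic c y)) (snd c (\<gamma> 0)) a) (at 0)"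
      by (rule smooth_fn.dV_curve[OF S(1) a S(2)])
        (rule eventually_mono[OF ev], rule chart_in_model[OF M c])
    then have "DERIV (\<lambda>t. f (ic c (snd c (\<gamma> t)))) 0 :> dV (model M) (\<lambda>y. f (ic c y)) (snd c (\<gamma> 0)) a"
      unfolding has_real_derivative_iff_has_vector_derivative .
    moreover have "deriv (\<lambda>t. f (\<gamma> t)) 0 = deriv (\<lambda>t. f (ic c (snd c (\<gamma> t)))) 0"
      by (rule deriv_cong_ev[OF eventually_mono[OF ev]]) (simp_all add: chart_ic[OF M c])
    ultimately show ?thesis using True ic0 DERIV_imp_deriv unfolding velocity_def cv_def by fastforce
  next
    case False
    then show ?thesis using ic0 by (simp add: velocity_def cv_def)
  qed
qed

lemma smooth_coord_curve:
  assumes c: "c \<in> charts M" and y: "y \<in> snd c ` fst c" and a: "a \<in> model M"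
  shows "smooth_at EU M (\<lambda>t::real. ic c (y + t *\<^sub>R a)) 0"
proof (rule smooth_at_compose[OF atlas_EU _ M, where N = "flat (model M) (snd c ` fst c)" and H = "ic c"])
  show "atlas (flat (model M) (snd c ` fst c))" by (rule atlas_flat[OF atlas_model[OF M] chart_open[OF M c]])
  have blin: "bounded_linear (\<lambda>t. t *\<^sub>R a)" by (rule bounded_linear_scaleR_left)
  have sm: "smooth_on UNIV (\<lambda>t::real. y + t *\<^sub>R a)"
    by (intro smooth_on_add smooth_on_const smooth_on_linear blin)
  have yM: "y \<in> model M" using y openin_subset_subspace[OF chart_open[OF M c]] by blast
  have "open ((\<lambda>t::real. y + t *\<^sub>R a) -` (snd c ` fst c))"
    using smooth_preimage_open[OF sm _ _ chart_open[OF M c], of UNIV]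
      subspace_add[OF atlas_model[OF M] yM subspace_scale[OF atlas_model[OF M] a]] by auto
  then show "smooth_at EU (flat (model M) (snd c ` fst c)) (\<lambda>t::real. y + t *\<^sub>R a) 0"
    using smooth_on_subset[OF sm subset_UNIV] y
    by (intro smooth_at_flat_flatI[where T = "(\<lambda>t::real. y + t *\<^sub>R a) -` (snd c ` fst c)"]) auto
  show "smooth_at (flat (model M) (snd c ` fst c)) M (ic c) (y + 0 *\<^sub>R a)"
    using smooth_at_ic[OF M c y] by simp
qed

lemma coord_curve:
  assumes c: "c \<in> charts M" and y: "y \<in> snd c ` fst c" and a: "a \<in> model M"
  shows "eventually (\<lambda>t::real. y + t *\<^sub>R a \<in> snd c ` fst c) (nhds 0)"
proof -
  have sm: "smooth_on UNIV (\<lambda>t::real. y + t *\<^sub>R a)"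
    by (intro smooth_on_add smooth_on_const smooth_on_linear bounded_linear_scaleR_left)
  have yM: "y \<in> model M" using y openin_subset_subspace[OF chart_open[OF M c]] by blast
  have "open ((\<lambda>t::real. y + t *\<^sub>R a) -` (snd c ` fst c))"
    using smooth_preimage_open[OF sm _ _ chart_open[OF M c], of UNIV]
      subspace_add[OF atlas_model[OF M] yM subspace_scale[OF atlas_model[OF M] a]] by auto
  then show ?thesis using y unfolding eventually_nhds
    by (intro exI[of _ "(\<lambda>t::real. y + t *\<^sub>R a) -` (snd c ` fst c)"]) auto
qed

text \<open>The coordinate line stays in the chart image only for small \<open>t\<close>. Beyond
  that \<open>inv_into\<close> is arbitrary, but the velocity at 0 does not see it.\<close>

lemma coord_vec_cv:
  assumes c: "c \<in> charts M" and y: "y \<in> snd c ` fst c" and a: "a \<in> model M"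
  shows "coord_vec M c y a = cv M c y a"
proof -
  let ?g = "\<lambda>t::real. ic c (y + t *\<^sub>R a)"
  have ev: "eventually (\<lambda>t. ?g t \<in> fst c) (nhds 0)"
    by (rule eventually_mono[OF coord_curve[OF c y a]]) (rule ic_in)
  have der: "((\<lambda>t. y + t *\<^sub>R a) has_vector_derivative a) (at 0)"
    by (auto intro!: derivative_eq_intros)
  from coord_curve[OF c y a, unfolded eventually_nhds] obtain T where T: "open T" "0 \<in> T" "\<And>t. t \<in> T \<Longrightarrow> y + t *\<^sub>R a \<in> snd c ` fst c"
    by blast
  have "((\<lambda>t. snd c (?g t)) has_vector_derivative a) (at 0)"
    by (rule has_vector_derivative_transform_within_open[OF der T(1,2)]) (rule chart_of_ic[symmetric], rule T(3))
  from velocity_cv[OF c ev this] show ?thesis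
    unfolding coord_vec_def ic_def[symmetric] using chart_of_ic[OF y] by simp
qed

text \<open>\<open>tangent_space\<close> asks for a curve that is smooth on an interval; smoothness
  at 0 spreads to a neighbourhood of 0, which contains one.\<close>

lemma velocity_in_tangent:
  fixes \<gamma> :: "real \<Rightarrow> 'a"
  assumes g: "smooth_at EU M \<gamma> 0"
  shows "velocity M \<gamma> \<in> tangent_space M (\<gamma> 0)"
proof -
  obtain W where W: "openin (mtop (flat UNIV (UNIV::real set))) W" "0 \<in> W" "\<And>t. t \<in> W \<Longrightarrow> smooth_at EU M \<gamma> t"
    using smooth_at_nhd[OF atlas_EU g] by blast
  have "open W" using W(1) openin_flat[of UNIV "UNIV::real set" W] by auto
  then obtain e where e: "e > 0" "ball 0 e \<subseteq> W" using W(2) unfolding open_contains_ball by blast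
  have be: "{-e<..<e} = ball 0 e" by (auto simp: ball_def dist_real_def)
  have at: "atlas (flat UNIV {-e<..<e})" by (rule atlas_flat) auto
  have "smooth_at (flat UNIV {-e<..<e}) M \<gamma> t" if "t \<in> {-e<..<e}" for t
    by (rule smooth_at_flat_dom[OF subspace_UNIV _ _ that M W(3)]) (use that e(2) be in auto)
  then have "smooth_map (euclid {-e<..<e}) M \<gamma>"
    unfolding euclid_eq_flat smooth_map_iff[OF at M] by simp
  then show ?thesis unfolding tangent_space_def using e(1) by blast
qed

lemma tangentE:
  assumes "v \<in> tangent_space M p"
  obtains \<gamma> :: "real \<Rightarrow> 'a" where "smooth_at EU M \<gamma> 0" "\<gamma> 0 = p" "v = velocity M \<gamma>"
proof -
  obtain \<gamma> e where g: "e > 0" "smooth_map (euclid {-e<..<e}) M \<gamma>" "\<gamma> 0 = p" "v = velocity M \<gamma>"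
    using assms unfolding tangent_space_def by blast
  have at: "atlas (flat UNIV {-e<..<e})" by (rule atlas_flat) auto
  have "smooth_at (flat UNIV {-e<..<e}) M \<gamma> 0"
    using g(1,2) unfolding euclid_eq_flat smooth_map_iff[OF at M] by simp
  then have "smooth_at EU M \<gamma> 0"
    using smooth_at_flat_dom[OF subspace_UNIV _ _ _ M, of "{-e<..<e}" UNIV 0 \<gamma>] by auto
  then show ?thesis using that g(3,4) by blast
qed

lemma tangent_points: "v \<in> tangent_space M p \<Longrightarrow> p \<in> points M"
  using tangentE smooth_at_points(2)[OF atlas_EU M] by metis

lemma tangent_space_cv:
  assumes c: "c \<in> charts M" "p \<in> fst c"
  shows "tangent_space M p = cv M c (snd c p) ` model M"
proof (intro antisym subsetI)
  fix v assume "v \<in> tangent_space M p"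
  then obtain \<gamma> :: "real \<Rightarrow> 'a" where g: "smooth_at EU M \<gamma> 0" "\<gamma> 0 = p" "v = velocity M \<gamma>" by (rule tangentE)
  have g0: "\<gamma> 0 \<in> fst c" using c(2) g(2) by simp
  obtain a where a: "a \<in> model M" "((\<lambda>t. snd c (\<gamma> t)) has_vector_derivative a) (at 0)"
    "eventually (\<lambda>t. \<gamma> t \<in> fst c) (nhds 0)" using curve_chart[OF g(1) c(1) g0] by blast
  show "v \<in> cv M c (snd c p) ` model M"
    using velocity_cv[OF c(1) a(3,2)] a(1) g(2,3) by blast
next
  fix v assume "v \<in> cv M c (snd c p) ` model M"
  then obtain a where a: "a \<in> model M" "v = cv M c (snd c p) a" by blast
  have y: "snd c p \<in> snd c ` fst c" using c(2) by blast
  have "v = velocity M (\<lambda>t. ic c (snd c p + t *\<^sub>R a))"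
    using a coord_vec_cv[OF c(1) y a(1)] unfolding coord_vec_def ic_def[symmetric] by simp
  then show "v \<in> tangent_space M p"
    using velocity_in_tangent[OF smooth_coord_curve[OF c(1) y a(1)]] chart_ic[OF M c] by simp
qed

text \<open>The components of a chart are smooth near \<open>p\<close>, so a coordinate vector may
  be evaluated on them. In particular \<open>a\<close> can be recovered from its coordinate
  vector.\<close>

lemma chart_diff_cv:
  assumes c: "c \<in> charts M" "p \<in> fst c" and a: "a \<in> model M"
  shows "chart_diff (snd c) (cv M c (snd c p) a) = a"
proof -
  let ?y = "snd c p"
  have ic: "ic c ?y = p" by (rule chart_ic[OF M c])
  have "cv M c ?y a (\<lambda>x. snd c x \<bullet> i) = a \<bullet> i" for i
  proof -
    have "smooth_at M EU (snd c) p"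
      by (rule smooth_at_EU_cod[OF M smooth_at_chart[OF M c] chart_points[OF M c]])
    then have "smooth_near M p (\<lambda>x. snd c x \<bullet> i)"
      using smooth_at_linear[OF M _ bounded_linear_inner_left] smooth_near_iff[OF M] by blast
    then have "cv M c ?y a (\<lambda>x. snd c x \<bullet> i) = dV (model M) (\<lambda>z. snd c (ic c z) \<bullet> i) ?y a"
      by (simp add: cv_def ic)
    also have "\<dots> = dV (model M) (\<lambda>z. z \<bullet> i) ?y a"
    proof (rule fun_cong[OF smooth_fn.dV_cong[symmetric]])
      show "smooth_fn (model M) (snd c ` fst c) (\<lambda>z. z \<bullet> i)"
        by unfold_locales (rule atlas_model[OF M] chart_open[OF M c(1)] smooth_on_linear[OF bounded_linear_inner_left])+
    qed (use c(2) chart_of_ic[of _ c] in auto)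
    also have "\<dots> = a \<bullet> i"
      using dV_linear[OF bounded_linear_inner_left, of "model M" i] proj_id[OF atlas_model[OF M] a] by simp
    finally show ?thesis .
  qed
  then show ?thesis unfolding chart_diff_def by (simp add: euclidean_representation)
qed

lemma cv_linear:
  assumes c: "c \<in> charts M" "p \<in> fst c"
  shows "cv M c (snd c p) (x *\<^sub>R a + y *\<^sub>R b) = lincomb x (cv M c (snd c p) a) y (cv M c (snd c p) b)"
proof (rule ext)
  fix f
  show "cv M c (snd c p) (x *\<^sub>R a + y *\<^sub>R b) f = lincomb x (cv M c (snd c p) a) y (cv M c (snd c p) b) f"
  proof (cases "smooth_near M p f")
    case True
    obtain S where S: "smooth_fn (model M) S (\<lambda>y. f (ic c y))" "snd c p \<in> S"
      using near_rep[OF True c] by blast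
    interpret linear "dV (model M) (\<lambda>y. f (ic c y)) (snd c p)" by (rule smooth_fn.linear_dV[OF S])
    show ?thesis unfolding cv_def lincomb_def by (simp add: add scale)
  qed (simp add: cv_def lincomb_def chart_ic[OF M c])
qed

lemma tangent_cv:
  assumes c: "c \<in> charts M" "p \<in> fst c" and v: "v \<in> tangent_space M p"
  shows "chart_diff (snd c) v \<in> model M" "cv M c (snd c p) (chart_diff (snd c) v) = v"
proof -
  obtain a where a: "a \<in> model M" "v = cv M c (snd c p) a" using v tangent_space_cv[OF c] by blast
  then show "chart_diff (snd c) v \<in> model M" "cv M c (snd c p) (chart_diff (snd c) v) = v"
    using chart_diff_cv[OF c a(1)] by simp_all
qed

lemma cv_tangent: "c \<in> charts M \<Longrightarrow> p \<in> fst c \<Longrightarrow> a \<in> model M \<Longrightarrow> cv M c (snd c p) a \<in> tangent_space M p"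
  using tangent_space_cv by blast

lemma tangent_lincomb:
  assumes "u \<in> tangent_space M p" "v \<in> tangent_space M p"
  shows "lincomb a u b v \<in> tangent_space M p"
proof -
  obtain c where c: "c \<in> charts M" "p \<in> fst c" using atlas_cover[OF M tangent_points[OF assms(1)]] by blast
  let ?D = "chart_diff (snd c)"
  have "lincomb a u b v = cv M c (snd c p) (a *\<^sub>R ?D u + b *\<^sub>R ?D v)"
    using tangent_cv(2)[OF c] assms cv_linear[OF c] by simp
  moreover have "a *\<^sub>R ?D u + b *\<^sub>R ?D v \<in> model M"
    using tangent_cv(1)[OF c] assms atlas_model[OF M] by (simp add: subspace_add subspace_scale)
  ultimately show ?thesis using cv_tangent[OF c] by simp
qed

lemma tangent_zero: "p \<in> points M \<Longrightarrow> (\<lambda>_. 0) \<in> tangent_space M p"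
proof -
  assume "p \<in> points M"
  then obtain c where c: "c \<in> charts M" "p \<in> fst c" using atlas_cover[OF M] by blast
  have "cv M c (snd c p) 0 \<in> tangent_space M p"
    by (rule cv_tangent[OF c subspace_0[OF atlas_model[OF M]]])
  from tangent_lincomb[OF this this, of 0 0] show ?thesis by (simp add: lincomb_def)
qed

lemma tangent_not_near:
  assumes "v \<in> tangent_space M p" "\<not> smooth_near M p f" shows "v f = 0"
proof -
  obtain \<gamma> :: "real \<Rightarrow> 'a" where g: "\<gamma> 0 = p" "v = velocity M \<gamma>" using assms(1) by (rule tangentE)
  then show ?thesis using assms(2) by (simp add: velocity_def)
qed

end

lemma chart_diff_lincomb: "chart_diff \<phi> (lincomb a u b v) = a *\<^sub>R chart_diff \<phi> u + b *\<^sub>R chart_diff \<phi> v"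
  unfolding chart_diff_def lincomb_def
  by (simp add: scaleR_sum_right sum.distrib[symmetric] scaleR_add_left)

lemma push_lincomb: "push M N F p (lincomb a u b v) = lincomb a (push M N F p u) b (push M N F p v)"
  unfolding push_def lincomb_def by auto

lemma push_zero: "push M N F p (\<lambda>_. 0) = (\<lambda>_. 0)"
  unfolding push_def by auto

lemma push_velocity:
  assumes "atlas M" "atlas N" "smooth_at M N F (\<gamma> 0)"
  shows "push M N F (\<gamma> 0) (velocity M \<gamma>) = velocity N (\<lambda>t. F (\<gamma> t))"
  unfolding push_def velocity_def using smooth_near_compose[OF assms] by auto

lemma push_push:
  assumes "atlas N" "atlas L" "smooth_at N L H (F p)"
  shows "push N L H (F p) (push M N F p v) = push M L (\<lambda>x. H (F x)) p v"
  unfolding push_def using smooth_near_compose[OF assms] by auto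

lemma push_tangent:
  assumes M: "atlas M" and N: "atlas N" and F: "smooth_at M N F p" and v: "v \<in> tangent_space M p"
  shows "push M N F p v \<in> tangent_space N (F p)"
proof -
  obtain \<gamma> :: "real \<Rightarrow> 'a" where g: "smooth_at EU M \<gamma> 0" "\<gamma> 0 = p" "v = velocity M \<gamma>" by (rule tangentE[OF M v])
  have "smooth_at EU N (\<lambda>t. F (\<gamma> t)) 0"
    by (rule smooth_at_compose[OF atlas_EU M N g(1)]) (simp add: g(2) F)
  from velocity_in_tangent[OF N this] show ?thesis
    using push_velocity[OF M N, of F \<gamma>] F g(2,3) by simp
qed

text \<open>A tangent vector is the velocity of a curve that stays in \<open>W\<close> for small
  times, where both image curves coincide.\<close>

lemma push_cong:
  assumes M: "atlas M" and N: "atlas N" and F: "smooth_at M N F p" and v: "v \<in> tangent_space M p"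
    and W: "openin (mtop M) W" "p \<in> W" and eq: "\<And>x. x \<in> W \<Longrightarrow> F x = F' x"
  shows "push M N F p v = push M N F' p v"
proof -
  obtain \<gamma> :: "real \<Rightarrow> 'a" where g: "smooth_at EU M \<gamma> 0" "\<gamma> 0 = p" "v = velocity M \<gamma>" by (rule tangentE[OF M v])
  obtain Z where Z: "openin (mtop (flat UNIV (UNIV::real set))) Z" "0 \<in> Z" "\<And>t. t \<in> Z \<Longrightarrow> smooth_at EU M \<gamma> t"
    using smooth_at_nhd[OF atlas_EU g(1)] by blast
  have "openin (mtop EU) (Z \<inter> \<gamma> -` W)" by (rule smooth_at_preimage_open[OF atlas_EU M Z(1,3) W(1)])
  then have "open (Z \<inter> \<gamma> -` W)" using openin_flat[of UNIV "UNIV::real set"] by auto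
  then have "eventually (\<lambda>t. F (\<gamma> t) = F' (\<gamma> t)) (nhds 0)"
    unfolding eventually_nhds using Z(2) W(2) g(2) eq by (intro exI[of _ "Z \<inter> \<gamma> -` W"]) auto
  then have "velocity N (\<lambda>t. F (\<gamma> t)) = velocity N (\<lambda>t. F' (\<gamma> t))" by (rule velocity_cong)
  then show ?thesis
    using push_velocity[OF M N, of F \<gamma>] push_velocity[OF M N, of F' \<gamma>]
      smooth_at_cong[OF M F W eq] F g(2,3) by simp
qed

lemma push_id:
  assumes M: "atlas M" and v: "v \<in> tangent_space M p"
  shows "push M M (\<lambda>x. x) p v = v"
  using tangent_not_near[OF M v] unfolding push_def by auto

text \<open>The coordinate line through the point is pushed forward; the coordinate velocity of its
  image is the directional derivative of the coordinate expression.\<close>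

lemma push_cv:
  assumes M: "atlas M" and N: "atlas N" and r: "local_rep M N F p c d S" and a: "a \<in> model M"
  shows "push M N F p (cv M c (snd c p) a) =
    cv N d (snd d (F p)) (dV (model M) (\<lambda>y. snd d (F (ic c y))) (snd c p) a)"
proof -
  note s = r[unfolded local_rep_def]
  have c: "c \<in> charts M" "p \<in> fst c" and d: "d \<in> charts N" and y: "snd c p \<in> snd c ` fst c" using s by blast+
  let ?g = "\<lambda>t::real. ic c (snd c p + t *\<^sub>R a)"
  have g0: "?g 0 = p" using chart_ic[OF M c] by simp
  interpret smooth_fn "model M" S "\<lambda>y. snd d (F (ic c y))" by (rule smooth_fn_rep[OF M r])
  have "smooth_at EU M ?g 0" by (rule smooth_coord_curve[OF M c(1) y a])
  then have "smooth_at EU N (\<lambda>t. F (?g t)) 0"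
    by (rule smooth_at_compose[OF atlas_EU M N]) (use local_rep_smooth_at[OF r] g0 in simp)
  moreover have "F (?g 0) \<in> fst d" using s g0 chart_ic[OF M c] by (metis)
  ultimately have "eventually (\<lambda>t. F (?g t) \<in> fst d) (nhds 0)"
    using curve_chart[OF N _ d] by blast
  from velocity_cv[OF N d this] dV_line[of "snd c p" a] s a
  have "velocity N (\<lambda>t. F (?g t)) = cv N d (snd d (F (?g 0))) (dV (model M) (\<lambda>y. snd d (F (ic c y))) (snd c p) a)"
    by blast
  moreover have "cv M c (snd c p) a = velocity M ?g"
    using coord_vec_cv[OF M c(1) y a] unfolding coord_vec_def ic_def[symmetric] by simp
  ultimately show ?thesis
    using push_velocity[OF M N, of F ?g] local_rep_smooth_at[OF r] by (simp only: g0)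
qed

text \<open>The coordinate velocity is the partial derivative, in direction \<open>(1, 0)\<close>,
  of the coordinate expression of \<open>F\<close> on the product. Fields and forms that are defined
  by velocities of a family of curves owe their smoothness to this.\<close>

lemma smooth_at_velocity:
  fixes A :: "('a, 'e::euclidean_space) mfd" and N :: "('b, 'f::euclidean_space) mfd"
  assumes A: "atlas A" and N: "atlas N" and F: "smooth_at (prod_mfd (flat UNIV (UNIV::real set)) A) N F (0, p)"
    and d: "d \<in> charts N" "F (0, p) \<in> fst d"
  shows "smooth_at A EU (\<lambda>x. chart_diff (snd d) (velocity N (\<lambda>t. F (t, x)))) p"
proof -
  let ?R = "flat UNIV (UNIV::real set)"
  let ?P = "prod_mfd ?R A"
  have P: "atlas ?P" by (rule atlas_prod[OF atlas_EU A])
  have p: "p \<in> points A" using smooth_at_points(1)[OF P N F] by (simp add: prod_mfd_simps)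
  obtain e where e: "e \<in> charts A" "p \<in> fst e" using atlas_cover[OF A p] by blast
  let ?k = "prodc (UNIV::real set, \<lambda>x. x) e"
  have k: "?k \<in> charts ?P" "(0, p) \<in> fst ?k" using prodc_chart[OF atlas_EU A _ e(1)] e(2) by auto
  obtain S where S: "local_rep ?P N F (0, p) ?k d S" using smooth_at_rep[OF P N F k d] by blast
  note s = S[unfolded local_rep_def]
  define G where "G = (\<lambda>y. snd d (F (ic ?k y)))"
  interpret G: smooth_fn "UNIV \<times> model A" S G
    using smooth_fn_rep[OF P S] unfolding G_def by (simp add: prod_mfd_simps)
  have pair: "smooth_on UNIV (\<lambda>y::'e. (0::real, y))" by (intro smooth_on_Pair smooth_on_const smooth_on_id)
  define S0 where "S0 = model A \<inter> (\<lambda>y. (0, y)) -` S"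
  have S0: "opn (model A) S0" unfolding S0_def
    by (rule smooth_preimage_open[OF smooth_on_subset[OF pair subset_UNIV] _ _ G.S]) auto
  have key: "chart_diff (snd d) (velocity N (\<lambda>t. F (t, ic e y))) = dV (UNIV \<times> model A) G (0, y) (1, 0)"
    if y: "y \<in> S0" for y
  proof -
    have yS: "(0, y) \<in> S" using y by (simp add: S0_def)
    have ye: "y \<in> snd e ` fst e" using s yS by (auto simp: image_prodc)
    let ?x = "ic e y"
    have xA: "?x \<in> points A" by (rule chart_points[OF A e(1) ic_in[OF ye]])
    have ick: "ic ?k (t, y) = (t, ?x)" for t :: real
      using ic_prodc[OF atlas_EU A _ e(1) _ ye, of "(UNIV, \<lambda>x. x)" t] by simp
    have "smooth_at ?P N F (0, ?x)"
      using local_rep_smooth_at[OF local_rep_point[OF P S yS]] unfolding ick .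
    moreover have "smooth_at ?R ?P (\<lambda>t. (t, ?x)) 0"
      by (rule smooth_at_Pair[OF atlas_EU A atlas_EU smooth_at_id[OF atlas_EU] smooth_at_const[OF atlas_EU A]])
        (simp_all add: xA)
    ultimately have sg: "smooth_at ?R N (\<lambda>t. F (t, ?x)) 0"
      using smooth_at_compose[OF atlas_EU P N] by blast
    have Fx: "F (0, ?x) \<in> fst d" using s yS ick[of 0] by metis
    obtain a where a: "a \<in> model N" "((\<lambda>t. snd d (F (t, ?x))) has_vector_derivative a) (at 0)"
      "eventually (\<lambda>t. F (t, ?x) \<in> fst d) (nhds 0)"
      using curve_chart[OF N sg d(1) Fx] by blast
    have "((\<lambda>t. G ((0, y) + t *\<^sub>R (1, 0))) has_vector_derivative dV (UNIV \<times> model A) G (0, y) (1, 0)) (at 0)"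
      by (rule G.dV_line[OF yS]) (simp add: subspace_0[OF atlas_model[OF A]])
    then have "((\<lambda>t. snd d (F (t, ?x))) has_vector_derivative dV (UNIV \<times> model A) G (0, y) (1, 0)) (at 0)"
      unfolding G_def by (simp add: ick)
    with a(2) have "a = dV (UNIV \<times> model A) G (0, y) (1, 0)" by (rule vector_derivative_unique_at)
    then show ?thesis
      using velocity_cv[OF N d(1) a(3,2)] chart_diff_cv[OF N d(1) Fx a(1)] by simp
  qed
  have "smooth_on S0 (\<lambda>y. dV (UNIV \<times> model A) G (0, y) (1, 0))"
    by (rule smooth_on_compose[OF smooth_on_subset[OF pair subset_UNIV] G.dV_smooth]) (auto simp: S0_def)
  then have "smooth_on S0 (\<lambda>y. chart_diff (snd d) (velocity N (\<lambda>t. F (t, ic e y))))"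
    by (rule smooth_on_cong) (simp add: key)
  moreover have "snd e p \<in> S0" using s chart_in_model[OF A e] by (simp add: S0_def)
  moreover have "S0 \<subseteq> snd e ` fst e" using s by (auto simp: S0_def image_prodc)
  ultimately have "local_rep A EU (\<lambda>x. chart_diff (snd d) (velocity N (\<lambda>t. F (t, x)))) p e (UNIV, \<lambda>x. x) S0"
    unfolding local_rep_def using e S0 by simp
  then show ?thesis by (rule local_rep_smooth_at)
qed

lemma chart_diff_real:
  assumes "(c has_vector_derivative c') (at (0::real))"
  shows "chart_diff (\<lambda>x::real. x) (velocity EU c) = c'"
proof -
  have "velocity EU c = cv EU (UNIV, \<lambda>x. x) (snd (UNIV :: real set, \<lambda>x. x) (c 0)) c'"
    by (rule velocity_cv[OF atlas_EU]) (use assms in auto)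
  then show ?thesis using chart_diff_cv[OF atlas_EU, of "(UNIV, \<lambda>x::real. x)" "c 0" c'] by simp
qed

lemma velocity_const: "velocity M (\<lambda>t. p) = (\<lambda>_. 0)"
  unfolding velocity_def by auto

section \<open>The exterior derivative of a 1-form\<close>

text \<open>Nothing is required outside the tangent spaces, so forms are compared on tangent vectors
  only.\<close>

definition one_form :: "('a, 'e::euclidean_space) mfd \<Rightarrow> 'a form1 \<Rightarrow> bool" where
  "one_form M \<theta> \<longleftrightarrow>
     (\<forall>p\<in>points M. \<forall>u\<in>tangent_space M p. \<forall>v\<in>tangent_space M p. \<forall>a b.
        \<theta> p (lincomb a u b v) = a * \<theta> p u + b * \<theta> p v) \<and>
     (\<forall>c\<in>charts M. \<forall>a\<in>model M. smooth_on (snd c ` fst c) (coef1 M \<theta> c a))"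

text \<open>The vector of the model space that represents \<open>\<theta>\<close> in the chart by
  the inner product. One vector-valued function replaces the family of all coefficients.\<close>

definition covec :: "('a, 'e::euclidean_space) mfd \<Rightarrow> 'a form1 \<Rightarrow> ('a, 'e) chart \<Rightarrow> 'e \<Rightarrow> 'e" where
  "covec M \<theta> c y = (\<Sum>b\<in>onb (model M). coef1 M \<theta> c b y *\<^sub>R b)"

text \<open>The formula of \<open>ext_deriv1\<close> in a prescribed chart, freed from the choice
  made there.\<close>

definition ext_chart :: "('a, 'e::euclidean_space) mfd \<Rightarrow> 'a form1 \<Rightarrow> ('a, 'e) chart \<Rightarrow> 'a form2" where
  "ext_chart M \<theta> c p u v =
     dir_deriv (coef1 M \<theta> c (chart_diff (snd c) v)) (chart_diff (snd c) u) (snd c p) -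
     dir_deriv (coef1 M \<theta> c (chart_diff (snd c) u)) (chart_diff (snd c) v) (snd c p)"

lemma one_formD:
  assumes "one_form M \<theta>" "u \<in> tangent_space M p" "v \<in> tangent_space M p" "p \<in> points M"
  shows "\<theta> p (lincomb a u b v) = a * \<theta> p u + b * \<theta> p v"
  using assms unfolding one_form_def by blast

lemma coef1_cv:
  assumes "atlas M" "c \<in> charts M" "y \<in> snd c ` fst c" "a \<in> model M"
  shows "coef1 M \<theta> c a y = \<theta> (ic c y) (cv M c y a)"
  unfolding coef1_def ic_def[symmetric] coord_vec_cv[OF assms] ..

text \<open>\<open>L\<close> is linear on \<open>V\<close> only; composition with the projection
  makes it linear everywhere, and then it can be expanded in the orthonormal basis.\<close>

lemma linear_onb_expand:
  fixes L :: "'e::euclidean_space \<Rightarrow> real"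
  assumes V: "subspace V" and a: "a \<in> V"
    and L: "\<And>x y r s. x \<in> V \<Longrightarrow> y \<in> V \<Longrightarrow> L (r *\<^sub>R x + s *\<^sub>R y) = r * L x + s * L y"
  shows "L a = (\<Sum>b\<in>onb V. L b *\<^sub>R b) \<bullet> a"
proof -
  let ?L = "\<lambda>x. L (proj V x)"
  have pl: "linear (proj V)" using bounded_linear_proj linear_conv_bounded_linear by blast
  have lin: "linear ?L"
  proof (rule linearI)
    show "L (proj V (x + y)) = L (proj V x) + L (proj V y)" for x y
      using L[of "proj V x" "proj V y" 1 1] proj_in[OF V] by (simp add: linear_add[OF pl])
    show "L (proj V (r *\<^sub>R x)) = r *\<^sub>R L (proj V x)" for r x
      using L[of "proj V x" "proj V x" r 0] proj_in[OF V] by (simp add: linear_scale[OF pl])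
  qed
  have "L a = ?L (\<Sum>b\<in>onb V. (a \<bullet> b) *\<^sub>R b)"
    unfolding proj_def[of V a, symmetric] using proj_id[OF V] a proj_in[OF V] by simp
  also have "\<dots> = (\<Sum>b\<in>onb V. (a \<bullet> b) *\<^sub>R ?L b)"
    unfolding linear_sum[OF lin] linear_scale[OF lin] ..
  also have "\<dots> = (\<Sum>b\<in>onb V. (L b *\<^sub>R b) \<bullet> a)"
    using onb(1)[OF V] by (intro sum.cong refl) (auto simp: proj_id[OF V] inner_commute)
  finally show ?thesis by (simp add: inner_sum_left)
qed

lemma dV_add:
  assumes f: "smooth_fn V S f" and g: "smooth_fn V S g" and y: "y \<in> S"
  shows "dV V (\<lambda>x. f x + g x) y a = dV V f y a + dV V g y a"
  using frechet_derivative_eqI[OF has_derivative_add[OF smooth_fn.has_dV[OF f y] smooth_fn.has_dV[OF g y]]]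
  unfolding dV_def by simp

lemma smooth_fn_congr: "smooth_fn V S f \<Longrightarrow> (\<And>x. x \<in> S \<Longrightarrow> f x = g x) \<Longrightarrow> smooth_fn V S g"
  unfolding smooth_fn_def by (auto intro: smooth_on_cong)

lemma dV_inner_const:
  assumes f: "smooth_fn V S f" and y: "y \<in> S"
  shows "smooth_fn V S (\<lambda>z. f z \<bullet> w)" "dV V (\<lambda>z. f z \<bullet> w) y a = dV V f y a \<bullet> w"
proof -
  have w: "smooth_fn V S (\<lambda>_. w)" using f smooth_on_const unfolding smooth_fn_def by blast
  show "smooth_fn V S (\<lambda>z. f z \<bullet> w)" using f smooth_on_inner[OF _ smooth_on_const] unfolding smooth_fn_def by blast
  have "dV V (\<lambda>_. w) y a = 0" unfolding dV_def by (simp add: frechet_derivative_const)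
  then show "dV V (\<lambda>z. f z \<bullet> w) y a = dV V f y a \<bullet> w"
    using dV_bilinear[OF bounded_bilinear_inner f w y] by simp
qed

context
  fixes M :: "('a, 'e::euclidean_space) mfd" and \<theta> :: "'a form1"
  assumes M: "atlas M" and th: "one_form M \<theta>"
begin

lemma covec_inner:
  assumes c: "c \<in> charts M" and y: "y \<in> snd c ` fst c" and a: "a \<in> model M"
  shows "\<theta> (ic c y) (cv M c y a) = covec M \<theta> c y \<bullet> a"
proof -
  have p: "c \<in> charts M" "ic c y \<in> fst c" using c ic_in[OF y] by blast+
  have yy: "snd c (ic c y) = y" by (rule chart_of_ic[OF y])
  have "covec M \<theta> c y = (\<Sum>b\<in>onb (model M). \<theta> (ic c y) (cv M c y b) *\<^sub>R b)"
    unfolding covec_def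
    by (intro sum.cong refl) (use coef1_cv[OF M c y] onb(1)[OF atlas_model[OF M]] in auto)
  moreover have "\<theta> (ic c y) (cv M c y (r *\<^sub>R u + s *\<^sub>R v)) = r * \<theta> (ic c y) (cv M c y u) + s * \<theta> (ic c y) (cv M c y v)"
    if "u \<in> model M" "v \<in> model M" for u v r s
    using cv_linear[OF M p, of r u s v] cv_tangent[OF M p] that one_formD[OF th] chart_points[OF M p]
    by (simp add: yy)
  ultimately show ?thesis
    using linear_onb_expand[OF atlas_model[OF M] a, of "\<lambda>a. \<theta> (ic c y) (cv M c y a)"] by simp
qed

lemma smooth_fn_covec: "c \<in> charts M \<Longrightarrow> smooth_fn (model M) (snd c ` fst c) (covec M \<theta> c)"
proof
  assume c: "c \<in> charts M"
  show "subspace (model M)" by (rule atlas_model[OF M])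
  show "opn (model M) (snd c ` fst c)" by (rule chart_open[OF M c])
  have "smooth_on (snd c ` fst c) (coef1 M \<theta> c b)" if "b \<in> onb (model M)" for b
    using th c onb(1)[OF atlas_model[OF M]] that unfolding one_form_def by blast
  then show "smooth_on (snd c ` fst c) (covec M \<theta> c)"
    unfolding covec_def by (intro smooth_on_sum smooth_on_scaleR smooth_on_const) auto
qed

lemma dir_deriv_coef1:
  assumes c: "c \<in> charts M" and y: "y \<in> snd c ` fst c" and a: "a \<in> model M" and b: "b \<in> model M"
  shows "dir_deriv (coef1 M \<theta> c b) a y = dV (model M) (covec M \<theta> c) y a \<bullet> b"
proof -
  note S = smooth_fn_covec[OF c]
  note I = dV_inner_const[OF S y, of b]
  have eq: "covec M \<theta> c z \<bullet> b = coef1 M \<theta> c b z" if "z \<in> snd c ` fst c" for z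
    using covec_inner[OF c that b] coef1_cv[OF M c that b] by simp
  have "smooth_fn (model M) (snd c ` fst c) (coef1 M \<theta> c b)"
    by (rule smooth_fn_congr[OF I(1) eq])
  from dir_deriv_eq[OF this y a] show ?thesis
    using smooth_fn.dV_cong[OF I(1) eq y] I(2) by simp
qed

lemma ext_chart_eq:
  assumes c: "c \<in> charts M" "p \<in> fst c" and u: "u \<in> tangent_space M p" and v: "v \<in> tangent_space M p"
  shows "ext_chart M \<theta> c p u v =
    dV (model M) (covec M \<theta> c) (snd c p) (chart_diff (snd c) u) \<bullet> chart_diff (snd c) v -
    dV (model M) (covec M \<theta> c) (snd c p) (chart_diff (snd c) v) \<bullet> chart_diff (snd c) u"
proof -
  have "snd c p \<in> snd c ` fst c" using c(2) by blast
  then show ?thesis unfolding ext_chart_def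
    using dir_deriv_coef1[OF c(1)] tangent_cv(1)[OF M c] u v by simp
qed

end

definition pullform ::
    "('a, 'e::euclidean_space) mfd \<Rightarrow> ('b, 'f::euclidean_space) mfd \<Rightarrow> ('a \<Rightarrow> 'b) \<Rightarrow> 'b form1 \<Rightarrow> 'a form1" where
  "pullform A B F \<theta> p u = \<theta> (F p) (push A B F p u)"

lemma pullform_coef:
  assumes A: "atlas A" and B: "atlas B" and th: "one_form B \<theta>" and r: "local_rep A B F p c d S"
    and agree: "\<And>x w. x \<in> points A \<Longrightarrow> w \<in> tangent_space A x \<Longrightarrow> \<theta>' x w = pullform A B F \<theta> x w"
    and y: "y \<in> S" and a: "a \<in> model A"
  shows "coef1 A \<theta>' c a y =
    covec B \<theta> d (snd d (F (ic c y))) \<bullet> dV (model A) (\<lambda>y. snd d (F (ic c y))) y a"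
proof -
  note s = r[unfolded local_rep_def]
  let ?f = "\<lambda>y. snd d (F (ic c y))"
  have c: "c \<in> charts A" and d: "d \<in> charts B" and yc: "y \<in> snd c ` fst c" using s y by blast+
  have p: "ic c y \<in> fst c" by (rule ic_in[OF yc])
  have yy: "snd c (ic c y) = y" by (rule chart_of_ic[OF yc])
  have Fd: "F (ic c y) \<in> fst d" using s y by blast
  have w: "cv A c y a \<in> tangent_space A (ic c y)" using cv_tangent[OF A c p a] by (simp add: yy)
  have dv: "dV (model A) ?f y a \<in> model B"
    by (rule dV_in[OF smooth_fn_rep[OF A r] atlas_model[OF B] _ y]) (use s chart_in_model[OF B d] in blast)
  have "coef1 A \<theta>' c a y = \<theta> (F (ic c y)) (push A B F (ic c y) (cv A c y a))"
    using coef1_cv[OF A c yc a] agree[OF chart_points[OF A c p] w] by (simp add: pullform_def)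
  also have "push A B F (ic c y) (cv A c y a) = cv B d (?f y) (dV (model A) ?f y a)"
    using push_cv[OF A B local_rep_point[OF A r y] a] by (simp add: yy)
  also have "\<theta> (F (ic c y)) \<dots> = covec B \<theta> d (?f y) \<bullet> dV (model A) ?f y a"
    using covec_inner[OF B th d _ dv, of "?f y"] Fd chart_ic[OF B d Fd] by simp
  finally show ?thesis .
qed

lemma pullform_smooth:
  assumes A: "atlas A" and B: "atlas B" and th: "one_form B \<theta>" and r: "local_rep A B F p c d S"
    and a: "a \<in> model A"
  shows "smooth_fn (model A) S
    (\<lambda>y. covec B \<theta> d (snd d (F (ic c y))) \<bullet> dV (model A) (\<lambda>y. snd d (F (ic c y))) y a)"
proof -
  interpret f: smooth_fn "model A" S "\<lambda>y. snd d (F (ic c y))" by (rule smooth_fn_rep[OF A r])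
  have d: "d \<in> charts B" using r unfolding local_rep_def by blast
  interpret g: smooth_fn "model B" "snd d ` fst d" "covec B \<theta> d" by (rule smooth_fn_covec[OF B th d])
  have "smooth_on S (\<lambda>y. covec B \<theta> d (snd d (F (ic c y))))"
    by (rule smooth_on_compose[OF f.f g.f]) (use r in \<open>auto simp: local_rep_def\<close>)
  then show ?thesis using f.V f.S f.dV_smooth smooth_on_inner unfolding smooth_fn_def by blast
qed

lemma one_form_pullform:
  assumes A: "atlas A" and B: "atlas B" and th: "one_form B \<theta>" and F: "\<And>p. p \<in> points A \<Longrightarrow> smooth_at A B F p"
  shows "one_form A (pullform A B F \<theta>)"
  unfolding one_form_def
proof (intro conjI ballI allI)
  fix p u v and x y :: real assume p: "p \<in> points A" and u: "u \<in> tangent_space A p" and v: "v \<in> tangent_space A p"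
  show "pullform A B F \<theta> p (lincomb x u y v) = x * pullform A B F \<theta> p u + y * pullform A B F \<theta> p v"
    unfolding pullform_def push_lincomb
    by (rule one_formD[OF th push_tangent[OF A B F[OF p] u] push_tangent[OF A B F[OF p] v]
          smooth_at_points(2)[OF A B F[OF p]]])
next
  fix c a assume c: "c \<in> charts A" and a: "a \<in> model A"
  show "smooth_on (snd c ` fst c) (coef1 A (pullform A B F \<theta>) c a)"
  proof (rule smooth_on_local)
    fix y assume "y \<in> snd c ` fst c"
    then obtain p where p: "p \<in> fst c" "y = snd c p" by blast
    have Fp: "smooth_at A B F p" by (rule F[OF chart_points[OF A c p(1)]])
    obtain d where d: "d \<in> charts B" "F p \<in> fst d" using atlas_cover[OF B smooth_at_points(2)[OF A B Fp]] by blast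
    obtain S where r: "local_rep A B F p c d S" using smooth_at_rep[OF A B Fp c p(1) d] by blast
    have "smooth_on S (coef1 A (pullform A B F \<theta>) c a)"
      using pullform_smooth[OF A B th r a] pullform_coef[OF A B th r refl _ a]
      unfolding smooth_fn_def by (auto intro: smooth_on_cong)
    moreover have "opn (snd c ` fst c) S"
      using r openin_subset_trans[OF _ _ openin_subset_subspace[OF chart_open[OF A c]]] unfolding local_rep_def by blast
    ultimately show "\<exists>S. opn (snd c ` fst c) S \<and> y \<in> S \<and> smooth_on S (coef1 A (pullform A B F \<theta>) c a)"
      using r p(2) unfolding local_rep_def by blast
  qed
qed

text \<open>Naturality of the exterior derivative, in fixed charts. The product rule yields a term
  with the second derivative of the coordinate map, which is symmetric and cancels under
  antisymmetrisation, and a term that the chain rule identifies with the derivative of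
  \<open>covec\<close> on the target. The assumption \<open>agree\<close> compares the forms on
  tangent vectors only, so different descriptions of one form can be exchanged.\<close>

lemma ext_chart_pull:
  assumes A: "atlas A" and B: "atlas B" and th: "one_form B \<theta>" and r: "local_rep A B F p c d S"
    and agree: "\<And>x w. x \<in> points A \<Longrightarrow> w \<in> tangent_space A x \<Longrightarrow> \<theta>' x w = pullform A B F \<theta> x w"
    and u: "u \<in> tangent_space A p" and v: "v \<in> tangent_space A p"
  shows "ext_chart A \<theta>' c p u v = ext_chart B \<theta> d (F p) (push A B F p u) (push A B F p v)"
proof -
  note s = r[unfolded local_rep_def]
  let ?f = "\<lambda>y. snd d (F (ic c y))" and ?y = "snd c p" and ?z = "snd d (F p)"
  have c: "c \<in> charts A" "p \<in> fst c" and d: "d \<in> charts B" and y: "?y \<in> S" using s by blast+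
  have icp: "ic c ?y = p" by (rule chart_ic[OF A c])
  have Fd: "F p \<in> fst d" using s y icp by force
  interpret f: smooth_fn "model A" S ?f by (rule smooth_fn_rep[OF A r])
  interpret g: smooth_fn "model B" "snd d ` fst d" "covec B \<theta> d" by (rule smooth_fn_covec[OF B th d])
  have fS: "?f ` S \<subseteq> snd d ` fst d" using s by blast
  have Fp: "smooth_at A B F p" by (rule local_rep_smooth_at[OF r])
  have coord: "chart_diff (snd d) (push A B F p w) = dV (model A) ?f ?y (chart_diff (snd c) w)"
    "dV (model A) ?f ?y (chart_diff (snd c) w) \<in> model B"
    if w: "w \<in> tangent_space A p" for w
  proof -
    note t = tangent_cv[OF A c w]
    show dv: "dV (model A) ?f ?y (chart_diff (snd c) w) \<in> model B"
      by (rule dV_in[OF f.smooth_fn_axioms atlas_model[OF B] _ y]) (use s chart_in_model[OF B d] in blast)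
    show "chart_diff (snd d) (push A B F p w) = dV (model A) ?f ?y (chart_diff (snd c) w)"
      using push_cv[OF A B r t(1)] t(2) chart_diff_cv[OF B d Fd dv] by simp
  qed
  have main: "dir_deriv (coef1 A \<theta>' c b) a ?y =
      covec B \<theta> d ?z \<bullet> dV (model A) (\<lambda>y. dV (model A) ?f y b) ?y a +
      dV (model B) (covec B \<theta> d) ?z (dV (model A) ?f ?y a) \<bullet> dV (model A) ?f ?y b"
    if a: "a \<in> model A" and b: "b \<in> model A" for a b
  proof -
    let ?h = "\<lambda>y. covec B \<theta> d (?f y) \<bullet> dV (model A) ?f y b"
    have h: "smooth_fn (model A) S ?h" by (rule pullform_smooth[OF A B th r b])
    have eq: "?h y = coef1 A \<theta>' c b y" if "y \<in> S" for y
      using pullform_coef[OF A B th r agree that b] by simp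
    have "dir_deriv (coef1 A \<theta>' c b) a ?y = dV (model A) ?h ?y a"
      using dir_deriv_eq[OF smooth_fn_congr[OF h eq] y a] smooth_fn.dV_cong[OF h eq y] by simp
    also have "\<dots> = covec B \<theta> d (?f ?y) \<bullet> dV (model A) (\<lambda>y. dV (model A) ?f y b) ?y a +
      dV (model A) (\<lambda>y. covec B \<theta> d (?f y)) ?y a \<bullet> dV (model A) ?f ?y b"
    proof (rule dV_bilinear[OF bounded_bilinear_inner _ _ y])
      show "smooth_fn (model A) S (\<lambda>y. covec B \<theta> d (?f y))"
        using f.V f.S smooth_on_compose[OF f.f g.f fS] by unfold_locales
      show "smooth_fn (model A) S (\<lambda>y. dV (model A) ?f y b)"
        using f.V f.S f.dV_smooth by unfold_locales
    qed
    also have "dV (model A) (\<lambda>y. covec B \<theta> d (?f y)) ?y a = dV (model B) (covec B \<theta> d) (?f ?y) (dV (model A) ?f ?y a)"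
      by (rule dV_chain[OF f.smooth_fn_axioms g.smooth_fn_axioms fS y])
    finally show ?thesis unfolding icp .
  qed
  note tu = tangent_cv(1)[OF A c u] and tv = tangent_cv(1)[OF A c v]
  show ?thesis
    unfolding ext_chart_eq[OF B th d Fd push_tangent[OF A B Fp u] push_tangent[OF A B Fp v]]
    unfolding ext_chart_def main[OF tu tv] main[OF tv tu] coord(1)[OF u] coord(1)[OF v]
    using dV_symmetric[OF f.smooth_fn_axioms y tu tv] by simp
qed

lemma ext_deriv1_ext_chart:
  assumes M: "atlas M" and p: "p \<in> points M"
  shows "\<exists>c\<in>charts M. p \<in> fst c \<and> ext_deriv1 M \<theta> p u v = ext_chart M \<theta> c p u v"
proof -
  have "\<exists>c. c \<in> charts M \<and> p \<in> fst c" using atlas_cover[OF M p] by blast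
  from someI_ex[OF this] show ?thesis unfolding ext_deriv1_def ext_chart_def Let_def by blast
qed

lemma ext_deriv1_pull:
  assumes A: "atlas A" and B: "atlas B" and th: "one_form B \<theta>" and F: "smooth_at A B F p"
    and agree: "\<And>x w. x \<in> points A \<Longrightarrow> w \<in> tangent_space A x \<Longrightarrow> \<theta>' x w = pullform A B F \<theta> x w"
    and u: "u \<in> tangent_space A p" and v: "v \<in> tangent_space A p"
  shows "ext_deriv1 A \<theta>' p u v = ext_deriv1 B \<theta> (F p) (push A B F p u) (push A B F p v)"
proof -
  obtain c where c: "c \<in> charts A" "p \<in> fst c" "ext_deriv1 A \<theta>' p u v = ext_chart A \<theta>' c p u v"
    using ext_deriv1_ext_chart[OF A smooth_at_points(1)[OF A B F]] by blast
  obtain d where d: "d \<in> charts B" "F p \<in> fst d" "ext_deriv1 B \<theta> (F p) (push A B F p u) (push A B F p v) =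
      ext_chart B \<theta> d (F p) (push A B F p u) (push A B F p v)"
    using ext_deriv1_ext_chart[OF B smooth_at_points(2)[OF A B F]] by blast
  obtain S where r: "local_rep A B F p c d S" using smooth_at_rep[OF A B F c(1,2) d(1,2)] by blast
  show ?thesis unfolding c(3) d(3) by (rule ext_chart_pull[OF A B th r agree u v])
qed

text \<open>Independence of the chart is naturality under the identity map, expressed in two
  different charts.\<close>

lemma ext_deriv1_chart:
  assumes M: "atlas M" and th: "one_form M \<theta>" and c: "c \<in> charts M" "p \<in> fst c"
    and u: "u \<in> tangent_space M p" and v: "v \<in> tangent_space M p"
  shows "ext_deriv1 M \<theta> p u v = ext_chart M \<theta> c p u v"
proof -
  note p = chart_points[OF M c]
  obtain d where d: "d \<in> charts M" "p \<in> fst d" "ext_deriv1 M \<theta> p u v = ext_chart M \<theta> d p u v"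
    using ext_deriv1_ext_chart[OF M p] by blast
  obtain S where r: "local_rep M M (\<lambda>x. x) p d c S"
    using smooth_at_rep[OF M M smooth_at_id[OF M p] d(1,2) c] by blast
  show ?thesis unfolding d(3)
    using ext_chart_pull[OF M M th r _ u v, of \<theta>] push_id[OF M] u v by (simp add: pullform_def)
qed

context
  fixes M :: "('a, 'e::euclidean_space) mfd" and \<theta> :: "'a form1" and \<omega> :: "'a form2"
  assumes M: "atlas M" and th: "one_form M \<theta>" and om: "\<omega> = (\<lambda>p u v. - ext_deriv1 M \<theta> p u v)"
begin

lemma exact_form_chart:
  assumes c: "c \<in> charts M" "p \<in> fst c" and u: "u \<in> tangent_space M p" and v: "v \<in> tangent_space M p"
  shows "\<omega> p u v =
    dV (model M) (covec M \<theta> c) (snd c p) (chart_diff (snd c) v) \<bullet> chart_diff (snd c) u -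
    dV (model M) (covec M \<theta> c) (snd c p) (chart_diff (snd c) u) \<bullet> chart_diff (snd c) v"
  unfolding om ext_deriv1_chart[OF M th c u v] ext_chart_eq[OF M th c u v] by simp

lemma exact_form_coef:
  assumes c: "c \<in> charts M" and y: "y \<in> snd c ` fst c" and a: "a \<in> model M" and b: "b \<in> model M"
  shows "coef2 M \<omega> c a b y = dV (model M) (covec M \<theta> c) y b \<bullet> a - dV (model M) (covec M \<theta> c) y a \<bullet> b"
proof -
  have p: "ic c y \<in> fst c" by (rule ic_in[OF y])
  have yy: "snd c (ic c y) = y" by (rule chart_of_ic[OF y])
  note t = cv_tangent[OF M c p, unfolded yy]
  show ?thesis
    unfolding coef2_def ic_def[symmetric] coord_vec_cv[OF M c y a] coord_vec_cv[OF M c y b]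
      exact_form_chart[OF c p t[OF a] t[OF b]]
    using chart_diff_cv[OF M c p a] chart_diff_cv[OF M c p b] by (simp add: yy)
qed

lemma two_form_exact: "two_form M \<omega>"
  unfolding two_form_def
proof (intro conjI ballI allI)
  fix p u v assume p: "p \<in> points M" and u: "u \<in> tangent_space M p" and v: "v \<in> tangent_space M p"
  obtain c where c: "c \<in> charts M" "p \<in> fst c" using atlas_cover[OF M p] by blast
  interpret smooth_fn "model M" "snd c ` fst c" "covec M \<theta> c" by (rule smooth_fn_covec[OF M th c(1)])
  interpret l: linear "dV (model M) (covec M \<theta> c) (snd c p)" by (rule linear_dV) (use c in blast)
  show "\<omega> p u v = - \<omega> p v u"
    unfolding exact_form_chart[OF c u v] exact_form_chart[OF c v u] by simp
  fix w and x y :: real assume w: "w \<in> tangent_space M p"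
  show "\<omega> p (lincomb x u y v) w = x * \<omega> p u w + y * \<omega> p v w"
    unfolding exact_form_chart[OF c tangent_lincomb[OF M u v] w] exact_form_chart[OF c u w] exact_form_chart[OF c v w]
      chart_diff_lincomb
    by (simp add: l.add l.scale inner_add_left inner_add_right algebra_simps)
next
  fix c a b assume c: "c \<in> charts M" and a: "a \<in> model M" and b: "b \<in> model M"
  interpret smooth_fn "model M" "snd c ` fst c" "covec M \<theta> c" by (rule smooth_fn_covec[OF M th c(1)])
  have "smooth_on (snd c ` fst c) (\<lambda>y. dV (model M) (covec M \<theta> c) y b \<bullet> a + dV (model M) (covec M \<theta> c) y a \<bullet> (-b))"
    by (intro smooth_on_add smooth_on_inner dV_smooth smooth_on_const)
  then show "smooth_on (snd c ` fst c) (coef2 M \<omega> c a b)"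
    by (rule smooth_on_cong) (simp add: exact_form_coef[OF c _ a b])
qed

text \<open>The coefficients of the form are differences of first derivatives of
  \<open>covec\<close>. In the cyclic sum of their derivatives, second derivatives of
  \<open>covec\<close> cancel in pairs by symmetry.\<close>

lemma closed_form2_exact: "closed_form2 M \<omega>"
  unfolding closed_form2_def
proof (intro ballI)
  fix k y a b c assume k: "k \<in> charts M" and y: "y \<in> snd k ` fst k" and a: "a \<in> model M" and b: "b \<in> model M"
    and c: "c \<in> model M"
  interpret smooth_fn "model M" "snd k ` fst k" "covec M \<theta> k" by (rule smooth_fn_covec[OF M th k])
  let ?D = "\<lambda>u v. dV (model M) (\<lambda>y. dV (model M) (covec M \<theta> k) y u) y v"
  have "dir_deriv (coef2 M \<omega> k u v) w y = ?D v w \<bullet> u - ?D u w \<bullet> v"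
    if u: "u \<in> model M" and v: "v \<in> model M" and w: "w \<in> model M" for u v w
  proof -
    let ?h = "\<lambda>y. dV (model M) (covec M \<theta> k) y v \<bullet> u + dV (model M) (covec M \<theta> k) y u \<bullet> (- v)"
    have s: "smooth_fn (model M) (snd k ` fst k) (\<lambda>y. dV (model M) (covec M \<theta> k) y z)" for z
      using V S dV_smooth by unfold_locales
    note I = dV_inner_const[OF s y]
    have h: "smooth_fn (model M) (snd k ` fst k) ?h"
      unfolding smooth_fn_def by (intro conjI V S smooth_on_add smooth_fn.f[OF I(1)])
    have eq: "?h z = coef2 M \<omega> k u v z" if "z \<in> snd k ` fst k" for z
      using exact_form_coef[OF k that u v] by simp
    have "dir_deriv (coef2 M \<omega> k u v) w y = dV (model M) ?h y w"
      using dir_deriv_eq[OF smooth_fn_congr[OF h eq] y w] smooth_fn.dV_cong[OF h eq y] by simp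
    also have "\<dots> = ?D v w \<bullet> u + ?D u w \<bullet> (- v)"
      unfolding dV_add[OF I(1) I(1) y] I(2) ..
    finally show ?thesis by simp
  qed
  then show "dir_deriv (coef2 M \<omega> k b c) a y + dir_deriv (coef2 M \<omega> k c a) b y + dir_deriv (coef2 M \<omega> k a b) c y = 0"
    using a b c dV_symmetric[OF smooth_fn_axioms y] by simp
qed

end

text \<open>States smoothness of the coefficients pointwise and through velocities of coordinate
  lines, which is how results on smooth families of curves deliver it.\<close>

lemma one_formI:
  assumes M: "atlas M"
    and lin: "\<And>p u v a b. p \<in> points M \<Longrightarrow> u \<in> tangent_space M p \<Longrightarrow> v \<in> tangent_space M p \<Longrightarrow>
      \<theta> p (lincomb a u b v) = a * \<theta> p u + b * \<theta> p v"
    and sm: "\<And>c y a. c \<in> charts M \<Longrightarrow> y \<in> snd c ` fst c \<Longrightarrow> a \<in> model M \<Longrightarrow>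
      smooth_at (flat (model M) (snd c ` fst c)) EU (\<lambda>y. \<theta> (ic c y) (velocity M (\<lambda>t. ic c (y + t *\<^sub>R a)))) y"
  shows "one_form M \<theta>"
  unfolding one_form_def
proof (intro conjI ballI allI)
  fix c a assume c: "c \<in> charts M" and a: "a \<in> model M"
  let ?S = "snd c ` fst c"
  show "smooth_on ?S (coef1 M \<theta> c a)"
  proof (rule smooth_on_local)
    fix y assume y: "y \<in> ?S"
    obtain T where T: "opn (model M) T" "y \<in> T" "T \<subseteq> ?S" "smooth_on T (\<lambda>y. \<theta> (ic c y) (velocity M (\<lambda>t. ic c (y + t *\<^sub>R a))))"
      using smooth_at_flatD[OF atlas_model[OF M] chart_open[OF M c] atlas_EU sm[OF c y a], of "(UNIV, \<lambda>x. x)"] by auto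
    have "smooth_on T (coef1 M \<theta> c a)"
      by (rule smooth_on_cong[OF T(4)]) (simp add: coef1_def coord_vec_def ic_def)
    moreover have "opn ?S T" using openin_subset_trans[OF T(1,3) openin_subset_subspace[OF chart_open[OF M c]]] .
    ultimately show "\<exists>T. opn ?S T \<and> y \<in> T \<and> smooth_on T (coef1 M \<theta> c a)" using T(2) by blast
  qed
qed (rule lin)

section \<open>Quotients, transport of structure and submanifolds\<close>

text \<open>The submersion theorem for manifolds: surjectivity on tangent spaces means surjectivity
  of the derivative of the coordinate expression, and the section found in coordinates is moved back
  through both charts.\<close>

lemma smooth_right_inverse_at:
  assumes P: "atlas P" and Q: "atlas Q" and pi: "smooth_at P Q \<pi> p"
    and onto: "tangent_space Q (\<pi> p) \<subseteq> push P Q \<pi> p ` tangent_space P p"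
  obtains V s where "openin (mtop Q) V" "\<pi> p \<in> V" "s (\<pi> p) = p" "\<And>q. q \<in> V \<Longrightarrow> smooth_at Q P s q"
    "\<And>q. q \<in> V \<Longrightarrow> \<pi> (s q) = q"
proof -
  obtain c where c: "c \<in> charts P" "p \<in> fst c" using atlas_cover[OF P smooth_at_points(1)[OF P Q pi]] by blast
  obtain d where d: "d \<in> charts Q" "\<pi> p \<in> fst d" using atlas_cover[OF Q smooth_at_points(2)[OF P Q pi]] by blast
  obtain S where r: "local_rep P Q \<pi> p c d S" using smooth_at_rep[OF P Q pi c d] by blast
  note s = r[unfolded local_rep_def]
  let ?f = "\<lambda>y. snd d (\<pi> (ic c y))"
  have icp: "ic c (snd c p) = p" by (rule chart_ic[OF P c])
  have y: "snd c p \<in> S" using s by blast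
  interpret smooth_fn "model P" S ?f by (rule smooth_fn_rep[OF P r])
  have fS: "?f ` S \<subseteq> model Q" using s chart_in_model[OF Q d(1)] by blast
  have "model Q \<subseteq> dV (model P) ?f (snd c p) ` model P"
  proof
    fix b assume b: "b \<in> model Q"
    then obtain u where u: "u \<in> tangent_space P p" "push P Q \<pi> p u = cv Q d (snd d (\<pi> p)) b"
      using onto cv_tangent[OF Q d b] by force
    note t = tangent_cv[OF P c u(1)]
    have "dV (model P) ?f (snd c p) (chart_diff (snd c) u) \<in> model Q"
      by (rule dV_in[OF smooth_fn_axioms atlas_model[OF Q] fS y])
    then have "b = dV (model P) ?f (snd c p) (chart_diff (snd c) u)"
      using push_cv[OF P Q r t(1)] t(2) u(2) chart_diff_cv[OF Q d b] chart_diff_cv[OF Q d] by metis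
    then show "b \<in> dV (model P) ?f (snd c p) ` model P" using t(1) by blast
  qed
  from smooth_right_inverse[OF smooth_fn_axioms atlas_model[OF Q] fS y this]
  obtain T s0 where T: "opn (model Q) T" "?f (snd c p) \<in> T" "smooth_on T s0" "s0 ` T \<subseteq> S"
    "s0 (?f (snd c p)) = snd c p" "\<And>z. z \<in> T \<Longrightarrow> ?f (s0 z) = z" by blast
  define T' where "T' = T \<inter> snd d ` fst d"
  have T': "opn (model Q) T'" unfolding T'_def by (rule openin_Int[OF T(1) chart_open[OF Q d(1)]])
  have T'd: "T' \<subseteq> snd d ` fst d" by (simp add: T'_def)
  have in_c: "s0 z \<in> snd c ` fst c" if "z \<in> T'" for z using that T(4) s by (auto simp: T'_def)
  define sec where "sec q = ic c (s0 (snd d q))" for q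
  have dT: "q \<in> fst d" "snd d q \<in> T'" if q: "q \<in> ic d ` T'" for q
  proof -
    obtain z where z: "z \<in> T'" "q = ic d z" using q by blast
    have "z \<in> snd d ` fst d" using z(1) T'd by blast
    then show "q \<in> fst d" "snd d q \<in> T'" using ic_in[of z d] chart_of_ic[of z d] z by simp_all
  qed
  have PT: "atlas (flat (model Q) T')" by (rule atlas_flat[OF atlas_model[OF Q] T'])
  have Pc: "atlas (flat (model P) (snd c ` fst c))" by (rule atlas_flat[OF V chart_open[OF P c(1)]])
  show ?thesis
  proof (rule that[of "ic d ` T'" sec])
    show op: "openin (mtop Q) (ic d ` T')" by (rule openin_ic[OF Q d(1) T' T'd])
    have "snd d (\<pi> p) \<in> T'" using T(2) d(2) by (simp add: T'_def icp)
    then show "\<pi> p \<in> ic d ` T'" using chart_ic[OF Q d] by (intro image_eqI[of _ _ "snd d (\<pi> p)"]) simp_all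
    show "sec (\<pi> p) = p" using T(5) by (simp add: sec_def icp)
    fix q assume q: "q \<in> ic d ` T'"
    show "smooth_at Q P sec q"
      unfolding sec_def
    proof (rule smooth_at_compose[OF Q PT P, where F = "snd d" and H = "\<lambda>z. ic c (s0 z)"])
      show "smooth_at Q (flat (model Q) T') (snd d) q"
        by (rule smooth_at_flat_cod[OF Q smooth_at_chart[OF Q d(1) dT(1)[OF q]] op q]) (use dT in blast)
      show "smooth_at (flat (model Q) T') P (\<lambda>z. ic c (s0 z)) (snd d q)"
      proof (rule smooth_at_compose[OF PT Pc P])
        show "smooth_at (flat (model Q) T') (flat (model P) (snd c ` fst c)) s0 (snd d q)"
          by (rule smooth_at_flat_flatI[OF T' dT(2)[OF q] subset_refl _ smooth_on_subset[OF T(3)]])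
            (use in_c in \<open>auto simp: T'_def\<close>)
        show "smooth_at (flat (model P) (snd c ` fst c)) P (ic c) (s0 (snd d q))"
          by (rule smooth_at_ic[OF P c(1) in_c[OF dT(2)[OF q]]])
      qed
    qed
    have z: "snd d q \<in> T" using dT(2)[OF q] by (simp add: T'_def)
    then have "\<pi> (sec q) \<in> fst d" using T(4) s unfolding sec_def by blast
    moreover have "snd d (\<pi> (sec q)) = snd d q" unfolding sec_def by (rule T(6)[OF z])
    ultimately show "\<pi> (sec q) = q" using inj_onD[OF chart_inj[OF Q d(1)]] dT(1)[OF q] by blast
  qed
qed

lemma quotient_manifoldD:
  assumes "atlas P" "quotient_manifold P \<pi> Q"
  shows "manifold Q" "atlas Q" "\<pi> ` points P = points Q" "\<And>p. p \<in> points P \<Longrightarrow> smooth_at P Q \<pi> p"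
    "\<And>p. p \<in> points P \<Longrightarrow> push P Q \<pi> p ` tangent_space P p = tangent_space Q (\<pi> p)"
proof -
  show "manifold Q" "\<pi> ` points P = points Q"
    "\<And>p. p \<in> points P \<Longrightarrow> push P Q \<pi> p ` tangent_space P p = tangent_space Q (\<pi> p)"
    using assms(2) unfolding quotient_manifold_def by blast+
  show "atlas Q" using \<open>manifold Q\<close> manifold_iff by blast
  then show "\<And>p. p \<in> points P \<Longrightarrow> smooth_at P Q \<pi> p"
    using assms(2) smooth_map_iff[OF assms(1)] unfolding quotient_manifold_def by blast
qed

lemma quotient_manifoldI:
  assumes P: "atlas P" and Q: "manifold Q" and im: "\<pi> ` points P = points Q"
    and sm: "\<And>p. p \<in> points P \<Longrightarrow> smooth_at P Q \<pi> p"
    and onto: "\<And>p v. p \<in> points P \<Longrightarrow> v \<in> tangent_space Q (\<pi> p) \<Longrightarrow> v \<in> push P Q \<pi> p ` tangent_space P p"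
  shows "quotient_manifold P \<pi> Q"
proof -
  have Qa: "atlas Q" using Q manifold_iff by blast
  show ?thesis
    unfolding quotient_manifold_def smooth_map_iff[OF P Qa]
    using Q im sm onto push_tangent[OF P Qa sm] by blast
qed

lemma quotient_section:
  assumes P: "atlas P" and q: "quotient_manifold P \<pi> Q" and p: "p \<in> points P"
  obtains V s where "openin (mtop Q) V" "\<pi> p \<in> V" "s (\<pi> p) = p" "\<And>q. q \<in> V \<Longrightarrow> smooth_at Q P s q"
    "\<And>q. q \<in> V \<Longrightarrow> \<pi> (s q) = q"
  using smooth_right_inverse_at[OF P quotient_manifoldD(2)[OF P q] quotient_manifoldD(4)[OF P q p]]
    quotient_manifoldD(5)[OF P q p] by blast

text \<open>Near \<open>\<pi> p\<close>, the map \<open>F\<close> is the composition of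
  \<open>F \<circ> \<pi>\<close> with a local section through \<open>p\<close>.\<close>

lemma quotient_descend:
  assumes P: "atlas P" and N: "atlas N" and q: "quotient_manifold P \<pi> Q" and F: "smooth_at P N (\<lambda>x. F (\<pi> x)) p"
  shows "smooth_at Q N F (\<pi> p)"
proof -
  note Q = quotient_manifoldD(2)[OF P q]
  obtain V s where s: "openin (mtop Q) V" "\<pi> p \<in> V" "s (\<pi> p) = p" "\<And>q. q \<in> V \<Longrightarrow> smooth_at Q P s q"
    "\<And>q. q \<in> V \<Longrightarrow> \<pi> (s q) = q"
    using quotient_section[OF P q smooth_at_points(1)[OF P N F]] by blast
  have "smooth_at Q N (\<lambda>q. F (\<pi> (s q))) (\<pi> p)"
    by (rule smooth_at_compose[OF Q P N s(4)[OF s(2)]]) (simp add: s(3) F)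
  then show ?thesis by (rule smooth_at_cong[OF Q _ s(1,2)]) (simp add: s(5))
qed

lemma quotient_compose:
  assumes P: "atlas P" and q: "quotient_manifold P \<pi> Q" and q': "quotient_manifold Q \<pi>' R"
  shows "quotient_manifold P (\<lambda>x. \<pi>' (\<pi> x)) R"
proof -
  note D = quotient_manifoldD[OF P q]
  note D' = quotient_manifoldD[OF D(2) q']
  have pq: "\<pi> p \<in> points Q" if "p \<in> points P" for p using that D(3) by blast
  have sm: "smooth_at P R (\<lambda>x. \<pi>' (\<pi> x)) p" if "p \<in> points P" for p
    by (rule smooth_at_compose[OF P D(2) D'(2) D(4)[OF that] D'(4)[OF pq[OF that]]])
  show ?thesis
  proof (rule quotient_manifoldI[OF P D'(1) _ sm])
    show "(\<lambda>x. \<pi>' (\<pi> x)) ` points P = points R" using D(3) D'(3) by (metis image_image)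
    fix p v assume p: "p \<in> points P" and v: "v \<in> tangent_space R (\<pi>' (\<pi> p))"
    then obtain w where w: "w \<in> tangent_space Q (\<pi> p)" "v = push Q R \<pi>' (\<pi> p) w" using D'(5)[OF pq] by blast
    then obtain u where u: "u \<in> tangent_space P p" "w = push P Q \<pi> p u" using D(5)[OF p] by blast
    show "v \<in> push P R (\<lambda>x. \<pi>' (\<pi> x)) p ` tangent_space P p"
      using push_push[OF D(2) D'(2), of \<pi>' \<pi> p P u] D'(4)[OF pq[OF p]] u w by auto
  qed
qed

lemma quotient_cong:
  assumes P: "atlas P" and q: "quotient_manifold P \<pi> Q" and eq: "\<And>p. p \<in> points P \<Longrightarrow> \<pi> p = \<pi>' p"
  shows "quotient_manifold P \<pi>' Q"
proof -
  note D = quotient_manifoldD[OF P q]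
  show ?thesis
  proof (rule quotient_manifoldI[OF P D(1)])
    show "\<pi>' ` points P = points Q" using D(3) eq by simp
    show "smooth_at P Q \<pi>' p" if "p \<in> points P" for p
      by (rule smooth_at_cong[OF P D(4)[OF that] openin_points[OF P] that eq])
    fix p v assume p: "p \<in> points P" and v: "v \<in> tangent_space Q (\<pi>' p)"
    then obtain u where "u \<in> tangent_space P p" "v = push P Q \<pi> p u" using D(5)[OF p] eq[OF p] by auto
    then show "v \<in> push P Q \<pi>' p ` tangent_space P p"
      using push_cong[OF P D(2) D(4)[OF p] _ openin_points[OF P] p eq] by blast
  qed
qed

text \<open>In a product chart the coordinate velocity is the pair of the coordinate velocities of
  the components. \<open>key\<close> computes it for both curves in the charts chosen at their
  common base point.\<close>

lemma velocity_prod_eqI: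
  assumes M: "atlas M" and N: "atlas N"
    and g: "smooth_at EU (prod_mfd M N) \<gamma> 0" and g': "smooth_at EU (prod_mfd M N) \<gamma>' (0::real)"
    and eq: "\<gamma> 0 = \<gamma>' 0" "velocity M (\<lambda>t. fst (\<gamma> t)) = velocity M (\<lambda>t. fst (\<gamma>' t))"
      "velocity N (\<lambda>t. snd (\<gamma> t)) = velocity N (\<lambda>t. snd (\<gamma>' t))"
  shows "velocity (prod_mfd M N) \<gamma> = velocity (prod_mfd M N) \<gamma>'"
proof -
  note P = atlas_prod[OF M N]
  have "\<gamma> 0 \<in> points M \<times> points N" using smooth_at_points(2)[OF atlas_EU P g] by (simp add: prod_mfd_simps)
  then have "fst (\<gamma> 0) \<in> points M" "snd (\<gamma> 0) \<in> points N" by auto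
  then obtain c d where c: "c \<in> charts M" "fst (\<gamma> 0) \<in> fst c" and d: "d \<in> charts N" "snd (\<gamma> 0) \<in> fst d"
    using atlas_cover[OF M] atlas_cover[OF N] by blast
  let ?k = "prodc c d"
  have key: "velocity (prod_mfd M N) \<delta> = cv (prod_mfd M N) ?k (snd ?k (\<delta> 0))
      (chart_diff (snd c) (velocity M (\<lambda>t. fst (\<delta> t))), chart_diff (snd d) (velocity N (\<lambda>t. snd (\<delta> t))))"
    if dl: "smooth_at EU (prod_mfd M N) \<delta> (0::real)" and d0: "\<delta> 0 = \<gamma> 0" for \<delta>
  proof -
    have pt: "\<delta> 0 \<in> points M \<times> points N" using smooth_at_points(2)[OF atlas_EU P dl] by (simp add: prod_mfd_simps)
    have f: "smooth_at EU M (\<lambda>t. fst (\<delta> t)) 0"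
      by (rule smooth_at_compose[OF atlas_EU P M dl smooth_at_fst[OF M N pt]])
    have s: "smooth_at EU N (\<lambda>t. snd (\<delta> t)) 0"
      by (rule smooth_at_compose[OF atlas_EU P N dl smooth_at_snd[OF M N pt]])
    have fc: "fst (\<delta> 0) \<in> fst c" and sd: "snd (\<delta> 0) \<in> fst d" using c d d0 by simp_all
    obtain a where a: "a \<in> model M" "((\<lambda>t. snd c (fst (\<delta> t))) has_vector_derivative a) (at 0)"
      "eventually (\<lambda>t. fst (\<delta> t) \<in> fst c) (nhds 0)" using curve_chart[OF M f c(1) fc] by blast
    obtain b where b: "b \<in> model N" "((\<lambda>t. snd d (snd (\<delta> t))) has_vector_derivative b) (at 0)"
      "eventually (\<lambda>t. snd (\<delta> t) \<in> fst d) (nhds 0)" using curve_chart[OF N s d(1) sd] by blast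
    have ev: "eventually (\<lambda>t. \<delta> t \<in> fst ?k) (nhds 0)"
      using eventually_conj[OF a(3) b(3)] by (rule eventually_mono) (auto simp: mem_Times_iff)
    have "((\<lambda>t. (snd c (fst (\<delta> t)), snd d (snd (\<delta> t)))) has_vector_derivative (a, b)) (at 0)"
      by (rule has_vector_derivative_Pair[OF a(2) b(2)])
    then have "((\<lambda>t. snd ?k (\<delta> t)) has_vector_derivative (a, b)) (at 0)"
      by (simp add: map_prod_def case_prod_beta)
    from velocity_cv[OF P prodc_chart[OF M N c(1) d(1)] ev this]
    show ?thesis
      using velocity_cv[OF M c(1) a(3,2)] velocity_cv[OF N d(1) b(3,2)]
        chart_diff_cv[OF M c(1) fc a(1)] chart_diff_cv[OF N d(1) sd b(1)] by simp
  qed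
  show ?thesis unfolding key[OF g refl] key[OF g' eq(1)[symmetric]] eq ..
qed

text \<open>For surjectivity on tangent vectors, the velocities of the two components are lifted
  separately. The pair of lifted curves then has the right image, by
  \<open>velocity_prod_eqI\<close>.\<close>

lemma quotient_prod:
  assumes P: "atlas P" and P': "atlas P'" and q: "quotient_manifold P \<pi> Q" and q': "quotient_manifold P' \<pi>' Q'"
  shows "quotient_manifold (prod_mfd P P') (\<lambda>x. (\<pi> (fst x), \<pi>' (snd x))) (prod_mfd Q Q')"
proof -
  note D = quotient_manifoldD[OF P q] and D' = quotient_manifoldD[OF P' q']
  note PP = atlas_prod[OF P P'] and QQ = atlas_prod[OF D(2) D'(2)]
  let ?p = "\<lambda>x. (\<pi> (fst x), \<pi>' (snd x))"
  have sm: "smooth_at (prod_mfd P P') (prod_mfd Q Q') ?p x" if "x \<in> points (prod_mfd P P')" for x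
  proof -
    have x: "x \<in> points P \<times> points P'" using that by (simp add: prod_mfd_simps)
    then have x': "fst x \<in> points P" "snd x \<in> points P'" by auto
    show ?thesis
      by (intro smooth_at_Pair[OF D(2) D'(2) PP] smooth_at_compose[OF PP P D(2) smooth_at_fst[OF P P' x] D(4)[OF x'(1)]]
          smooth_at_compose[OF PP P' D'(2) smooth_at_snd[OF P P' x] D'(4)[OF x'(2)]])
  qed
  show ?thesis
  proof (rule quotient_manifoldI[OF PP manifold_prod[OF D(1) D'(1)] _ sm])
    show "?p ` points (prod_mfd P P') = points (prod_mfd Q Q')"
      unfolding prod_mfd_simps D(3)[symmetric] D'(3)[symmetric] by force
    fix x v assume x: "x \<in> points (prod_mfd P P')" and v: "v \<in> tangent_space (prod_mfd Q Q') (?p x)"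
    obtain \<delta> :: "real \<Rightarrow> _" where dl: "smooth_at EU (prod_mfd Q Q') \<delta> 0" "\<delta> 0 = ?p x" "v = velocity (prod_mfd Q Q') \<delta>"
      by (rule tangentE[OF QQ v])
    have x': "fst x \<in> points P" "snd x \<in> points P'" using x by (auto simp: prod_mfd_simps)
    have pt: "\<delta> 0 \<in> points Q \<times> points Q'" using smooth_at_points(2)[OF atlas_EU QQ dl(1)] by (simp add: prod_mfd_simps)
    have "velocity Q (\<lambda>t. fst (\<delta> t)) \<in> tangent_space Q (\<pi> (fst x))"
      using velocity_in_tangent[OF D(2) smooth_at_compose[OF atlas_EU QQ D(2) dl(1) smooth_at_fst[OF D(2) D'(2) pt]]] dl(2) by simp
    then obtain u where u: "u \<in> tangent_space P (fst x)" "velocity Q (\<lambda>t. fst (\<delta> t)) = push P Q \<pi> (fst x) u"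
      using D(5)[OF x'(1)] by blast
    have "velocity Q' (\<lambda>t. snd (\<delta> t)) \<in> tangent_space Q' (\<pi>' (snd x))"
      using velocity_in_tangent[OF D'(2) smooth_at_compose[OF atlas_EU QQ D'(2) dl(1) smooth_at_snd[OF D(2) D'(2) pt]]] dl(2) by simp
    then obtain w where w: "w \<in> tangent_space P' (snd x)" "velocity Q' (\<lambda>t. snd (\<delta> t)) = push P' Q' \<pi>' (snd x) w"
      using D'(5)[OF x'(2)] by blast
    obtain g :: "real \<Rightarrow> _" where g: "smooth_at EU P g 0" "g 0 = fst x" "u = velocity P g" by (rule tangentE[OF P u(1)])
    obtain h :: "real \<Rightarrow> _" where h: "smooth_at EU P' h 0" "h 0 = snd x" "w = velocity P' h" by (rule tangentE[OF P' w(1)])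
    have gh: "smooth_at EU (prod_mfd P P') (\<lambda>t. (g t, h t)) 0" by (rule smooth_at_Pair[OF P P' atlas_EU g(1) h(1)])
    have smx: "smooth_at (prod_mfd P P') (prod_mfd Q Q') ?p ((\<lambda>t. (g t, h t)) 0)" using sm[OF x] by (simp add: g h)
    have pgh: "smooth_at EU (prod_mfd Q Q') (\<lambda>t. ?p (g t, h t)) 0"
      by (rule smooth_at_compose[OF atlas_EU PP QQ gh]) (use smx in simp)
    have "push (prod_mfd P P') (prod_mfd Q Q') ?p x (velocity (prod_mfd P P') (\<lambda>t. (g t, h t))) =
        velocity (prod_mfd Q Q') (\<lambda>t. ?p (g t, h t))"
      using push_velocity[OF PP QQ, of ?p "\<lambda>t. (g t, h t)"] smx by (simp add: g h)
    also have "\<dots> = v" unfolding dl(3)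
    proof (rule velocity_prod_eqI[OF D(2) D'(2) pgh dl(1)])
      show "?p (g 0, h 0) = \<delta> 0" by (simp add: g h dl)
      show "velocity Q (\<lambda>t. fst (?p (g t, h t))) = velocity Q (\<lambda>t. fst (\<delta> t))"
        using push_velocity[OF P D(2), of \<pi> g] D(4)[OF x'(1)] u(2) by (simp add: g)
      show "velocity Q' (\<lambda>t. snd (?p (g t, h t))) = velocity Q' (\<lambda>t. snd (\<delta> t))"
        using push_velocity[OF P' D'(2), of \<pi>' h] D'(4)[OF x'(2)] w(2) by (simp add: h)
    qed
    finally have e: "push (prod_mfd P P') (prod_mfd Q Q') ?p x (velocity (prod_mfd P P') (\<lambda>t. (g t, h t))) = v" .
    have "velocity (prod_mfd P P') (\<lambda>t. (g t, h t)) \<in> tangent_space (prod_mfd P P') x"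
      using velocity_in_tangent[OF PP gh] g(2) h(2) by simp
    then show "v \<in> push (prod_mfd P P') (prod_mfd Q Q') ?p x ` tangent_space (prod_mfd P P') x"
      unfolding e[symmetric] by (rule imageI)
  qed
qed

text \<open>Besides the points, the model space is moved, by \<open>T\<close>, into another type.
  Thus spaces whose dimension is known only through a subspace can be modelled on types fixed in
  advance.\<close>

definition transport :: "('a \<Rightarrow> 'b) \<Rightarrow> ('e \<Rightarrow> 'f) \<Rightarrow> ('a, 'e) mfd \<Rightarrow> ('b, 'f) mfd" where
  "transport \<beta> T M = \<lparr>points = \<beta> ` points M, model = T ` model M,
     charts = (\<lambda>c. (\<beta> ` fst c, \<lambda>x. T (snd c (inv_into (points M) \<beta> x)))) ` charts M\<rparr>"

locale transported =
  fixes M :: "('a, 'e::euclidean_space) mfd" and \<beta> :: "'a \<Rightarrow> 'b" and T :: "'e \<Rightarrow> 'f::euclidean_space"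
  assumes M: "manifold M" and inj: "inj_on \<beta> (points M)" and T: "linear T" and injT: "inj_on T (model M)"
begin

abbreviation "N \<equiv> transport \<beta> T M"
abbreviation "\<beta>' \<equiv> inv_into (points M) \<beta>"

definition tc :: "('a, 'e) chart \<Rightarrow> ('b, 'f) chart" where
  "tc c = (\<beta> ` fst c, \<lambda>x. T (snd c (\<beta>' x)))"

lemma Ma: "atlas M" using M manifold_iff by blast

lemma N_simps: "points N = \<beta> ` points M" "model N = T ` model M" "charts N = tc ` charts M"
  unfolding transport_def tc_def by simp_all

lemma inv_b: "p \<in> points M \<Longrightarrow> \<beta>' (\<beta> p) = p"
  using inj by (rule inv_into_f_f)

lemma chart_inv_b: "c \<in> charts M \<Longrightarrow> p \<in> fst c \<Longrightarrow> \<beta>' (\<beta> p) = p"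
  using inv_b chart_points[OF Ma] by blast

lemma tc_image:
  assumes c: "c \<in> charts M" and U: "U \<subseteq> fst c"
  shows "snd (tc c) ` (\<beta> ` U) = T ` snd c ` U"
  unfolding image_image tc_def by (intro image_cong refl) (use chart_inv_b[OF c] U in auto)

text \<open>\<open>T\<close> is injective on the model space only. A linear left inverse on that
  space presents the image as a preimage, which is open by continuity.\<close>

lemma image_open: "opn (model M) S \<Longrightarrow> opn (T ` model M) (T ` S)"
proof -
  assume S: "opn (model M) S"
  obtain g where g: "linear g" "\<And>v. v \<in> model M \<Longrightarrow> g (T v) = v"
    using linear_exists_left_inverse_on[OF T atlas_model[OF Ma] injT] by blast
  have bg: "bounded_linear g" using g(1) linear_conv_bounded_linear by blast
  have "opn (T ` model M) (T ` model M \<inter> g -` S)"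
    by (rule smooth_preimage_open[OF smooth_on_linear[OF bg] openin_subtopology_self _ S]) (use g(2) in auto)
  moreover have "T ` model M \<inter> g -` S = T ` S"
    using g(2) openin_subset_subspace[OF S] by (auto simp: subset_iff)
  ultimately show ?thesis by simp
qed

lemma ic_tc:
  assumes c: "c \<in> charts M" and y: "y \<in> snd c ` fst c"
  shows "ic (tc c) (T y) = \<beta> (ic c y)"
proof -
  have inj: "inj_on (snd (tc c)) (fst (tc c))"
  proof (rule inj_onI)
    fix x x' assume xx: "x \<in> fst (tc c)" "x' \<in> fst (tc c)" "snd (tc c) x = snd (tc c) x'"
    then obtain p p' where p: "p \<in> fst c" "p' \<in> fst c" "x = \<beta> p" "x' = \<beta> p'" by (auto simp: tc_def)
    then have "T (snd c p) = T (snd c p')" using xx(3) chart_inv_b[OF c] by (simp add: tc_def)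
    then have "snd c p = snd c p'" using inj_onD[OF injT] chart_in_model[OF Ma c] p by blast
    then show "x = x'" using inj_onD[OF chart_inj[OF Ma c]] p by blast
  qed
  have p: "ic c y \<in> fst c" by (rule ic_in[OF y])
  have "T y = snd (tc c) (\<beta> (ic c y))" using chart_inv_b[OF c p] chart_of_ic[OF y] by (simp add: tc_def)
  moreover have "\<beta> (ic c y) \<in> fst (tc c)" using p by (simp add: tc_def)
  ultimately show ?thesis unfolding ic_def[of "tc c"] by (simp only: inv_into_f_f[OF inj])
qed

lemma inter_tc:
  assumes c: "c \<in> charts M" and d: "d \<in> charts M"
  shows "fst (tc c) \<inter> fst (tc d) = \<beta> ` (fst c \<inter> fst d)"
proof -
  have "fst c \<subseteq> points M" "fst d \<subseteq> points M" using chart_points[OF Ma c] chart_points[OF Ma d] by blast+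
  from inj_on_image_Int[OF inj this] show ?thesis by (simp add: tc_def)
qed

lemma atlas_N: "atlas N"
  unfolding atlas_def
proof (intro conjI ballI)
  show "subspace (model N)" unfolding N_simps using linear_subspace_image[OF T atlas_model[OF Ma]] .
  show "\<Union> (fst ` charts N) = points N" unfolding N_simps
    unfolding tc_def image_image fst_conv using Ma[unfolded atlas_def] by blast
  fix k assume "k \<in> charts N"
  then obtain c where c: "c \<in> charts M" "k = tc c" unfolding N_simps by blast
  show "inj_on (snd k) (fst k)"
  proof (rule inj_onI)
    fix x x' assume xx: "x \<in> fst k" "x' \<in> fst k" "snd k x = snd k x'"
    then obtain p p' where p: "p \<in> fst c" "p' \<in> fst c" "x = \<beta> p" "x' = \<beta> p'" by (auto simp: c tc_def)
    then have "T (snd c p) = T (snd c p')" using xx(3) chart_inv_b[OF c(1)] by (simp add: c tc_def)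
    then have "snd c p = snd c p'" using inj_onD[OF injT] chart_in_model[OF Ma c(1)] p by blast
    then show "x = x'" using inj_onD[OF chart_inj[OF Ma c(1)]] p by blast
  qed
  have "fst k = \<beta> ` fst c" by (simp add: c tc_def)
  then show "opn (model N) (snd k ` fst k)"
    using tc_image[OF c(1) subset_refl] image_open[OF chart_open[OF Ma c(1)]] by (simp add: c N_simps)
  fix l assume "l \<in> charts N"
  then obtain d where d: "d \<in> charts M" "l = tc d" unfolding N_simps by blast
  have eq: "snd k ` (fst k \<inter> fst l) = T ` snd c ` (fst c \<inter> fst d)"
    unfolding c d inter_tc[OF c(1) d(1)] by (rule tc_image[OF c(1)]) simp
  then show "opn (model N) (snd k ` (fst k \<inter> fst l))"
    using image_open[OF transition_open[OF Ma c(1) d(1)]] by (simp add: N_simps)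
  obtain g where g: "linear g" "\<And>v. v \<in> model M \<Longrightarrow> g (T v) = v"
    using linear_exists_left_inverse_on[OF T atlas_model[OF Ma] injT] by blast
  have bg: "bounded_linear g" and bT: "bounded_linear T" using g(1) T linear_conv_bounded_linear by blast+
  have cm: "y \<in> model M" if "y \<in> snd c ` (fst c \<inter> fst d)" for y
    using that chart_in_model[OF Ma c(1)] by blast
  have "smooth_on (T ` snd c ` (fst c \<inter> fst d)) (\<lambda>z. T (snd d (ic c (g z))))"
    by (rule smooth_on_compose[OF smooth_on_compose[OF smooth_on_linear[OF bg] transition_smooth[OF Ma c(1) d(1)]]
          smooth_on_linear[OF bT, of UNIV]]) (use g(2) cm in auto)
  then show "smooth_on (snd k ` (fst k \<inter> fst l)) (\<lambda>y. snd l (ic k y))"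
    unfolding eq
  proof (rule smooth_on_cong)
    fix z assume "z \<in> T ` snd c ` (fst c \<inter> fst d)"
    then obtain p where p: "p \<in> fst c" "p \<in> fst d" "z = T (snd c p)" by blast
    have "ic k z = \<beta> p" using ic_tc[OF c(1), of "snd c p"] p chart_ic[OF Ma c(1)] by (simp add: c)
    then show "T (snd d (ic c (g z))) = snd l (ic k z)"
      using p g(2)[OF chart_in_model[OF Ma c(1) p(1)]] chart_ic[OF Ma c(1) p(1)] chart_inv_b[OF d(1) p(2)]
      by (simp add: d tc_def)
  qed
qed

lemma smooth_b: "p \<in> points M \<Longrightarrow> smooth_at M N \<beta> p"
proof -
  assume p: "p \<in> points M"
  obtain c where c: "c \<in> charts M" "p \<in> fst c" using atlas_cover[OF Ma p] by blast
  have bT: "bounded_linear T" using T linear_conv_bounded_linear by blast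
  have "smooth_on (snd c ` fst c) (\<lambda>y. snd (tc c) (\<beta> (ic c y)))"
    by (rule smooth_on_cong[OF smooth_on_linear[OF bT]])
      (use chart_ic[OF Ma c(1)] chart_inv_b[OF c(1)] in \<open>auto simp: tc_def\<close>)
  then have "local_rep M N \<beta> p c (tc c) (snd c ` fst c)"
    unfolding local_rep_def using c chart_open[OF Ma c(1)] chart_ic[OF Ma c(1)]
    by (auto simp: N_simps) (auto simp: tc_def)
  then show ?thesis by (rule local_rep_smooth_at)
qed

lemma smooth_inv_b: "q \<in> points N \<Longrightarrow> smooth_at N M \<beta>' q"
proof -
  assume "q \<in> points N"
  then obtain p where p: "p \<in> points M" "q = \<beta> p" unfolding N_simps by blast
  obtain c where c: "c \<in> charts M" "p \<in> fst c" using atlas_cover[OF Ma p(1)] by blast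
  obtain g where g: "linear g" "\<And>v. v \<in> model M \<Longrightarrow> g (T v) = v"
    using linear_exists_left_inverse_on[OF T atlas_model[OF Ma] injT] by blast
  have bg: "bounded_linear g" using g(1) linear_conv_bounded_linear by blast
  let ?S = "T ` snd c ` fst c"
  have icz: "\<beta>' (ic (tc c) z) = ic c (g z)" "g z \<in> snd c ` fst c" if z: "z \<in> ?S" for z
  proof -
    obtain y where y: "y \<in> snd c ` fst c" "z = T y" using z by blast
    have "g z = y" using y g(2) chart_open[OF Ma c(1)] openin_subset_subspace by blast
    then show "\<beta>' (ic (tc c) z) = ic c (g z)" "g z \<in> snd c ` fst c"
      using ic_tc[OF c(1) y(1)] chart_inv_b[OF c(1) ic_in[OF y(1)]] y by simp_all
  qed
  have "smooth_on ?S (\<lambda>z. snd c (\<beta>' (ic (tc c) z)))"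
    by (rule smooth_on_cong[OF smooth_on_linear[OF bg]]) (use icz chart_of_ic[of _ c] in simp)
  moreover have "snd (tc c) q \<in> ?S" using c p chart_inv_b[OF c] by (simp add: tc_def)
  moreover have "?S = snd (tc c) ` fst (tc c)" using tc_image[OF c(1) subset_refl] by (simp add: tc_def)
  ultimately have "local_rep N M \<beta>' q (tc c) c ?S"
    unfolding local_rep_def using c p(2) image_open[OF chart_open[OF Ma c(1)]] icz ic_in[of _ c]
    by (auto simp: N_simps) (auto simp: tc_def)
  then show ?thesis by (rule local_rep_smooth_at)
qed

lemma b_inv: "q \<in> points N \<Longrightarrow> \<beta> (\<beta>' q) = q"
  unfolding N_simps by (rule f_inv_into_f)

lemma inv_b_in: "q \<in> points N \<Longrightarrow> \<beta>' q \<in> points M"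
  unfolding N_simps by (rule inv_into_into)

lemma manifold_N: "manifold N"
proof -
  have sm: "smooth_map M N \<beta>" "smooth_map N M \<beta>'"
    using smooth_map_iff[OF Ma atlas_N] smooth_map_iff[OF atlas_N Ma] smooth_b smooth_inv_b by blast+
  have "homeomorphic_maps (mtop M) (mtop N) \<beta> \<beta>'"
    unfolding homeomorphic_maps_def topspace_mtop[OF Ma] topspace_mtop[OF atlas_N]
    using smooth_map_continuous[OF Ma atlas_N sm(1)] smooth_map_continuous[OF atlas_N Ma sm(2)] inv_b b_inv by blast
  then have h: "mtop M homeomorphic_space mtop N" unfolding homeomorphic_space_def by blast
  show ?thesis using M atlas_N homeomorphic_Hausdorff_space[OF h] homeomorphic_space_second_countability[OF h]
    unfolding manifold_iff by blast
qed

text \<open>A diffeomorphism is a submersion; in this form it can be chained with other quotients by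
  \<open>quotient_compose\<close>.\<close>

lemma quotient_b: "quotient_manifold M \<beta> N"
proof (rule quotient_manifoldI[OF Ma manifold_N _ smooth_b])
  show "\<beta> ` points M = points N" by (simp add: N_simps)
  fix p v assume p: "p \<in> points M" and v: "v \<in> tangent_space N (\<beta> p)"
  have bp: "\<beta> p \<in> points N" using p by (simp add: N_simps)
  have "smooth_at N M \<beta>' (\<beta> p)" by (rule smooth_inv_b[OF bp])
  have u: "push N M \<beta>' (\<beta> p) v \<in> tangent_space M p"
    using push_tangent[OF atlas_N Ma smooth_inv_b[OF bp] v] inv_b[OF p] by simp
  have "push M N \<beta> p (push N M \<beta>' (\<beta> p) v) = push N N (\<lambda>x. \<beta> (\<beta>' x)) (\<beta> p) v"
    using push_push[OF Ma atlas_N, of \<beta> \<beta>' "\<beta> p" N v] smooth_b[OF p] inv_b[OF p] by simp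
  also have "\<dots> = push N N (\<lambda>x. x) (\<beta> p) v"
    by (rule push_cong[OF atlas_N atlas_N smooth_at_id[OF atlas_N bp] v openin_points[OF atlas_N] bp, symmetric])
      (simp add: b_inv)
  also have "\<dots> = v" by (rule push_id[OF atlas_N v])
  finally show "v \<in> push M N \<beta> p ` tangent_space M p" by (intro image_eqI[OF _ u]) simp
qed

lemma quotient_inv_b: "quotient_manifold N \<beta>' M"
proof (rule quotient_manifoldI[OF atlas_N M _ smooth_inv_b])
  show "\<beta>' ` points N = points M" using inv_b inv_b_in by (force simp: N_simps)
  fix q v assume q: "q \<in> points N" and v: "v \<in> tangent_space M (\<beta>' q)"
  note p = inv_b_in[OF q]
  have u: "push M N \<beta> (\<beta>' q) v \<in> tangent_space N q"
    using push_tangent[OF Ma atlas_N smooth_b[OF p] v] b_inv[OF q] by simp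
  have "push N M \<beta>' q (push M N \<beta> (\<beta>' q) v) = push M M (\<lambda>x. \<beta>' (\<beta> x)) (\<beta>' q) v"
    using push_push[OF atlas_N Ma, of \<beta>' \<beta> "\<beta>' q" M v] smooth_inv_b[OF q] b_inv[OF q] by simp
  also have "\<dots> = push M M (\<lambda>x. x) (\<beta>' q) v"
    by (rule push_cong[OF Ma Ma smooth_at_id[OF Ma p] v openin_points[OF Ma] p, symmetric]) (simp add: inv_b)
  also have "\<dots> = v" by (rule push_id[OF Ma v])
  finally show "v \<in> push N M \<beta>' q ` tangent_space N q" by (intro image_eqI[OF _ u]) simp
qed

end

text \<open>Local retractions settle both conditions on the inclusion. They invert it on tangent
  vectors, which gives injectivity there, and every open set of \<open>S\<close> is locally the
  trace of its preimage under a retraction, which gives the subspace topology.\<close>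

lemma embedded_submanifoldI:
  assumes S: "manifold S" and N: "atlas N" and sub: "points S \<subseteq> points N"
    and incl: "\<And>p. p \<in> points S \<Longrightarrow> smooth_at S N (\<lambda>x. x) p"
    and ret: "\<And>p. p \<in> points S \<Longrightarrow> \<exists>W \<rho>. openin (mtop N) W \<and> p \<in> W \<and> (\<forall>x\<in>W. smooth_at N S \<rho> x) \<and>
      (\<forall>x\<in>W \<inter> points S. \<rho> x = x)"
  shows "embedded_submanifold S N"
proof -
  have Sa: "atlas S" using S manifold_iff by blast
  have im: "push S N (\<lambda>x. x) p u = push S N (\<lambda>x. x) p v \<Longrightarrow> u = v"
    if p: "p \<in> points S" and u: "u \<in> tangent_space S p" and v: "v \<in> tangent_space S p" for p u v
  proof -
    assume eq: "push S N (\<lambda>x. x) p u = push S N (\<lambda>x. x) p v"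
    obtain W \<rho> where W: "openin (mtop N) W" "p \<in> W" "\<And>x. x \<in> W \<Longrightarrow> smooth_at N S \<rho> x"
      "\<And>x. x \<in> W \<Longrightarrow> x \<in> points S \<Longrightarrow> \<rho> x = x" using ret[OF p] by blast
    have op: "openin (mtop S) (points S \<inter> (\<lambda>x. x) -` W)"
      by (rule smooth_at_preimage_open[OF Sa N openin_points[OF Sa] incl W(1)])
    have ret_push: "push N S \<rho> p (push S N (\<lambda>x. x) p w) = w" if w: "w \<in> tangent_space S p" for w
    proof -
      have "push N S \<rho> p (push S N (\<lambda>x. x) p w) = push S S \<rho> p w"
        by (rule push_push[OF N Sa, where F = "\<lambda>x. x"]) (rule W(3)[OF W(2)])
      also have "\<dots> = push S S (\<lambda>x. x) p w"
      proof (rule push_cong[OF Sa Sa smooth_at_id[OF Sa p] w op, symmetric])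
        show "p \<in> points S \<inter> (\<lambda>x. x) -` W" using p W(2) by simp
        show "x = \<rho> x" if "x \<in> points S \<inter> (\<lambda>x. x) -` W" for x using that W(4)[of x] by simp
      qed
      also have "\<dots> = w" by (rule push_id[OF Sa w])
      finally show ?thesis .
    qed
    show "u = v" using trans[OF sym[OF ret_push[OF u, unfolded eq]] ret_push[OF v]] .
  qed
  have top: "mtop S = subtopology (mtop N) (points S)"
    unfolding topology_eq
  proof (intro allI iffI)
    fix U assume U: "openin (mtop S) U"
    show "openin (subtopology (mtop N) (points S)) U"
    proof (subst openin_subopen, intro ballI)
      fix p assume p: "p \<in> U"
      then have pS: "p \<in> points S" using U unfolding openin_mtop[OF Sa] by blast
      obtain W \<rho> where W: "openin (mtop N) W" "p \<in> W" "\<And>x. x \<in> W \<Longrightarrow> smooth_at N S \<rho> x"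
        "\<And>x. x \<in> W \<Longrightarrow> x \<in> points S \<Longrightarrow> \<rho> x = x" using ret[OF pS] by blast
      have "openin (mtop N) (W \<inter> \<rho> -` U)" by (rule smooth_at_preimage_open[OF N Sa W(1,3) U])
      moreover have "(W \<inter> \<rho> -` U) \<inter> points S \<subseteq> U" using W(4) by auto
      moreover have "p \<in> (W \<inter> \<rho> -` U) \<inter> points S" using p pS W by simp
      ultimately show "\<exists>V. openin (subtopology (mtop N) (points S)) V \<and> p \<in> V \<and> V \<subseteq> U"
        unfolding openin_subtopology by blast
    qed
  next
    fix U assume "openin (subtopology (mtop N) (points S)) U"
    then obtain V where V: "openin (mtop N) V" "U = V \<inter> points S" unfolding openin_subtopology by blast
    have "openin (mtop S) (points S \<inter> (\<lambda>x. x) -` V)"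
      by (rule smooth_at_preimage_open[OF Sa N openin_points[OF Sa] incl V(1)])
    moreover have "points S \<inter> (\<lambda>x. x) -` V = U" using V(2) by auto
    ultimately show "openin (mtop S) U" by simp
  qed
  show ?thesis
    unfolding embedded_submanifold_def smooth_map_iff[OF Sa N]
    by (intro conjI ballI S sub incl top inj_onI) (assumption | (rule im; assumption))+
qed

context transported
begin

lemma push_inv_b:
  assumes p: "p \<in> points M" and u: "u \<in> tangent_space M p"
  shows "push N M \<beta>' (\<beta> p) (push M N \<beta> p u) = u"
proof -
  have bp: "\<beta> p \<in> points N" using p by (simp add: N_simps)
  have "push N M \<beta>' (\<beta> p) (push M N \<beta> p u) = push M M (\<lambda>x. \<beta>' (\<beta> x)) p u"
    by (rule push_push[OF atlas_N Ma, where F = \<beta>]) (rule smooth_inv_b[OF bp])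
  also have "\<dots> = push M M (\<lambda>x. x) p u"
    by (rule push_cong[OF Ma Ma smooth_at_id[OF Ma p] u openin_points[OF Ma] p, symmetric]) (simp add: inv_b)
  also have "\<dots> = u" by (rule push_id[OF Ma u])
  finally show ?thesis .
qed

lemma ext_deriv1_push:
  assumes th: "one_form M \<theta>" and p: "p \<in> points M" and u: "u \<in> tangent_space M p" and v: "v \<in> tangent_space M p"
  shows "ext_deriv1 N (pullform N M \<beta>' \<theta>) (\<beta> p) (push M N \<beta> p u) (push M N \<beta> p v) = ext_deriv1 M \<theta> p u v"
proof (rule ext_deriv1_pull[OF Ma atlas_N one_form_pullform[OF atlas_N Ma th smooth_inv_b] smooth_b[OF p] _ u v, symmetric])
  show "\<theta> x w = pullform M N \<beta> (pullform N M \<beta>' \<theta>) x w" if "x \<in> points M" "w \<in> tangent_space M x" for x w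
    unfolding pullform_def by (simp add: push_inv_b[OF that] inv_b[OF that(1)])
qed

text \<open>Up to sign the form is an exterior derivative, hence closed. Nondegeneracy is carried
  over because the two structures have corresponding tangent vectors and, by naturality, the same
  values.\<close>

lemma symplectic_pullform:
  assumes th: "one_form M \<theta>"
    and nondeg: "\<And>p u. p \<in> points M \<Longrightarrow> u \<in> tangent_space M p \<Longrightarrow>
      (\<forall>v\<in>tangent_space M p. - ext_deriv1 M \<theta> p u v = 0) \<Longrightarrow> u = (\<lambda>_. 0)"
  shows "symplectic_form N (\<lambda>p u v. - ext_deriv1 N (pullform N M \<beta>' \<theta>) p u v)"
  unfolding symplectic_form_def
proof (intro conjI ballI impI)
  have th': "one_form N (pullform N M \<beta>' \<theta>)" by (rule one_form_pullform[OF atlas_N Ma th smooth_inv_b])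
  show "two_form N (\<lambda>p u v. - ext_deriv1 N (pullform N M \<beta>' \<theta>) p u v)" by (rule two_form_exact[OF atlas_N th' refl])
  show "closed_form2 N (\<lambda>p u v. - ext_deriv1 N (pullform N M \<beta>' \<theta>) p u v)" by (rule closed_form2_exact[OF atlas_N th' refl])
  fix q u assume q: "q \<in> points N" and u: "u \<in> tangent_space N q"
    and z: "\<forall>v\<in>tangent_space N q. - ext_deriv1 N (pullform N M \<beta>' \<theta>) q u v = 0"
  note p = inv_b_in[OF q]
  let ?u = "push N M \<beta>' q u"
  have ut: "?u \<in> tangent_space M (\<beta>' q)" by (rule push_tangent[OF atlas_N Ma smooth_inv_b[OF q] u])
  have "?u = (\<lambda>_. 0)"
  proof (rule nondeg[OF p ut], intro ballI)
    fix w assume "w \<in> tangent_space M (\<beta>' q)"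
    then obtain v where v: "v \<in> tangent_space N q" "w = push N M \<beta>' q v"
      using quotient_manifoldD(5)[OF atlas_N quotient_inv_b q] by blast
    show "- ext_deriv1 M \<theta> (\<beta>' q) ?u w = 0"
      using z v ext_deriv1_pull[OF atlas_N Ma th smooth_inv_b[OF q] refl u v(1)] by simp
  qed
  then have "push M N \<beta> (\<beta>' q) ?u = (\<lambda>_. 0)" by (simp add: push_zero)
  moreover have "push M N \<beta> (\<beta>' q) ?u = push N N (\<lambda>x. \<beta> (\<beta>' x)) q u"
    by (rule push_push[OF Ma atlas_N, where F = \<beta>']) (rule smooth_b[OF p])
  moreover have "push N N (\<lambda>x. \<beta> (\<beta>' x)) q u = push N N (\<lambda>x. x) q u"
    by (rule push_cong[OF atlas_N atlas_N smooth_at_id[OF atlas_N q] u openin_points[OF atlas_N] q, symmetric])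
      (simp add: b_inv)
  ultimately show "u = (\<lambda>_. 0)" using push_id[OF atlas_N u] by simp
qed

end

text \<open>Both manifolds are images of \<open>M\<close>: going back along \<open>\<beta>\<close>
  and forward along \<open>\<gamma>\<close> is smooth in both directions, and both forms correspond
  to the negative exterior derivative of \<open>\<theta>\<close> on \<open>M\<close>.\<close>

lemma symplectomorphism_transport:
  assumes b: "transported M \<beta> T" and c: "transported M \<gamma> S" and th: "one_form M \<theta>"
  shows "symplectomorphism
    (transport \<beta> T M) (\<lambda>p u v. - ext_deriv1 (transport \<beta> T M) (pullform (transport \<beta> T M) M (inv_into (points M) \<beta>) \<theta>) p u v)
    (transport \<gamma> S M) (\<lambda>p u v. - ext_deriv1 (transport \<gamma> S M) (pullform (transport \<gamma> S M) M (inv_into (points M) \<gamma>) \<theta>) p u v)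
    (\<lambda>x. \<gamma> (inv_into (points M) \<beta> x))"
proof -
  interpret b: transported M \<beta> T by (rule b)
  interpret c: transported M \<gamma> S by (rule c)
  let ?F = "\<lambda>x. \<gamma> (b.\<beta>' x)"
  have bij: "bij_betw ?F (points b.N) (points c.N)"
    by (rule bij_betw_byWitness[where f' = "\<lambda>y. \<beta> (c.\<beta>' y)"])
      (auto simp: b.inv_b c.inv_b b.N_simps c.N_simps)
  have F: "smooth_at b.N c.N ?F x" if "x \<in> points b.N" for x
    by (rule smooth_at_compose[OF b.atlas_N b.Ma c.atlas_N b.smooth_inv_b[OF that] c.smooth_b[OF b.inv_b_in[OF that]]])
  have F': "smooth_at c.N b.N (\<lambda>y. \<beta> (c.\<beta>' y)) y" if "y \<in> points c.N" for y
    by (rule smooth_at_compose[OF c.atlas_N b.Ma b.atlas_N c.smooth_inv_b[OF that] b.smooth_b[OF c.inv_b_in[OF that]]])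
  have "inv_into (points b.N) ?F y = \<beta> (c.\<beta>' y)" if y: "y \<in> points c.N" for y
  proof (rule inv_into_f_eq[OF bij_betw_imp_inj_on[OF bij]])
    show "\<beta> (c.\<beta>' y) \<in> points b.N" using c.inv_b_in[OF y] by (simp add: b.N_simps)
    show "?F (\<beta> (c.\<beta>' y)) = y" using c.inv_b_in[OF y] c.b_inv[OF y] by (simp add: b.inv_b)
  qed
  then have "smooth_at c.N b.N (inv_into (points b.N) ?F) y" if "y \<in> points c.N" for y
    using smooth_at_cong[OF c.atlas_N F'[OF that] openin_points[OF c.atlas_N] that] by simp
  then have diffeo: "diffeomorphism b.N c.N ?F"
    unfolding diffeomorphism_def smooth_map_iff[OF b.atlas_N c.atlas_N] smooth_map_iff[OF c.atlas_N b.atlas_N]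
    using bij F by blast
  have "ext_deriv1 c.N (pullform c.N M c.\<beta>' \<theta>) (?F p) (push b.N c.N ?F p u) (push b.N c.N ?F p v) =
      ext_deriv1 b.N (pullform b.N M b.\<beta>' \<theta>) p u v"
    if p: "p \<in> points b.N" and u: "u \<in> tangent_space b.N p" and v: "v \<in> tangent_space b.N p" for p u v
  proof -
    note sm = b.smooth_inv_b[OF p]
    have pF: "push b.N c.N ?F p w = push M c.N \<gamma> (b.\<beta>' p) (push b.N M b.\<beta>' p w)" for w
      by (rule push_push[OF b.Ma c.atlas_N, where F = "b.\<beta>'", symmetric]) (rule c.smooth_b[OF b.inv_b_in[OF p]])
    show ?thesis
      unfolding pF c.ext_deriv1_push[OF th b.inv_b_in[OF p] push_tangent[OF b.atlas_N b.Ma sm u] push_tangent[OF b.atlas_N b.Ma sm v]]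
      by (rule ext_deriv1_pull[OF b.atlas_N b.Ma th sm refl u v, symmetric])
  qed
  then show ?thesis unfolding symplectomorphism_def using diffeo by simp
qed

lemma quotient_id:
  assumes "manifold M" shows "quotient_manifold M (\<lambda>x. x) M"
proof -
  have M: "atlas M" using assms manifold_iff by blast
  show ?thesis
    by (rule quotient_manifoldI[OF M assms _ smooth_at_id[OF M]]) (auto simp: image_iff intro!: bexI push_id[OF M, symmetric])
qed

section \<open>The cotangent bundle\<close>

text \<open>If all values near \<open>p\<close> lie in one chart of the target, smoothness of the
  coordinates of the map is enough. This suits targets that are given by explicit charts.\<close>

lemma smooth_at_into_chart:
  assumes A: "atlas A" and N: "atlas N" and d: "d \<in> charts N" and W: "openin (mtop A) W" "p \<in> W"
    and F: "\<And>x. x \<in> W \<Longrightarrow> F x \<in> fst d" and sm: "smooth_at A EU (\<lambda>x. snd d (F x)) p"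
  shows "smooth_at A N F p"
proof -
  have p: "p \<in> points A" using W openin_mtop[OF A] by blast
  obtain c where c: "c \<in> charts A" "p \<in> fst c" using atlas_cover[OF A p] by blast
  obtain S where S: "local_rep A EU (\<lambda>x. snd d (F x)) p c (UNIV, \<lambda>x. x) S"
    using smooth_at_rep[OF A atlas_EU sm c, of "(UNIV, \<lambda>x. x)"] by auto
  note s = S[unfolded local_rep_def]
  define S' where "S' = S \<inter> snd c ` (fst c \<inter> W)"
  have "opn (model A) S'" unfolding S'_def using s openin_mtopD[OF A W(1) c(1)] by blast
  moreover have "F (ic c y) \<in> fst d" if "y \<in> S'" for y
    using that chart_ic[OF A c(1)] F by (auto simp: S'_def)
  moreover have "smooth_on S' (\<lambda>y. snd d (F (ic c y)))"
    by (rule smooth_on_subset[of S]) (use s in \<open>auto simp: S'_def\<close>)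
  ultimately have "local_rep A N F p c d S'"
    unfolding local_rep_def using s c d W(2) by (auto simp: S'_def)
  then show ?thesis by (rule local_rep_smooth_at)
qed

text \<open>The chart image is only relatively open. Since \<open>f\<close> takes values in the
  model space, it lands in the chart image near \<open>p\<close> as soon as it does at
  \<open>p\<close>.\<close>

lemma smooth_at_ic_comp:
  assumes M: "atlas M" and A: "atlas A" and c: "c \<in> charts M" and f: "smooth_at A EU f p"
    and fp: "f p \<in> snd c ` fst c" and fM: "\<And>x. x \<in> points A \<Longrightarrow> f x \<in> model M"
  shows "smooth_at A M (\<lambda>x. ic c (f x)) p"
proof -
  obtain T where T: "open T" "snd c ` fst c = model M \<inter> T" using chart_open[OF M c] unfolding openin_open by blast
  obtain W0 where W0: "openin (mtop A) W0" "p \<in> W0" "\<And>x. x \<in> W0 \<Longrightarrow> smooth_at A EU f x"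
    using smooth_at_nhd[OF A f] by blast
  have opT: "openin (mtop (flat UNIV UNIV)) T" using T(1) by (simp add: openin_flat)
  have op: "openin (mtop A) (W0 \<inter> f -` T)" by (rule smooth_at_preimage_open[OF A atlas_EU W0(1,3) opT])
  have W0A: "W0 \<subseteq> points A" using W0(1) openin_mtop[OF A] by blast
  have R: "atlas (flat (model M) (snd c ` fst c))" by (rule atlas_flat[OF atlas_model[OF M] chart_open[OF M c]])
  have "smooth_at A (flat (model M) (snd c ` fst c)) f p"
  proof (rule smooth_at_flat_cod[OF A f op])
    show "p \<in> W0 \<inter> f -` T" using W0(2) fp T(2) by blast
    show "f ` (W0 \<inter> f -` T) \<subseteq> snd c ` fst c" using W0A fM unfolding T(2) by blast
  qed
  from smooth_at_compose[OF A R M this smooth_at_ic[OF M c fp]] show ?thesis .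
qed

lemma smooth_at_chart_comp:
  assumes A: "atlas A" and N: "atlas N" and F: "smooth_at A N F p" and d: "d \<in> charts N" "F p \<in> fst d"
  shows "smooth_at A EU (\<lambda>x. snd d (F x)) p"
  by (rule smooth_at_compose[OF A N atlas_EU F])
    (rule smooth_at_EU_cod[OF N smooth_at_chart[OF N d] chart_points[OF N d]])

context
  fixes M :: "('a, 'e::euclidean_space) mfd"
  assumes M: "atlas M"
begin

abbreviation "V \<equiv> model M"
abbreviation "TM \<equiv> cotangent_bundle M"

text \<open>Inverse to the fibre coordinate \<open>cf\<close>; the default 0 off the tangent space
  is the one demanded by \<open>cotangent_space\<close>.\<close>

definition cov :: "('a, 'e) chart \<Rightarrow> 'a \<Rightarrow> 'e \<Rightarrow> 'a cvec" where
  "cov c p a = (\<lambda>v. if v \<in> tangent_space M p then a \<bullet> chart_diff (snd c) v else 0)"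

text \<open>Names the \<open>THE\<close> in the charts of \<open>cotangent_bundle\<close>.\<close>

definition cf :: "('a, 'e) chart \<Rightarrow> 'a \<Rightarrow> 'a cvec \<Rightarrow> 'e" where
  "cf c p \<alpha> = (THE a. a \<in> V \<and> (\<forall>v\<in>tangent_space M p. \<alpha> v = a \<bullet> chart_diff (snd c) v))"

definition ctc :: "('a, 'e) chart \<Rightarrow> ('a \<times> 'a cvec, 'e \<times> 'e) chart" where
  "ctc c = (SIGMA p:fst c. cotangent_space M p, \<lambda>(p, \<alpha>). (snd c p, cf c p \<alpha>))"

lemma TM_simps: "points TM = (SIGMA p:points M. cotangent_space M p)" "model TM = V \<times> V"
  "charts TM = ctc ` charts M"
  unfolding cotangent_bundle_def ctc_def cf_def by (simp_all add: case_prod_beta)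

lemma cotangentD:
  assumes "\<alpha> \<in> cotangent_space M p"
  shows "u \<in> tangent_space M p \<Longrightarrow> v \<in> tangent_space M p \<Longrightarrow> \<alpha> (lincomb a u b v) = a * \<alpha> u + b * \<alpha> v"
    "v \<notin> tangent_space M p \<Longrightarrow> \<alpha> v = 0"
  using assms unfolding cotangent_space_def by blast+

lemma cov_cotangent:
  "cov c p a \<in> cotangent_space M p"
  unfolding cotangent_space_def cov_def
  by (auto simp: chart_diff_lincomb inner_add_right tangent_lincomb[OF M])

text \<open>Uniqueness: two representing vectors in the model space differ by a vector of that space
  which is orthogonal to itself.\<close>

lemma cf_eqI:
  assumes c: "c \<in> charts M" "p \<in> fst c" and a: "a \<in> V" "\<And>v. v \<in> tangent_space M p \<Longrightarrow> \<alpha> v = a \<bullet> chart_diff (snd c) v"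
  shows "cf c p \<alpha> = a"
  unfolding cf_def
proof (rule the_equality)
  show "a \<in> V \<and> (\<forall>v\<in>tangent_space M p. \<alpha> v = a \<bullet> chart_diff (snd c) v)" using a by blast
  fix b assume b: "b \<in> V \<and> (\<forall>v\<in>tangent_space M p. \<alpha> v = b \<bullet> chart_diff (snd c) v)"
  have "b - a \<in> V" using a(1) b subspace_diff[OF atlas_model[OF M]] by blast
  then have "cv M c (snd c p) (b - a) \<in> tangent_space M p" by (rule cv_tangent[OF M c])
  with a(2) b have "b \<bullet> (b - a) = a \<bullet> (b - a)"
    using chart_diff_cv[OF M c \<open>b - a \<in> V\<close>] by metis
  then have "(b - a) \<bullet> (b - a) = 0" by (simp add: inner_diff_left)
  then show "b = a" by simp
qed

lemma cf_eq:
  assumes c: "c \<in> charts M" "p \<in> fst c" and \<alpha>: "\<alpha> \<in> cotangent_space M p"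
  shows "cf c p \<alpha> = (\<Sum>b\<in>onb V. \<alpha> (cv M c (snd c p) b) *\<^sub>R b)" (is "_ = ?a")
    "v \<in> tangent_space M p \<Longrightarrow> \<alpha> v = cf c p \<alpha> \<bullet> chart_diff (snd c) v" "cf c p \<alpha> \<in> V" "cov c p (cf c p \<alpha>) = \<alpha>"
proof -
  have aV: "?a \<in> V"
    using onb(1)[OF atlas_model[OF M]] by (intro subspace_sum subspace_scale atlas_model[OF M]) auto
  have ev: "\<alpha> v = ?a \<bullet> chart_diff (snd c) v" if v: "v \<in> tangent_space M p" for v
  proof -
    note t = tangent_cv[OF M c v]
    have "\<alpha> (cv M c (snd c p) (chart_diff (snd c) v)) = ?a \<bullet> chart_diff (snd c) v"
    proof (rule linear_onb_expand[OF atlas_model[OF M] t(1)])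
      fix x y r s assume "x \<in> V" "y \<in> V"
      then show "\<alpha> (cv M c (snd c p) (r *\<^sub>R x + s *\<^sub>R y)) = r * \<alpha> (cv M c (snd c p) x) + s * \<alpha> (cv M c (snd c p) y)"
        unfolding cv_linear[OF M c] by (intro cotangentD(1)[OF \<alpha>] cv_tangent[OF M c])
    qed
    then show ?thesis unfolding t(2) .
  qed
  show eq: "cf c p \<alpha> = ?a" by (rule cf_eqI[OF c aV ev])
  show "v \<in> tangent_space M p \<Longrightarrow> \<alpha> v = cf c p \<alpha> \<bullet> chart_diff (snd c) v" unfolding eq by (rule ev)
  show "cf c p \<alpha> \<in> V" unfolding eq by (rule aV)
  show "cov c p (cf c p \<alpha>) = \<alpha>" unfolding eq cov_def using ev cotangentD(2)[OF \<alpha>] by auto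
qed

lemma cf_cov: "c \<in> charts M \<Longrightarrow> p \<in> fst c \<Longrightarrow> a \<in> V \<Longrightarrow> cf c p (cov c p a) = a"
  by (rule cf_eqI) (simp_all add: cov_def)

lemma ctc_simps: "fst (ctc c) = (SIGMA p:fst c. cotangent_space M p)" "snd (ctc c) x = (snd c (fst x), cf c (fst x) (snd x))"
  unfolding ctc_def by (simp_all add: case_prod_beta)

lemma ctc_inj: "c \<in> charts M \<Longrightarrow> inj_on (snd (ctc c)) (fst (ctc c))"
proof (rule inj_onI)
  fix x y assume c: "c \<in> charts M" and x: "x \<in> fst (ctc c)" and y: "y \<in> fst (ctc c)" and eq: "snd (ctc c) x = snd (ctc c) y"
  have x': "fst x \<in> fst c" "snd x \<in> cotangent_space M (fst x)" and y': "fst y \<in> fst c" "snd y \<in> cotangent_space M (fst y)"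
    using x y by (auto simp: ctc_simps)
  have e: "snd c (fst x) = snd c (fst y)" "cf c (fst x) (snd x) = cf c (fst y) (snd y)" using eq by (simp_all add: ctc_simps)
  have f: "fst x = fst y" using inj_onD[OF chart_inj[OF M c] e(1) x'(1) y'(1)] .
  have "snd x = snd y" using cf_eq(4)[OF c x'] cf_eq(4)[OF c y'] e(2) f by metis
  then show "x = y" using f by (simp add: prod_eq_iff)
qed

lemma ctc_image: "c \<in> charts M \<Longrightarrow> U \<subseteq> fst c \<Longrightarrow> snd (ctc c) ` (SIGMA p:U. cotangent_space M p) = snd c ` U \<times> V"
proof (intro antisym subsetI)
  fix z assume c: "c \<in> charts M" and U: "U \<subseteq> fst c"
  { assume "z \<in> snd (ctc c) ` (SIGMA p:U. cotangent_space M p)"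
    then obtain p \<alpha> where p: "p \<in> U" "\<alpha> \<in> cotangent_space M p" "z = snd (ctc c) (p, \<alpha>)" by blast
    have "p \<in> fst c" using p(1) U by blast
    then show "z \<in> snd c ` U \<times> V" using p cf_eq(3)[OF c _ p(2)] by (simp add: ctc_simps) }
  { assume "z \<in> snd c ` U \<times> V"
    then obtain p a where p: "p \<in> U" "a \<in> V" "z = (snd c p, a)" by blast
    have "p \<in> fst c" using p(1) U by blast
    then have "z = snd (ctc c) (p, cov c p a)" using p cf_cov[OF c] by (simp add: ctc_simps)
    then show "z \<in> snd (ctc c) ` (SIGMA p:U. cotangent_space M p)"
      using p(1) cov_cotangent by blast }
qed

lemma ic_ctc:
  assumes c: "c \<in> charts M" and y: "y \<in> snd c ` fst c" and a: "a \<in> V"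
  shows "ic (ctc c) (y, a) = (ic c y, cov c (ic c y) a)"
proof -
  have p: "ic c y \<in> fst c" by (rule ic_in[OF y])
  have "(y, a) = snd (ctc c) (ic c y, cov c (ic c y) a)"
    using cf_cov[OF c p a] chart_of_ic[OF y] by (simp add: ctc_simps)
  moreover have "(ic c y, cov c (ic c y) a) \<in> fst (ctc c)" using p cov_cotangent by (simp add: ctc_simps)
  ultimately show ?thesis unfolding ic_def[of "ctc c"] by (simp only: inv_into_f_f[OF ctc_inj[OF c]])
qed

lemma atlas_TM: "atlas TM"
  unfolding atlas_def
proof (intro conjI ballI)
  show "subspace (model TM)" unfolding TM_simps by (intro subspace_Times atlas_model[OF M])
  have "\<Union> (fst ` charts TM) = (\<Union>c\<in>charts M. SIGMA p:fst c. cotangent_space M p)"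
    unfolding TM_simps by (simp add: ctc_simps)
  also have "\<dots> = (SIGMA p:\<Union> (fst ` charts M). cotangent_space M p)" by blast
  finally show "\<Union> (fst ` charts TM) = points TM" using M unfolding TM_simps atlas_def by simp
  fix k assume "k \<in> charts TM"
  then obtain c where c: "c \<in> charts M" "k = ctc c" unfolding TM_simps by blast
  show "inj_on (snd k) (fst k)" unfolding c(2) by (rule ctc_inj[OF c(1)])
  show "opn (model TM) (snd k ` fst k)"
    unfolding c(2) ctc_simps(1) ctc_image[OF c(1) subset_refl] TM_simps
    by (rule openin_Times[OF chart_open[OF M c(1)] openin_subtopology_self])
  fix l assume "l \<in> charts TM"
  then obtain d where d: "d \<in> charts M" "l = ctc d" unfolding TM_simps by blast
  have int: "fst k \<inter> fst l = (SIGMA p:fst c \<inter> fst d. cotangent_space M p)"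
    unfolding c(2) d(2) ctc_simps(1) by blast
  let ?A = "snd c ` (fst c \<inter> fst d)"
  have eq: "snd k ` (fst k \<inter> fst l) = ?A \<times> V"
    unfolding int unfolding c(2) by (rule ctc_image[OF c(1)]) simp
  show "opn (model TM) (snd k ` (fst k \<inter> fst l))"
    unfolding eq TM_simps by (rule openin_Times[OF transition_open[OF M c(1) d(1)] openin_subtopology_self])
  let ?t = "\<lambda>y. snd d (ic c y)" and ?s = "\<lambda>z. snd c (ic d z)"
  let ?B = "snd d ` (fst d \<inter> fst c)"
  interpret s: smooth_fn V ?B ?s
    using atlas_model[OF M] transition_open[OF M d(1) c(1)] transition_smooth[OF M d(1) c(1)] by unfold_locales
  have tB: "?t y \<in> ?B" if "y \<in> ?A" for y
    using that chart_ic[OF M c(1)] by auto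
  \<comment> \<open>Fibre coordinates change by the transpose of the derivative of the inverse
    transition map \<open>?s\<close>: the coefficient at a basis vector is the old coordinate paired
    with the image of this vector. Written out in the basis, it is smooth in both variables.\<close>
  let ?h = "\<lambda>x. (?t (fst x), \<Sum>b\<in>onb V. (snd x \<bullet> dV V ?s (?t (fst x)) b) *\<^sub>R b)"
  have t: "smooth_on (?A \<times> V) (\<lambda>x. ?t (fst x))"
    by (rule smooth_on_compose[OF smooth_on_linear[OF bounded_linear_fst] transition_smooth[OF M c(1) d(1)]]) auto
  have "smooth_on (?A \<times> V) ?h"
    by (intro smooth_on_Pair t smooth_on_sum smooth_on_scaleR smooth_on_inner smooth_on_const
        smooth_on_linear[OF bounded_linear_snd] smooth_on_compose[OF t s.dV_smooth]) (use tB in auto)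
  then show "smooth_on (snd k ` (fst k \<inter> fst l)) (\<lambda>y. snd l (ic k y))"
    unfolding eq
  proof (rule smooth_on_cong)
    fix x assume "x \<in> ?A \<times> V"
    then obtain p a where p: "p \<in> fst c" "p \<in> fst d" "a \<in> V" "x = (snd c p, a)" by blast
    have icp: "ic c (snd c p) = p" by (rule chart_ic[OF M c(1) p(1)])
    have ick: "ic k x = (p, cov c p a)"
      using ic_ctc[OF c(1) _ p(3), of "snd c p"] p(1) icp by (simp add: c(2) p(4))
    have r: "local_rep M M (\<lambda>x. x) p d c ?B"
      unfolding local_rep_def using c d p transition_open[OF M d(1) c(1)] transition_smooth[OF M d(1) c(1)]
        chart_ic[OF M d(1)] by auto
    have "cov c p a (cv M d (snd d p) b) = a \<bullet> dV V ?s (snd d p) b" if b: "b \<in> onb V" for b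
    proof -
      have bV: "b \<in> V" using b onb(1)[OF atlas_model[OF M]] by blast
      have tv: "cv M d (snd d p) b \<in> tangent_space M p" by (rule cv_tangent[OF M d(1) p(2) bV])
      have dvV: "dV V ?s (snd d p) b \<in> V"
        by (rule dV_in[OF s.smooth_fn_axioms atlas_model[OF M]])
          (use p chart_in_model[OF M c(1)] chart_ic[OF M d(1)] in auto)
      have "cv M d (snd d p) b = cv M c (snd c p) (dV V ?s (snd d p) b)"
        using push_cv[OF M M r bV] push_id[OF M tv] by simp
      then show ?thesis using tv chart_diff_cv[OF M c(1) p(1) dvV] by (simp add: cov_def)
    qed
    then have "(\<Sum>b\<in>onb V. (a \<bullet> dV V ?s (snd d p) b) *\<^sub>R b) = cf d p (cov c p a)"
      unfolding cf_eq(1)[OF d(1) p(2) cov_cotangent] by (intro sum.cong) simp_all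
    then show "?h x = snd l (ic k x)" unfolding ick d(2) ctc_simps by (simp add: p(4) icp)
  qed
qed

lemma smooth_at_TM_fst: "x \<in> points TM \<Longrightarrow> smooth_at TM M fst x"
proof -
  assume x: "x \<in> points TM"
  obtain k where k: "k \<in> charts TM" "x \<in> fst k" using atlas_cover[OF atlas_TM x] by blast
  then obtain c where c: "c \<in> charts M" "k = ctc c" unfolding TM_simps by blast
  have xc: "fst x \<in> fst c" using k(2) by (auto simp: c ctc_simps)
  have "smooth_at TM EU (\<lambda>x. fst (snd k x)) x"
    by (rule smooth_at_linear[OF atlas_TM smooth_at_chart_comp[OF atlas_TM atlas_TM smooth_at_id[OF atlas_TM x] k] bounded_linear_fst])
  then have "smooth_at TM EU (\<lambda>x. snd c (fst x)) x" by (simp add: c ctc_simps)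
  then show ?thesis
    by (rule smooth_at_into_chart[OF atlas_TM M c(1) openin_chart_domain[OF atlas_TM k(1)] k(2), rotated])
      (auto simp: c ctc_simps)
qed

lemma smooth_at_cf:
  assumes c: "c \<in> charts M" and x: "x \<in> fst (ctc c)"
  shows "smooth_at TM EU (\<lambda>x. cf c (fst x) (snd x)) x"
proof -
  have k: "ctc c \<in> charts TM" using c unfolding TM_simps by blast
  have "smooth_at TM EU (\<lambda>x. snd (snd (ctc c) x)) x"
    by (rule smooth_at_linear[OF atlas_TM smooth_at_chart_comp[OF atlas_TM atlas_TM
          smooth_at_id[OF atlas_TM chart_points[OF atlas_TM k x]] k x] bounded_linear_snd])
  then show ?thesis by (simp add: ctc_simps)
qed

text \<open>The fibre coordinate is assembled from the values on coordinate fields, so smoothness of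
  a field of covectors along \<open>f\<close> may be tested on these in a single chart.\<close>

lemma smooth_at_into_TM:
  assumes A: "atlas A" and f: "smooth_at A M f p" and W: "openin (mtop A) W" "p \<in> W"
    and \<alpha>: "\<And>x. x \<in> W \<Longrightarrow> \<alpha> x \<in> cotangent_space M (f x)"
    and c: "c \<in> charts M" "f p \<in> fst c"
    and sm: "\<And>b. b \<in> V \<Longrightarrow> smooth_at A EU (\<lambda>x. \<alpha> x (cv M c (snd c (f x)) b)) p"
  shows "smooth_at A TM (\<lambda>x. (f x, \<alpha> x)) p"
proof -
  obtain W' where W': "openin (mtop A) W'" "p \<in> W'" "\<And>x. x \<in> W' \<Longrightarrow> smooth_at A M f x"
    using smooth_at_nhd[OF A f] by blast
  let ?W = "(W' \<inter> f -` fst c) \<inter> W"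
  have "openin (mtop A) (W' \<inter> f -` fst c)"
    by (rule smooth_at_preimage_open[OF A M W'(1,3) openin_chart_domain[OF M c(1)]])
  then have op: "openin (mtop A) ?W" using W(1) by (rule openin_Int)
  have pW: "p \<in> ?W" using W'(2) W(2) c(2) by simp
  have k: "ctc c \<in> charts TM" using c(1) unfolding TM_simps by blast
  have pA: "p \<in> points A" by (rule smooth_at_points(1)[OF A M f])
  have "smooth_at A EU (\<lambda>x. (snd c (f x), \<Sum>b\<in>onb V. \<alpha> x (cv M c (snd c (f x)) b) *\<^sub>R b)) p"
    using onb(1)[OF atlas_model[OF M]]
    by (intro smooth_at_EU_Pair[OF A] smooth_at_chart_comp[OF A M f c] smooth_at_sum[OF A pA]
        smooth_at_scaleR[OF A] sm smooth_at_EU_const[OF A pA]) auto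
  then have "smooth_at A EU (\<lambda>x. snd (ctc c) (f x, \<alpha> x)) p"
    by (rule smooth_at_cong[OF A _ op pW]) (use cf_eq(1)[OF c(1) _ \<alpha>] in \<open>simp add: ctc_simps\<close>)
  then show ?thesis
    by (rule smooth_at_into_chart[OF A atlas_TM k op pW, rotated]) (use \<alpha> in \<open>simp add: ctc_simps\<close>)
qed

text \<open>In a chart, evaluating a covector on the vector field generated by \<open>G\<close> is
  the inner product of its fibre coordinate with the coordinate velocity of \<open>G\<close>, and
  both are smooth. The retraction onto the level set is built from such an evaluation.\<close>

lemma smooth_at_eval:
  assumes x: "x \<in> points TM" and G: "smooth_at (prod_mfd (flat UNIV (UNIV::real set)) M) M G (0, fst x)"
    and G0: "\<And>h. h \<in> points M \<Longrightarrow> G (0, h) = h"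
    and Gs: "\<And>h. h \<in> points M \<Longrightarrow> smooth_at EU M (\<lambda>t. G (t, h)) 0"
  shows "smooth_at TM EU (\<lambda>x. snd x (velocity M (\<lambda>t. G (t, fst x)))) x"
proof -
  have fx: "fst x \<in> points M" using x unfolding TM_simps by auto
  obtain c where c: "c \<in> charts M" "fst x \<in> fst c" using atlas_cover[OF M fx] by blast
  have k: "ctc c \<in> charts TM" "x \<in> fst (ctc c)" using c x by (auto simp: TM_simps ctc_simps)
  have "smooth_at M EU (\<lambda>h. chart_diff (snd c) (velocity M (\<lambda>t. G (t, h)))) (fst x)"
    by (rule smooth_at_velocity[OF M M G c(1)]) (simp add: G0[OF fx] c(2))
  then have "smooth_at TM EU (\<lambda>x. chart_diff (snd c) (velocity M (\<lambda>t. G (t, fst x)))) x"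
    by (rule smooth_at_compose[OF atlas_TM M atlas_EU smooth_at_TM_fst[OF x]])
  then have "smooth_at TM EU (\<lambda>x. cf c (fst x) (snd x) \<bullet> chart_diff (snd c) (velocity M (\<lambda>t. G (t, fst x)))) x"
    by (rule smooth_at_inner[OF atlas_TM smooth_at_cf[OF c(1) k(2)]])
  then show ?thesis
  proof (rule smooth_at_cong[OF atlas_TM _ openin_chart_domain[OF atlas_TM k(1)] k(2)])
    fix z assume "z \<in> fst (ctc c)"
    then have z: "fst z \<in> fst c" "snd z \<in> cotangent_space M (fst z)" by (auto simp: ctc_simps)
    have zM: "fst z \<in> points M" by (rule chart_points[OF M c(1) z(1)])
    have "velocity M (\<lambda>t. G (t, fst z)) \<in> tangent_space M (fst z)"
      using velocity_in_tangent[OF M Gs[OF zM]] G0[OF zM] by simp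
    then show "cf c (fst z) (snd z) \<bullet> chart_diff (snd c) (velocity M (\<lambda>t. G (t, fst z))) = snd z (velocity M (\<lambda>t. G (t, fst z)))"
      using cf_eq(2)[OF c(1) z] by simp
  qed
qed

text \<open>In cotangent coordinates \<open>(q, p)\<close> this is the form \<open>p dq\<close>:
  \<open>fst\<close> maps the coordinate line in direction \<open>(a, b)\<close> to the line in
  direction \<open>a\<close>, so the coefficient is the linear function
  \<open>p \<bullet> a\<close>.\<close>

lemma one_form_canonical: "one_form TM (canonical_1form M)"
  unfolding one_form_def
proof (intro conjI ballI allI)
  fix x u v and a b :: real assume x: "x \<in> points TM" and u: "u \<in> tangent_space TM x" and v: "v \<in> tangent_space TM x"
  have \<alpha>: "snd x \<in> cotangent_space M (fst x)" using x unfolding TM_simps by auto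
  note p = push_tangent[OF atlas_TM M smooth_at_TM_fst[OF x]]
  show "canonical_1form M x (lincomb a u b v) = a * canonical_1form M x u + b * canonical_1form M x v"
    unfolding canonical_1form_def push_lincomb by (rule cotangentD(1)[OF \<alpha> p[OF u] p[OF v]])
next
  fix k w assume "k \<in> charts TM" and w: "w \<in> model TM"
  then obtain c where c: "c \<in> charts M" "k = ctc c" unfolding TM_simps by blast
  have k: "ctc c \<in> charts TM" using c unfolding TM_simps by blast
  obtain a b where ab: "w = (a, b)" "a \<in> V" "b \<in> V" using w unfolding TM_simps by blast
  have im: "snd k ` fst k = snd c ` fst c \<times> V" unfolding c(2) ctc_simps(1) by (rule ctc_image[OF c(1) subset_refl])
  have "coef1 TM (canonical_1form M) k w z = snd z \<bullet> a" if z: "z \<in> snd k ` fst k" for z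
  proof -
    obtain y e where y: "z = (y, e)" "y \<in> snd c ` fst c" "e \<in> V" using z unfolding im by blast
    have p: "ic c y \<in> fst c" by (rule ic_in[OF y(2)])
    have icz: "ic k z = (ic c y, cov c (ic c y) e)" unfolding c(2) y(1) by (rule ic_ctc[OF c(1) y(2,3)])
    let ?g = "\<lambda>t::real. ic k (z + t *\<^sub>R w)"
    have g0: "?g 0 = ic k z" by simp
    have wk: "w \<in> model TM" by (rule w)
    have "smooth_at TM M fst (ic k z)"
      using smooth_at_TM_fst chart_points[OF atlas_TM k] ic_in[OF z] c(2) by simp
    then have "push TM M fst (?g 0) (velocity TM ?g) = velocity M (\<lambda>t. fst (?g t))"
      by (intro push_velocity[OF atlas_TM M]) (simp only: g0)
    moreover have "eventually (\<lambda>t. fst (?g t) = ic c (y + t *\<^sub>R a)) (nhds 0)"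
    proof (rule eventually_mono[OF coord_curve[OF M c(1) y(2) ab(2)]])
      fix t :: real assume t: "y + t *\<^sub>R a \<in> snd c ` fst c"
      have "e + t *\<^sub>R b \<in> V" using y(3) ab(3) atlas_model[OF M] by (simp add: subspace_add subspace_scale)
      then show "fst (?g t) = ic c (y + t *\<^sub>R a)" unfolding c(2) y(1) ab(1) using ic_ctc[OF c(1) t] by simp
    qed
    from velocity_cong[OF this, of M] have "velocity M (\<lambda>t. fst (?g t)) = cv M c y a"
      using coord_vec_cv[OF M c(1) y(2) ab(2)] unfolding coord_vec_def ic_def[symmetric] by simp
    ultimately have "canonical_1form M (ic k z) (coord_vec TM k z w) = cov c (ic c y) e (cv M c y a)"
      unfolding canonical_1form_def coord_vec_def ic_def[symmetric] g0 by (simp add: icz)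
    also have "\<dots> = e \<bullet> a"
      using cv_tangent[OF M c(1) p ab(2)] chart_diff_cv[OF M c(1) p ab(2)] chart_of_ic[OF y(2)] by (simp add: cov_def)
    finally show ?thesis unfolding coef1_def ic_def[symmetric] by (simp add: y(1))
  qed
  then show "smooth_on (snd k ` fst k) (coef1 TM (canonical_1form M) k w)"
    by (intro smooth_on_cong[OF smooth_on_inner[OF smooth_on_linear[OF bounded_linear_snd] smooth_on_const[of _ a]]]) simp
qed

end

section \<open>Lie groups\<close>

locale lie =
  fixes G :: "'g monoid" (structure) and M :: "('g, 'e::euclidean_space) mfd"
  assumes lie: "lie_group G M"
begin

sublocale group G using lie unfolding lie_group_def by blast

lemma M_manifold: "manifold M" using lie unfolding lie_group_def by blast

lemma Ma: "atlas M" using M_manifold manifold_iff by blast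

lemma points_M: "points M = carrier G" using lie unfolding lie_group_def by blast

lemma smooth_at_carrier: "atlas A \<Longrightarrow> smooth_at A M f p \<Longrightarrow> f p \<in> carrier G"
  using smooth_at_points(2)[of A M f p] Ma points_M by simp

lemma smooth_at_mult:
  assumes A: "atlas A" and f: "smooth_at A M f p" and g: "smooth_at A M g p"
  shows "smooth_at A M (\<lambda>x. f x \<otimes> g x) p"
proof -
  have "smooth_map (prod_mfd M M) M (\<lambda>(g, h). g \<otimes> h)" using lie unfolding lie_group_def by blast
  then have "smooth_at (prod_mfd M M) M (\<lambda>(g, h). g \<otimes> h) (f p, g p)"
    unfolding smooth_map_iff[OF atlas_prod[OF Ma Ma] Ma]
    using smooth_at_points(2)[OF A Ma f] smooth_at_points(2)[OF A Ma g] by (simp add: prod_mfd_simps)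
  from smooth_at_compose[OF A atlas_prod[OF Ma Ma] Ma smooth_at_Pair[OF Ma Ma A f g] this]
  show ?thesis by simp
qed

lemma smooth_at_inv:
  assumes A: "atlas A" and f: "smooth_at A M f p"
  shows "smooth_at A M (\<lambda>x. inv (f x)) p"
proof -
  have "smooth_map M M (\<lambda>g. inv g)" using lie unfolding lie_group_def by blast
  then have "smooth_at M M (\<lambda>g. inv g) (f p)"
    unfolding smooth_map_iff[OF Ma Ma] using smooth_at_points(2)[OF A Ma f] by blast
  then show ?thesis by (rule smooth_at_compose[OF A Ma Ma f])
qed

lemma smooth_at_M_const: "atlas A \<Longrightarrow> p \<in> points A \<Longrightarrow> g \<in> carrier G \<Longrightarrow> smooth_at A M (\<lambda>x. g) p"
  by (rule smooth_at_const[OF _ Ma]) (simp_all add: points_M)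

lemma smooth_at_M_id: "g \<in> carrier G \<Longrightarrow> smooth_at M M (\<lambda>x. x) g"
  by (rule smooth_at_id[OF Ma]) (simp add: points_M)

lemma smooth_left: "g \<in> carrier G \<Longrightarrow> h \<in> carrier G \<Longrightarrow> smooth_at M M (\<lambda>x. g \<otimes> x) h"
  by (intro smooth_at_mult[OF Ma] smooth_at_M_const[OF Ma] smooth_at_M_id) (simp_all add: points_M)

lemma smooth_right: "g \<in> carrier G \<Longrightarrow> h \<in> carrier G \<Longrightarrow> smooth_at M M (\<lambda>x. x \<otimes> g) h"
  by (intro smooth_at_mult[OF Ma] smooth_at_M_const[OF Ma] smooth_at_M_id) (simp_all add: points_M)

lemma smooth_conj: "g \<in> carrier G \<Longrightarrow> h \<in> carrier G \<Longrightarrow> smooth_at M M (\<lambda>x. g \<otimes> x \<otimes> inv g) h"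
  by (intro smooth_at_mult[OF Ma] smooth_at_M_const[OF Ma] smooth_at_M_id) (simp_all add: points_M)

abbreviation "\<gg> \<equiv> lie_algebra G M"

lemma push_carrier_cong:
  assumes "smooth_at M M F g" "v \<in> tangent_space M g" "\<And>x. x \<in> carrier G \<Longrightarrow> F x = F' x"
  shows "push M M F g v = push M M F' g v"
proof (rule push_cong[OF Ma Ma assms(1,2) openin_points[OF Ma]])
  show "g \<in> points M" by (rule smooth_at_points(1)[OF Ma Ma assms(1)])
qed (simp add: assms(3) points_M)

lemma tangent_carrier: "v \<in> tangent_space M g \<Longrightarrow> g \<in> carrier G"
  using tangent_points[OF Ma] points_M by blast

text \<open>The right invariant Maurer-Cartan form, with values in the Lie algebra.\<close>

definition rho :: "'g \<Rightarrow> 'g tvec \<Rightarrow> 'g tvec" where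
  "rho g v = push M M (\<lambda>h. h \<otimes> inv g) g v"

lemma rho_in:
  assumes v: "v \<in> tangent_space M g" shows "rho g v \<in> \<gg>"
proof -
  have g: "g \<in> carrier G" using tangent_carrier[OF v] .
  show ?thesis using push_tangent[OF Ma Ma smooth_right[of "inv g" g] v] g unfolding rho_def by simp
qed

lemma rho_velocity:
  assumes "smooth_at EU M \<gamma> (0::real)"
  shows "rho (\<gamma> 0) (velocity M \<gamma>) = velocity M (\<lambda>t. \<gamma> t \<otimes> inv (\<gamma> 0))"
proof -
  have g: "\<gamma> 0 \<in> carrier G" by (rule smooth_at_carrier[OF atlas_EU assms])
  show ?thesis unfolding rho_def
    by (rule push_velocity[OF Ma Ma]) (use g in \<open>simp add: smooth_right\<close>)
qed

lemma Ad_in: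
  assumes g: "g \<in> carrier G" and \<xi>: "\<xi> \<in> \<gg>" shows "Ad G M g \<xi> \<in> \<gg>"
  using push_tangent[OF Ma Ma smooth_conj[OF g one_closed] \<xi>] g unfolding Ad_def by simp

lemma Ad_lincomb: "Ad G M g (lincomb a u b v) = lincomb a (Ad G M g u) b (Ad G M g v)"
  unfolding Ad_def by (rule push_lincomb)

lemma Ad_velocity:
  assumes g: "g \<in> carrier G" and \<gamma>: "\<gamma> 0 = \<one>"
  shows "Ad G M g (velocity M \<gamma>) = velocity M (\<lambda>t. g \<otimes> \<gamma> t \<otimes> inv g)"
  unfolding Ad_def using push_velocity[OF Ma Ma, of "\<lambda>h. g \<otimes> h \<otimes> inv g" \<gamma>] smooth_conj[OF g] \<gamma> by simp

lemma Ad_mult: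
  assumes g: "g \<in> carrier G" and h: "h \<in> carrier G" and \<xi>: "\<xi> \<in> \<gg>"
  shows "Ad G M g (Ad G M h \<xi>) = Ad G M (g \<otimes> h) \<xi>"
proof -
  have one: "h \<otimes> \<one> \<otimes> inv h = \<one>" using h by simp
  have "Ad G M g (Ad G M h \<xi>) = push M M (\<lambda>x. g \<otimes> (h \<otimes> x \<otimes> inv h) \<otimes> inv g) \<one> \<xi>"
    unfolding Ad_def
    using push_push[OF Ma Ma, of "\<lambda>x. g \<otimes> x \<otimes> inv g" "\<lambda>x. h \<otimes> x \<otimes> inv h" \<one> M \<xi>] smooth_conj[OF g one_closed]
    by (simp only: one)
  also have "\<dots> = Ad G M (g \<otimes> h) \<xi>"
    unfolding Ad_def
  proof (rule push_carrier_cong[OF _ \<xi>])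
    show "smooth_at M M (\<lambda>x. g \<otimes> (h \<otimes> x \<otimes> inv h) \<otimes> inv g) \<one>"
      by (intro smooth_at_mult[OF Ma] smooth_at_M_const[OF Ma] smooth_at_M_id) (simp_all add: points_M g h)
  qed (simp add: m_assoc inv_mult_group g h)
  finally show ?thesis .
qed

lemma Ad_one: "\<xi> \<in> \<gg> \<Longrightarrow> Ad G M \<one> \<xi> = \<xi>"
  unfolding Ad_def
  using push_carrier_cong[of "\<lambda>h. \<one> \<otimes> h \<otimes> inv \<one>" \<one> \<xi> "\<lambda>x. x"] smooth_conj[OF one_closed one_closed] push_id[OF Ma]
  by simp

lemma Ad_star_apply: "\<xi> \<in> \<gg> \<Longrightarrow> Ad_star G M g \<nu> \<xi> = \<nu> (Ad G M g \<xi>)"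
  by (simp add: Ad_star_def)

lemma Ad_star_mult:
  assumes "g \<in> carrier G" "h \<in> carrier G"
  shows "Ad_star G M (g \<otimes> h) \<nu> = Ad_star G M h (Ad_star G M g \<nu>)"
  unfolding Ad_star_def using Ad_in[OF assms(2)] Ad_mult[OF assms] by auto

lemma Ad_star_rscale: "Ad_star G M g (rscale r \<nu>) = rscale r (Ad_star G M g \<nu>)"
  unfolding Ad_star_def rscale_def by auto

lemma Ad_star_cotangent:
  assumes "g \<in> carrier G" "\<nu> \<in> cotangent_space M \<one>"
  shows "Ad_star G M g \<nu> \<in> cotangent_space M \<one>"
  using assms cotangentD(1)[OF Ma assms(2)] Ad_in[OF assms(1)] tangent_lincomb[OF Ma]
  unfolding cotangent_space_def Ad_star_def by (auto simp: Ad_lincomb)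

text \<open>Both sides are the push-forward by
  \<open>h \<mapsto> k \<otimes> h \<otimes> inv (k \<otimes> g)\<close>: in the right
  trivialisation, left translations act by \<open>Ad\<close>.\<close>

lemma rho_left:
  assumes k: "k \<in> carrier G" and v: "v \<in> tangent_space M g"
  shows "rho (k \<otimes> g) (push M M (\<lambda>h. k \<otimes> h) g v) = Ad G M k (rho g v)"
proof -
  have g: "g \<in> carrier G" using tangent_carrier[OF v] .
  have 1: "rho (k \<otimes> g) (push M M (\<lambda>h. k \<otimes> h) g v) = push M M (\<lambda>h. k \<otimes> h \<otimes> inv (k \<otimes> g)) g v"
    unfolding rho_def
    by (rule push_push[OF Ma Ma, where F = "\<lambda>h. k \<otimes> h"]) (simp add: smooth_right k g)
  have "Ad G M k (rho g v) = push M M (\<lambda>h. k \<otimes> (h \<otimes> inv g) \<otimes> inv k) g v"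
    unfolding rho_def Ad_def
    using push_push[OF Ma Ma, of "\<lambda>x. k \<otimes> x \<otimes> inv k" "\<lambda>h. h \<otimes> inv g" g M v] smooth_conj[OF k] g by simp
  also have "\<dots> = push M M (\<lambda>h. k \<otimes> h \<otimes> inv (k \<otimes> g)) g v"
  proof (rule push_carrier_cong[OF _ v])
    show "smooth_at M M (\<lambda>h. k \<otimes> (h \<otimes> inv g) \<otimes> inv k) g"
      by (intro smooth_at_mult[OF Ma] smooth_at_M_const[OF Ma] smooth_at_M_id) (simp_all add: points_M g k)
  qed (simp add: m_assoc inv_mult_group g k)
  finally show ?thesis using 1 by simp
qed

text \<open>All curves of the family start at the unit, so one chart there suffices:
  \<open>\<nu>\<close> is the inner product with a fixed vector, and only the coordinate velocity
  varies.\<close>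

lemma smooth_at_functional:
  assumes A: "atlas A" and \<nu>: "\<nu> \<in> cotangent_space M \<one>"
    and F: "smooth_at (prod_mfd (flat UNIV (UNIV::real set)) A) M F (0, p)"
    and W: "openin (mtop A) W" "p \<in> W"
    and F1: "\<And>x. x \<in> W \<Longrightarrow> F (0, x) = \<one>" "\<And>x. x \<in> W \<Longrightarrow> smooth_at EU M (\<lambda>t. F (t, x)) 0"
  shows "smooth_at A EU (\<lambda>x. \<nu> (velocity M (\<lambda>t. F (t, x)))) p"
proof -
  have "\<one> \<in> points M" by (simp add: points_M)
  then obtain c where c: "c \<in> charts M" "\<one> \<in> fst c" using atlas_cover[OF Ma] by blast
  have p: "p \<in> points A" using W openin_mtop[OF A] by blast
  have "smooth_at A EU (\<lambda>x. chart_diff (snd c) (velocity M (\<lambda>t. F (t, x)))) p"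
    by (rule smooth_at_velocity[OF A Ma F c(1)]) (simp add: F1(1)[OF W(2)] c(2))
  then have "smooth_at A EU (\<lambda>x. cf M c \<one> \<nu> \<bullet> chart_diff (snd c) (velocity M (\<lambda>t. F (t, x)))) p"
    by (rule smooth_at_inner[OF A smooth_at_EU_const[OF A p]])
  then show ?thesis
  proof (rule smooth_at_cong[OF A _ W])
    fix x assume x: "x \<in> W"
    have "velocity M (\<lambda>t. F (t, x)) \<in> tangent_space M \<one>"
      using velocity_in_tangent[OF Ma F1(2)[OF x]] F1(1)[OF x] by simp
    then show "cf M c \<one> \<nu> \<bullet> chart_diff (snd c) (velocity M (\<lambda>t. F (t, x))) = \<nu> (velocity M (\<lambda>t. F (t, x)))"
      using cf_eq(2)[OF Ma c \<nu>] by simp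
  qed
qed

end

locale lie_exp = lie G M for G :: "'g monoid" (structure) and M :: "('g, 'e::euclidean_space) mfd" +
  fixes ex :: "'g tvec \<Rightarrow> 'g"
  assumes ex: "exponential_map G M ex"
begin

abbreviation "e \<xi> t \<equiv> ex (rscale t \<xi>)"

context
  fixes \<xi> assumes \<xi>: "\<xi> \<in> \<gg>"
begin

lemma e_smooth: "smooth_at EU M (e \<xi>) t"
  using ex \<xi> smooth_map_iff[OF atlas_EU Ma, of "e \<xi>"] unfolding exponential_map_def euclid_eq_flat by auto

lemma e_carrier [simp]: "e \<xi> t \<in> carrier G"
  using smooth_at_carrier[OF atlas_EU e_smooth] .

lemma e_add: "e \<xi> (s + t) = e \<xi> s \<otimes> e \<xi> t"
  using ex \<xi> unfolding exponential_map_def by blast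

lemma e_0 [simp]: "e \<xi> 0 = \<one>"
  using e_add[of 0 0] l_cancel_one[OF e_carrier e_carrier, of 0 0] by simp

lemma e_velocity: "velocity M (e \<xi>) = \<xi>"
  using ex \<xi> unfolding exponential_map_def by blast

lemma e_inv: "inv (e \<xi> t) = e \<xi> (- t)"
  by (rule inv_equality) (simp_all add: e_add[symmetric])

lemma smooth_at_e:
  assumes A: "atlas A" and f: "smooth_at A EU f p"
  shows "smooth_at A M (\<lambda>x. e \<xi> (f x)) p"
  by (rule smooth_at_compose[OF A atlas_EU Ma f e_smooth])

end

text \<open>A concrete curve for every tangent vector: translate the vector to the unit from the
  right, exponentiate, and translate back.\<close>

lemma vel_right:
  assumes v: "v \<in> tangent_space M g"
  shows "velocity M (\<lambda>t. e (rho g v) t \<otimes> g) = v"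
proof -
  have g: "g \<in> carrier G" using tangent_carrier[OF v] .
  note \<xi> = rho_in[OF v]
  have "velocity M (\<lambda>t. e (rho g v) t \<otimes> g) = push M M (\<lambda>h. h \<otimes> g) \<one> (velocity M (e (rho g v)))"
    using push_velocity[OF Ma Ma, of "\<lambda>h. h \<otimes> g" "e (rho g v)"] smooth_right[OF g] e_0[OF \<xi>] by simp
  also have "\<dots> = push M M (\<lambda>h. h \<otimes> g) \<one> (push M M (\<lambda>h. h \<otimes> inv g) g v)"
    unfolding e_velocity[OF \<xi>] unfolding rho_def ..
  also have "\<dots> = push M M (\<lambda>h. h \<otimes> inv g \<otimes> g) g v"
    using push_push[OF Ma Ma, of "\<lambda>h. h \<otimes> g" "\<lambda>h. h \<otimes> inv g" g M v] smooth_right[OF g] g by simp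
  also have "\<dots> = push M M (\<lambda>x. x) g v"
    by (rule push_carrier_cong[OF smooth_at_M_id[OF g] v, symmetric]) (simp add: m_assoc g)
  also have "\<dots> = v" by (rule push_id[OF Ma v])
  finally show ?thesis .
qed

lemma vel_left:
  assumes v: "v \<in> tangent_space M g"
  obtains \<xi> where "\<xi> \<in> \<gg>" "velocity M (\<lambda>t. g \<otimes> e \<xi> t) = v"
proof -
  have g: "g \<in> carrier G" using tangent_carrier[OF v] .
  let ?\<xi> = "push M M (\<lambda>h. inv g \<otimes> h) g v"
  have \<xi>: "?\<xi> \<in> \<gg>" using push_tangent[OF Ma Ma smooth_left[of "inv g" g] v] g by simp
  have "velocity M (\<lambda>t. g \<otimes> e ?\<xi> t) = push M M (\<lambda>h. g \<otimes> h) \<one> (velocity M (e ?\<xi>))"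
    using push_velocity[OF Ma Ma, of "\<lambda>h. g \<otimes> h" "e ?\<xi>"] smooth_left[OF g] e_0[OF \<xi>] by simp
  also have "\<dots> = push M M (\<lambda>h. g \<otimes> (inv g \<otimes> h)) g v"
    unfolding e_velocity[OF \<xi>]
    using push_push[OF Ma Ma, of "\<lambda>h. g \<otimes> h" "\<lambda>h. inv g \<otimes> h" g M v] smooth_left[OF g] g by simp
  also have "\<dots> = push M M (\<lambda>x. x) g v"
    by (rule push_carrier_cong[OF smooth_at_M_id[OF g] v, symmetric]) (simp add: m_assoc[symmetric] g)
  also have "\<dots> = v" by (rule push_id[OF Ma v])
  finally show ?thesis by (rule that[OF \<xi>])
qed

lemma Ad_e: "g \<in> carrier G \<Longrightarrow> \<xi> \<in> \<gg> \<Longrightarrow> Ad G M g \<xi> = velocity M (\<lambda>t. g \<otimes> e \<xi> t \<otimes> inv g)"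
  using Ad_velocity[of g "e \<xi>"] e_velocity[of \<xi>] by simp

lemma velocity_apply_deriv: "smooth_near M (\<gamma> 0) f \<Longrightarrow> velocity M \<gamma> f = deriv (\<lambda>t. f (\<gamma> t)) 0"
  by (simp add: velocity_def)

lemma left_invariant_apply:
  assumes g: "g \<in> carrier G" and \<xi>: "\<xi> \<in> \<gg>" and f: "smooth_near M g f"
  shows "left_invariant_field G M \<xi> g f = deriv (\<lambda>t. f (g \<otimes> e \<xi> t)) 0"
proof -
  have "left_invariant_field G M \<xi> g = velocity M (\<lambda>t. g \<otimes> e \<xi> t)"
    unfolding left_invariant_field_def
    using push_velocity[OF Ma Ma, of "\<lambda>h. g \<otimes> h" "e \<xi>"] smooth_left[OF g] e_0[OF \<xi>] e_velocity[OF \<xi>] by simp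
  then show ?thesis using f g e_0[OF \<xi>] by (simp add: velocity_def)
qed

text \<open>\<open>lie_bracket\<close> applies a tangent vector to this function of
  \<open>g\<close>, and tangent vectors are 0 by convention on functions that are not smooth near
  the base point. Without smoothness here, the bracket could not be computed by
  differentiation.\<close>

lemma left_invariant_smooth:
  assumes \<xi>: "\<xi> \<in> \<gg>" and f: "smooth_near M \<one> f"
  shows "smooth_near M \<one> (\<lambda>g. left_invariant_field G M \<xi> g f)"
proof -
  let ?R = "flat UNIV (UNIV::real set)"
  let ?P = "prod_mfd ?R M"
  have P: "atlas ?P" by (rule atlas_prod[OF atlas_EU Ma])
  obtain W where W: "openin (mtop M) W" "\<one> \<in> W" "\<And>x. x \<in> W \<Longrightarrow> smooth_at M EU f x"
    using smooth_at_nhd[OF Ma f[unfolded smooth_near_iff[OF Ma]]] by blast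
  have WG: "x \<in> carrier G" if "x \<in> W" for x using W(1) that openin_mtop[OF Ma] points_M by blast
  have m: "smooth_at ?P M (\<lambda>x. snd x \<otimes> e \<xi> (fst x)) (0, g)" if "g \<in> carrier G" for g
    using that by (intro smooth_at_mult[OF P] smooth_at_e[OF \<xi> P] smooth_at_snd[OF atlas_EU Ma] smooth_at_fst[OF atlas_EU Ma])
      (simp_all add: points_M)
  have F: "smooth_at ?P EU (\<lambda>x. f (snd x \<otimes> e \<xi> (fst x))) (0, g)" if "g \<in> W" for g
    by (rule smooth_at_compose[OF P Ma atlas_EU m[OF WG[OF that]]]) (use W(3)[OF that] WG[OF that] \<xi> in simp)
  have "smooth_at M EU (\<lambda>g. chart_diff (\<lambda>x::real. x) (velocity EU (\<lambda>t. f (g \<otimes> e \<xi> t)))) \<one>"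
    using smooth_at_velocity[OF Ma atlas_EU F[OF W(2)], of "(UNIV, \<lambda>x. x)"] by simp
  then have "smooth_at M EU (\<lambda>g. left_invariant_field G M \<xi> g f) \<one>"
  proof (rule smooth_at_cong[OF Ma _ W(1,2)])
    fix g assume g: "g \<in> W"
    have "smooth_at ?R ?P (\<lambda>t. (t, g)) 0"
      by (rule smooth_at_Pair[OF atlas_EU Ma atlas_EU smooth_at_id[OF atlas_EU] smooth_at_M_const[OF atlas_EU]])
        (simp_all add: WG[OF g])
    from smooth_at_compose[OF atlas_EU P atlas_EU this F[OF g]]
    have "smooth_at ?R EU (\<lambda>t. f (g \<otimes> e \<xi> t)) 0" by simp
    then obtain a where a: "((\<lambda>t. f (g \<otimes> e \<xi> t)) has_vector_derivative a) (at 0)"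
      using curve_chart[OF atlas_EU, of "\<lambda>t. f (g \<otimes> e \<xi> t)" "(UNIV, \<lambda>x. x)"] by auto
    have "left_invariant_field G M \<xi> g f = a"
      using left_invariant_apply[OF WG[OF g] \<xi>] W(3)[OF g] a
      by (simp add: smooth_near_iff[OF Ma] has_real_derivative_iff_has_vector_derivative[symmetric] DERIV_imp_deriv)
    then show "chart_diff (\<lambda>x::real. x) (velocity EU (\<lambda>t. f (g \<otimes> e \<xi> t))) = left_invariant_field G M \<xi> g f"
      using chart_diff_real[OF a] by simp
  qed
  then show ?thesis unfolding smooth_near_iff[OF Ma] .
qed

text \<open>Compare mixed second derivatives of \<open>f (exp s\<xi> exp t\<eta> exp u\<xi>)\<close> at 0.\<close>

lemma bracket_derivative_apply:
  assumes \<xi>: "\<xi> \<in> \<gg>" and \<eta>: "\<eta> \<in> \<gg>" and f: "smooth_near M \<one> f"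
  shows "((\<lambda>s. Ad G M (e \<xi> s) \<eta> f) has_vector_derivative lie_bracket G M \<xi> \<eta> f) (at 0)"
proof -
  let ?E = "flat UNIV (UNIV :: (real \<times> real \<times> real) set)"
  define \<Phi> where "\<Phi> x = f (e \<xi> (fst x) \<otimes> e \<eta> (fst (snd x)) \<otimes> e \<xi> (snd (snd x)))" for x :: "real \<times> real \<times> real"
  have lin: "smooth_at ?E EU (\<lambda>x. fst x) z" "smooth_at ?E EU (\<lambda>x. fst (snd x)) z" "smooth_at ?E EU (\<lambda>x. snd (snd x)) z" for z
    using smooth_at_linear[OF atlas_EU smooth_at_id[OF atlas_EU], of z]
      bounded_linear_fst bounded_linear_compose[OF bounded_linear_fst bounded_linear_snd]
      bounded_linear_compose[OF bounded_linear_snd bounded_linear_snd] by auto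
  have "smooth_at ?E EU \<Phi> 0" unfolding \<Phi>_def
  proof (rule smooth_at_compose[OF atlas_EU Ma atlas_EU])
    show "smooth_at ?E M (\<lambda>x. e \<xi> (fst x) \<otimes> e \<eta> (fst (snd x)) \<otimes> e \<xi> (snd (snd x))) 0"
      by (intro smooth_at_mult[OF atlas_EU] smooth_at_e[OF \<xi> atlas_EU] smooth_at_e[OF \<eta> atlas_EU] lin)
    show "smooth_at M EU f (e \<xi> (fst 0) \<otimes> e \<eta> (fst (snd 0)) \<otimes> e \<xi> (snd (snd (0 :: real \<times> real \<times> real))))"
      using f \<xi> \<eta> by (simp add: smooth_near_iff[OF Ma])
  qed
  then obtain T where T: "open T" "0 \<in> T" "smooth_on T \<Phi>"
    using smooth_at_flatD[OF subspace_UNIV _ atlas_EU, of UNIV \<Phi> 0 "(UNIV, \<lambda>x. x)"] by auto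
  interpret \<Phi>: smooth_fn UNIV T \<Phi> using T by unfold_locales auto
  define a b c where "a = (1::real, 0::real, 0::real)" and "b = (0::real, 1::real, 0::real)" and "c = (0::real, 0::real, 1::real)"
  let ?D = "\<lambda>u w. dV UNIV (\<lambda>x. dV UNIV \<Phi> x u) 0 w"
  have d2: "smooth_fn UNIV T (\<lambda>x. dV UNIV \<Phi> x u)" for u
    using \<Phi>.V \<Phi>.S \<Phi>.dV_smooth by unfold_locales
  have ev: "eventually (\<lambda>s. s *\<^sub>R w \<in> T) (nhds 0)" for w
    using continuous_open_preimage[of UNIV "\<lambda>s::real. s *\<^sub>R w" T] T(1,2) unfolding eventually_nhds
    by (intro exI[of _ "(\<lambda>s::real. s *\<^sub>R w) -` T"]) (auto intro!: continuous_intros)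
  have evW: "eventually (\<lambda>s. smooth_near M (e \<zeta> s) f) (nhds 0)" if \<zeta>: "\<zeta> \<in> \<gg>" for \<zeta>
  proof -
    obtain W where W: "openin (mtop M) W" "\<one> \<in> W" "\<And>x. x \<in> W \<Longrightarrow> smooth_at M EU f x"
      using smooth_at_nhd[OF Ma f[unfolded smooth_near_iff[OF Ma]]] by blast
    have "openin (mtop (flat UNIV UNIV)) (UNIV \<inter> e \<zeta> -` W)"
      by (rule smooth_at_preimage_open[OF atlas_EU Ma _ e_smooth[OF \<zeta>] W(1)])
        (simp add: openin_flat)
    then have "open (e \<zeta> -` W)" by (simp add: openin_flat)
    then show ?thesis unfolding eventually_nhds smooth_near_iff[OF Ma]
      using W(2,3) e_0[OF \<zeta>] by (intro exI[of _ "e \<zeta> -` W"]) auto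
  qed
  have partial: "deriv (\<lambda>t. \<Phi> (x + t *\<^sub>R u)) 0 = dV UNIV \<Phi> x u" if "x \<in> T" for x u
    using \<Phi>.dV_line[OF that, of u] unfolding has_real_derivative_iff_has_vector_derivative[symmetric]
    by (simp add: DERIV_imp_deriv)
  have second: "((\<lambda>s. dV UNIV \<Phi> (s *\<^sub>R w) u) has_vector_derivative ?D u w) (at 0)" for u w
    using smooth_fn.dV_line[OF d2 T(2), of w] by simp
  have one: "\<xi> (\<lambda>g. left_invariant_field G M \<eta> g f) = ?D b a"
  proof -
    have "\<xi> (\<lambda>g. left_invariant_field G M \<eta> g f) = deriv (\<lambda>s. left_invariant_field G M \<eta> (e \<xi> s) f) 0"
      using velocity_apply_deriv[of "e \<xi>" "\<lambda>g. left_invariant_field G M \<eta> g f"] left_invariant_smooth[OF \<eta> f]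
      by (simp add: e_velocity[OF \<xi>] e_0[OF \<xi>])
    also have "\<dots> = deriv (\<lambda>s. dV UNIV \<Phi> (s *\<^sub>R a) b) 0"
    proof (rule deriv_cong_ev[OF eventually_mono[OF eventually_conj[OF ev[of a] evW[OF \<xi>]]]])
      fix s assume s: "s *\<^sub>R a \<in> T \<and> smooth_near M (e \<xi> s) f"
      show "left_invariant_field G M \<eta> (e \<xi> s) f = dV UNIV \<Phi> (s *\<^sub>R a) b"
        using left_invariant_apply[OF e_carrier[OF \<xi>] \<eta>] s partial[of "s *\<^sub>R a" b] e_carrier[OF \<eta>] \<xi>
        by (simp add: \<Phi>_def a_def b_def)
    qed simp
    also have "\<dots> = ?D b a"
      using second[where u = b and w = a] unfolding has_real_derivative_iff_has_vector_derivative[symmetric]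
      by (simp add: DERIV_imp_deriv)
    finally show ?thesis .
  qed
  have two: "\<eta> (\<lambda>g. left_invariant_field G M \<xi> g f) = ?D c b"
  proof -
    have "\<eta> (\<lambda>g. left_invariant_field G M \<xi> g f) = deriv (\<lambda>s. left_invariant_field G M \<xi> (e \<eta> s) f) 0"
      using velocity_apply_deriv[of "e \<eta>" "\<lambda>g. left_invariant_field G M \<xi> g f"] left_invariant_smooth[OF \<xi> f]
      by (simp add: e_velocity[OF \<eta>] e_0[OF \<eta>])
    also have "\<dots> = deriv (\<lambda>s. dV UNIV \<Phi> (s *\<^sub>R b) c) 0"
    proof (rule deriv_cong_ev[OF eventually_mono[OF eventually_conj[OF ev[of b] evW[OF \<eta>]]]])
      fix s assume s: "s *\<^sub>R b \<in> T \<and> smooth_near M (e \<eta> s) f"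
      show "left_invariant_field G M \<xi> (e \<eta> s) f = dV UNIV \<Phi> (s *\<^sub>R b) c"
        using left_invariant_apply[OF e_carrier[OF \<eta>] \<xi>] s partial[of "s *\<^sub>R b" c] e_carrier[OF \<eta>] \<xi>
        by (simp add: \<Phi>_def b_def c_def)
    qed simp
    also have "\<dots> = ?D c b"
      using second[where u = c and w = b] unfolding has_real_derivative_iff_has_vector_derivative[symmetric]
      by (simp add: DERIV_imp_deriv)
    finally show ?thesis .
  qed
  \<comment> \<open>Along \<open>s\<close> times \<open>a - c\<close> the outer factors are the
    exponentials of \<open>s\<xi>\<close> and \<open>-s\<xi>\<close>, so this mixed derivative is
    the derivative of \<open>Ad\<close>. Linearity in the direction and symmetry of second
    derivatives turn it into the commutator.\<close>
  have "?D b (a - c) = ?D b a - ?D b c"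
    by (rule linear_diff[OF smooth_fn.linear_dV[OF d2 T(2)]])
  also have "?D b c = ?D c b" by (rule dV_symmetric[OF \<Phi>.smooth_fn_axioms T(2)]) simp_all
  finally have br: "?D b (a - c) = lie_bracket G M \<xi> \<eta> f"
    using f one two by (simp add: lie_bracket_def)
  obtain Z where Z: "open Z" "0 \<in> Z" "\<And>s. s \<in> Z \<Longrightarrow> s *\<^sub>R (a - c) \<in> T"
    using ev[of "a - c"] unfolding eventually_nhds by blast
  have "Ad G M (e \<xi> s) \<eta> f = dV UNIV \<Phi> (s *\<^sub>R (a - c)) b" if s: "s \<in> Z" for s
  proof -
    have "Ad G M (e \<xi> s) \<eta> f = deriv (\<lambda>t. f (e \<xi> s \<otimes> e \<eta> t \<otimes> inv (e \<xi> s))) 0"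
      using Ad_e[OF e_carrier[OF \<xi>] \<eta>, of s] f \<xi> \<eta>
        velocity_apply_deriv[of "\<lambda>t. e \<xi> s \<otimes> e \<eta> t \<otimes> inv (e \<xi> s)" f] by simp
    also have "\<dots> = deriv (\<lambda>t. \<Phi> (s *\<^sub>R (a - c) + t *\<^sub>R b)) 0"
      by (simp add: \<Phi>_def a_def b_def c_def e_inv[OF \<xi>])
    finally show ?thesis using partial[OF Z(3)[OF s]] by simp
  qed
  then show ?thesis
    using has_vector_derivative_transform_within_open[OF second[where u = b and w = "a - c"] Z(1,2)] br by simp
qed

text \<open>\<open>bracket_derivative_apply\<close> differentiates one function at a time. Applied
  to the chart components, it gives the derivative \<open>w\<close> of the coordinate curve of
  \<open>Ad\<close>, and comparison on all other functions shows that the bracket is the coordinate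
  vector of \<open>w\<close>. So it is a tangent vector, and covectors, being inner products in
  coordinates, can be differentiated along the curve.\<close>

lemma bracket_derivative:
  assumes \<xi>: "\<xi> \<in> \<gg>" and \<eta>: "\<eta> \<in> \<gg>"
  shows "lie_bracket G M \<xi> \<eta> \<in> \<gg>"
    "\<nu> \<in> cotangent_space M \<one> \<Longrightarrow>
      ((\<lambda>s. \<nu> (Ad G M (e \<xi> s) \<eta>)) has_vector_derivative \<nu> (lie_bracket G M \<xi> \<eta>)) (at 0)"
proof -
  have "\<one> \<in> points M" by (simp add: points_M)
  then obtain c where c: "c \<in> charts M" "\<one> \<in> fst c" using atlas_cover[OF Ma] by blast
  let ?A = "\<lambda>s. Ad G M (e \<xi> s) \<eta>"
  have A: "?A s \<in> \<gg>" for s by (rule Ad_in[OF e_carrier[OF \<xi>] \<eta>])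
  define w where "w = chart_diff (snd c) (lie_bracket G M \<xi> \<eta>)"
  have "smooth_at M EU (snd c) \<one>"
    by (rule smooth_at_EU_cod[OF Ma smooth_at_chart[OF Ma c] chart_points[OF Ma c]])
  then have near: "smooth_near M \<one> (\<lambda>x. snd c x \<bullet> i)" for i
    using smooth_at_linear[OF Ma _ bounded_linear_inner_left] smooth_near_iff[OF Ma] by blast
  have der: "((\<lambda>s. chart_diff (snd c) (?A s)) has_vector_derivative w) (at 0)"
    unfolding chart_diff_def w_def
    by (rule has_vector_derivative_sum)
      (rule bounded_linear.has_vector_derivative[OF bounded_linear_scaleR_left bracket_derivative_apply[OF \<xi> \<eta> near]])
  \<comment> \<open>The coordinate curve stays in the model space, so projecting changes neither the
    curve nor its derivative \<open>w\<close>, and \<open>w\<close> lies in the model space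
    too.\<close>
  have pm: "proj (model M) (chart_diff (snd c) (?A s)) = chart_diff (snd c) (?A s)" for s
    by (rule proj_id[OF atlas_model[OF Ma] tangent_cv(1)[OF Ma c A]])
  have "((\<lambda>s. proj (model M) (chart_diff (snd c) (?A s))) has_vector_derivative proj (model M) w) (at 0)"
    by (rule bounded_linear.has_vector_derivative[OF bounded_linear_proj der])
  then have "proj (model M) w = w" unfolding pm using der by (rule vector_derivative_unique_at)
  then have wV: "w \<in> model M" using proj_in[OF atlas_model[OF Ma], of w] by simp
  have eq: "lie_bracket G M \<xi> \<eta> = cv M c (snd c \<one>) w"
  proof (rule ext)
    fix f
    show "lie_bracket G M \<xi> \<eta> f = cv M c (snd c \<one>) w f"
    proof (cases "smooth_near M \<one> f")
      case True
      obtain S where S: "smooth_fn (model M) S (\<lambda>y. f (ic c y))" "snd c \<one> \<in> S"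
        using near_rep[OF Ma True c] by blast
      let ?L = "dV (model M) (\<lambda>z. f (ic c z)) (snd c \<one>)"
      have bl: "bounded_linear ?L" using smooth_fn.linear_dV[OF S] linear_conv_bounded_linear by blast
      have "((\<lambda>s. ?L (chart_diff (snd c) (?A s))) has_vector_derivative ?L w) (at 0)"
        by (rule bounded_linear.has_vector_derivative[OF bl der])
      moreover have "?L (chart_diff (snd c) (?A s)) = ?A s f" for s
      proof -
        have "?A s f = cv M c (snd c \<one>) (chart_diff (snd c) (?A s)) f" unfolding tangent_cv(2)[OF Ma c A] ..
        then show ?thesis using True chart_ic[OF Ma c] by (simp add: cv_def)
      qed
      ultimately have "((\<lambda>s. ?A s f) has_vector_derivative ?L w) (at 0)" by simp
      with bracket_derivative_apply[OF \<xi> \<eta> True] have "lie_bracket G M \<xi> \<eta> f = ?L w"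
        by (rule vector_derivative_unique_at)
      then show ?thesis using True chart_ic[OF Ma c] by (simp add: cv_def)
    qed (simp add: lie_bracket_def cv_def chart_ic[OF Ma c])
  qed
  show in_g: "lie_bracket G M \<xi> \<eta> \<in> \<gg>" unfolding eq by (rule cv_tangent[OF Ma c wV])
  assume \<nu>: "\<nu> \<in> cotangent_space M \<one>"
  have "((\<lambda>s. cf M c \<one> \<nu> \<bullet> chart_diff (snd c) (?A s)) has_vector_derivative cf M c \<one> \<nu> \<bullet> w) (at 0)"
    by (rule bounded_linear.has_vector_derivative[OF bounded_linear_inner_right der])
  then show "((\<lambda>s. \<nu> (?A s)) has_vector_derivative \<nu> (lie_bracket G M \<xi> \<eta>)) (at 0)"
    using cf_eq(2)[OF Ma c \<nu>] A in_g by (simp add: w_def)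
qed

text \<open>Written as a \<open>lincomb\<close>, with a dummy second summand, so that linearity of
  covectors applies as it stands.\<close>

lemma lie_bracket_antisym: "lie_bracket G M \<eta> \<xi> = lincomb (-1) (lie_bracket G M \<xi> \<eta>) 0 (lie_bracket G M \<xi> \<eta>)"
  by (rule ext) (simp add: lie_bracket_def lincomb_def)

lemma rho_push_right:
  assumes g: "g \<in> carrier G" and \<xi>: "\<xi> \<in> \<gg>"
  shows "push M M (\<lambda>h. h \<otimes> g) \<one> \<xi> \<in> tangent_space M g" "rho g (push M M (\<lambda>h. h \<otimes> g) \<one> \<xi>) = \<xi>"
    "push M M (\<lambda>h. h \<otimes> g) \<one> \<xi> = velocity M (\<lambda>t. e \<xi> t \<otimes> g)"
proof -
  show 1: "push M M (\<lambda>h. h \<otimes> g) \<one> \<xi> \<in> tangent_space M g"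
    using push_tangent[OF Ma Ma smooth_right[OF g one_closed] \<xi>] g by simp
  show 2: "push M M (\<lambda>h. h \<otimes> g) \<one> \<xi> = velocity M (\<lambda>t. e \<xi> t \<otimes> g)"
    using push_velocity[OF Ma Ma, of "\<lambda>h. h \<otimes> g" "e \<xi>"] smooth_right[OF g] \<xi> by (simp add: e_velocity)
  have "smooth_at EU M (\<lambda>t. e \<xi> t \<otimes> g) 0"
    by (intro smooth_at_mult[OF atlas_EU] e_smooth[OF \<xi>] smooth_at_M_const[OF atlas_EU]) (simp_all add: g)
  from rho_velocity[OF this] show "rho g (push M M (\<lambda>h. h \<otimes> g) \<one> \<xi>) = \<xi>"
    unfolding 2 using g \<xi> by (simp add: m_assoc e_velocity)
qed

lemma push_right_rho:
  assumes v: "v \<in> tangent_space M g" shows "push M M (\<lambda>h. h \<otimes> g) \<one> (rho g v) = v"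
  using rho_push_right(3)[OF tangent_carrier[OF v] rho_in[OF v]] vel_right[OF v] by simp

end

section \<open>The quotient by the kernel group\<close>

locale ray = lie_exp G M ex for G :: "'g monoid" (structure) and M :: "('g, 'e::euclidean_space) mfd" and ex +
  fixes \<mu> :: "'g cvec" and K :: "'g set" and Q :: "('g set, 'q::euclidean_space) mfd"
  assumes mu: "\<mu> \<in> cotangent_space M \<one>"
    and span_g: "{lincomb 1 \<xi> 1 \<eta> |\<xi> \<eta>. \<xi> \<in> cvec_kernel G M \<mu> \<and> \<eta> \<in> isotropy_algebra G M \<mu>} = lie_algebra G M"
    and kernel: "kernel_group G M \<mu> K"
    and quot: "quotient_manifold M (\<lambda>g. K #> g) Q"
begin

abbreviation "\<pi> \<equiv> \<lambda>g. K #> g"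

section \<open>The subgroup \<open>K\<close> and its cosets\<close>

lemma obtain_N:
  obtains N :: "('g, 'e) mfd" where "lie_group (G\<lparr>carrier := K\<rparr>) N" "smooth_map N M (\<lambda>k. k)"
    "inj_on (push N M (\<lambda>k. k) \<one>) (tangent_space N \<one>)"
    "push N M (\<lambda>k. k) \<one> ` tangent_space N \<one> = isotropy_algebra G M \<mu> \<inter> cvec_kernel G M \<mu>" "\<one> \<in> K"
proof -
  obtain N :: "('g, 'e) mfd" where N: "lie_group (G\<lparr>carrier := K\<rparr>) N" "smooth_map N M (\<lambda>k. k)"
    "\<forall>k\<in>K. inj_on (push N M (\<lambda>k. k) k) (tangent_space N k)"
    "push N M (\<lambda>k. k) \<one> ` tangent_space N \<one> = isotropy_algebra G M \<mu> \<inter> cvec_kernel G M \<mu>"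
    using kernel unfolding kernel_group_def by blast
  have "group (G\<lparr>carrier := K\<rparr>)" using N(1) unfolding lie_group_def by blast
  then have "\<one> \<in> K" using group.is_monoid[of "G\<lparr>carrier := K\<rparr>"] monoid.one_closed[of "G\<lparr>carrier := K\<rparr>"] by simp
  then show ?thesis using that[of N] N by blast
qed

lemma K_isotropy: "K \<subseteq> isotropy_group G M \<mu>"
proof -
  have "subgroup K (G\<lparr>carrier := isotropy_group G M \<mu>\<rparr>)"
    using kernel unfolding kernel_group_def by (intro normal_imp_subgroup) blast
  from subgroup.subset[OF this] show ?thesis by simp
qed

lemma K_carrier: "K \<subseteq> carrier G"
  using K_isotropy unfolding isotropy_group_def by blast

lemma K_subgroup: "subgroup K G"
proof -
  obtain N :: "('g, 'e) mfd" where "lie_group (G\<lparr>carrier := K\<rparr>) N" by (rule obtain_N)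
  then have "group (G\<lparr>carrier := K\<rparr>)" unfolding lie_group_def by blast
  then show ?thesis by (rule group_incl_imp_subgroup[OF K_carrier])
qed

text \<open>The isotropy group is defined by the coadjoint action, which involves
  \<open>inv g\<close>; hence the passage to the inverse of \<open>k\<close>.\<close>

lemma K_Ad_star: "k \<in> K \<Longrightarrow> Ad_star G M k \<mu> = \<mu>"
proof -
  assume k: "k \<in> K"
  then have "inv k \<in> isotropy_group G M \<mu>" using subgroup.m_inv_closed[OF K_subgroup] K_isotropy by blast
  then show ?thesis using k K_carrier by (auto simp: isotropy_group_def)
qed

lemma mu_Ad: "k \<in> K \<Longrightarrow> \<xi> \<in> \<gg> \<Longrightarrow> \<mu> (Ad G M k \<xi>) = \<mu> \<xi>"
  using K_Ad_star Ad_star_apply by metis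

lemma pi_left: "k \<in> K \<Longrightarrow> g \<in> carrier G \<Longrightarrow> \<pi> (k \<otimes> g) = \<pi> g"
  using coset_mult_assoc[OF K_carrier, of k g] coset_join2[OF _ K_subgroup, of k] K_carrier by auto

lemma pi_right: "g \<in> carrier G \<Longrightarrow> h \<in> carrier G \<Longrightarrow> \<pi> g #> h = \<pi> (g \<otimes> h)"
  by (rule coset_mult_assoc[OF K_carrier])

lemma pi_eqE:
  assumes "g \<in> carrier G" "\<pi> g = \<pi> h"
  obtains k where "k \<in> K" "g = k \<otimes> h"
  using rcos_self[OF assms(1) K_subgroup] assms(2) unfolding r_coset_def by blast

lemma pi_mem: "g \<in> carrier G \<Longrightarrow> g \<in> \<pi> g" by (rule rcos_self[OF _ K_subgroup])

lemma mem_pi: "h \<in> \<pi> g \<Longrightarrow> g \<in> carrier G \<Longrightarrow> h \<in> carrier G \<and> \<pi> h = \<pi> g"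
proof -
  assume h: "h \<in> \<pi> g" and g: "g \<in> carrier G"
  obtain k where "k \<in> K" "h = k \<otimes> g" using h unfolding r_coset_def by blast
  then show ?thesis using pi_left[OF _ g] g K_carrier by auto
qed

lemma pi_one: "\<pi> g = K \<Longrightarrow> g \<in> carrier G \<Longrightarrow> g \<in> K"
  using pi_mem by blast

lemmas Q_props = quotient_manifoldD[OF Ma quot]
lemmas Qm = Q_props(1)
lemmas Qa = Q_props(2)
lemmas points_Q = Q_props(3)[unfolded points_M, symmetric]
lemmas pi_smooth = Q_props(4)[unfolded points_M]
lemmas pi_onto = Q_props(5)[unfolded points_M]

lemma smooth_at_pi: "atlas A \<Longrightarrow> smooth_at A M f p \<Longrightarrow> smooth_at A Q (\<lambda>x. \<pi> (f x)) p"
  by (rule smooth_at_compose[OF _ Ma Qa _ pi_smooth]) (simp_all add: smooth_at_carrier)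

text \<open>Right translations commute with the left action of \<open>K\<close>, so they descend to
  \<open>G/K\<close>, and smoothness descends with them.\<close>

lemma smooth_at_right_Q:
  assumes g: "g \<in> carrier G" and h: "h \<in> carrier G"
  shows "smooth_at Q Q (\<lambda>q. q #> h) (\<pi> g)"
proof (rule quotient_descend[OF Ma Qa quot])
  have "smooth_at M Q (\<lambda>x. \<pi> (x \<otimes> h)) g" by (rule smooth_at_pi[OF Ma smooth_right[OF h g]])
  then show "smooth_at M Q (\<lambda>x. \<pi> x #> h) g"
    by (rule smooth_at_cong[OF Ma _ openin_points[OF Ma]]) (simp_all add: points_M g h pi_right)
qed

lemma push_pi_right:
  assumes v: "v \<in> tangent_space M g" and h: "h \<in> carrier G"
  shows "push M Q \<pi> (g \<otimes> h) (push M M (\<lambda>x. x \<otimes> h) g v) = push Q Q (\<lambda>q. q #> h) (\<pi> g) (push M Q \<pi> g v)"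
proof -
  have g: "g \<in> carrier G" by (rule tangent_carrier[OF v])
  have 1: "push M Q \<pi> (g \<otimes> h) (push M M (\<lambda>x. x \<otimes> h) g v) = push M Q (\<lambda>x. \<pi> (x \<otimes> h)) g v"
    by (rule push_push[OF Ma Qa, where F = "\<lambda>x. x \<otimes> h"]) (simp add: pi_smooth g h)
  have 2: "push Q Q (\<lambda>q. q #> h) (\<pi> g) (push M Q \<pi> g v) = push M Q (\<lambda>x. \<pi> x #> h) g v"
    by (rule push_push[OF Qa Qa, where F = \<pi>]) (rule smooth_at_right_Q[OF g h])
  have "push M Q (\<lambda>x. \<pi> (x \<otimes> h)) g v = push M Q (\<lambda>x. \<pi> x #> h) g v"
    by (rule push_cong[OF Ma Qa smooth_at_pi[OF Ma smooth_right[OF h g]] v openin_points[OF Ma]])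
      (simp_all add: points_M g h pi_right)
  then show ?thesis using 1 2 by simp
qed

section \<open>Vertical vectors and the kernel group\<close>

lemma e_rscale: "ex (rscale (t * r) \<xi>) = e (rscale r \<xi>) t"
  by (simp add: rscale_def mult.assoc)

lemma rscale_in: "\<xi> \<in> \<gg> \<Longrightarrow> rscale r \<xi> \<in> \<gg>"
  using tangent_lincomb[OF Ma, of \<xi> \<one> \<xi> r 0] by (simp add: lincomb_def rscale_def)

lemma mu_rscale: "\<xi> \<in> \<gg> \<Longrightarrow> \<nu> \<in> cotangent_space M \<one> \<Longrightarrow> \<nu> (rscale r \<xi>) = r * \<nu> \<xi>"
  using cotangentD(1)[OF Ma, of \<nu> \<one> \<xi> \<xi> r 0] by (simp add: lincomb_def rscale_def)

text \<open>By the one-parameter group law, the curve of cosets of \<open>e \<xi>\<close> at time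
  \<open>t0 + t\<close> is the right translate by \<open>e \<xi> t0\<close> of its position at time
  \<open>t\<close>. So its velocity vanishes at every time and not only at 0. In a chart around the
  coset \<open>K\<close> the curve is then constant on an interval.\<close>

lemma vertical_exp_in_K:
  assumes \<xi>: "\<xi> \<in> \<gg>" and vert: "push M Q \<pi> \<one> \<xi> = (\<lambda>_. 0)"
  obtains \<epsilon> where "\<epsilon> > 0" "\<And>t. \<bar>t\<bar> < \<epsilon> \<Longrightarrow> e \<xi> t \<in> K"
proof -
  define c where "c t = \<pi> (e \<xi> t)" for t
  have csm: "smooth_at EU Q c t" for t
    unfolding c_def by (rule smooth_at_pi[OF atlas_EU e_smooth[OF \<xi>]])
  have shift: "smooth_at EU Q (\<lambda>t. c (t0 + t)) 0" "velocity Q (\<lambda>t. c (t0 + t)) = (\<lambda>_. 0)" for t0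
  proof -
    have lin: "smooth_at EU EU (\<lambda>t::real. t0 + t) 0"
      by (intro smooth_at_add[OF atlas_EU] smooth_at_EU_const[OF atlas_EU] smooth_at_id[OF atlas_EU]) auto
    show "smooth_at EU Q (\<lambda>t. c (t0 + t)) 0"
      by (rule smooth_at_compose[OF atlas_EU atlas_EU Qa lin csm])
    have "c (t0 + t) = \<pi> (e \<xi> t) #> e \<xi> t0" for t
      using e_add[OF \<xi>, of t t0] \<xi> by (simp add: c_def pi_right add.commute)
    then have "velocity Q (\<lambda>t. c (t0 + t)) = velocity Q (\<lambda>t. \<pi> (e \<xi> t) #> e \<xi> t0)" by simp
    also have "\<dots> = push Q Q (\<lambda>q. q #> e \<xi> t0) (\<pi> (e \<xi> 0)) (velocity Q (\<lambda>t. \<pi> (e \<xi> t)))"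
      by (rule push_velocity[OF Qa Qa, symmetric, where \<gamma> = "\<lambda>t. \<pi> (e \<xi> t)"]) (simp add: smooth_at_right_Q \<xi>)
    also have "velocity Q (\<lambda>t. \<pi> (e \<xi> t)) = push M Q \<pi> \<one> \<xi>"
      using push_velocity[OF Ma Qa, of \<pi> "e \<xi>"] pi_smooth[OF one_closed] by (simp add: \<xi> e_velocity)
    finally show "velocity Q (\<lambda>t. c (t0 + t)) = (\<lambda>_. 0)" unfolding vert push_zero .
  qed
  have "c 0 \<in> points Q" by (rule smooth_at_points(2)[OF atlas_EU Qa csm])
  then obtain d where d: "d \<in> charts Q" "c 0 \<in> fst d" using atlas_cover[OF Qa] by blast
  have "openin (mtop (flat UNIV UNIV)) (UNIV \<inter> c -` fst d)"
    by (rule smooth_at_preimage_open[OF atlas_EU Qa _ csm openin_chart_domain[OF Qa d(1)]]) (simp add: openin_flat)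
  then have "open (c -` fst d)" by (simp add: openin_flat)
  then obtain \<epsilon> where \<epsilon>: "\<epsilon> > 0" "ball 0 \<epsilon> \<subseteq> c -` fst d" using d(2) unfolding open_contains_ball by force
  have "((\<lambda>t. snd d (c t)) has_derivative (\<lambda>h. 0)) (at t0 within ball 0 \<epsilon>)" if t0: "t0 \<in> ball 0 \<epsilon>" for t0
  proof -
    have ct0: "c (t0 + 0) \<in> fst d" using \<epsilon>(2) t0 by auto
    obtain a where a: "a \<in> model Q" "((\<lambda>t. snd d (c (t0 + t))) has_vector_derivative a) (at 0)"
      "eventually (\<lambda>t. c (t0 + t) \<in> fst d) (nhds 0)"
      using curve_chart[OF Qa shift(1) d(1) ct0] by blast
    have "cv Q d (snd d (c (t0 + 0))) a = (\<lambda>_. 0)"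
      using velocity_cv[OF Qa d(1) a(3,2)] shift(2) by simp
    then have "a = chart_diff (snd d) (\<lambda>_. 0)" using chart_diff_cv[OF Qa d(1) ct0 a(1)] by simp
    then have "a = 0" by (simp add: chart_diff_def)
    have d1: "((\<lambda>t. t - t0) has_derivative (\<lambda>h. h)) (at t0)" by (auto intro!: derivative_eq_intros)
    have d2: "((\<lambda>t. snd d (c (t0 + t))) has_derivative (\<lambda>h. h *\<^sub>R a)) (at (t0 - t0))"
      using a(2) by (simp add: has_vector_derivative_def)
    from has_derivative_compose[OF d1 d2]
    have "((\<lambda>t. snd d (c t)) has_derivative (\<lambda>h. h *\<^sub>R a)) (at t0)" by simp
    then have "((\<lambda>t. snd d (c t)) has_derivative (\<lambda>h. 0)) (at t0)" by (simp add: \<open>a = 0\<close>)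
    then show ?thesis by (rule has_derivative_at_withinI)
  qed
  from has_derivative_zero_constant[OF convex_ball this]
  obtain y where y: "\<And>t. t \<in> ball 0 \<epsilon> \<Longrightarrow> snd d (c t) = y" by blast
  have "e \<xi> t \<in> K" if "\<bar>t\<bar> < \<epsilon>" for t
  proof -
    have t: "t \<in> ball 0 \<epsilon>" "0 \<in> ball 0 \<epsilon>" using that \<epsilon>(1) by (auto simp: dist_real_def)
    have "snd d (c t) = snd d (c 0)" using y[OF t(1)] y[OF t(2)] by simp
    moreover have "c t \<in> fst d" using \<epsilon>(2) t(1) by auto
    ultimately have "c t = c 0" using inj_onD[OF chart_inj[OF Qa d(1)]] d(2) by blast
    then have "\<pi> (e \<xi> t) = K" using \<xi> coset_mult_one[OF K_carrier] by (simp add: c_def)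
    then show ?thesis using pi_one \<xi> by simp
  qed
  then show ?thesis using that \<epsilon>(1) by blast
qed

text \<open>The horizontality of the right invariant 1-form of \<open>\<mu>\<close> uses the second countability of the kernel group:
  if \<open>\<xi>\<close> is vertical and \<open>\<mu> \<xi> \<noteq> 0\<close>, then \<open>exp t\<xi>\<close> lies in \<open>K\<close> for small \<open>t\<close>, and the translates of
  a small open set of \<open>K\<close> by these elements are uncountably many disjoint open sets of \<open>K\<close>.\<close>

lemma vertical_mu_one:
  assumes \<xi>: "\<xi> \<in> \<gg>" and vert: "push M Q \<pi> \<one> \<xi> = (\<lambda>_. 0)"
  shows "\<mu> \<xi> = 0"
proof (rule ccontr)
  assume ne: "\<mu> \<xi> \<noteq> 0"
  obtain \<epsilon> where \<epsilon>: "\<epsilon> > 0" "\<And>t. \<bar>t\<bar> < \<epsilon> \<Longrightarrow> e \<xi> t \<in> K" using vertical_exp_in_K[OF \<xi> vert] by blast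
  obtain N :: "('g, 'e) mfd" where N: "lie_group (G\<lparr>carrier := K\<rparr>) N" "smooth_map N M (\<lambda>k. k)"
    "inj_on (push N M (\<lambda>k. k) \<one>) (tangent_space N \<one>)"
    "push N M (\<lambda>k. k) \<one> ` tangent_space N \<one> = isotropy_algebra G M \<mu> \<inter> cvec_kernel G M \<mu>" "\<one> \<in> K" by (rule obtain_N)
  interpret LK: lie "G\<lparr>carrier := K\<rparr>" N by (rule lie.intro[OF N(1)])
  note Na = LK.Ma
  have pN: "points N = K" using LK.points_M by simp
  have incl: "smooth_at N M (\<lambda>k. k) k" if "k \<in> K" for k
    using N(2) that unfolding smooth_map_iff[OF Na Ma] pN by blast
  let ?R = "flat UNIV (UNIV::real set)"
  let ?P = "prod_mfd N ?R"
  note P = atlas_prod[OF Na atlas_EU]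
  \<comment> \<open>As \<open>\<mu> \<xi> \<noteq> 0\<close> while \<open>\<mu>\<close> vanishes on
    the Lie algebra of \<open>K\<close>, the vector \<open>\<xi>\<close> is transverse to
    \<open>K\<close>. So this map on \<open>K\<close> times the line will turn out to have an
    injective differential at the unit.\<close>
  define \<Theta> where "\<Theta> x = fst x \<otimes> e \<xi> (snd x)" for x
  have \<Theta>: "smooth_at ?P M \<Theta> (\<one>, 0)" unfolding \<Theta>_def
    by (intro smooth_at_mult[OF P] smooth_at_e[OF \<xi> P] smooth_at_snd[OF Na atlas_EU]
        smooth_at_compose[OF P Na Ma smooth_at_fst[OF Na atlas_EU] incl]) (simp_all add: pN N(5))
  have \<Theta>1: "\<Theta> (\<one>, 0) = \<one>" by (simp add: \<Theta>_def \<xi>)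
  obtain n where n: "n \<in> charts N" "\<one> \<in> fst n" using atlas_cover[OF Na] N(5) pN by blast
  have "\<one> \<in> points M" by (simp add: points_M)
  then obtain d where d: "d \<in> charts M" "\<one> \<in> fst d" using atlas_cover[OF Ma] by blast
  let ?k = "prodc n (UNIV::real set, \<lambda>x. x)"
  have k: "?k \<in> charts ?P" "(\<one>, 0) \<in> fst ?k" using prodc_chart[OF Na atlas_EU n(1)] n(2) by auto
  have "\<Theta> (\<one>, 0) \<in> fst d" using d(2) \<Theta>1 by simp
  then obtain S where r: "local_rep ?P M \<Theta> (\<one>, 0) ?k d S" using smooth_at_rep[OF P Ma \<Theta> k d(1)] by blast
  note s = r[unfolded local_rep_def]
  let ?f = "\<lambda>y. snd d (\<Theta> (ic ?k y))" and ?y0 = "(snd n \<one>, 0::real)"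
  have V: "model ?P = model N \<times> UNIV" by (simp add: prod_mfd_simps)
  interpret f: smooth_fn "model N \<times> UNIV" S ?f using smooth_fn_rep[OF P r] unfolding V .
  have y0: "?y0 \<in> S" using s by simp
  have icn: "ic n (snd n \<one>) = \<one>" by (rule chart_ic[OF Na n])
  let ?D = "dV (model N \<times> UNIV) ?f ?y0"
  have DV: "?D w \<in> model M" for w
    by (rule dV_in[OF f.smooth_fn_axioms atlas_model[OF Ma] _ y0]) (use s chart_in_model[OF Ma d(1)] in auto)
  have push_D: "push ?P M \<Theta> (\<one>, 0) (velocity ?P (\<lambda>t. (ic n (snd n \<one> + t *\<^sub>R a), t * \<tau>))) = cv M d (snd d \<one>) (?D (a, \<tau>))"
    if a: "a \<in> model N" for a \<tau>
  proof -
    have aV: "(a, \<tau>) \<in> model ?P" unfolding V using a by simp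
    have yk: "?y0 \<in> snd ?k ` fst ?k" using s y0 by blast
    have "cv ?P ?k ?y0 (a, \<tau>) = velocity ?P (\<lambda>t. ic ?k (?y0 + t *\<^sub>R (a, \<tau>)))"
      unfolding coord_vec_cv[OF P k(1) yk aV, symmetric] coord_vec_def ic_def[symmetric] ..
    also have "\<dots> = velocity ?P (\<lambda>t. (ic n (snd n \<one> + t *\<^sub>R a), t * \<tau>))"
    proof (rule velocity_cong, rule eventually_mono[OF coord_curve[OF Na n(1) _ a]])
      show "snd n \<one> \<in> snd n ` fst n" using n(2) by blast
      show "ic ?k (?y0 + t *\<^sub>R (a, \<tau>)) = (ic n (snd n \<one> + t *\<^sub>R a), t * \<tau>)"
        if "snd n \<one> + t *\<^sub>R a \<in> snd n ` fst n" for t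
        using ic_prodc[OF Na atlas_EU n(1) _ that, of "(UNIV, \<lambda>x. x)" "t * \<tau>"] by simp
    qed
    finally show ?thesis using push_cv[OF P Ma r aV] \<Theta>1 by (simp add: V)
  qed
  have n1: "snd n \<one> \<in> snd n ` fst n" using n(2) by blast
  have inj: "w = 0" if w: "w \<in> model N \<times> UNIV" "?D w = 0" for w
  proof -
    obtain a \<tau> where a: "w = (a, \<tau>)" "a \<in> model N" using w(1) by blast
    have z: "0 \<in> model N" by (rule subspace_0[OF atlas_model[OF Na]])
    have vel: "push ?P M \<Theta> (\<one>, 0) (velocity ?P (\<lambda>t. (ic n (snd n \<one> + t *\<^sub>R b), t * \<sigma>))) =
        velocity M (\<lambda>t. ic n (snd n \<one> + t *\<^sub>R b) \<otimes> e \<xi> (t * \<sigma>))" for b \<sigma>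
      using push_velocity[OF P Ma, of \<Theta> "\<lambda>t. (ic n (snd n \<one> + t *\<^sub>R b), t * \<sigma>)"] \<Theta> icn by (simp add: \<Theta>_def)
    define u where "u = cv N n (snd n \<one>) a"
    have u: "u \<in> tangent_space N \<one>" unfolding u_def by (rule cv_tangent[OF Na n a(2)])
    have "velocity M (\<lambda>t. ic n (snd n \<one> + t *\<^sub>R a) \<otimes> e \<xi> (t * 0)) = velocity M (\<lambda>t. ic n (snd n \<one> + t *\<^sub>R a))"
    proof (rule velocity_cong, rule eventually_mono[OF coord_curve[OF Na n(1) n1 a(2)]])
      fix t assume "snd n \<one> + t *\<^sub>R a \<in> snd n ` fst n"
      then have "ic n (snd n \<one> + t *\<^sub>R a) \<in> K" using chart_points[OF Na n(1) ic_in] pN by blast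
      then show "ic n (snd n \<one> + t *\<^sub>R a) \<otimes> e \<xi> (t * 0) = ic n (snd n \<one> + t *\<^sub>R a)"
        using K_carrier by (auto simp: \<xi>)
    qed
    also have "\<dots> = push N M (\<lambda>k. k) \<one> u"
      using push_velocity[OF Na Ma, of "\<lambda>k. k" "\<lambda>t. ic n (snd n \<one> + t *\<^sub>R a)"] incl[OF N(5)] icn
        coord_vec_cv[OF Na n(1) n1 a(2)] unfolding coord_vec_def ic_def[symmetric] u_def by simp
    finally have 1: "cv M d (snd d \<one>) (?D (a, 0)) = push N M (\<lambda>k. k) \<one> u"
      using push_D[OF a(2), of 0] vel[of a 0] by simp
    have 2: "cv M d (snd d \<one>) (?D (0, \<tau>)) = rscale \<tau> \<xi>"
      using push_D[OF z, of \<tau>] vel[of 0 \<tau>] e_rscale[of _ \<tau> \<xi>] e_velocity[OF rscale_in[OF \<xi>], of \<tau>] icn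
      by (simp add: rscale_in[OF \<xi>])
    have "(a, 0) + (0, \<tau>) = w" using a(1) by simp
    then have "?D (a, 0) + ?D (0, \<tau>) = 0" using linear_add[OF f.linear_dV[OF y0], of "(a, 0)" "(0, \<tau>)"] w(2) by simp
    then have sum: "lincomb 1 (push N M (\<lambda>k. k) \<one> u) 1 (rscale \<tau> \<xi>) = cv M d (snd d \<one>) 0"
      using cv_linear[OF Ma d, of 1 "?D (a, 0)" 1 "?D (0, \<tau>)"] 1 2 by simp
    have cv0: "cv M d (snd d \<one>) 0 = (\<lambda>_. 0)"
      using cv_linear[OF Ma d, of 0 0 0 0] by (simp add: lincomb_def)
    \<comment> \<open>Applying \<open>\<mu>\<close> removes the component along \<open>K\<close> and
      leaves \<open>\<tau> * \<mu> \<xi>\<close>, whence \<open>\<tau> = 0\<close>; then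
      \<open>u\<close> vanishes because \<open>K\<close> is immersed.\<close>
    have uk: "push N M (\<lambda>k. k) \<one> u \<in> cvec_kernel G M \<mu>" using N(4) u by blast
    then have uk': "push N M (\<lambda>k. k) \<one> u \<in> \<gg>" "\<mu> (push N M (\<lambda>k. k) \<one> u) = 0" unfolding cvec_kernel_def by blast+
    have "\<mu> (\<lambda>_. 0) = 0"
      using cotangentD(1)[OF Ma mu \<xi> \<xi>, of 0 0] by (simp add: lincomb_def)
    then have "0 = 1 * \<mu> (push N M (\<lambda>k. k) \<one> u) + 1 * \<mu> (rscale \<tau> \<xi>)"
      using cotangentD(1)[OF Ma mu uk'(1) rscale_in[OF \<xi>], of 1 1 \<tau>] sum cv0 by simp
    then have \<tau>: "\<tau> = 0" using uk'(2) mu_rscale[OF \<xi> mu] ne by simp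
    have "push N M (\<lambda>k. k) \<one> u = (\<lambda>_. 0)"
      using sum cv0 \<tau> by (simp add: lincomb_def rscale_def)
    then have "push N M (\<lambda>k. k) \<one> u = push N M (\<lambda>k. k) \<one> (\<lambda>_. 0)" by (simp add: push_zero)
    moreover have "(\<lambda>_. 0) \<in> tangent_space N \<one>" by (rule tangent_zero[OF Na]) (simp add: pN N(5))
    ultimately have "u = (\<lambda>_. 0)" using inj_onD[OF N(3)] u by blast
    then have "a = chart_diff (snd n) (\<lambda>_. 0)" using chart_diff_cv[OF Na n a(2)] by (simp add: u_def)
    then show ?thesis using \<tau> a(1) by (simp add: chart_diff_def zero_prod_def)
  qed
  obtain T where T: "opn (model N \<times> UNIV) T" "?y0 \<in> T" "T \<subseteq> S" "inj_on ?f T"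
    using smooth_locally_injective[OF f.smooth_fn_axioms y0 inj] by blast
  obtain U where U: "open U" "T = (model N \<times> UNIV) \<inter> U" using T(1) unfolding openin_open by blast
  have "?y0 \<in> U" using T(2) U(2) by blast
  then obtain A B where AB: "open A" "open B" "?y0 \<in> A \<times> B" "A \<times> B \<subseteq> U" by (rule open_prod_elim[OF U(1)]) (rule that; assumption)
  have AB0: "0 \<in> B" "snd n \<one> \<in> A" using AB(3) by auto
  obtain \<delta>' where \<delta>': "\<delta>' > 0" "ball 0 \<delta>' \<subseteq> B" using AB(2) AB0(1) unfolding open_contains_ball by blast
  \<comment> \<open>\<open>\<epsilon>\<close> keeps the exponentials in \<open>K\<close>, and
    \<open>\<delta>'\<close> keeps \<open>t\<close> in the box on which the map is
    injective.\<close>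
  define \<delta> where "\<delta> = min \<epsilon> \<delta>'"
  have \<delta>: "\<delta> > 0" using \<epsilon>(1) \<delta>'(1) by (simp add: \<delta>_def)
  define O1 where "O1 = snd n ` fst n \<inter> (model N \<inter> A)"
  have O1: "opn (model N) O1" "O1 \<subseteq> snd n ` fst n" unfolding O1_def
    by (rule openin_Int[OF chart_open[OF Na n(1)] openin_open_Int[OF AB(1)]]) simp
  define N0 where "N0 = ic n ` O1"
  have N0: "openin (mtop N) N0" unfolding N0_def by (rule openin_ic[OF Na n(1) O1])
  have "snd n \<one> \<in> O1" using n1 AB0(2) chart_in_model[OF Na n] by (simp add: O1_def)
  then have N01: "\<one> \<in> N0" unfolding N0_def using icn by (intro image_eqI[of _ _ "snd n \<one>"]) simp_all
  \<comment> \<open>Injectivity in coordinates means that the translates of \<open>N0\<close> by the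
    exponentials are pairwise disjoint for small \<open>t\<close>.\<close>
  have \<Theta>inj: "t = t'" if th: "x \<in> N0" "x' \<in> N0" "\<bar>t\<bar> < \<delta>" "\<bar>t'\<bar> < \<delta>" "x \<otimes> e \<xi> t = x' \<otimes> e \<xi> t'" for x x' t t'
  proof -
    obtain y y' where y: "y \<in> O1" "x = ic n y" "y' \<in> O1" "x' = ic n y'" using th(1,2) unfolding N0_def by blast
    have tB: "t \<in> B" "t' \<in> B" using that(3,4) \<delta>'(2) by (auto simp: \<delta>_def dist_real_def subset_iff)
    have yT: "(y, t) \<in> T" "(y', t') \<in> T" using y tB AB(4) U(2) by (auto simp: O1_def)
    have "ic ?k (y, t) = (x, t)" "ic ?k (y', t') = (x', t')"
      using y ic_prodc[OF Na atlas_EU n(1) _ subsetD[OF O1(2) y(1)], of "(UNIV, \<lambda>x. x)" t]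
        ic_prodc[OF Na atlas_EU n(1) _ subsetD[OF O1(2) y(3)], of "(UNIV, \<lambda>x. x)" t'] by simp_all
    then have "?f (y, t) = ?f (y', t')" using that(5) by (simp add: \<Theta>_def)
    from inj_onD[OF T(4) this yT] show ?thesis by simp
  qed
  \<comment> \<open>The translate of \<open>N0\<close> by \<open>e \<xi> t\<close>, written as a
    preimage under a right translation of \<open>K\<close>. It is open in \<open>mtop N\<close>
    because right translations by elements of \<open>K\<close> are smooth for the structure
    \<open>N\<close>.\<close>
  define At where "At t = K \<inter> (\<lambda>k. k \<otimes> inv (e \<xi> t)) -` N0" for t
  have eK: "e \<xi> t \<in> K" "inv (e \<xi> t) \<in> K" if "\<bar>t\<bar> < \<delta>" for t
    using \<epsilon>(2)[of t] \<epsilon>(2)[of "- t"] that by (simp_all add: \<delta>_def e_inv[OF \<xi>])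
  have Aop: "openin (mtop N) (At t)" if t: "\<bar>t\<bar> < \<delta>" for t
    unfolding At_def pN[symmetric]
  proof (rule smooth_at_preimage_open[OF Na Na openin_points[OF Na] _ N0])
    show "smooth_at N N (\<lambda>k. k \<otimes> inv (e \<xi> t)) k" if "k \<in> points N" for k
      using LK.smooth_right[of "inv (e \<xi> t)" k] eK(2)[OF t] that by (simp add: pN)
  qed
  have Ain: "e \<xi> t \<in> At t" if "\<bar>t\<bar> < \<delta>" for t
    using eK(1)[OF that] N01 by (simp add: At_def \<xi>)
  have Adis: "t = t'" if t: "\<bar>t\<bar> < \<delta>" "\<bar>t'\<bar> < \<delta>" and x: "x \<in> At t" "x \<in> At t'" for t t' x
  proof (rule \<Theta>inj[OF _ _ t])
    have xc: "x \<in> carrier G" using x(1) K_carrier by (auto simp: At_def)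
    show "x \<otimes> inv (e \<xi> t) \<in> N0" "x \<otimes> inv (e \<xi> t') \<in> N0" using x by (simp_all add: At_def)
    show "x \<otimes> inv (e \<xi> t) \<otimes> e \<xi> t = x \<otimes> inv (e \<xi> t') \<otimes> e \<xi> t'" using xc by (simp add: m_assoc \<xi>)
  qed
  have "second_countable (mtop N)" using LK.M_manifold unfolding manifold_iff by (elim conjE)
  then obtain \<B> where \<B>: "countable \<B>" "\<forall>U x. openin (mtop N) U \<and> x \<in> U \<longrightarrow> (\<exists>V\<in>\<B>. x \<in> V \<and> V \<subseteq> U)"
    unfolding second_countable_def by (elim exE conjE)
  have "\<exists>V. V \<in> \<B> \<and> e \<xi> t \<in> V \<and> V \<subseteq> At t" if "\<bar>t\<bar> < \<delta>" for t
    using \<B>(2)[rule_format, OF conjI, OF Aop[OF that] Ain[OF that]] by (simp add: Bex_def)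
  then obtain v where v: "\<And>t. \<bar>t\<bar> < \<delta> \<Longrightarrow> v t \<in> \<B> \<and> e \<xi> t \<in> v t \<and> v t \<subseteq> At t" by metis
  \<comment> \<open>Basic open sets inside disjoint translates are different, since each contains
    the corresponding exponential. So an interval would inject into the countable base.\<close>
  have "inj_on v {-\<delta><..<\<delta>}"
  proof (rule inj_onI)
    fix t t' assume t: "t \<in> {-\<delta><..<\<delta>}" "t' \<in> {-\<delta><..<\<delta>}" "v t = v t'"
    then have t': "\<bar>t\<bar> < \<delta>" "\<bar>t'\<bar> < \<delta>" by auto
    show "t = t'" by (rule Adis[OF t']) (use v[OF t'(1)] v[OF t'(2)] t(3) in auto)
  qed
  moreover have "v ` {-\<delta><..<\<delta>} \<subseteq> \<B>" using v by (auto simp: abs_less_iff)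
  ultimately have "countable {-\<delta><..<\<delta>}"
    using countable_subset[OF _ \<B>(1)] countable_image_inj_on by blast
  then show False using uncountable_open_interval[of "-\<delta>" \<delta>] \<delta> by simp
qed

section \<open>The reduced symplectic form\<close>

definition sigma :: "'g \<Rightarrow> 'g tvec \<Rightarrow> real" where
  "sigma g v = \<mu> (rho g v)"

lemma sigma_lincomb:
  "u \<in> tangent_space M g \<Longrightarrow> v \<in> tangent_space M g \<Longrightarrow> sigma g (lincomb a u b v) = a * sigma g u + b * sigma g v"
  unfolding sigma_def rho_def push_lincomb using cotangentD(1)[OF Ma mu] rho_in[unfolded rho_def] by blast

lemma sigma_velocity:
  "smooth_at EU M \<gamma> (0::real) \<Longrightarrow> sigma (\<gamma> 0) (velocity M \<gamma>) = \<mu> (velocity M (\<lambda>t. \<gamma> t \<otimes> inv (\<gamma> 0)))"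
  unfolding sigma_def by (simp add: rho_velocity)

text \<open>In the right trivialisation left translation by \<open>k\<close> acts by
  \<open>Ad\<close>, under which \<open>\<mu>\<close> is invariant.\<close>

lemma sigma_left: "k \<in> K \<Longrightarrow> v \<in> tangent_space M g \<Longrightarrow> sigma (k \<otimes> g) (push M M (\<lambda>h. k \<otimes> h) g v) = sigma g v"
  unfolding sigma_def using rho_left[of k v g] K_carrier mu_Ad[OF _ rho_in] by auto

text \<open>Right translation by \<open>inv g\<close> descends to \<open>G/K\<close>, so it carries
  a vertical vector at \<open>g\<close> to a vertical vector at the unit, where
  \<open>vertical_mu_one\<close> applies.\<close>

lemma sigma_vertical:
  assumes v: "v \<in> tangent_space M g" and vert: "push M Q \<pi> g v = (\<lambda>_. 0)"
  shows "sigma g v = 0"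
  unfolding sigma_def
proof (rule vertical_mu_one[OF rho_in[OF v]])
  have g: "g \<in> carrier G" by (rule tangent_carrier[OF v])
  have "push M Q \<pi> (g \<otimes> inv g) (push M M (\<lambda>x. x \<otimes> inv g) g v) = push Q Q (\<lambda>q. q #> inv g) (\<pi> g) (push M Q \<pi> g v)"
    by (rule push_pi_right[OF v]) (simp add: g)
  then show "push M Q \<pi> \<one> (rho g v) = (\<lambda>_. 0)" unfolding vert push_zero rho_def by (simp add: g)
qed

text \<open>The choice does not matter, because \<open>sigma\<close> is invariant under \<open>K\<close> and vanishes on vertical vectors.\<close>

definition sq :: "'g set \<Rightarrow> 'g set tvec \<Rightarrow> real" where
  "sq q w = (SOME r. \<exists>g v. v \<in> tangent_space M g \<and> \<pi> g = q \<and> push M Q \<pi> g v = w \<and> r = sigma g v)"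

text \<open>Left translation by the \<open>k\<close> that joins the base points moves
  \<open>v\<close> to \<open>g'\<close> without changing its image in \<open>G/K\<close>. The
  difference to \<open>v'\<close> is then vertical, and \<open>sigma\<close> sees neither the
  translation nor the difference.\<close>

lemma sigma_basic:
  assumes v: "v \<in> tangent_space M g" and v': "v' \<in> tangent_space M g'" and eq: "\<pi> g' = \<pi> g"
    "push M Q \<pi> g' v' = push M Q \<pi> g v"
  shows "sigma g' v' = sigma g v"
proof -
  have g: "g \<in> carrier G" "g' \<in> carrier G" using tangent_carrier v v' by blast+
  obtain k where k: "k \<in> K" "g' = k \<otimes> g" by (rule pi_eqE[OF g(2) eq(1)])
  have kc: "k \<in> carrier G" using k(1) K_carrier by blast
  let ?v = "push M M (\<lambda>h. k \<otimes> h) g v"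
  have vt: "?v \<in> tangent_space M g'" using push_tangent[OF Ma Ma smooth_left[OF kc g(1)] v] k(2) by simp
  have "push M Q \<pi> g' ?v = push M Q (\<lambda>h. \<pi> (k \<otimes> h)) g v"
    unfolding k(2) by (rule push_push[OF Ma Qa, where F = "\<lambda>h. k \<otimes> h"]) (simp add: pi_smooth g kc)
  also have "\<dots> = push M Q \<pi> g v"
    by (rule push_cong[OF Ma Qa smooth_at_pi[OF Ma smooth_left[OF kc g(1)]] v openin_points[OF Ma]])
      (simp_all add: points_M g pi_left[OF k(1)])
  finally have pe: "push M Q \<pi> g' ?v = push M Q \<pi> g v" .
  have "push M Q \<pi> g' (lincomb 1 v' (-1) ?v) = (\<lambda>_. 0)"
    unfolding push_lincomb eq(2) pe by (simp add: lincomb_def)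
  then have "sigma g' (lincomb 1 v' (-1) ?v) = 0"
    by (rule sigma_vertical[OF tangent_lincomb[OF Ma v' vt]])
  then have "sigma g' v' = sigma g' ?v" using sigma_lincomb[OF v' vt, of 1 "-1"] by simp
  then show ?thesis using sigma_left[OF k(1) v] k(2) by simp
qed

lemma sq_push:
  assumes v: "v \<in> tangent_space M g"
  shows "sq (\<pi> g) (push M Q \<pi> g v) = sigma g v"
proof -
  have "\<exists>r g' v'. v' \<in> tangent_space M g' \<and> \<pi> g' = \<pi> g \<and> push M Q \<pi> g' v' = push M Q \<pi> g v \<and> r = sigma g' v'"
    using v by blast
  from someI_ex[OF this] obtain g' v' where "v' \<in> tangent_space M g'" "\<pi> g' = \<pi> g"
    "push M Q \<pi> g' v' = push M Q \<pi> g v" "sq (\<pi> g) (push M Q \<pi> g v) = sigma g' v'"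
    unfolding sq_def by blast
  then show ?thesis using sigma_basic[OF v] by simp
qed

lemma sq_lincomb:
  assumes u: "u \<in> tangent_space Q q" and v: "v \<in> tangent_space Q q"
  shows "sq q (lincomb a u b v) = a * sq q u + b * sq q v"
proof -
  have "q \<in> points Q" by (rule tangent_points[OF Qa u])
  then obtain g where g: "g \<in> carrier G" "q = \<pi> g" unfolding points_Q by blast
  obtain u' v' where u': "u' \<in> tangent_space M g" "u = push M Q \<pi> g u'" and v': "v' \<in> tangent_space M g" "v = push M Q \<pi> g v'"
    using u v pi_onto[OF g(1)] g(2) by blast
  have "lincomb a u b v = push M Q \<pi> g (lincomb a u' b v')" unfolding u' v' push_lincomb ..
  then show ?thesis
    using sq_push[OF tangent_lincomb[OF Ma u'(1) v'(1)]] sq_push[OF u'(1)] sq_push[OF v'(1)]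
      sigma_lincomb[OF u'(1) v'(1)] by (simp add: g(2) u'(2) v'(2))
qed

lemma sq_velocity:
  assumes "smooth_at EU M \<gamma> (0::real)"
  shows "sq (\<pi> (\<gamma> 0)) (velocity Q (\<lambda>t. \<pi> (\<gamma> t))) = \<mu> (velocity M (\<lambda>t. \<gamma> t \<otimes> inv (\<gamma> 0)))"
  using sq_push[OF velocity_in_tangent[OF Ma assms]] sigma_velocity[OF assms]
    push_velocity[OF Ma Qa, of \<pi> \<gamma>] pi_smooth[OF smooth_at_carrier[OF atlas_EU assms]] by simp

text \<open>A local section \<open>s\<close> lifts the family to \<open>G\<close>, where
  \<open>sq\<close> becomes \<open>\<mu>\<close> of the velocity of
  \<open>s (H (t, x)) \<otimes> inv (s (H (0, x)))\<close>. These curves start at the unit, so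
  \<open>smooth_at_functional\<close> applies.\<close>

lemma sq_family:
  assumes A: "atlas A" and H: "smooth_at (prod_mfd (flat UNIV (UNIV::real set)) A) Q H (0, p)"
  shows "smooth_at A EU (\<lambda>x. sq (H (0, x)) (velocity Q (\<lambda>t. H (t, x)))) p"
proof -
  let ?R = "flat UNIV (UNIV::real set)"
  let ?P = "prod_mfd ?R A"
  have P: "atlas ?P" by (rule atlas_prod[OF atlas_EU A])
  have "H (0, p) \<in> points Q" by (rule smooth_at_points(2)[OF P Qa H])
  then obtain g where g: "g \<in> carrier G" "H (0, p) = \<pi> g" unfolding points_Q by blast
  obtain V s where s: "openin (mtop Q) V" "\<pi> g \<in> V" "s (\<pi> g) = g" "\<And>q. q \<in> V \<Longrightarrow> smooth_at Q M s q"
    "\<And>q. q \<in> V \<Longrightarrow> \<pi> (s q) = q"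
    using quotient_section[OF Ma quot, of g] g(1) points_M by blast
  obtain W0 where W0: "openin (mtop ?P) W0" "(0, p) \<in> W0" "\<And>z. z \<in> W0 \<Longrightarrow> smooth_at ?P Q H z"
    using smooth_at_nhd[OF P H] by blast
  define W1 where "W1 = W0 \<inter> H -` V"
  have W1: "openin (mtop ?P) W1" unfolding W1_def by (rule smooth_at_preimage_open[OF P Qa W0(1,3) s(1)])
  have pA: "p \<in> points A" using smooth_at_points(1)[OF P Qa H] by (simp add: prod_mfd_simps)
  have i0: "smooth_at A ?P (\<lambda>x. (0, x)) x" if "x \<in> points A" for x
    by (intro smooth_at_Pair[OF atlas_EU A A] smooth_at_id[OF A] smooth_at_EU_const[OF A] that)
  define W where "W = points A \<inter> (\<lambda>x. (0, x)) -` W1"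
  have W: "openin (mtop A) W" unfolding W_def
    by (rule smooth_at_preimage_open[OF A P openin_points[OF A] i0 W1])
  have pW: "p \<in> W" using pA W0(2) s(2) g(2) by (simp add: W_def W1_def)
  let ?F = "\<lambda>z. s (H z) \<otimes> inv (s (H (0, snd z)))"
  have sH: "smooth_at ?P M (\<lambda>z. s (H z)) (0, x)" if "x \<in> W" for x
    using that by (intro smooth_at_compose[OF P Qa Ma W0(3) s(4)]) (simp_all add: W_def W1_def)
  have sH0: "smooth_at A M (\<lambda>x. s (H (0, x))) x" if "x \<in> W" for x
    by (rule smooth_at_restrict0[OF A Ma sH[OF that]])
  have F: "smooth_at ?P M ?F (0, x)" if x: "x \<in> W" for x
  proof (intro smooth_at_mult[OF P] smooth_at_inv[OF P] sH[OF x])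
    have xA: "x \<in> points A" using x by (simp add: W_def)
    show "smooth_at ?P M (\<lambda>z. s (H (0, snd z))) (0, x)"
      by (rule smooth_at_compose[OF P A Ma smooth_at_snd[OF atlas_EU A]]) (simp_all add: xA sH0[OF x])
  qed
  have "smooth_at A EU (\<lambda>x. \<mu> (velocity M (\<lambda>t. ?F (t, x)))) p"
  proof (rule smooth_at_functional[OF A mu F[OF pW] W pW])
    fix x assume x: "x \<in> W"
    show "?F (0, x) = \<one>" using smooth_at_carrier[OF P sH[OF x]] by simp
    show "smooth_at EU M (\<lambda>t. ?F (t, x)) 0" by (rule smooth_slice[OF A Ma F[OF x]])
  qed
  then show ?thesis
  proof (rule smooth_at_cong[OF A _ W pW])
    fix x assume x: "x \<in> W"
    have sl: "smooth_at EU M (\<lambda>t. s (H (t, x))) 0" by (rule smooth_slice[OF A Ma sH[OF x]])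
    have "H (0, x) \<in> V" using x by (simp add: W_def W1_def)
    then have pi0: "\<pi> (s (H (0, x))) = H (0, x)" by (rule s(5))
    have "smooth_at ?P Q H (0, x)" using x W0(3) by (simp add: W_def W1_def)
    from smooth_slice[OF A Qa this] have "smooth_at EU Q (\<lambda>t. H (t, x)) 0" .
    then obtain Z where Z: "openin (mtop (flat UNIV (UNIV::real set))) Z" "0 \<in> Z" "\<And>t. t \<in> Z \<Longrightarrow> smooth_at EU Q (\<lambda>t. H (t, x)) t"
      using smooth_at_nhd[OF atlas_EU] by blast
    have "openin (mtop EU) (Z \<inter> (\<lambda>t. H (t, x)) -` V)" by (rule smooth_at_preimage_open[OF atlas_EU Qa Z(1,3) s(1)])
    then have "open (Z \<inter> (\<lambda>t. H (t, x)) -` V)" by (simp add: openin_flat)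
    then have "eventually (\<lambda>t. \<pi> (s (H (t, x))) = H (t, x)) (nhds 0)"
      unfolding eventually_nhds using Z(2) \<open>H (0, x) \<in> V\<close> s(5)
      by (intro exI[of _ "Z \<inter> (\<lambda>t. H (t, x)) -` V"]) auto
    then have "velocity Q (\<lambda>t. \<pi> (s (H (t, x)))) = velocity Q (\<lambda>t. H (t, x))" by (rule velocity_cong)
    then show "\<mu> (velocity M (\<lambda>t. ?F (t, x))) = sq (H (0, x)) (velocity Q (\<lambda>t. H (t, x)))"
      using sq_velocity[OF sl] pi0 by simp
  qed
qed

text \<open>The factor \<open>\<real>\<^sup>+\<close> enters through \<open>r = exp l\<close>. If \<open>\<mu> = 0\<close> the ray is a point, and \<open>l\<close> ranges over the
  zero space.\<close>

definition muz :: bool where "muz \<longleftrightarrow> (\<forall>\<xi>\<in>\<gg>. \<mu> \<xi> = 0)"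
definition ell :: "real set" where "ell = (if muz then {0} else UNIV)"
text \<open>Brings the logarithm of the radius into \<open>ell\<close>. The point of the ray does
  not change, because \<open>exp (pr (ln r))\<close> and \<open>r\<close> have the same effect on
  \<open>\<mu>\<close>.\<close>

definition pr :: "real \<Rightarrow> real" where "pr l = (if muz then 0 else l)"

section \<open>The model space \<open>G/K\<close> times \<open>ell\<close> and its 1-form\<close>

abbreviation "L \<equiv> flat ell ell"
abbreviation "B \<equiv> prod_mfd Q L"
abbreviation "MB \<equiv> prod_mfd M L"

lemma ell: "subspace ell" "opn ell ell" by (simp_all add: ell_def)

lemma pr_in: "pr l \<in> ell" by (simp add: pr_def ell_def)

lemma pr_ell: "l \<in> ell \<Longrightarrow> pr l = l" by (simp add: pr_def ell_def split: if_splits)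

lemma Lm: "manifold L" by (rule manifold_flat[OF ell])
lemma La: "atlas L" by (rule atlas_flat[OF ell])
lemma Bm: "manifold B" by (rule manifold_prod[OF Qm Lm])
lemma Ba: "atlas B" by (rule atlas_prod[OF Qa La])
lemma MBm: "manifold MB" by (rule manifold_prod[OF M_manifold Lm])
lemma MBa: "atlas MB" by (rule atlas_prod[OF Ma La])

lemma points_B: "points B = points Q \<times> ell" by (simp add: prod_mfd_simps)
lemma points_MB: "points MB = carrier G \<times> ell" by (simp add: prod_mfd_simps points_M)

lemma smooth_at_L:
  assumes A: "atlas A" and f: "smooth_at A EU f p" and fl: "\<And>x. x \<in> points A \<Longrightarrow> f x \<in> ell"
  shows "smooth_at A L f p"
  by (rule smooth_at_flat_cod[OF A f openin_points[OF A] smooth_at_points(1)[OF A atlas_EU f]]) (use fl in blast)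

lemma smooth_at_snd_B: "p \<in> points Q \<times> ell \<Longrightarrow> smooth_at B EU snd p"
  by (rule smooth_at_EU_cod[OF Ba smooth_at_snd[OF Qa La]]) (simp_all add: points_B)

lemma smooth_at_snd_MB: "p \<in> carrier G \<times> ell \<Longrightarrow> smooth_at MB EU snd p"
  by (rule smooth_at_EU_cod[OF MBa smooth_at_snd[OF Ma La]]) (simp_all add: points_MB points_M)

definition theta :: "('g set \<times> real) form1" where
  "theta x w = exp (snd x) * sq (fst x) (push B Q fst x w)"

lemma smooth_at_fst_B: "x \<in> points B \<Longrightarrow> smooth_at B Q fst x"
  using smooth_at_fst[OF Qa La] by (simp add: points_B)

lemma theta_velocity:
  assumes "smooth_at EU B \<gamma> (0::real)"
  shows "theta (\<gamma> 0) (velocity B \<gamma>) = exp (snd (\<gamma> 0)) * sq (fst (\<gamma> 0)) (velocity Q (\<lambda>t. fst (\<gamma> t)))"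
  unfolding theta_def
  using push_velocity[OF Ba Qa, of fst \<gamma>] smooth_at_fst_B[OF smooth_at_points(2)[OF atlas_EU Ba assms]] by simp

text \<open>The coefficients are, up to the exponential factor, values of \<open>sq\<close> on
  projected velocities of coordinate lines. The lines form a smooth family with the base point as
  parameter, so \<open>sq_family\<close> gives smoothness.\<close>

lemma one_form_theta: "one_form B theta"
proof (rule one_formI[OF Ba])
  fix x u v a b assume x: "x \<in> points B" and u: "u \<in> tangent_space B x" and v: "v \<in> tangent_space B x"
  show "theta x (lincomb a u b v) = a * theta x u + b * theta x v"
    unfolding theta_def push_lincomb
    using sq_lincomb[OF push_tangent[OF Ba Qa smooth_at_fst_B[OF x] u] push_tangent[OF Ba Qa smooth_at_fst_B[OF x] v]]
    by (simp add: algebra_simps)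
next
  fix c y a assume c: "c \<in> charts B" and y: "y \<in> snd c ` fst c" and a: "a \<in> model B"
  let ?S = "snd c ` fst c"
  let ?A = "flat (model B) ?S"
  have A: "atlas ?A" by (rule atlas_flat[OF atlas_model[OF Ba] chart_open[OF Ba c]])
  let ?R = "flat UNIV (UNIV::real set)"
  let ?P = "prod_mfd ?R ?A"
  have P: "atlas ?P" by (rule atlas_prod[OF atlas_EU A])
  have SV: "?S \<subseteq> model B" by (rule openin_subset_subspace[OF chart_open[OF Ba c]])
  have lin: "smooth_at ?P EU (\<lambda>z. snd z + fst z *\<^sub>R a) (0, z)" if "z \<in> ?S" for z
    using that
    by (intro smooth_at_add[OF P] smooth_at_scaleR[OF P] smooth_at_EU_const[OF P] smooth_at_fst[OF atlas_EU A]
        smooth_at_EU_cod[OF P smooth_at_snd[OF atlas_EU A]]) (simp_all add: prod_mfd_simps)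
  have mod: "snd z + fst z *\<^sub>R a \<in> model B" if "z \<in> points ?P" for z
    using that SV a atlas_model[OF Ba] by (auto simp: prod_mfd_simps intro!: subspace_add subspace_scale)
  let ?\<gamma> = "\<lambda>z. ic c (snd z + fst z *\<^sub>R a)"
  have \<gamma>: "smooth_at ?P B ?\<gamma> (0, z)" if "z \<in> ?S" for z
    by (rule smooth_at_ic_comp[OF Ba P c lin[OF that] _ mod]) (simp add: that)
  have pts: "ic c z \<in> points B" if "z \<in> ?S" for z by (rule chart_points[OF Ba c ic_in[OF that]])
  have H: "smooth_at ?P Q (\<lambda>z. fst (?\<gamma> z)) (0, y)"
    by (rule smooth_at_compose[OF P Ba Qa \<gamma>[OF y]]) (simp add: smooth_at_fst_B pts y)
  have icy: "smooth_at ?A B (ic c) y" by (rule smooth_at_ic[OF Ba c y])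
  have "smooth_at ?A EU (\<lambda>z. snd (ic c z)) y"
    by (rule smooth_at_compose[OF A Ba atlas_EU icy smooth_at_snd_B]) (use pts[OF y] in \<open>simp add: points_B\<close>)
  then have "smooth_at ?A EU (\<lambda>z. exp (snd (ic c z)) * sq (fst (?\<gamma> (0, z))) (velocity Q (\<lambda>t. fst (?\<gamma> (t, z))))) y"
    by (intro smooth_at_exp[OF A] sq_family[OF A H] smooth_at_EU_bilinear[OF A _ _ bounded_bilinear_mult])
  then show "smooth_at ?A EU (\<lambda>y. theta (ic c y) (velocity B (\<lambda>t. ic c (y + t *\<^sub>R a)))) y"
  proof (rule smooth_at_cong[OF A _ openin_points[OF A]])
    fix z assume "z \<in> points ?A"
    then have z: "z \<in> ?S" by simp
    show "exp (snd (ic c z)) * sq (fst (?\<gamma> (0, z))) (velocity Q (\<lambda>t. fst (?\<gamma> (t, z)))) =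
        theta (ic c z) (velocity B (\<lambda>t. ic c (z + t *\<^sub>R a)))"
      using theta_velocity[OF smooth_slice[OF A Ba \<gamma>[OF z]]] by simp
  qed (simp add: y)
qed

abbreviation "omega \<equiv> \<lambda>p u v. - ext_deriv1 B theta p u v"

text \<open>A translation on either side is provided for: \<open>g = \<one>\<close> gives right
  trivialised vectors, convenient for nondegeneracy, and \<open>h = \<one>\<close> gives left
  trivialised ones, in which the diagonal is described.\<close>

definition curve :: "'g \<Rightarrow> 'g \<Rightarrow> real \<Rightarrow> 'g tvec \<Rightarrow> real \<Rightarrow> real \<Rightarrow> 'g set \<times> real" where
  "curve g h l \<xi> r t = (\<pi> (g \<otimes> e \<xi> t \<otimes> h), l + t * r)"

lemma curve_0: "\<xi> \<in> \<gg> \<Longrightarrow> g \<in> carrier G \<Longrightarrow> h \<in> carrier G \<Longrightarrow> curve g h l \<xi> r 0 = (\<pi> (g \<otimes> h), l)"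
  by (simp add: curve_def)

lemma cancel_right:
  assumes "a \<in> carrier G" "k \<in> carrier G" "h \<in> carrier G"
  shows "a \<otimes> h \<otimes> inv (k \<otimes> h) = a \<otimes> inv k"
proof -
  have "h \<otimes> (inv h \<otimes> inv k) = inv k" using assms by (simp add: m_assoc[symmetric])
  then show ?thesis using assms by (simp add: inv_mult_group m_assoc)
qed

text \<open>Pull back to the plane along \<open>(s, t) \<mapsto> (g exp s\<xi>\<^sub>1 exp t\<xi>\<^sub>2 h, l + s r\<^sub>1 + t r\<^sub>2)\<close>.\<close>

lemma omega_curves:
  assumes g: "g \<in> carrier G" and h: "h \<in> carrier G" and l: "l \<in> ell" and \<xi>1: "\<xi>1 \<in> \<gg>" and \<xi>2: "\<xi>2 \<in> \<gg>"
    and r1: "r1 \<in> ell" and r2: "r2 \<in> ell"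
  shows "omega (\<pi> (g \<otimes> h), l) (velocity B (curve g h l \<xi>1 r1)) (velocity B (curve g h l \<xi>2 r2)) =
    - exp l * (\<mu> (Ad G M g (lie_bracket G M \<xi>1 \<xi>2)) + r1 * \<mu> (Ad G M g \<xi>2) - r2 * \<mu> (Ad G M g \<xi>1))"
proof -
  let ?E = "flat UNIV (UNIV :: (real \<times> real) set)"
  define m where "m z = g \<otimes> e \<xi>1 (fst z) \<otimes> e \<xi>2 (snd z) \<otimes> h" for z
  define F where "F z = (\<pi> (m z), l + fst z * r1 + snd z * r2)" for z
  have lin: "smooth_at ?E EU (\<lambda>z. fst z) z" "smooth_at ?E EU (\<lambda>z. snd z) z" for z
    using smooth_at_linear[OF atlas_EU smooth_at_id[OF atlas_EU], of z] bounded_linear_fst bounded_linear_snd by auto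
  have m_sm: "smooth_at ?E M m z" for z unfolding m_def
    by (intro smooth_at_mult[OF atlas_EU] smooth_at_e[OF \<xi>1 atlas_EU] smooth_at_e[OF \<xi>2 atlas_EU] lin
        smooth_at_M_const[OF atlas_EU]) (simp_all add: g h)
  have lell: "l + fst z * r1 + snd z * r2 \<in> ell" for z
    using l r1 r2 by (auto simp: ell_def)
  have F_sm: "smooth_at ?E B F z" for z unfolding F_def
    by (intro smooth_at_Pair[OF Qa La atlas_EU] smooth_at_pi[OF atlas_EU m_sm] smooth_at_L[OF atlas_EU] lell
        smooth_at_add[OF atlas_EU] smooth_at_EU_bilinear[OF atlas_EU _ _ bounded_bilinear_mult] lin
        smooth_at_EU_const[OF atlas_EU]) simp_all
  let ?\<theta> = "pullform ?E B F theta"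
  let ?c = "(UNIV :: (real \<times> real) set, \<lambda>x. x)"
  let ?a = "(1::real, 0::real)" and ?b = "(0::real, 1::real)"
  define u where "u w = velocity ?E (\<lambda>t::real. t *\<^sub>R w)" for w :: "real \<times> real"
  have ray_sm: "smooth_at (flat UNIV (UNIV::real set)) ?E (\<lambda>t. y + t *\<^sub>R w) 0" for y w
    by (rule smooth_at_flat_flatI[OF _ _ _ _ smooth_on_add[OF smooth_on_const
          smooth_on_linear[OF bounded_linear_scaleR_left, of UNIV]]]) auto
  have u_t: "u w \<in> tangent_space ?E 0" for w
    using velocity_in_tangent[OF atlas_EU ray_sm[of 0 w]] by (simp add: u_def)
  have u_cv: "chart_diff (\<lambda>x. x) (u w) = w" for w
  proof -
    have "((\<lambda>t. t *\<^sub>R w) has_vector_derivative w) (at 0)" by (auto intro!: derivative_eq_intros)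
    then have "u w = cv ?E ?c (snd ?c 0) w"
      unfolding u_def using velocity_cv[OF atlas_EU, of ?c "\<lambda>t. t *\<^sub>R w" w] by simp
    then show ?thesis using chart_diff_cv[OF atlas_EU, of ?c 0 w] by simp
  qed
  have push_u: "push ?E B F 0 (u w) = velocity B (\<lambda>t. F (t *\<^sub>R w))" for w
    using push_velocity[OF atlas_EU Ba, of F "\<lambda>t::real. t *\<^sub>R w"] F_sm[of 0] by (simp add: u_def)
  have F1: "F (t *\<^sub>R ?a) = curve g h l \<xi>1 r1 t" "F (t *\<^sub>R ?b) = curve g h l \<xi>2 r2 t" for t
    using g h \<xi>1 \<xi>2 by (simp_all add: F_def m_def curve_def)
  have F0: "F 0 = (\<pi> (g \<otimes> h), l)" using g h \<xi>1 \<xi>2 by (simp add: F_def m_def)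
  have coef: "coef1 ?E ?\<theta> ?c w y = exp (snd (F y)) * \<mu> (velocity M (\<lambda>t. m (y + t *\<^sub>R w) \<otimes> inv (m y)))" for w y
  proof -
    have "coef1 ?E ?\<theta> ?c w y = theta (F y) (velocity B (\<lambda>t. F (y + t *\<^sub>R w)))"
      unfolding coef1_def coord_vec_def ic_def[symmetric] pullform_def
      using push_velocity[OF atlas_EU Ba, of F "\<lambda>t::real. y + t *\<^sub>R w"] F_sm[of y] by simp
    also have "\<dots> = exp (snd (F y)) * sq (fst (F y)) (velocity Q (\<lambda>t. fst (F (y + t *\<^sub>R w))))"
      using theta_velocity[OF smooth_at_compose[OF atlas_EU atlas_EU Ba ray_sm F_sm], of y w] by simp
    also have "sq (fst (F y)) (velocity Q (\<lambda>t. fst (F (y + t *\<^sub>R w)))) = \<mu> (velocity M (\<lambda>t. m (y + t *\<^sub>R w) \<otimes> inv (m y)))"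
      using sq_velocity[OF smooth_at_compose[OF atlas_EU atlas_EU Ma ray_sm m_sm], of y w] by (simp add: F_def)
    finally show ?thesis .
  qed
  define \<nu> where "\<nu> = Ad_star G M g \<mu>"
  have \<nu>: "\<nu> \<in> cotangent_space M \<one>" unfolding \<nu>_def by (rule Ad_star_cotangent[OF g mu])
  have \<nu>_ap: "\<nu> \<eta> = \<mu> (Ad G M g \<eta>)" if "\<eta> \<in> \<gg>" for \<eta> unfolding \<nu>_def by (rule Ad_star_apply[OF that])
  \<comment> \<open>In direction \<open>?b\<close> along the first axis, \<open>h\<close> cancels
    and conjugation by \<open>g \<otimes> e \<xi>1 s\<close> remains. Its dependence on
    \<open>s\<close> is what produces the bracket.\<close>
  have "coef1 ?E ?\<theta> ?c ?b (s *\<^sub>R ?a) = exp (l + s * r1) * \<nu> (Ad G M (e \<xi>1 s) \<xi>2)" for s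
  proof -
    let ?k = "g \<otimes> e \<xi>1 s"
    have k: "?k \<in> carrier G" using g \<xi>1 by simp
    have eq: "m (s *\<^sub>R ?a + t *\<^sub>R ?b) \<otimes> inv (m (s *\<^sub>R ?a)) = ?k \<otimes> e \<xi>2 t \<otimes> inv ?k" for t
    proof -
      have "m (s *\<^sub>R ?a + t *\<^sub>R ?b) \<otimes> inv (m (s *\<^sub>R ?a)) = ?k \<otimes> e \<xi>2 t \<otimes> h \<otimes> inv (?k \<otimes> h)"
        using g h \<xi>1 \<xi>2 by (simp add: m_def)
      then show ?thesis using cancel_right[OF _ k h, of "?k \<otimes> e \<xi>2 t"] k \<xi>2 by simp
    qed
    have "velocity M (\<lambda>t. m (s *\<^sub>R ?a + t *\<^sub>R ?b) \<otimes> inv (m (s *\<^sub>R ?a))) = Ad G M g (Ad G M (e \<xi>1 s) \<xi>2)"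
      unfolding eq Ad_e[OF k \<xi>2, symmetric] using Ad_mult[OF g e_carrier[OF \<xi>1] \<xi>2] by simp
    then show ?thesis unfolding coef using \<nu>_ap[OF Ad_in[OF e_carrier[OF \<xi>1] \<xi>2]] by (simp add: F_def)
  qed
  then have c1: "(\<lambda>s. coef1 ?E ?\<theta> ?c ?b (0 + s *\<^sub>R ?a)) = (\<lambda>s. exp (l + s * r1) * \<nu> (Ad G M (e \<xi>1 s) \<xi>2))" by simp
  \<comment> \<open>In direction \<open>?a\<close> along the second axis, \<open>e \<xi>2 t\<close>
    cancels together with \<open>h\<close>, so \<open>t\<close> enters only through the exponential
    factor.\<close>
  have "coef1 ?E ?\<theta> ?c ?a (t *\<^sub>R ?b) = exp (l + t * r2) * \<nu> \<xi>1" for t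
  proof -
    have eq: "m (t *\<^sub>R ?b + s *\<^sub>R ?a) \<otimes> inv (m (t *\<^sub>R ?b)) = g \<otimes> e \<xi>1 s \<otimes> inv g" for s
    proof -
      let ?n = "e \<xi>2 t \<otimes> h"
      have n: "?n \<in> carrier G" using h \<xi>2 by simp
      have "m (t *\<^sub>R ?b + s *\<^sub>R ?a) \<otimes> inv (m (t *\<^sub>R ?b)) = g \<otimes> e \<xi>1 s \<otimes> ?n \<otimes> inv (g \<otimes> ?n)"
        using g h \<xi>1 \<xi>2 by (simp add: m_def m_assoc)
      then show ?thesis using cancel_right[OF _ g n, of "g \<otimes> e \<xi>1 s"] g \<xi>1 by simp
    qed
    show ?thesis unfolding coef eq Ad_e[OF g \<xi>1, symmetric] using \<nu>_ap[OF \<xi>1] by (simp add: F_def)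
  qed
  then have c2: "(\<lambda>t. coef1 ?E ?\<theta> ?c ?a (0 + t *\<^sub>R ?b)) = (\<lambda>t. exp (l + t * r2) * \<nu> \<xi>1)" by simp
  have "((\<lambda>s. \<nu> (Ad G M (e \<xi>1 s) \<xi>2)) has_real_derivative \<nu> (lie_bracket G M \<xi>1 \<xi>2)) (at 0)"
    using bracket_derivative(2)[OF \<xi>1 \<xi>2 \<nu>] unfolding has_real_derivative_iff_has_vector_derivative .
  then have "((\<lambda>s. exp (l + s * r1) * \<nu> (Ad G M (e \<xi>1 s) \<xi>2)) has_real_derivative
      exp l * (r1 * \<nu> \<xi>2 + \<nu> (lie_bracket G M \<xi>1 \<xi>2))) (at 0)"
    by (auto intro!: derivative_eq_intros simp: Ad_one[OF \<xi>2] \<xi>1 algebra_simps)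
  then have d1: "dir_deriv (coef1 ?E ?\<theta> ?c ?b) ?a 0 = exp l * (r1 * \<nu> \<xi>2 + \<nu> (lie_bracket G M \<xi>1 \<xi>2))"
    unfolding dir_deriv_def c1 by (rule DERIV_imp_deriv)
  have "((\<lambda>t. exp (l + t * r2) * \<nu> \<xi>1) has_real_derivative exp l * (r2 * \<nu> \<xi>1)) (at 0)"
    by (auto intro!: derivative_eq_intros)
  then have d2: "dir_deriv (coef1 ?E ?\<theta> ?c ?a) ?b 0 = exp l * (r2 * \<nu> \<xi>1)"
    unfolding dir_deriv_def c2 by (rule DERIV_imp_deriv)
  have "ext_deriv1 ?E ?\<theta> 0 (u ?a) (u ?b) = ext_chart ?E ?\<theta> ?c 0 (u ?a) (u ?b)"
    using ext_deriv1_ext_chart[OF atlas_EU, of "0 :: real \<times> real" ?\<theta> "u ?a" "u ?b"] by simp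
  also have "\<dots> = exp l * (r1 * \<nu> \<xi>2 + \<nu> (lie_bracket G M \<xi>1 \<xi>2)) - exp l * (r2 * \<nu> \<xi>1)"
    unfolding ext_chart_def snd_conv u_cv d1 d2 ..
  also have "ext_deriv1 ?E ?\<theta> 0 (u ?a) (u ?b) =
      ext_deriv1 B theta (F 0) (push ?E B F 0 (u ?a)) (push ?E B F 0 (u ?b))"
    by (rule ext_deriv1_pull[OF atlas_EU Ba one_form_theta F_sm refl u_t u_t])
  finally show ?thesis
    unfolding push_u F0 F1 using \<nu>_ap \<xi>1 \<xi>2 bracket_derivative(1)[OF \<xi>1 \<xi>2] by (simp add: algebra_simps)
qed

section \<open>Tangent vectors of the model space and nondegeneracy\<close>

lemma muz_mu: "muz \<Longrightarrow> \<mu> \<xi> = 0"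
  using cotangentD(2)[OF Ma mu, of \<xi>] unfolding muz_def by blast

text \<open>If \<open>\<mu> = 0\<close> both sides vanish; otherwise \<open>pr\<close> is the
  identity.\<close>

lemma exp_pr: "r > 0 \<Longrightarrow> exp (pr (ln r)) * \<mu> \<xi> = r * \<mu> \<xi>"
  using muz_mu by (auto simp: pr_def)

lemma rscale_exp_pr: "r > 0 \<Longrightarrow> rscale (exp (pr (ln r))) \<mu> = rscale r \<mu>"
  unfolding rscale_def by (auto simp: exp_pr)

lemma smooth_at_B_curve:
  assumes "smooth_at EU M \<gamma> (0::real)" "l \<in> ell" "r \<in> ell"
  shows "smooth_at EU B (\<lambda>t. (\<pi> (\<gamma> t), l + t * r)) 0"
  by (intro smooth_at_Pair[OF Qa La atlas_EU] smooth_at_pi[OF atlas_EU assms(1)] smooth_at_L[OF atlas_EU]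
      smooth_at_add[OF atlas_EU] smooth_at_EU_bilinear[OF atlas_EU _ _ bounded_bilinear_mult]
      smooth_at_EU_const[OF atlas_EU] smooth_at_id[OF atlas_EU])
    (use assms(2,3) in \<open>auto simp: ell_def split: if_splits\<close>)

text \<open>The component in \<open>G/K\<close> lifts to a vector \<open>w\<close> on
  \<open>G\<close>, and the component in \<open>ell\<close> is the number \<open>r\<close>. The
  curve representing \<open>w\<close> is left open, so that exponentials translated from the left or
  from the right can be inserted.\<close>

lemma tangent_B:
  assumes v: "v \<in> tangent_space B (\<pi> h, l)" and h: "h \<in> carrier G"
  obtains w r where "w \<in> tangent_space M h" "r \<in> ell"
    "\<And>\<gamma>. smooth_at EU M \<gamma> 0 \<Longrightarrow> \<gamma> 0 = h \<Longrightarrow> velocity M \<gamma> = w \<Longrightarrow> v = velocity B (\<lambda>t. (\<pi> (\<gamma> t), l + t * r))"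
proof -
  obtain \<delta> :: "real \<Rightarrow> _" where d: "smooth_at EU B \<delta> 0" "\<delta> 0 = (\<pi> h, l)" "v = velocity B \<delta>" by (rule tangentE[OF Ba v])
  have pt: "\<delta> 0 \<in> points Q \<times> points L" using smooth_at_points(2)[OF atlas_EU Ba d(1)] by (simp add: points_B)
  have l: "l \<in> ell" using pt d(2) by simp
  have f: "smooth_at EU Q (\<lambda>t. fst (\<delta> t)) 0" by (rule smooth_at_compose[OF atlas_EU Ba Qa d(1) smooth_at_fst[OF Qa La pt]])
  have s: "smooth_at EU L (\<lambda>t. snd (\<delta> t)) 0" by (rule smooth_at_compose[OF atlas_EU Ba La d(1) smooth_at_snd[OF Qa La pt]])
  have "velocity Q (\<lambda>t. fst (\<delta> t)) \<in> tangent_space Q (\<pi> h)" using velocity_in_tangent[OF Qa f] d(2) by simp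
  then obtain w where w: "w \<in> tangent_space M h" "velocity Q (\<lambda>t. fst (\<delta> t)) = push M Q \<pi> h w"
    using pi_onto[OF h] by blast
  let ?c = "(ell, \<lambda>x::real. x)"
  have cL: "?c \<in> charts L" and sl: "snd (\<delta> 0) \<in> fst ?c" using pt by (auto simp: mem_Times_iff)
  obtain r where "r \<in> model L" "((\<lambda>t. snd ?c (snd (\<delta> t))) has_vector_derivative r) (at 0)"
    "eventually (\<lambda>t. snd (\<delta> t) \<in> fst ?c) (nhds 0)"
    by (rule curve_chart[OF La s cL sl])
  then have r: "r \<in> ell" "((\<lambda>t. snd (\<delta> t)) has_vector_derivative r) (at 0)" "eventually (\<lambda>t. snd (\<delta> t) \<in> ell) (nhds 0)"
    by simp_all
  have vs: "velocity L (\<lambda>t. snd (\<delta> t)) = cv L (ell, \<lambda>x. x) l r"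
    using velocity_cv[OF La, of "(ell, \<lambda>x. x)" "\<lambda>t. snd (\<delta> t)" r] r(2,3) d(2) by simp
  have "\<And>t. l + t * r \<in> ell" using l r(1) by (auto simp: ell_def split: if_splits)
  moreover have "((\<lambda>t. l + t * r) has_vector_derivative r) (at 0)"
    unfolding has_real_derivative_iff_has_vector_derivative[symmetric] by (auto intro!: derivative_eq_intros)
  ultimately have vl: "velocity L (\<lambda>t. l + t * r) = cv L (ell, \<lambda>x. x) l r"
    using velocity_cv[OF La, of "(ell, \<lambda>x. x)" "\<lambda>t. l + t * r" r] by simp
  show ?thesis
  proof (rule that[OF w(1) r(1)])
    fix \<gamma> assume \<gamma>: "smooth_at EU M \<gamma> 0" "\<gamma> 0 = h" "velocity M \<gamma> = w"
    show "v = velocity B (\<lambda>t. (\<pi> (\<gamma> t), l + t * r))"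
      unfolding d(3)
    proof (rule velocity_prod_eqI[OF Qa La d(1) smooth_at_B_curve[OF \<gamma>(1) l r(1)]])
      show "\<delta> 0 = (\<pi> (\<gamma> 0), l + 0 * r)" by (simp add: d(2) \<gamma>(2))
      show "velocity Q (\<lambda>t. fst (\<delta> t)) = velocity Q (\<lambda>t. fst (\<pi> (\<gamma> t), l + t * r))"
        using push_velocity[OF Ma Qa, of \<pi> \<gamma>] pi_smooth[OF h] \<gamma> w(2) by simp
      show "velocity L (\<lambda>t. snd (\<delta> t)) = velocity L (\<lambda>t. snd (\<pi> (\<gamma> t), l + t * r))" using vs vl by simp
    qed
  qed
qed

lemma smooth_curves:
  assumes "g \<in> carrier G" "h \<in> carrier G" "\<xi> \<in> \<gg>"
  shows "smooth_at EU M (\<lambda>t. g \<otimes> e \<xi> t \<otimes> h) 0"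
  by (intro smooth_at_mult[OF atlas_EU] e_smooth[OF assms(3)] smooth_at_M_const[OF atlas_EU]) (simp_all add: assms)

lemma tangent_B_right:
  assumes v: "v \<in> tangent_space B (\<pi> h, l)" and h: "h \<in> carrier G"
  obtains \<xi> r where "\<xi> \<in> \<gg>" "r \<in> ell" "v = velocity B (curve \<one> h l \<xi> r)"
proof -
  obtain w r where w: "w \<in> tangent_space M h" "r \<in> ell"
    "\<And>\<gamma>. smooth_at EU M \<gamma> 0 \<Longrightarrow> \<gamma> 0 = h \<Longrightarrow> velocity M \<gamma> = w \<Longrightarrow> v = velocity B (\<lambda>t. (\<pi> (\<gamma> t), l + t * r))"
    by (rule tangent_B[OF v h]) (rule that; assumption)
  note \<xi> = rho_in[OF w(1)]
  have "v = velocity B (\<lambda>t. (\<pi> (\<one> \<otimes> e (rho h w) t \<otimes> h), l + t * r))"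
    by (rule w(3)[OF smooth_curves[OF one_closed h \<xi>]]) (simp_all add: h \<xi> vel_right[OF w(1)])
  then show ?thesis using that[OF \<xi> w(2)] by (simp add: curve_def[abs_def])
qed

lemma tangent_B_left:
  assumes v: "v \<in> tangent_space B (\<pi> h, l)" and h: "h \<in> carrier G"
  obtains \<xi> r where "\<xi> \<in> \<gg>" "r \<in> ell" "v = velocity B (curve h \<one> l \<xi> r)"
proof -
  obtain w r where w: "w \<in> tangent_space M h" "r \<in> ell"
    "\<And>\<gamma>. smooth_at EU M \<gamma> 0 \<Longrightarrow> \<gamma> 0 = h \<Longrightarrow> velocity M \<gamma> = w \<Longrightarrow> v = velocity B (\<lambda>t. (\<pi> (\<gamma> t), l + t * r))"
    by (rule tangent_B[OF v h]) (rule that; assumption)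
  obtain \<xi> where \<xi>: "\<xi> \<in> \<gg>" "velocity M (\<lambda>t. h \<otimes> e \<xi> t) = w" by (rule vel_left[OF w(1)])
  have "v = velocity B (\<lambda>t. (\<pi> (h \<otimes> e \<xi> t \<otimes> \<one>), l + t * r))"
    by (rule w(3)[OF smooth_curves[OF h one_closed \<xi>(1)]]) (simp_all add: h \<xi>)
  then show ?thesis using that[OF \<xi>(1) w(2)] by (simp add: curve_def[abs_def])
qed

lemma curve_tangent:
  assumes "g \<in> carrier G" "h \<in> carrier G" "\<xi> \<in> \<gg>" "l \<in> ell" "r \<in> ell"
  shows "velocity B (curve g h l \<xi> r) \<in> tangent_space B (\<pi> (g \<otimes> h), l)"
  using velocity_in_tangent[OF Ba smooth_at_B_curve[OF smooth_curves[OF assms(1-3)] assms(4,5)]] assms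
  by (simp add: curve_def[abs_def])

lemma omega_nondegenerate:
  assumes p: "p \<in> points B" and u: "u \<in> tangent_space B p" and z: "\<forall>v\<in>tangent_space B p. omega p u v = 0"
  shows "u = (\<lambda>_. 0)"
proof -
  obtain h l where hl: "h \<in> carrier G" "l \<in> ell" "p = (\<pi> h, l)" using p unfolding points_B points_Q by blast
  note h = hl(1) and l = hl(2)
  obtain \<xi> r where \<xi>: "\<xi> \<in> \<gg>" "r \<in> ell" "u = velocity B (curve \<one> h l \<xi> r)"
    using tangent_B_right[OF u[unfolded hl(3)] h] by blast
  have br: "lie_bracket G M \<xi> \<eta> \<in> \<gg>" if "\<eta> \<in> \<gg>" for \<eta> by (rule bracket_derivative(1)[OF \<xi>(1) that])
  have eq: "\<mu> (lie_bracket G M \<xi> \<eta>) + r * \<mu> \<eta> - s * \<mu> \<xi> = 0" if \<eta>: "\<eta> \<in> \<gg>" and s: "s \<in> ell" for \<eta> s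
  proof -
    have "velocity B (curve \<one> h l \<eta> s) \<in> tangent_space B p"
      using curve_tangent[OF one_closed h \<eta> l s] h hl(3) by simp
    then have "omega p u (velocity B (curve \<one> h l \<eta> s)) = 0" using z by blast
    then have "- exp l * (\<mu> (Ad G M \<one> (lie_bracket G M \<xi> \<eta>)) + r * \<mu> (Ad G M \<one> \<eta>) - s * \<mu> (Ad G M \<one> \<xi>)) = 0"
      using omega_curves[OF one_closed h l \<xi>(1) \<eta> \<xi>(2) s] h \<xi>(3) hl(3) by simp
    then show ?thesis using \<xi>(1) \<eta> br by (simp add: Ad_one)
  qed
  \<comment> \<open>The equations for \<open>s = 1\<close> and \<open>s = 0\<close> differ by
    \<open>\<mu> \<xi>\<close>; both values are available in \<open>ell\<close> unless
    \<open>\<mu> = 0\<close>.\<close>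
  have mx: "\<mu> \<xi> = 0"
  proof (cases muz)
    case True then show ?thesis by (rule muz_mu)
  next
    case False
    then have "1 \<in> ell" "0 \<in> ell" by (simp_all add: ell_def)
    from eq[OF \<xi>(1) this(1)] eq[OF \<xi>(1) this(2)] show ?thesis by simp
  qed
  \<comment> \<open>Antisymmetry puts \<open>\<eta>\<close> into the first slot of the bracket,
    where its coadjoint action annihilates \<open>\<mu>\<close>; with \<open>s = 0\<close> only
    \<open>r * \<mu> \<eta>\<close> is left.\<close>
  have iso0: "r * \<mu> \<eta> = 0" if \<eta>: "\<eta> \<in> isotropy_algebra G M \<mu>" for \<eta>
  proof -
    have \<eta>g: "\<eta> \<in> \<gg>" and "ad_star G M \<eta> \<mu> = (\<lambda>_. 0)" using \<eta> unfolding isotropy_algebra_def by blast+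
    then have "ad_star G M \<eta> \<mu> \<xi> = 0" by simp
    then have "\<mu> (lie_bracket G M \<eta> \<xi>) = 0" using \<xi>(1) by (simp add: ad_star_def)
    then have "\<mu> (lie_bracket G M \<xi> \<eta>) = 0"
      unfolding lie_bracket_antisym[of \<eta> \<xi>] using cotangentD(1)[OF Ma mu br[OF \<eta>g] br[OF \<eta>g]] by simp
    then show ?thesis using eq[OF \<eta>g subspace_0[OF ell(1)]] by simp
  qed
  have r: "r = 0"
  proof (rule ccontr)
    assume "r \<noteq> 0"
    then have nz: "\<not> muz" using \<xi>(2) by (auto simp: ell_def)
    then obtain \<zeta> where \<zeta>: "\<zeta> \<in> \<gg>" "\<mu> \<zeta> \<noteq> 0" unfolding muz_def by blast
    obtain a b where ab: "\<zeta> = lincomb 1 a 1 b" "a \<in> cvec_kernel G M \<mu>" "b \<in> isotropy_algebra G M \<mu>"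
      using \<zeta>(1) unfolding span_g[symmetric] by blast
    have "a \<in> \<gg>" "\<mu> a = 0" "b \<in> \<gg>" using ab unfolding cvec_kernel_def isotropy_algebra_def by blast+
    moreover have "\<mu> b = 0" using iso0[OF ab(3)] \<open>r \<noteq> 0\<close> by simp
    ultimately show False using \<zeta>(2) ab(1) cotangentD(1)[OF Ma mu, of a b 1 1] by simp
  qed
  have "ad_star G M \<xi> \<mu> = (\<lambda>_. 0)"
  proof (rule ext)
    fix \<eta>
    show "ad_star G M \<xi> \<mu> \<eta> = 0" using eq[OF _ subspace_0[OF ell(1)], of \<eta>] r by (simp add: ad_star_def)
  qed
  then have "\<xi> \<in> isotropy_algebra G M \<mu> \<inter> cvec_kernel G M \<mu>"
    unfolding isotropy_algebra_def cvec_kernel_def using \<xi>(1) mx by simp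
  moreover obtain N :: "('g, 'e) mfd" where N: "lie_group (G\<lparr>carrier := K\<rparr>) N" "smooth_map N M (\<lambda>k. k)"
    "push N M (\<lambda>k. k) \<one> ` tangent_space N \<one> = isotropy_algebra G M \<mu> \<inter> cvec_kernel G M \<mu>" "\<one> \<in> K" by (rule obtain_N)
  ultimately obtain w where w: "w \<in> tangent_space N \<one>" "\<xi> = push N M (\<lambda>k. k) \<one> w" by blast
  interpret LK: lie "G\<lparr>carrier := K\<rparr>" N by (rule lie.intro[OF N(1)])
  note Na = LK.Ma
  have pN: "points N = K" using LK.points_M by simp
  have incl: "smooth_at N M (\<lambda>k. k) k" if "k \<in> K" for k
    using N(2) that unfolding smooth_map_iff[OF Na Ma] pN by blast
  \<comment> \<open>Now \<open>\<xi>\<close> is the velocity of a curve in \<open>K\<close>. Left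
    multiplication by elements of \<open>K\<close> does not move the coset of \<open>h\<close>, so
    the component of \<open>u\<close> in \<open>G/K\<close> is 0.\<close>
  obtain \<kappa> :: "real \<Rightarrow> 'g" where \<kappa>: "smooth_at EU N \<kappa> 0" "\<kappa> 0 = \<one>" "w = velocity N \<kappa>" by (rule tangentE[OF Na w(1)])
  have \<kappa>M: "smooth_at EU M \<kappa> 0" by (rule smooth_at_compose[OF atlas_EU Na Ma \<kappa>(1)]) (simp add: \<kappa>(2) incl N(4))
  have \<xi>\<kappa>: "\<xi> = velocity M \<kappa>" using push_velocity[OF Na Ma, of "\<lambda>k. k" \<kappa>] incl[OF N(4)] \<kappa>(2,3) w(2) by simp
  obtain Z where Z: "openin (mtop (flat UNIV (UNIV::real set))) Z" "0 \<in> Z" "\<And>t. t \<in> Z \<Longrightarrow> smooth_at EU N \<kappa> t"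
    using smooth_at_nhd[OF atlas_EU \<kappa>(1)] by blast
  have "open Z" using Z(1) by (simp add: openin_flat)
  have \<kappa>K: "\<kappa> t \<in> K" if "t \<in> Z" for t using smooth_at_points(2)[OF atlas_EU Na Z(3)[OF that]] pN by simp
  have "eventually (\<lambda>t. \<pi> (\<kappa> t \<otimes> h) = \<pi> h) (nhds 0)"
    unfolding eventually_nhds using \<open>open Z\<close> Z(2) pi_left[OF \<kappa>K h] by blast
  then have "velocity Q (\<lambda>t. \<pi> (\<kappa> t \<otimes> h)) = velocity Q (\<lambda>t. \<pi> h)" by (rule velocity_cong)
  moreover have "velocity Q (\<lambda>t. \<pi> (\<gamma> t \<otimes> h)) = push M Q (\<lambda>x. \<pi> (x \<otimes> h)) \<one> (velocity M \<gamma>)" if "\<gamma> 0 = \<one>" for \<gamma>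
    using push_velocity[OF Ma Qa, of "\<lambda>x. \<pi> (x \<otimes> h)" \<gamma>] smooth_at_pi[OF Ma smooth_right[OF h one_closed]] that by simp
  from this[of \<kappa>] this[of "e \<xi>"] have "velocity Q (\<lambda>t. \<pi> (\<kappa> t \<otimes> h)) = velocity Q (\<lambda>t. \<pi> (e \<xi> t \<otimes> h))"
    using \<kappa>(2) \<xi>\<kappa> e_velocity[OF \<xi>(1)] \<xi>(1) by simp
  ultimately have vQ: "velocity Q (\<lambda>t. \<pi> (e \<xi> t \<otimes> h)) = velocity Q (\<lambda>t. \<pi> h)" by simp
  have "u = velocity B (\<lambda>t. (\<pi> (\<one> \<otimes> e \<xi> t \<otimes> h), l + t * 0))" using \<xi>(3) r by (simp add: curve_def[abs_def])
  also have "\<dots> = velocity B (\<lambda>t. (\<pi> h, l))"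
  proof (rule velocity_prod_eqI[OF Qa La])
    show "smooth_at EU B (\<lambda>t. (\<pi> (\<one> \<otimes> e \<xi> t \<otimes> h), l + t * 0)) 0"
      by (rule smooth_at_B_curve[OF smooth_curves[OF one_closed h \<xi>(1)] l subspace_0[OF ell(1)]])
    show "smooth_at EU B (\<lambda>t. (\<pi> h, l)) 0"
      by (rule smooth_at_const[OF atlas_EU Ba]) (use p hl(3) in simp_all)
  qed (use vQ h \<xi>(1) in simp_all)
  finally show ?thesis unfolding velocity_const .
qed

section \<open>The level set and its quotient\<close>

abbreviation "TG \<equiv> cotangent_bundle M"

lemma TGa: "atlas TG" by (rule atlas_TM[OF Ma])

lemma points_TG: "points TG = (SIGMA g:carrier G. cotangent_space M g)"
  using TM_simps(1)[OF Ma] points_M by simp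

definition jc :: "'g \<Rightarrow> real \<Rightarrow> 'g cvec" where
  "jc g l = (\<lambda>v. if v \<in> tangent_space M g then exp l * sigma g v else 0)"

definition j :: "'g \<times> real \<Rightarrow> 'g \<times> 'g cvec" where
  "j x = (fst x, jc (fst x) (snd x))"

lemma jc_cotangent: "jc g l \<in> cotangent_space M g"
  unfolding cotangent_space_def jc_def using sigma_lincomb tangent_lincomb[OF Ma]
  by (auto simp: algebra_simps)

lemma sigma_push_right: "g \<in> carrier G \<Longrightarrow> \<xi> \<in> \<gg> \<Longrightarrow> sigma g (push M M (\<lambda>h. h \<otimes> g) \<one> \<xi>) = \<mu> \<xi>"
  unfolding sigma_def by (simp only: rho_push_right(2))

lemma momentum_apply: "momentum_map G M (g, \<alpha>) = (\<lambda>\<xi>. if \<xi> \<in> \<gg> then \<alpha> (push M M (\<lambda>h. h \<otimes> g) \<one> \<xi>) else 0)"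
  unfolding momentum_map_def copull_def by simp

lemma momentum_j:
  assumes "g \<in> carrier G" shows "momentum_map G M (j (g, l)) = rscale (exp l) \<mu>"
  unfolding j_def fst_conv snd_conv momentum_apply
  unfolding jc_def rscale_def
proof (rule ext)
  fix \<xi>
  show "(if \<xi> \<in> \<gg> then if push M M (\<lambda>h. h \<otimes> g) \<one> \<xi> \<in> tangent_space M g
      then exp l * sigma g (push M M (\<lambda>h. h \<otimes> g) \<one> \<xi>) else 0 else 0) = exp l * \<mu> \<xi>"
    using rho_push_right(1)[OF assms, of \<xi>] sigma_push_right[OF assms, of \<xi>] cotangentD(2)[OF Ma mu, of \<xi>]
    by (cases "\<xi> \<in> \<gg>") simp_all
qed

text \<open>Each tangent vector at \<open>g\<close> is the right translate of one at the unit, so a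
  covector at \<open>g\<close> is determined by its momentum. For momentum \<open>r\<close> times
  \<open>\<mu>\<close> the parameter is \<open>ln r\<close>, made canonical by
  \<open>pr\<close>.\<close>

lemma ray_level_set_eq: "ray_level_set G M \<mu> = j ` (carrier G \<times> ell)"
proof (intro antisym subsetI)
  fix x assume "x \<in> ray_level_set G M \<mu>"
  then obtain r where x: "x \<in> points TG" "r > 0" "momentum_map G M x = rscale r \<mu>" unfolding ray_level_set_def by blast
  then obtain g \<alpha> where ga: "x = (g, \<alpha>)" "g \<in> carrier G" "\<alpha> \<in> cotangent_space M g" unfolding points_TG by blast
  have "\<alpha> v = jc g (pr (ln r)) v" for v
  proof (cases "v \<in> tangent_space M g")
    case True
    have "\<alpha> v = momentum_map G M x (rho g v)"
      unfolding ga(1) momentum_apply using rho_in[OF True] push_right_rho[OF True] by simp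
    also have "\<dots> = exp (pr (ln r)) * \<mu> (rho g v)" unfolding x(3) rscale_def exp_pr[OF x(2)] ..
    finally show ?thesis using True by (simp add: jc_def sigma_def)
  qed (simp add: jc_def cotangentD(2)[OF Ma ga(3)])
  then have "x = j (g, pr (ln r))" using ga(1) by (auto simp: j_def)
  then show "x \<in> j ` (carrier G \<times> ell)" using ga(2) pr_in by blast
next
  fix x assume "x \<in> j ` (carrier G \<times> ell)"
  then obtain g l where gl: "g \<in> carrier G" "x = j (g, l)" by blast
  then have "x \<in> points TG" using jc_cotangent by (simp add: j_def points_TG)
  then show "x \<in> ray_level_set G M \<mu>"
    unfolding ray_level_set_def using momentum_j[OF gl(1), of l] gl(2) exp_gt_zero by blast
qed

lemma not_muzE:
  assumes "\<not> muz" obtains \<xi> where "\<xi> \<in> \<gg>" "\<mu> \<xi> = 1"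
proof -
  obtain \<zeta> where \<zeta>: "\<zeta> \<in> \<gg>" "\<mu> \<zeta> \<noteq> 0" using assms unfolding muz_def by blast
  show ?thesis using that[of "rscale (1 / \<mu> \<zeta>) \<zeta>"] rscale_in[OF \<zeta>(1)] mu_rscale[OF \<zeta>(1) mu] \<zeta>(2) by simp
qed

lemma j_inj: "inj_on j (carrier G \<times> ell)"
proof (rule inj_onI)
  fix x y assume x: "x \<in> carrier G \<times> ell" and y: "y \<in> carrier G \<times> ell" and eq: "j x = j y"
  have f: "fst x = fst y" and c: "jc (fst x) (snd x) = jc (fst x) (snd y)" using eq by (auto simp: j_def)
  have g: "fst x \<in> carrier G" using x by auto
  have "snd x = snd y"
  proof (cases muz)
    case True then show ?thesis using x y by (auto simp: ell_def)
  next
    case False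
    then obtain \<xi> where \<xi>: "\<xi> \<in> \<gg>" "\<mu> \<xi> = 1" by (rule not_muzE)
    from fun_cong[OF c, of "push M M (\<lambda>h. h \<otimes> fst x) \<one> \<xi>"]
    show ?thesis using rho_push_right(1)[OF g \<xi>(1)] sigma_push_right[OF g \<xi>(1)] \<xi>(2) by (simp add: jc_def)
  qed
  then show "x = y" using f by (simp add: prod_eq_iff)
qed

text \<open>The value on the coordinate field is \<open>\<mu>\<close> of the velocity of the
  coordinate line multiplied from the right by \<open>inv x\<close>. These curves start at the unit,
  so \<open>smooth_at_functional\<close> applies.\<close>

lemma sigma_smooth_coord:
  assumes c: "c \<in> charts M" "g \<in> fst c" and b: "b \<in> model M"
  shows "smooth_at M EU (\<lambda>x. sigma x (cv M c (snd c x) b)) g"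
proof -
  let ?R = "flat UNIV (UNIV::real set)"
  let ?P = "prod_mfd ?R M"
  have P: "atlas ?P" by (rule atlas_prod[OF atlas_EU Ma])
  have pt: "(0, x) \<in> points ?R \<times> points M" if "x \<in> fst c" for x using chart_points[OF Ma c(1) that] by simp
  let ?H = "\<lambda>z. snd c (snd z) + fst z *\<^sub>R b"
  let ?Z = "UNIV \<times> fst c"
  have lin: "smooth_at ?P EU ?H (0, x)" if x: "x \<in> fst c" for x
    by (intro smooth_at_add[OF P] smooth_at_scaleR[OF P] smooth_at_EU_const[OF P] smooth_at_fst[OF atlas_EU Ma]
        smooth_at_chart_comp[OF P Ma smooth_at_snd[OF atlas_EU Ma pt[OF x]] c(1)]) (use pt[OF x] x in \<open>simp_all add: prod_mfd_simps\<close>)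
  text \<open>Outside the chart domain the coordinates are junk; project to stay in the model space.\<close>
  let ?H' = "\<lambda>z. proj (model M) (?H z)"
  have modH: "?H (t, x) \<in> model M" if "x \<in> fst c" for t :: real and x
    using chart_in_model[OF Ma c(1) that] b atlas_model[OF Ma] by (simp add: subspace_add subspace_scale)
  have HH: "?H' (t, x) = ?H (t, x)" if "x \<in> fst c" for t :: real and x
    using proj_id[OF atlas_model[OF Ma] modH[OF that]] by simp
  have sh: "smooth_at ?P M (\<lambda>z. ic c (?H' z)) (0, x)" if x: "x \<in> fst c" for x
    by (rule smooth_at_ic_comp[OF Ma P c(1) smooth_at_linear[OF P lin[OF x] bounded_linear_proj]])
      (use HH[OF x, of 0] x proj_in[OF atlas_model[OF Ma]] in auto)
  have W: "openin (mtop M) (fst c)" by (rule openin_chart_domain[OF Ma c(1)])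
  let ?F = "\<lambda>z. ic c (?H' z) \<otimes> inv (snd z)"
  have F: "smooth_at ?P M ?F (0, x)" if x: "x \<in> fst c" for x
    by (intro smooth_at_mult[OF P] smooth_at_inv[OF P] sh[OF x] smooth_at_snd[OF atlas_EU Ma pt[OF x]])
  have icx: "ic c (?H' (0, x)) = x" if x: "x \<in> fst c" for x
    using HH[OF x, of 0] chart_ic[OF Ma c(1) x] by simp
  have "smooth_at M EU (\<lambda>x. \<mu> (velocity M (\<lambda>t. ?F (t, x)))) g"
  proof (rule smooth_at_functional[OF Ma mu F[OF c(2)] W c(2)])
    fix x assume x: "x \<in> fst c"
    have "x \<in> carrier G" using chart_points[OF Ma c(1) x] points_M by simp
    then show "?F (0, x) = \<one>" using icx[OF x] by simp
    show "smooth_at EU M (\<lambda>t. ?F (t, x)) 0" by (rule smooth_slice[OF Ma Ma F[OF x]])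
  qed
  then show ?thesis
  proof (rule smooth_at_cong[OF Ma _ W c(2)])
    fix x assume x: "x \<in> fst c"
    have sx: "snd c x \<in> snd c ` fst c" using x by blast
    have "velocity M (\<lambda>t. ic c (?H' (t, x))) = cv M c (snd c x) b"
      using coord_vec_cv[OF Ma c(1) sx b] HH[OF x] unfolding coord_vec_def ic_def[symmetric] by simp
    then show "\<mu> (velocity M (\<lambda>t. ?F (t, x))) = sigma x (cv M c (snd c x) b)"
      using sigma_velocity[OF smooth_slice[OF Ma Ma sh[OF x]]] icx[OF x] by simp
  qed
qed

lemma j_smooth_TG:
  assumes x: "x \<in> points MB" shows "smooth_at MB TG j x"
proof -
  have x': "x \<in> points M \<times> points L" "x \<in> carrier G \<times> ell" using x by (simp_all add: points_MB points_M)
  have fx: "fst x \<in> points M" using x' by auto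
  obtain c where c: "c \<in> charts M" "fst x \<in> fst c" using atlas_cover[OF Ma fx] by blast
  note f = smooth_at_fst[OF Ma La x'(1)]
  obtain W where W: "openin (mtop MB) W" "x \<in> W" "\<And>y. y \<in> W \<Longrightarrow> fst y \<in> fst c" "W \<subseteq> points MB"
  proof
    show "openin (mtop MB) (points MB \<inter> fst -` fst c)"
      by (rule smooth_at_preimage_open[OF MBa Ma openin_points[OF MBa] smooth_at_fst[OF Ma La] openin_chart_domain[OF Ma c(1)]])
        (simp add: points_MB points_M)
  qed (use x c in auto)
  have "smooth_at MB TG (\<lambda>y. (fst y, jc (fst y) (snd y))) x"
  proof (rule smooth_at_into_TM[OF Ma MBa f W(1,2) _ c])
    fix b assume b: "b \<in> model M"
    have "smooth_at MB EU (\<lambda>y. exp (snd y) * sigma (fst y) (cv M c (snd c (fst y)) b)) x"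
      by (intro smooth_at_EU_bilinear[OF MBa _ _ bounded_bilinear_mult] smooth_at_exp[OF MBa] smooth_at_snd_MB[OF x'(2)]
          smooth_at_compose[OF MBa Ma atlas_EU f sigma_smooth_coord[OF c b]])
    then show "smooth_at MB EU (\<lambda>y. jc (fst y) (snd y) (cv M c (snd c (fst y)) b)) x"
      by (rule smooth_at_cong[OF MBa _ W(1,2)]) (use cv_tangent[OF Ma c(1) W(3) b] in \<open>simp add: jc_def\<close>)
  qed (rule jc_cotangent)
  then show ?thesis unfolding j_def[abs_def] .
qed

text \<open>Any nonzero vector would do: it embeds the line into \<open>'e\<close>, so that the
  level set can be modelled on \<open>'e \<times> 'e\<close>.\<close>

definition i0 :: 'e where "i0 = (SOME i. i \<in> Basis)"

lemma i0: "i0 \<noteq> 0" unfolding i0_def using SOME_Basis nonzero_Basis by blast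

definition TP :: "'e \<times> real \<Rightarrow> 'e \<times> 'e" where "TP x = (fst x, snd x *\<^sub>R i0)"

lemma TP: "linear TP" "inj_on TP A"
  by (auto simp: TP_def i0 prod_eq_iff scaleR_add_left intro!: linearI inj_onI)

interpretation P: transported MB j TP
  by (rule transported.intro[OF MBm _ TP]) (simp add: points_MB j_inj)

text \<open>The retraction keeps the base point and recovers \<open>l\<close>. If
  \<open>\<mu> \<noteq> 0\<close>, take \<open>\<xi>\<close> with \<open>\<mu> \<xi> = 1\<close>:
  evaluation on the right invariant field of \<open>\<xi>\<close> equals \<open>exp l\<close> on the
  level set, and its logarithm is smooth on the open set where it is positive. If
  \<open>\<mu> = 0\<close>, the level set is the zero section and the retraction is the bundle
  projection.\<close>

lemma embedded_P: "embedded_submanifold P.N TG"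
proof (rule embedded_submanifoldI[OF P.manifold_N TGa])
  show "points P.N \<subseteq> points TG"
    unfolding P.N_simps points_MB using jc_cotangent by (auto simp: j_def points_TG)
  fix x assume "x \<in> points P.N"
  then obtain y where y: "y \<in> points MB" "x = j y" unfolding P.N_simps by blast
  show "smooth_at P.N TG (\<lambda>x. x) x"
    unfolding y(2) by (rule quotient_descend[OF MBa TGa P.quotient_b]) (rule j_smooth_TG[OF y(1)])
  show "\<exists>W \<rho>. openin (mtop TG) W \<and> x \<in> W \<and> (\<forall>x\<in>W. smooth_at TG P.N \<rho> x) \<and> (\<forall>x\<in>W \<inter> points P.N. \<rho> x = x)"
  proof (cases muz)
    case True
    have "smooth_at TG P.N (\<lambda>z. j (fst z, 0)) z" if z: "z \<in> points TG" for z
    proof (rule smooth_at_compose[OF TGa MBa P.atlas_N])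
      show "smooth_at TG MB (\<lambda>z. (fst z, 0)) z"
        by (intro smooth_at_Pair[OF Ma La TGa] smooth_at_TM_fst[OF Ma z] smooth_at_const[OF TGa La z])
          (simp add: subspace_0[OF ell(1)])
      show "smooth_at MB P.N j (fst z, 0)" using z by (intro P.smooth_b) (auto simp: points_MB points_TG subspace_0[OF ell(1)])
    qed
    moreover have "j (fst z, 0) = z" if "z \<in> points P.N" for z
      using that True unfolding P.N_simps points_MB by (auto simp: ell_def j_def)
    moreover have "x \<in> points TG" using y smooth_at_points(2)[OF MBa TGa j_smooth_TG] by blast
    ultimately show ?thesis
      by (intro exI[of _ "points TG"] exI[of _ "\<lambda>z. j (fst z, 0)"]) (simp add: openin_points[OF TGa])
  next
    case False
    then obtain \<xi> where \<xi>: "\<xi> \<in> \<gg>" "\<mu> \<xi> = 1" by (rule not_muzE)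
    have ell: "ell = UNIV" using False by (simp add: ell_def)
    define f where "f z = snd z (velocity M (\<lambda>t. e \<xi> t \<otimes> fst z))" for z :: "'g \<times> 'g cvec"
    have P: "atlas (prod_mfd (flat UNIV (UNIV::real set)) M)" by (rule atlas_prod[OF atlas_EU Ma])
    have f_sm: "smooth_at TG EU f z" if z: "z \<in> points TG" for z
      unfolding f_def
    proof -
      have fz: "fst z \<in> carrier G" using z by (auto simp: points_TG)
      have G: "smooth_at (prod_mfd (flat UNIV (UNIV::real set)) M) M (\<lambda>y. e \<xi> (fst y) \<otimes> snd y) (0, h)" if "h \<in> carrier G" for h
        by (intro smooth_at_mult[OF P] smooth_at_e[OF \<xi>(1) P] smooth_at_fst[OF atlas_EU Ma] smooth_at_snd[OF atlas_EU Ma])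
          (simp_all add: points_M that)
      have "smooth_at TG EU (\<lambda>x. snd x (velocity M (\<lambda>t. (\<lambda>y. e \<xi> (fst y) \<otimes> snd y) (t, fst x)))) z"
        by (rule smooth_at_eval[OF Ma z G[OF fz]])
          (use smooth_slice[OF Ma Ma G] \<xi>(1) in \<open>simp_all add: points_M\<close>)
      then show "smooth_at TG EU (\<lambda>z. snd z (velocity M (\<lambda>t. e \<xi> t \<otimes> fst z))) z" by simp
    qed
    have fj: "f (j (g, l)) = exp l" if g: "g \<in> carrier G" for g l
      using rho_push_right[OF g \<xi>(1)] sigma_push_right[OF g \<xi>(1)] \<xi>(2) by (simp add: f_def j_def jc_def)
    let ?W = "points TG \<inter> f -` {0<..}"
    have W: "openin (mtop TG) ?W" by (rule open_positive[OF TGa openin_points[OF TGa] f_sm])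
    have "smooth_at TG P.N (\<lambda>z. j (fst z, ln (f z))) z" if z: "z \<in> ?W" for z
    proof (rule smooth_at_compose[OF TGa MBa P.atlas_N])
      have z': "z \<in> points TG" "f z > 0" using z by auto
      show "smooth_at TG MB (\<lambda>z. (fst z, ln (f z))) z"
        by (intro smooth_at_Pair[OF Ma La TGa] smooth_at_TM_fst[OF Ma z'(1)] smooth_at_L[OF TGa] smooth_at_ln[OF TGa f_sm] z')
          (simp add: ell)
      show "smooth_at MB P.N j (fst z, ln (f z))" 
      proof (rule P.smooth_b)
        have "ln (f z) \<in> ell" by (simp add: ell)
        then show "(fst z, ln (f z)) \<in> points MB" unfolding points_MB using z'(1) unfolding points_TG by auto
      qed
    qed
    moreover have "j (fst z, ln (f z)) = z" if z: "z \<in> points P.N" for z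
    proof -
      obtain g l where "g \<in> carrier G" "z = j (g, l)" using z unfolding P.N_simps points_MB by blast
      then show ?thesis using fj by (simp add: j_def)
    qed
    moreover have "x \<in> ?W"
    proof -
      have "x \<in> points TG" using y(2) smooth_at_points(2)[OF MBa TGa j_smooth_TG[OF y(1)]] by simp
      moreover have "f x = exp (snd y)" using fj[of "fst y" "snd y"] y unfolding points_MB by auto
      ultimately show ?thesis by simp
    qed
    ultimately show ?thesis using W by (intro exI[of _ ?W] exI[of _ "\<lambda>z. j (fst z, ln (f z))"]) blast
  qed
qed

section \<open>The action of \<open>K\<close> on the level set and the reduced space\<close>

lemma points_P: "points P.N = ray_level_set G M \<mu>"
  unfolding P.N_simps points_MB ray_level_set_eq ..

text \<open>The lifted action pulls covectors back along left translation by \<open>inv k\<close>,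
  which lies in \<open>K\<close> and therefore preserves \<open>sigma\<close>.\<close>

lemma lift_j:
  assumes k: "k \<in> K" and g: "g \<in> carrier G"
  shows "cotangent_lift G M k (j (g, l)) = j (k \<otimes> g, l)"
proof -
  have kc: "k \<in> carrier G" "inv k \<in> carrier G" "inv k \<in> K" using k K_carrier subgroup.m_inv_closed[OF K_subgroup] by auto
  have kg: "inv k \<otimes> (k \<otimes> g) = g" using kc g by (simp add: m_assoc[symmetric])
  have "copull M M (\<lambda>h. inv k \<otimes> h) (k \<otimes> g) (jc g l) v = jc (k \<otimes> g) l v" for v
  proof (cases "v \<in> tangent_space M (k \<otimes> g)")
    case True
    let ?w = "push M M (\<lambda>h. inv k \<otimes> h) (k \<otimes> g) v"
    have w: "?w \<in> tangent_space M g"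
      using push_tangent[OF Ma Ma smooth_left[OF kc(2)] True] kc g kg by simp
    have "sigma g ?w = sigma (k \<otimes> g) v" using sigma_left[OF kc(3) True] kg by simp
    then show ?thesis using True w by (simp add: copull_def jc_def)
  qed (simp add: copull_def jc_def)
  then show ?thesis unfolding cotangent_lift_def j_def by (auto simp: kc)
qed

lemma lift_points:
  assumes k: "k \<in> K" shows "cotangent_lift G M k ` points P.N = points P.N"
proof (intro antisym subsetI)
  have kc: "k \<in> carrier G" "inv k \<in> carrier G" using k K_carrier by auto
  fix x assume "x \<in> cotangent_lift G M k ` points P.N"
  then obtain g l where "g \<in> carrier G" "l \<in> ell" "x = cotangent_lift G M k (j (g, l))" unfolding P.N_simps points_MB by blast
  then show "x \<in> points P.N" unfolding P.N_simps points_MB using lift_j[OF k] kc(1) by auto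
next
  have kc: "k \<in> carrier G" "inv k \<in> carrier G" using k K_carrier by auto
  fix x assume "x \<in> points P.N"
  then obtain g l where g: "g \<in> carrier G" "l \<in> ell" "x = j (g, l)" unfolding P.N_simps points_MB by blast
  have "x = cotangent_lift G M k (j (inv k \<otimes> g, l))"
    using lift_j[OF k, of "inv k \<otimes> g"] kc g by (simp add: m_assoc[symmetric])
  then show "x \<in> cotangent_lift G M k ` points P.N" unfolding P.N_simps points_MB using kc g by blast
qed

text \<open>The \<open>K\<close>-orbit over a coset, written without choosing a
  representative.\<close>

definition bR :: "'g set \<times> real \<Rightarrow> ('g \<times> 'g cvec) set" where
  "bR x = (\<lambda>h. j (h, snd x)) ` fst x"

lemma lift_orbit_j:
  assumes g: "g \<in> carrier G" shows "lift_orbit G M K (j (g, l)) = bR (\<pi> g, l)"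
proof -
  have "\<pi> g = (\<lambda>k. k \<otimes> g) ` K" unfolding r_coset_def by blast
  then show ?thesis unfolding lift_orbit_def bR_def by (simp add: image_image lift_j[OF _ g] cong: image_cong)
qed

lemma bR_inj: "inj_on bR (points B)"
proof (rule inj_onI)
  fix x y assume x: "x \<in> points B" and y: "y \<in> points B" and eq: "bR x = bR y"
  have "fst ` bR z = fst z" for z unfolding bR_def image_image by (simp add: j_def)
  then have f: "fst x = fst y" using eq by metis
  obtain g where g: "g \<in> carrier G" "fst x = \<pi> g" using x unfolding points_B points_Q by auto
  have "j (g, snd x) \<in> bR x" unfolding bR_def g(2) using pi_mem[OF g(1)] by (rule imageI)
  then have "j (g, snd x) \<in> bR y" by (simp only: eq)
  then have "j (g, snd x) \<in> (\<lambda>h. j (h, snd y)) ` \<pi> g" by (simp only: bR_def f[symmetric] g(2))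
  then obtain h where h: "h \<in> \<pi> g" "j (g, snd x) = j (h, snd y)" by blast
  have "h \<in> carrier G" using mem_pi[OF h(1) g(1)] by blast
  then have "(g, snd x) = (h, snd y)" using inj_onD[OF j_inj h(2)] g x y by (auto simp: points_B)
  then show "x = y" using f by (simp add: prod_eq_iff)
qed

text \<open>The projection to \<open>G/K\<close> is a submersion, so the model space of
  \<open>Q\<close> has at most the dimension of that of \<open>M\<close>, and an isometric embedding
  exists. Hence the reduced space fits into \<open>'e \<times> 'e\<close>, although \<open>Q\<close>
  is modelled on an unrelated type.\<close>

lemma embed_Q: "\<exists>U :: 'q \<Rightarrow> 'e. linear U \<and> inj_on U (model Q)"
proof -
  have "\<one> \<in> points M" by (simp add: points_M)
  then obtain c where c: "c \<in> charts M" "\<one> \<in> fst c" using atlas_cover[OF Ma] by blast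
  have "\<pi> \<one> \<in> points Q" unfolding points_Q by blast
  then obtain d where d: "d \<in> charts Q" "\<pi> \<one> \<in> fst d" using atlas_cover[OF Qa] by blast
  define A where "A a = chart_diff (snd d) (push M Q \<pi> \<one> (cv M c (snd c \<one>) a))" for a
  have "A (x *\<^sub>R a + y *\<^sub>R b) = x *\<^sub>R A a + y *\<^sub>R A b" for x a y b
    unfolding A_def cv_linear[OF Ma c] push_lincomb chart_diff_lincomb ..
  from this[of 1 _ 1] this[of _ _ 0] have linA: "linear A" by (intro linearI) simp_all
  have "model Q \<subseteq> A ` model M"
  proof
    fix b assume b: "b \<in> model Q"
    have "cv Q d (snd d (\<pi> \<one>)) b \<in> push M Q \<pi> \<one> ` tangent_space M \<one>"
      using cv_tangent[OF Qa d b] pi_onto[OF one_closed] by simp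
    then obtain v where v: "v \<in> tangent_space M \<one>" "cv Q d (snd d (\<pi> \<one>)) b = push M Q \<pi> \<one> v" by blast
    have "A (chart_diff (snd c) v) = b"
      unfolding A_def tangent_cv(2)[OF Ma c v(1)] v(2)[symmetric] by (rule chart_diff_cv[OF Qa d b])
    then show "b \<in> A ` model M" using tangent_cv(1)[OF Ma c v(1)] by blast
  qed
  then have "dim (model Q) \<le> dim (model M)" using dim_subset dim_image_le[OF linA, of "model M"] by (metis order_trans)
  then obtain U :: "'q \<Rightarrow> 'e" where U: "linear U" "\<And>x. x \<in> model Q \<Longrightarrow> norm (U x) = norm x"
    using isometry_subset_subspace[OF atlas_model[OF Qa] atlas_model[OF Ma]] by metis
  have "inj_on U (model Q)"
  proof (rule inj_onI)
    fix x y assume xy: "x \<in> model Q" "y \<in> model Q" "U x = U y"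
    have "norm (U (x - y)) = norm (x - y)" by (rule U(2)[OF subspace_diff[OF atlas_model[OF Qa] xy(1,2)]])
    then show "x = y" using xy(3) linear_diff[OF U(1)] by simp
  qed
  then show ?thesis using U(1) by blast
qed

definition UQ :: "'q \<Rightarrow> 'e" where "UQ = (SOME U. linear U \<and> inj_on U (model Q))"

lemma UQ: "linear UQ" "inj_on UQ (model Q)"
  using someI_ex[OF embed_Q] unfolding UQ_def by blast+

definition TR :: "'q \<times> real \<Rightarrow> 'e \<times> 'e" where "TR x = (UQ (fst x), snd x *\<^sub>R i0)"

lemma TR: "linear TR" "inj_on TR (model B)"
  using inj_onD[OF UQ(2)]
  by (auto simp: TR_def i0 prod_eq_iff prod_mfd_simps scaleR_add_left linear_add[OF UQ(1)] linear_scale[OF UQ(1)]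
      intro!: linearI inj_onI)

interpretation R: transported B bR TR
  by (rule transported.intro[OF Bm bR_inj TR])

lemma quotient_MB: "quotient_manifold MB (\<lambda>x. (\<pi> (fst x), snd x)) B"
proof -
  have "quotient_manifold L (\<lambda>x. x) L"
    by (rule quotient_manifoldI[OF La Lm _ smooth_at_id[OF La]]) (auto simp: image_iff intro!: bexI push_id[OF La, symmetric])
  from quotient_prod[OF Ma La quot this] show ?thesis .
qed

text \<open>On the level set the orbit map factors through \<open>G\<close> times \<open>ell\<close>
  and \<open>G/K\<close> times \<open>ell\<close>; each factor is a submersion, and so is the
  composition.\<close>

lemma quotient_R: "quotient_manifold P.N (lift_orbit G M K) R.N"
proof (rule quotient_cong[OF P.atlas_N quotient_compose[OF P.atlas_N quotient_compose[OF P.atlas_N P.quotient_inv_b quotient_MB] R.quotient_b]])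
  fix x assume "x \<in> points P.N"
  then obtain g l where g: "g \<in> carrier G" "l \<in> ell" "x = j (g, l)" unfolding P.N_simps points_MB by blast
  have "P.\<beta>' x = (g, l)" unfolding g(3) by (rule P.inv_b) (simp add: points_MB g)
  then show "bR (\<pi> (fst (P.\<beta>' x)), snd (P.\<beta>' x)) = lift_orbit G M K x" using lift_orbit_j[OF g(1)] g(3) by simp
qed

lemma ray_reduced_manifold_R: "ray_reduced_manifold G M \<mu> K P.N R.N"
  unfolding ray_reduced_manifold_def using embedded_P points_P lift_points quotient_R by blast

abbreviation "theta_R \<equiv> pullform R.N B R.\<beta>' theta"
abbreviation "omega_R \<equiv> \<lambda>p u v. - ext_deriv1 R.N theta_R p u v"

lemma symplectic_R: "symplectic_form R.N omega_R"
  by (rule R.symplectic_pullform[OF one_form_theta]) (rule omega_nondegenerate)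

lemma one_form_theta_R: "one_form R.N theta_R"
  by (rule one_form_pullform[OF R.atlas_N Ba one_form_theta R.smooth_inv_b])

text \<open>Both the canonical 1-form and the 1-form of the quotient pull back to \<open>exp l * sigma\<close> on the level set.\<close>

lemma pull_theta_level:
  assumes x: "x \<in> points P.N" and w: "w \<in> tangent_space P.N x"
  shows "pullform P.N R.N (lift_orbit G M K) theta_R x w = pullform P.N TG (\<lambda>x. x) (canonical_1form M) x w"
proof -
  obtain g l where g: "g \<in> carrier G" "l \<in> ell" "x = j (g, l)" using x unfolding P.N_simps points_MB by blast
  note lo = quotient_manifoldD[OF P.atlas_N quotient_R]
  have lx: "lift_orbit G M K x \<in> points R.N" using lo(3) x by blast
  have lift_inv: "R.\<beta>' (lift_orbit G M K (j (h, m))) = (\<pi> h, m)" if "h \<in> carrier G" "m \<in> ell" for h m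
    unfolding lift_orbit_j[OF that(1)] by (rule R.inv_b) (use that in \<open>auto simp: points_B points_Q\<close>)
  have xTG: "x \<in> points TG" using embedded_P x unfolding embedded_submanifold_def by blast
  have incl: "smooth_at P.N TG (\<lambda>x. x) x"
    using embedded_P x smooth_map_iff[OF P.atlas_N TGa] unfolding embedded_submanifold_def by blast
  have fst_sm: "smooth_at P.N M fst x"
    by (rule smooth_at_compose[OF P.atlas_N TGa Ma incl smooth_at_TM_fst[OF Ma xTG]])
  define v where "v = push P.N M fst x w"
  have v: "v \<in> tangent_space M g" unfolding v_def using push_tangent[OF P.atlas_N Ma fst_sm w] g(3) by (simp add: j_def)
  have RB: "smooth_at R.N B R.\<beta>' (lift_orbit G M K x)" by (rule R.smooth_inv_b[OF lx])
  have \<beta>x: "R.\<beta>' (lift_orbit G M K x) = (\<pi> g, l)" using lift_inv[OF g(1,2)] g(3) by simp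
  have Bf: "smooth_at B Q fst (\<pi> g, l)" by (rule smooth_at_fst_B) (use g in \<open>auto simp: points_B points_Q\<close>)
  \<comment> \<open>Orbit map, inverse of \<open>bR\<close> and projection to \<open>G/K\<close>
    together send a covector to the coset of its base point. So the vector at which
    \<open>sq\<close> is evaluated is the image of \<open>v\<close>.\<close>
  have "push B Q fst (\<pi> g, l) (push R.N B R.\<beta>' (lift_orbit G M K x) (push P.N R.N (lift_orbit G M K) x w)) =
      push B Q fst (R.\<beta>' (lift_orbit G M K x)) (push P.N B (\<lambda>y. R.\<beta>' (lift_orbit G M K y)) x w)"
    using push_push[OF R.atlas_N Ba, of R.\<beta>' "lift_orbit G M K" x P.N w] RB \<beta>x by simp
  also have "\<dots> = push P.N Q (\<lambda>y. fst (R.\<beta>' (lift_orbit G M K y))) x w"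
    by (rule push_push[OF Ba Qa, where F = "\<lambda>y. R.\<beta>' (lift_orbit G M K y)"]) (simp add: \<beta>x Bf)
  also have "\<dots> = push P.N Q (\<lambda>y. \<pi> (fst y)) x w"
  proof (rule push_cong[OF P.atlas_N Qa _ w openin_points[OF P.atlas_N] x, symmetric])
    show "smooth_at P.N Q (\<lambda>y. \<pi> (fst y)) x" by (rule smooth_at_pi[OF P.atlas_N fst_sm])
    fix y assume "y \<in> points P.N"
    then obtain h m where h: "h \<in> carrier G" "m \<in> ell" "y = j (h, m)" unfolding P.N_simps points_MB by blast
    then show "\<pi> (fst y) = fst (R.\<beta>' (lift_orbit G M K y))" using lift_inv by (simp add: j_def)
  qed
  also have "\<dots> = push M Q \<pi> g v"
    unfolding v_def using push_push[OF Ma Qa, of \<pi> fst x P.N w] pi_smooth[OF g(1)] g(3) by (simp add: j_def)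
  finally have 1: "pullform P.N R.N (lift_orbit G M K) theta_R x w = exp l * sigma g v"
    unfolding pullform_def theta_def \<beta>x by (simp add: sq_push[OF v])
  have "push TG M fst x (push P.N TG (\<lambda>x. x) x w) = v"
    unfolding v_def by (rule push_push[OF TGa Ma, where F = "\<lambda>x. x"]) (rule smooth_at_TM_fst[OF Ma xTG])
  then have "pullform P.N TG (\<lambda>x. x) (canonical_1form M) x w = exp l * sigma g v"
    unfolding pullform_def canonical_1form_def using v g(3) by (simp add: j_def jc_def)
  with 1 show ?thesis by simp
qed

text \<open>By \<open>pull_theta_level\<close> the two 1-forms have the same pullback to the level
  set. Naturality along the orbit map and along the inclusion then equates the pullbacks of their
  exterior derivatives.\<close>

lemma ray_reduced_form_R: "ray_reduced_form G M K P.N R.N omega_R"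
  unfolding ray_reduced_form_def
proof (intro conjI ballI)
  show "two_form R.N omega_R" by (rule two_form_exact[OF R.atlas_N one_form_theta_R refl])
  fix x u v assume x: "x \<in> points P.N" and u: "u \<in> tangent_space P.N x" and v: "v \<in> tangent_space P.N x"
  have incl: "smooth_at P.N TG (\<lambda>x. x) x"
    using embedded_P x smooth_map_iff[OF P.atlas_N TGa] unfolding embedded_submanifold_def by blast
  let ?\<theta> = "pullform P.N R.N (lift_orbit G M K) theta_R"
  have "ext_deriv1 R.N theta_R (lift_orbit G M K x) (push P.N R.N (lift_orbit G M K) x u) (push P.N R.N (lift_orbit G M K) x v) =
      ext_deriv1 P.N ?\<theta> x u v"
    by (rule ext_deriv1_pull[OF P.atlas_N R.atlas_N one_form_theta_R quotient_manifoldD(4)[OF P.atlas_N quotient_R x] refl u v, symmetric])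
  also have "\<dots> = ext_deriv1 TG (canonical_1form M) x (push P.N TG (\<lambda>x. x) x u) (push P.N TG (\<lambda>x. x) x v)"
    by (rule ext_deriv1_pull[OF P.atlas_N TGa one_form_canonical[OF Ma] incl pull_theta_level u v])
  finally show "omega_R (lift_orbit G M K x) (push P.N R.N (lift_orbit G M K) x u) (push P.N R.N (lift_orbit G M K) x v) =
      canonical_form M x (push P.N TG (\<lambda>x. x) x u) (push P.N TG (\<lambda>x. x) x v)"
    unfolding canonical_form_def by simp
qed

text \<open>Points and tangent vectors of the quotient lift to the level set, where the defining
  equation fixes the value.\<close>

lemma ray_reduced_form_unique:
  assumes w: "ray_reduced_form G M K P.N R.N \<omega>'" and w': "ray_reduced_form G M K P.N R.N \<omega>''"
    and q: "q \<in> points R.N" and u: "u \<in> tangent_space R.N q" and v: "v \<in> tangent_space R.N q"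
  shows "\<omega>' q u v = \<omega>'' q u v"
proof -
  note lo = quotient_manifoldD[OF P.atlas_N quotient_R]
  obtain x where x: "x \<in> points P.N" "q = lift_orbit G M K x" using q lo(3) by blast
  obtain a where a: "a \<in> tangent_space P.N x" "u = push P.N R.N (lift_orbit G M K) x a" using u lo(5)[OF x(1)] x(2) by blast
  obtain b where b: "b \<in> tangent_space P.N x" "v = push P.N R.N (lift_orbit G M K) x b" using v lo(5)[OF x(1)] x(2) by blast
  show ?thesis using w w' x(1) a(1) b(1) unfolding ray_reduced_form_def x(2) a(2) b(2) by metis
qed

end

section \<open>The diagonal manifold\<close>

locale ray_cone = ray G M ex \<mu> K Q for G :: "'g monoid" (structure) and M :: "('g, 'e::euclidean_space) mfd"
    and ex and \<mu> and K and Q :: "('g set, 'q::euclidean_space) mfd" +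
  fixes C :: "('g cvec, 'o::euclidean_space) mfd"
  assumes cone: "orbit_cone G M \<mu> C"
begin

interpretation R: transported B bR TR by (rule transported.intro[OF Bm bR_inj TR])

abbreviation "RP \<equiv> flat UNIV {0::real<..}"
abbreviation "MR \<equiv> prod_mfd M RP"
abbreviation "CQ \<equiv> prod_mfd C Q"

text \<open>The orbit map of \<open>orbit_cone\<close>; being a left action, it involves the
  inverse. The diagonal uses \<open>Ad_star\<close> at \<open>g\<close> itself, which is this map at
  \<open>inv g\<close>.\<close>

definition orb :: "'g \<times> real \<Rightarrow> 'g cvec" where
  "orb x = Ad_star G M (inv (fst x)) (rscale (snd x) \<mu>)"

lemma RPa: "atlas RP" by (rule atlas_flat) auto
lemma MRa: "atlas MR" by (rule atlas_prod[OF Ma RPa])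
lemma points_MR: "points MR = carrier G \<times> {0<..}" by (simp add: prod_mfd_simps points_M)

lemma quotient_orb: "quotient_manifold MR orb C"
  using cone unfolding orbit_cone_def euclid_eq_flat orb_def[abs_def] by (simp add: case_prod_unfold)

lemmas C_props = quotient_manifoldD[OF MRa quotient_orb]
lemmas Ca = C_props(2)

lemma CQa: "atlas CQ" by (rule atlas_prod[OF Ca Qa])
lemma points_CQ: "points CQ = points C \<times> points Q" by (simp add: prod_mfd_simps)

lemma Ad_star_orb: "g \<in> carrier G \<Longrightarrow> Ad_star G M g (rscale r \<mu>) = orb (inv g, r)"
  by (simp add: orb_def)

lemma Ad_star_cancel:
  assumes "g \<in> carrier G" "\<xi> \<in> \<gg>"
  shows "Ad_star G M g \<nu> (Ad G M (inv g) \<xi>) = \<nu> \<xi>"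
  using assms by (simp add: Ad_star_apply[OF Ad_in] Ad_mult Ad_one)

text \<open>A representative is chosen to obtain a function of the coset. The choice does not
  matter, because \<open>K\<close> fixes \<open>\<mu>\<close>.\<close>

definition Psi :: "'g set \<times> real \<Rightarrow> 'g cvec \<times> 'g set" where
  "Psi x = (Ad_star G M (SOME g. g \<in> fst x) (rscale (exp (snd x)) \<mu>), fst x)"

lemma Psi:
  assumes g: "g \<in> carrier G"
  shows "Psi (\<pi> g, l) = (Ad_star G M g (rscale (exp l) \<mu>), \<pi> g)"
proof -
  let ?h = "SOME h. h \<in> \<pi> g"
  have "?h \<in> \<pi> g" using pi_mem[OF g] by (rule someI)
  then obtain k where k: "k \<in> K" "?h = k \<otimes> g" unfolding r_coset_def by blast
  have "k \<in> carrier G" using k(1) K_carrier by blast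
  then show ?thesis unfolding Psi_def fst_conv snd_conv k(2) by (simp add: Ad_star_mult g Ad_star_rscale K_Ad_star[OF k(1)])
qed

lemma snd_Psi: "snd (Psi x) = fst x" by (simp add: Psi_def)

lemma rscale_mu_inj:
  assumes "l \<in> ell" "m \<in> ell" "\<And>\<xi>. \<xi> \<in> \<gg> \<Longrightarrow> rscale (exp l) \<mu> \<xi> = rscale (exp m) \<mu> \<xi>"
  shows "l = m"
proof (cases muz)
  case True then show ?thesis using assms(1,2) by (simp add: ell_def)
next
  case False
  then obtain \<xi> where \<xi>: "\<xi> \<in> \<gg>" "\<mu> \<xi> = 1" by (rule not_muzE)
  show ?thesis using assms(3)[OF \<xi>(1)] \<xi>(2) by (simp add: rscale_def)
qed

text \<open>The second component gives back the coset. For a fixed representative \<open>g\<close>,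
  \<open>Ad_star\<close> can be undone by evaluating at \<open>Ad\<close> of \<open>inv g\<close>,
  which leaves two multiples of \<open>\<mu>\<close> with parameters in \<open>ell\<close>.\<close>

lemma Psi_inj: "inj_on Psi (points B)"
proof (rule inj_onI)
  fix x y assume x: "x \<in> points B" and y: "y \<in> points B" and eq: "Psi x = Psi y"
  have f: "fst x = fst y" using arg_cong[OF eq, of snd] by (simp only: snd_Psi)
  obtain g l where g: "g \<in> carrier G" "l \<in> ell" "x = (\<pi> g, l)" using x unfolding points_B points_Q by blast
  have y2: "snd y \<in> ell" "y = (\<pi> g, snd y)" using y f g(3) unfolding points_B by (auto simp: prod_eq_iff)
  have eq1: "Ad_star G M g (rscale (exp l) \<mu>) = Ad_star G M g (rscale (exp (snd y)) \<mu>)"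
    using eq unfolding g(3) Psi[OF g(1)] by (subst (asm) y2(2)) (simp only: Psi[OF g(1)] prod.inject)
  have "l = snd y"
  proof (rule rscale_mu_inj[OF g(2) y2(1)])
    fix \<xi> assume \<xi>: "\<xi> \<in> \<gg>"
    show "rscale (exp l) \<mu> \<xi> = rscale (exp (snd y)) \<mu> \<xi>"
      using fun_cong[OF eq1, of "Ad G M (inv g) \<xi>"] unfolding Ad_star_cancel[OF g(1) \<xi>] .
  qed
  then show "x = y" using g(3) y2(2) by simp
qed

text \<open>A nonzero vector that embeds the line, here into the factor on which the cone is
  modelled.\<close>

definition o0 :: 'o where "o0 = (SOME i. i \<in> Basis)"

lemma o0: "o0 \<noteq> 0" unfolding o0_def using SOME_Basis nonzero_Basis by blast

definition TD :: "'q \<times> real \<Rightarrow> 'o \<times> 'q" where "TD x = (snd x *\<^sub>R o0, fst x)"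

lemma TD: "linear TD" "inj_on TD A"
  by (auto simp: TD_def o0 prod_eq_iff scaleR_add_left intro!: linearI inj_onI)

interpretation D: transported B Psi TD by (rule transported.intro[OF Bm Psi_inj TD])

lemma points_D: "points D.N = diag_product G M \<mu> K"
proof (intro antisym subsetI)
  fix x assume "x \<in> points D.N"
  then obtain g l where g: "g \<in> carrier G" "x = Psi (\<pi> g, l)" unfolding D.N_simps points_B points_Q by blast
  show "x \<in> diag_product G M \<mu> K" unfolding g(2) Psi[OF g(1)] diag_product_def using g(1) exp_gt_zero by blast
next
  fix x assume "x \<in> diag_product G M \<mu> K"
  then obtain g r where g: "x = (Ad_star G M g (rscale r \<mu>), \<pi> g)" "g \<in> carrier G" "r > 0" unfolding diag_product_def by blast
  have "x = Psi (\<pi> g, pr (ln r))" unfolding Psi[OF g(2)] rscale_exp_pr[OF g(3)] by (rule g(1))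
  then show "x \<in> points D.N" unfolding D.N_simps points_B points_Q using g(2) pr_in by blast
qed

lemma pi_l: "g \<in> carrier G \<Longrightarrow> (\<pi> g, pr l) \<in> points B"
  unfolding points_B points_Q using pr_in by blast

text \<open>On \<open>G\<close> times \<open>ell\<close> the first component is the orbit map after
  inversion and exponential, and the second is the projection. Smoothness then descends to
  \<open>G/K\<close> times \<open>ell\<close>.\<close>

lemma Psi_smooth:
  assumes g: "g \<in> carrier G" and l: "l \<in> ell"
  shows "smooth_at B CQ Psi (\<pi> g, l)"
proof -
  have gl: "(g, l) \<in> points MB" using g l by (simp add: points_MB)
  have gl': "(g, l) \<in> points M \<times> points L" using g l by (simp add: points_M)
  have "smooth_at MB MR (\<lambda>y. (inv (fst y), exp (snd y))) (g, l)"
  proof (rule smooth_at_Pair[OF Ma RPa MBa])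
    show "smooth_at MB M (\<lambda>y. inv (fst y)) (g, l)" by (rule smooth_at_inv[OF MBa smooth_at_fst[OF Ma La gl']])
    show "smooth_at MB RP (\<lambda>y. exp (snd y)) (g, l)"
      by (rule smooth_at_flat_cod[OF MBa smooth_at_exp[OF MBa smooth_at_snd_MB] openin_points[OF MBa] gl]) (use gl in \<open>auto simp: points_MB\<close>)
  qed
  from smooth_at_compose[OF MBa MRa Ca this C_props(4)]
  have "smooth_at MB C (\<lambda>y. orb (inv (fst y), exp (snd y))) (g, l)" using g by (simp add: points_MR)
  from smooth_at_Pair[OF Ca Qa MBa this smooth_at_pi[OF MBa smooth_at_fst[OF Ma La gl']]]
  have "smooth_at MB CQ (\<lambda>y. (orb (inv (fst y), exp (snd y)), \<pi> (fst y))) (g, l)" .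
  then have "smooth_at MB CQ (\<lambda>y. Psi (\<pi> (fst y), snd y)) (g, l)"
    by (rule smooth_at_cong[OF MBa _ openin_points[OF MBa] gl]) (auto simp: points_MB Psi Ad_star_orb)
  from quotient_descend[OF MBa CQa quotient_MB this] show ?thesis by simp
qed

text \<open>The points of \<open>C\<close> are covectors, but its smooth structure is that of an
  orbit, so evaluation has to be tested upstairs. On the product of \<open>MR\<close> with
  \<open>M\<close> it is \<open>\<mu>\<close> applied to a smooth family of adjoint images of
  \<open>\<xi>\<close>, scaled by the radius, and it descends along the submersion to
  \<open>prod_mfd C M\<close>.\<close>

lemma smooth_evaluation:
  assumes \<xi>: "\<xi> \<in> \<gg>" and z: "\<nu> \<in> points C" "g \<in> carrier G"
  shows "smooth_at (prod_mfd C M) EU (\<lambda>z. fst z (Ad G M (inv (snd z)) \<xi>)) (\<nu>, g)"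
proof -
  let ?A = "prod_mfd MR M"
  note A = atlas_prod[OF MRa Ma]
  obtain x where x: "x \<in> points MR" "\<nu> = orb x" using z(1) C_props(3) by blast
  have pt: "(x, g) \<in> points MR \<times> points M" "(x, g) \<in> points ?A" using x z(2) by (simp_all add: points_M prod_mfd_simps)
  let ?a = "\<lambda>y. inv (fst (fst y)) \<otimes> inv (snd y)"
  have pts: "fst (fst y) \<in> carrier G \<and> snd (fst y) > 0 \<and> snd y \<in> carrier G" if "y \<in> points ?A" for y
    using that by (auto simp: prod_mfd_simps points_M)
  have f: "smooth_at ?A MR fst y" if "y \<in> points ?A" for y
    by (rule smooth_at_fst[OF MRa Ma]) (use that in \<open>simp add: prod_mfd_simps\<close>)
  have ff: "smooth_at ?A M (\<lambda>y. fst (fst y)) y" "smooth_at ?A RP (\<lambda>y. snd (fst y)) y" if y: "y \<in> points ?A" for y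
  proof -
    have "fst y \<in> points M \<times> points RP" using pts[OF y] by (simp add: mem_Times_iff points_M)
    from smooth_at_compose[OF A MRa Ma f[OF y] smooth_at_fst[OF Ma RPa this]]
      smooth_at_compose[OF A MRa RPa f[OF y] smooth_at_snd[OF Ma RPa this]]
    show "smooth_at ?A M (\<lambda>y. fst (fst y)) y" "smooth_at ?A RP (\<lambda>y. snd (fst y)) y" .
  qed
  have s: "smooth_at ?A M snd y" if "y \<in> points ?A" for y
    by (rule smooth_at_snd[OF MRa Ma]) (use that in \<open>simp add: prod_mfd_simps\<close>)
  have a: "smooth_at ?A M ?a y" if y: "y \<in> points ?A" for y
    by (intro smooth_at_mult[OF A] smooth_at_inv[OF A] ff[OF y] s[OF y])
  let ?P = "prod_mfd (flat UNIV (UNIV::real set)) ?A"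
  note P = atlas_prod[OF atlas_EU A]
  let ?F = "\<lambda>w. ?a (snd w) \<otimes> e \<xi> (fst w) \<otimes> inv (?a (snd w))"
  have F: "smooth_at ?P M ?F (0, y)" if y: "y \<in> points ?A" for y
  proof -
    have py: "(0, y) \<in> points (flat UNIV (UNIV::real set)) \<times> points ?A" using y by simp
    have as: "smooth_at ?P M (\<lambda>w. ?a (snd w)) (0, y)"
      by (rule smooth_at_compose[OF P A Ma smooth_at_snd[OF atlas_EU A py]]) (simp add: a[OF y])
    show ?thesis
      by (intro smooth_at_mult[OF P] smooth_at_inv[OF P] smooth_at_e[OF \<xi> P] as smooth_at_fst[OF atlas_EU A py])
  qed
  have "smooth_at ?A EU (\<lambda>y. \<mu> (velocity M (\<lambda>t. ?F (t, y)))) (x, g)"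
  proof (rule smooth_at_functional[OF A mu F[OF pt(2)] openin_points[OF A] pt(2)])
    fix y assume y: "y \<in> points ?A"
    show "?F (0, y) = \<one>" using pts[OF y] \<xi> by simp
    show "smooth_at EU M (\<lambda>t. ?F (t, y)) 0" by (rule smooth_slice[OF A Ma F[OF y]])
  qed
  then have "smooth_at ?A EU (\<lambda>y. snd (fst y) * \<mu> (velocity M (\<lambda>t. ?F (t, y)))) (x, g)"
    by (intro smooth_at_EU_bilinear[OF A _ _ bounded_bilinear_mult] smooth_at_EU_cod[OF A ff(2)] pt)
  then have "smooth_at ?A EU (\<lambda>y. orb (fst y) (Ad G M (inv (snd y)) \<xi>)) (x, g)"
  proof (rule smooth_at_cong[OF A _ openin_points[OF A] pt(2)])
    fix y assume y: "y \<in> points ?A"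
    have c: "inv (fst (fst y)) \<in> carrier G" "inv (snd y) \<in> carrier G" using pts[OF y] by simp_all
    have "velocity M (\<lambda>t. ?F (t, y)) = Ad G M (?a y) \<xi>" using Ad_e[OF m_closed[OF c] \<xi>] by simp
    then show "snd (fst y) * \<mu> (velocity M (\<lambda>t. ?F (t, y))) = orb (fst y) (Ad G M (inv (snd y)) \<xi>)"
      unfolding orb_def Ad_star_apply[OF Ad_in[OF c(2) \<xi>]] rscale_def Ad_mult[OF c \<xi>] by simp
  qed
  from quotient_descend[OF A atlas_EU quotient_prod[OF MRa Ma quotient_orb quotient_id[OF M_manifold]], of "\<lambda>z. fst z (Ad G M (inv (snd z)) \<xi>)" "(x, g)"] this
  show ?thesis by (simp add: x(2))
qed

text \<open>The retraction keeps the coset and recovers \<open>l\<close> from the covector. With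
  \<open>\<mu> \<xi> = 1\<close> and a local section \<open>s\<close> of the projection to
  \<open>G/K\<close>, the value of the covector at \<open>Ad G M (inv (s q)) \<xi>\<close> is
  \<open>exp l\<close> on the diagonal, and its logarithm is taken where it is positive. If
  \<open>\<mu> = 0\<close>, the coset alone determines the point.\<close>

lemma embedded_D: "embedded_submanifold D.N CQ"
proof (rule embedded_submanifoldI[OF D.manifold_N CQa])
  have incl: "smooth_at D.N CQ (\<lambda>x. x) x" if x: "x \<in> points D.N" for x
  proof -
    obtain g l where g: "g \<in> carrier G" "l \<in> ell" "x = Psi (\<pi> g, l)" using x unfolding D.N_simps points_B points_Q by blast
    show ?thesis unfolding g(3) by (rule quotient_descend[OF Ba CQa D.quotient_b]) (rule Psi_smooth[OF g(1,2)])
  qed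
  then show sub: "points D.N \<subseteq> points CQ" using smooth_at_points(1)[OF D.atlas_N CQa] smooth_at_points(2)[OF D.atlas_N CQa] by blast
  fix x assume x: "x \<in> points D.N"
  show "smooth_at D.N CQ (\<lambda>x. x) x" by (rule incl[OF x])
  obtain g l where g: "g \<in> carrier G" "l \<in> ell" "x = Psi (\<pi> g, l)" using x unfolding D.N_simps points_B points_Q by blast
  have sndCQ: "smooth_at CQ Q snd z" if "z \<in> points CQ" for z
    by (rule smooth_at_snd[OF Ca Qa]) (use that in \<open>simp add: points_CQ\<close>)
  have PsiB: "smooth_at CQ D.N (\<lambda>z. Psi (snd z, f z)) z"
    if z: "z \<in> points CQ" and f: "smooth_at CQ L f z" for z f
  proof (rule smooth_at_compose[OF CQa Ba D.atlas_N smooth_at_Pair[OF Qa La CQa sndCQ[OF z] f]])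
    show "smooth_at B D.N Psi (snd z, f z)"
      by (rule D.smooth_b) (use z smooth_at_points(2)[OF CQa La f] in \<open>auto simp: points_CQ points_B\<close>)
  qed
  show "\<exists>W \<rho>. openin (mtop CQ) W \<and> x \<in> W \<and> (\<forall>x\<in>W. smooth_at CQ D.N \<rho> x) \<and> (\<forall>x\<in>W \<inter> points D.N. \<rho> x = x)"
  proof (cases muz)
    case True
    have "smooth_at CQ D.N (\<lambda>z. Psi (snd z, 0)) z" if "z \<in> points CQ" for z
      by (rule PsiB[OF that smooth_at_const[OF CQa La that]]) (simp add: subspace_0[OF ell(1)])
    moreover have "Psi (snd z, 0) = z" if z: "z \<in> points D.N" for z
    proof -
      obtain y where y: "y \<in> points B" "z = Psi y" using z unfolding D.N_simps by blast
      have "snd y \<in> ell" using y(1) unfolding points_B by (simp add: mem_Times_iff)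
      then have "snd y = 0" using True by (simp add: ell_def)
      then have "y = (snd z, 0)" using y(2) by (simp add: prod_eq_iff snd_Psi)
      then show ?thesis using y(2) by simp
    qed
    ultimately show ?thesis using x sub
      by (intro exI[of _ "points CQ"] exI[of _ "\<lambda>z. Psi (snd z, 0)"]) (auto simp: openin_points[OF CQa])
  next
    case False
    then obtain \<xi> where \<xi>: "\<xi> \<in> \<gg>" "\<mu> \<xi> = 1" by (rule not_muzE)
    have ellU: "ell = UNIV" using False by (simp add: ell_def)
    have gM: "g \<in> points M" using g(1) points_M by simp
    obtain V s where s: "openin (mtop Q) V" "\<pi> g \<in> V" "s (\<pi> g) = g" "\<And>q. q \<in> V \<Longrightarrow> smooth_at Q M s q"
      "\<And>q. q \<in> V \<Longrightarrow> \<pi> (s q) = q"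
      using quotient_section[OF Ma quot gM] by blast
    have sc: "s q \<in> carrier G" if "q \<in> V" for q by (rule smooth_at_carrier[OF Qa s(4)[OF that]])
    define f where "f z = fst z (Ad G M (inv (s (snd z))) \<xi>)" for z :: "'g cvec \<times> 'g set"
    let ?W0 = "points CQ \<inter> snd -` V"
    have W0: "openin (mtop CQ) ?W0" by (rule smooth_at_preimage_open[OF CQa Qa openin_points[OF CQa] sndCQ s(1)])
    have f_sm: "smooth_at CQ EU f z" if z: "z \<in> ?W0" for z
    proof -
      have z': "fst z \<in> points C" "z \<in> points C \<times> points Q" "snd z \<in> V" using z by (auto simp: points_CQ)
      note CM = atlas_prod[OF Ca Ma]
      have "smooth_at CQ (prod_mfd C M) (\<lambda>z. (fst z, s (snd z))) z"
        by (intro smooth_at_Pair[OF Ca Ma CQa] smooth_at_fst[OF Ca Qa] smooth_at_compose[OF CQa Qa Ma sndCQ s(4)]) (use z z' in auto)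
      from smooth_at_compose[OF CQa CM atlas_EU this smooth_evaluation[OF \<xi>(1) z'(1) sc[OF z'(3)]]]
      show ?thesis unfolding f_def by simp
    qed
    have fPsi: "f (Psi (q, m)) = exp m" if q: "q \<in> V" for q m
      using Psi[OF sc[OF q], of m] s(5)[OF q] \<xi>(2) by (simp add: f_def Ad_star_cancel[OF sc[OF q] \<xi>(1)] rscale_def)
    let ?W = "?W0 \<inter> f -` {0<..}"
    have W: "openin (mtop CQ) ?W" by (rule open_positive[OF CQa W0 f_sm])
    have "smooth_at CQ D.N (\<lambda>z. Psi (snd z, ln (f z))) z" if z: "z \<in> ?W" for z
    proof (rule PsiB)
      show "z \<in> points CQ" using z by blast
      show "smooth_at CQ L (\<lambda>z. ln (f z)) z"
        by (rule smooth_at_L[OF CQa smooth_at_ln[OF CQa f_sm]]) (use z in \<open>auto simp: ellU\<close>)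
    qed
    moreover have "Psi (snd z, ln (f z)) = z" if z: "z \<in> ?W \<inter> points D.N" for z
    proof -
      obtain y where y: "z = Psi y" using z unfolding D.N_simps by blast
      have "fst y \<in> V" using z y by (simp add: snd_Psi)
      from fPsi[OF this, of "snd y"] show ?thesis by (simp add: y snd_Psi)
    qed
    moreover have "x \<in> ?W" using x sub fPsi[OF s(2), of l] s(2) g(3) by (auto simp: snd_Psi)
    ultimately show ?thesis using W by (intro exI[of _ ?W] exI[of _ "\<lambda>z. Psi (snd z, ln (f z))"]) blast
  qed
qed

text \<open>\<open>Ad_star\<close> reverses products, so acting by \<open>g\<close> and then by the
  exponential is acting by their product, and the exponential function turns a sum of logarithms
  into a product of scalings. If \<open>\<mu> = 0\<close>, scalings have no effect and
  \<open>pr\<close> discards them.\<close>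

lemma diag_curve_eq:
  assumes g: "g \<in> carrier G" and r: "r > 0" and \<xi>: "\<xi> \<in> \<gg>"
  shows "diag_curve G M ex \<mu> K g r \<xi> s = (\<lambda>t. Psi (curve g \<one> (pr (ln r)) \<xi> (pr s) t))"
proof (rule ext)
  fix t
  have "exp (pr (ln r) + t * pr s) * \<mu> \<eta> = exp (t * s) * (r * \<mu> \<eta>)" for \<eta>
    using r muz_mu by (simp add: pr_def exp_add)
  then have "rscale (exp (pr (ln r) + t * pr s)) \<mu> = rscale (exp (t * s)) (rscale r \<mu>)" unfolding rscale_def by (intro ext)
  then show "diag_curve G M ex \<mu> K g r \<xi> s t = Psi (curve g \<one> (pr (ln r)) \<xi> (pr s) t)"
    using g \<xi> by (simp add: diag_curve_def curve_def Psi Ad_star_mult Ad_star_rscale)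
qed

lemma diag_vector_eq:
  assumes g: "g \<in> carrier G" and r: "r > 0" and \<xi>: "\<xi> \<in> \<gg>"
  shows "diag_vector G M ex \<mu> K D.N g r \<xi> s =
    push B D.N Psi (\<pi> g, pr (ln r)) (velocity B (curve g \<one> (pr (ln r)) \<xi> (pr s)))"
proof -
  have "curve g \<one> (pr (ln r)) \<xi> (pr s) 0 = (\<pi> g, pr (ln r))" using curve_0[OF \<xi> g one_closed] g by simp
  moreover have "smooth_at B D.N Psi (\<pi> g, pr (ln r))" by (rule D.smooth_b[OF pi_l[OF g]])
  ultimately show ?thesis
    unfolding diag_vector_def diag_curve_eq[OF assms] using push_velocity[OF Ba D.atlas_N, of Psi "curve g \<one> (pr (ln r)) \<xi> (pr s)"] by simp
qed

lemma Psi_pr: "g \<in> carrier G \<Longrightarrow> r > 0 \<Longrightarrow> Psi (\<pi> g, pr (ln r)) = (Ad_star G M g (rscale r \<mu>), \<pi> g)"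
  by (simp add: Psi rscale_exp_pr)

text \<open>The tangent space is the image of the one of \<open>G/K\<close> times
  \<open>ell\<close>, all of whose vectors are velocities of left trivialised curves. The number
  \<open>s\<close> runs through all reals although \<open>ell\<close> may be zero; \<open>pr\<close>
  mediates between the two.\<close>

lemma tangent_D:
  assumes g: "g \<in> carrier G" and r: "r > 0"
  shows "tangent_space D.N (Ad_star G M g (rscale r \<mu>), \<pi> g) = {diag_vector G M ex \<mu> K D.N g r \<xi> s |\<xi> s. \<xi> \<in> \<gg>}"
proof -
  let ?l = "pr (ln r)"
  note p = pi_l[OF g, of "ln r"]
  have "tangent_space D.N (Psi (\<pi> g, ?l)) = push B D.N Psi (\<pi> g, ?l) ` tangent_space B (\<pi> g, ?l)"
    by (rule quotient_manifoldD(5)[OF Ba D.quotient_b p, symmetric])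
  also have "\<dots> = {diag_vector G M ex \<mu> K D.N g r \<xi> s |\<xi> s. \<xi> \<in> \<gg>}"
  proof (intro antisym subsetI)
    fix v assume "v \<in> push B D.N Psi (\<pi> g, ?l) ` tangent_space B (\<pi> g, ?l)"
    then obtain w where w: "w \<in> tangent_space B (\<pi> g, ?l)" "v = push B D.N Psi (\<pi> g, ?l) w" by blast
    obtain \<xi> s where \<xi>: "\<xi> \<in> \<gg>" "s \<in> ell" "w = velocity B (curve g \<one> ?l \<xi> s)"
      using tangent_B_left[OF w(1) g] by blast
    have "v = diag_vector G M ex \<mu> K D.N g r \<xi> s" unfolding diag_vector_eq[OF g r \<xi>(1)] w(2) \<xi>(3) pr_ell[OF \<xi>(2)] ..
    then show "v \<in> {diag_vector G M ex \<mu> K D.N g r \<xi> s |\<xi> s. \<xi> \<in> \<gg>}" using \<xi>(1) by blast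
  next
    fix v assume "v \<in> {diag_vector G M ex \<mu> K D.N g r \<xi> s |\<xi> s. \<xi> \<in> \<gg>}"
    then obtain \<xi> s where \<xi>: "\<xi> \<in> \<gg>" "v = diag_vector G M ex \<mu> K D.N g r \<xi> s" by blast
    have "velocity B (curve g \<one> ?l \<xi> (pr s)) \<in> tangent_space B (\<pi> g, ?l)"
      using curve_tangent[OF g one_closed \<xi>(1) pr_in pr_in] g by simp
    then show "v \<in> push B D.N Psi (\<pi> g, ?l) ` tangent_space B (\<pi> g, ?l)" unfolding \<xi>(2) diag_vector_eq[OF g r \<xi>(1)] by (rule imageI)
  qed
  finally show ?thesis unfolding Psi_pr[OF g r] .
qed

definition omega_D :: "('g cvec \<times> 'g set) form2" where
  "omega_D = (\<lambda>p u v. - ext_deriv1 D.N (pullform D.N B D.\<beta>' theta) p u v)"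

lemma symplectic_D: "symplectic_form D.N omega_D"
  unfolding omega_D_def by (rule D.symplectic_pullform[OF one_form_theta]) (rule omega_nondegenerate)

text \<open>This is \<open>omega_curves\<close> with right factor \<open>\<one>\<close>. On values
  of \<open>\<mu>\<close>, the factor \<open>exp (pr (ln r))\<close> acts as \<open>r\<close>;
  likewise \<open>pr r1\<close> and \<open>pr r2\<close> only multiply values of
  \<open>\<mu>\<close> and act as \<open>r1\<close> and \<open>r2\<close>.\<close>

lemma omega_D_formula:
  assumes g: "g \<in> carrier G" and r: "r > 0" and \<xi>1: "\<xi>1 \<in> \<gg>" and \<xi>2: "\<xi>2 \<in> \<gg>"
  shows "omega_D (Ad_star G M g (rscale r \<mu>), \<pi> g) (diag_vector G M ex \<mu> K D.N g r \<xi>1 r1) (diag_vector G M ex \<mu> K D.N g r \<xi>2 r2) =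
    - Ad_star G M g (rscale r \<mu>) (lie_bracket G M \<xi>1 \<xi>2)
    + r2 * Ad_star G M g (rscale r \<mu>) \<xi>1 - r1 * Ad_star G M g (rscale r \<mu>) \<xi>2"
proof -
  let ?l = "pr (ln r)"
  note p = pi_l[OF g, of "ln r"]
  have ct: "velocity B (curve g \<one> ?l \<xi> (pr s)) \<in> tangent_space B (\<pi> g, ?l)" if "\<xi> \<in> \<gg>" for \<xi> s
    using curve_tangent[OF g one_closed that pr_in pr_in] g by simp
  have pm: "pr s * \<mu> \<eta> = s * \<mu> \<eta>" for s \<eta> using muz_mu by (simp add: pr_def)
  have ap: "Ad_star G M g (rscale r \<mu>) \<eta> = r * \<mu> (Ad G M g \<eta>)" if "\<eta> \<in> \<gg>" for \<eta>
    unfolding Ad_star_apply[OF that] rscale_def ..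
  have "omega_D (Psi (\<pi> g, ?l)) (diag_vector G M ex \<mu> K D.N g r \<xi>1 r1) (diag_vector G M ex \<mu> K D.N g r \<xi>2 r2) =
      omega (\<pi> (g \<otimes> \<one>), ?l) (velocity B (curve g \<one> ?l \<xi>1 (pr r1))) (velocity B (curve g \<one> ?l \<xi>2 (pr r2)))"
    unfolding omega_D_def diag_vector_eq[OF g r \<xi>1] diag_vector_eq[OF g r \<xi>2] D.ext_deriv1_push[OF one_form_theta p ct[OF \<xi>1] ct[OF \<xi>2]]
    using g by simp
  also have "\<dots> = - (exp ?l * \<mu> (Ad G M g (lie_bracket G M \<xi>1 \<xi>2))) - pr r1 * (exp ?l * \<mu> (Ad G M g \<xi>2))
      + pr r2 * (exp ?l * \<mu> (Ad G M g \<xi>1))"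
    unfolding omega_curves[OF g one_closed pr_in \<xi>1 \<xi>2 pr_in pr_in] by (simp add: algebra_simps)
  also have "\<dots> = - (r * \<mu> (Ad G M g (lie_bracket G M \<xi>1 \<xi>2))) - r1 * (r * \<mu> (Ad G M g \<xi>2)) + r2 * (r * \<mu> (Ad G M g \<xi>1))"
    unfolding exp_pr[OF r] mult.left_commute[of _ r] pm ..
  finally show ?thesis unfolding Psi_pr[OF g r] ap[OF \<xi>1] ap[OF \<xi>2] ap[OF bracket_derivative(1)[OF \<xi>1 \<xi>2]] by simp
qed

lemmas symplectomorphism_R_D =
  symplectomorphism_transport[OF R.transported_axioms D.transported_axioms one_form_theta, folded omega_D_def]

end

text \<open>Well-definedness of the reduced space is expressed by the existence of \<open>P\<close>,
  \<open>R\<close> and \<open>\<omega>R\<close> together with uniqueness of the form on tangent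
  vectors. The structure on the diagonal is the one embedded in \<open>prod_mfd C Q\<close>.\<close>

theorem theorem5p1:
  fixes G :: "'g monoid"
    and M :: "('g, 'e::euclidean_space) mfd"
    and ex :: "'g tvec \<Rightarrow> 'g"
    and \<mu> :: "'g cvec"
    and K :: "'g set"
    and Q :: "('g set, 'q::euclidean_space) mfd"
    and C :: "('g cvec, 'o::euclidean_space) mfd"
  assumes "lie_group G M"
    and "exponential_map G M ex"
    and "\<mu> \<in> cotangent_space M \<one>\<^bsub>G\<^esub>"
    and "{lincomb 1 \<xi> 1 \<eta> |\<xi> \<eta>. \<xi> \<in> cvec_kernel G M \<mu> \<and> \<eta> \<in> isotropy_algebra G M \<mu>} = lie_algebra G M"
    and "kernel_group G M \<mu> K"
    and "quotient_manifold M (\<lambda>g. K #>\<^bsub>G\<^esub> g) Q"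
    and "orbit_cone G M \<mu> C"
  shows "\<exists>(P :: ('g \<times> 'g cvec, 'e \<times> 'e) mfd) (R :: (('g \<times> 'g cvec) set, 'e \<times> 'e) mfd)
          (D :: ('g cvec \<times> 'g set, 'o \<times> 'q) mfd) \<omega>R \<omega>D \<Phi>.
      ray_reduced_manifold G M \<mu> K P R \<and>
      ray_reduced_form G M K P R \<omega>R \<and>
      (\<forall>\<omega>'. ray_reduced_form G M K P R \<omega>' \<longrightarrow>
         (\<forall>x\<in>points R. \<forall>u\<in>tangent_space R x. \<forall>v\<in>tangent_space R x. \<omega>' x u v = \<omega>R x u v)) \<and>
      symplectic_form R \<omega>R \<and>
      embedded_submanifold D (prod_mfd C Q) \<and> points D = diag_product G M \<mu> K \<and>
      (\<forall>g\<in>carrier G. \<forall>r>0.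
         tangent_space D (Ad_star G M g (rscale r \<mu>), K #>\<^bsub>G\<^esub> g) =
         {diag_vector G M ex \<mu> K D g r \<xi> s |\<xi> s. \<xi> \<in> lie_algebra G M}) \<and>
      symplectic_form D \<omega>D \<and>
      (\<forall>g\<in>carrier G. \<forall>r>0. \<forall>\<xi>1\<in>lie_algebra G M. \<forall>\<xi>2\<in>lie_algebra G M. \<forall>r1 r2.
         \<omega>D (Ad_star G M g (rscale r \<mu>), K #>\<^bsub>G\<^esub> g)
            (diag_vector G M ex \<mu> K D g r \<xi>1 r1) (diag_vector G M ex \<mu> K D g r \<xi>2 r2) =
         - Ad_star G M g (rscale r \<mu>) (lie_bracket G M \<xi>1 \<xi>2)
         + r2 * Ad_star G M g (rscale r \<mu>) \<xi>1
         - r1 * Ad_star G M g (rscale r \<mu>) \<xi>2) \<and>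
      symplectomorphism R \<omega>R D \<omega>D \<Phi>"
proof -
  interpret ray_cone G M ex \<mu> K Q C using assms by unfold_locales
  show ?thesis
  proof (intro exI conjI)
    show "ray_reduced_manifold G M \<mu> K (transport j TP MB) (transport bR TR B)" by (rule ray_reduced_manifold_R)
    show "ray_reduced_form G M K (transport j TP MB) (transport bR TR B) omega_R" by (rule ray_reduced_form_R)
    show "symplectic_form (transport bR TR B) omega_R" by (rule symplectic_R)
    show "embedded_submanifold (transport Psi TD B) (prod_mfd C Q)" by (rule embedded_D)
    show "points (transport Psi TD B) = diag_product G M \<mu> K" by (rule points_D)
    show "symplectic_form (transport Psi TD B) omega_D" by (rule symplectic_D)
    show "symplectomorphism (transport bR TR B) omega_R (transport Psi TD B) omega_D
      (\<lambda>x. Psi (inv_into (points B) bR x))" by (rule symplectomorphism_R_D)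
    show "\<forall>\<omega>'. ray_reduced_form G M K (transport j TP MB) (transport bR TR B) \<omega>' \<longrightarrow>
        (\<forall>x\<in>points (transport bR TR B). \<forall>u\<in>tangent_space (transport bR TR B) x. \<forall>v\<in>tangent_space (transport bR TR B) x.
          \<omega>' x u v = omega_R x u v)"
      by (intro allI impI ballI) (rule ray_reduced_form_unique[OF _ ray_reduced_form_R])
  qed (intro ballI allI impI, rule tangent_D omega_D_formula; assumption)+
qed

end
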